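(* Assume $m=n$ for all $n$. Assume that $\mu_{X_n}$ converges almost surely weakly to a non-random compactly supported probability measure $\mu_X$, that the smallest singular value of $X_n$ converges almost surely to $a:=\inf\operatorname{supp}\mu_X$, that $a>0$, and that $\nu$ has mean zero, variance one and satisfies a log-Sobolev inequality. Let $\widetilde X_n=X_n+P_n$, with $P_n$ built according to either the i.i.d. model or the orthonormalized model. Let $i_0\in\{1,\dots,r\}$ be such that $\theta_{i_0}>\underline\theta$. For each $n$, let $\widetilde\sigma_{i_0}=\sigma_{n+1-i_0}(\widetilde X_n)$ and let $\widetilde u,\widetilde v$ be left and right unit singular vectors of $\widetilde X_n$ associated with $\widetilde\sigma_{i_0}$. Let $\rho=\varphi_{\mu_X}^{-1}(-1/\theta_{i_0})$ (the limit of $\widetilde\sigma_{i_0}$). Then, as $n\to\infty$, almost surely: a) $$|\langle\widetilde u,\operatorname{Span}\{u_i:\theta_i=\theta_{i_0}\}\rangle|^2\to\frac{-1}{\theta_{i_0}^2\varphi_{\mu_X}'(\rho)}.$$ b) $$|\langle\widetilde v,\operatorname{Span}\{v_i:\theta_i=\theta_{i_0}\}\rangle|^2\to\frac{-1}{\theta_{i_0}^2\varphi_{\mu_X}'(\rho)}.$$ c) $$|\langle\widetilde u,\operatorname{Span}\{u_i:\theta_i\ne\theta_{i_0}\}\rangle|^2\to0,\qquad|\langle\widetilde v,\operatorname{Span}\{v_i:\theta_i\ne\theta_{i_0}\}\rangle|^2\to0,$$ and $$\langle\varphi_{\mu_X}(\rho)P_n\widetilde v-\widetilde u,\ \operatorn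ame{Span}\{u_i:\theta_i=\theta_{i_0}\}\rangle\to0.$$
   Context: Let $\mathbb K=\mathbb R$ or $\mathbb C$. $X_n$ is an $n\times n$ random matrix with entries in $\mathbb K$. The singular values of an $n\times n$ matrix $M$ are written $\sigma_1(M)\ge\cdots\ge\sigma_n(M)$, and $\mu_{X_n}=\frac1n\sum_{i=1}^n\delta_{\sigma_i(X_n)}$. Perturbation. Fix $r\ge1$ and deterministic $\theta_1\ge\cdots\ge\theta_r>0$, independent of $n$. Let $\nu$ be a probability measure on $\mathbb K$. For every $n$ let $G_u^{(n)}$, $G_v^{(n)}$ be two independent $n\times r$ matrices with i.i.d. entries of law $\nu$; the families $(G_u^{(n)},G_v^{(n)})_n$ and $(X_n)_n$ are independent. Column vectors $u_1,\dots,u_r,v_1,\dots,v_r\in\mathbb K^{n\times1}$ are obtained in one of two ways. i.i.d. model: $u_i$, $v_i$ are the $i$-th columns of $\frac1{\sqrt n}G_u^{(n)}$, $\frac1{\sqrt n}G_v^{(n)}$. Orthonormalized model: the $u_i$'s (resp. $v_i$'s) result from Gram-Schmidt orthonormalization of the columns of $G_u^{(n)}$ (resp. $G_v^{(n)}$), which is well defined with probability tending to one. Set $P_n=\sum_{i=1}^r\theta_iu_iv_i^*$ and $\widetilde X_n=X_n+P_n$. Log-Sobolev inequality: there is a constant $C>0$ such that $\int f^2\log\frac{f^2}{\int f^2d\nu}\,d\nu\le 2C\int|\nabla f|^2d\nu$ for all continuously differentiable $f\in L^2(\nu)$ (with $\mathbb C$ identified with $\mathbb R^2$). $\varphi_{\mu_X}(z)=\int\frac{z}{z^2-t^2}d\mu_X(t)$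 for $z\in(0,a)$, where it is negative; $\varphi_{\mu_X}^{-1}$ is the functional inverse of $\varphi_{\mu_X}$ on $(0,a)$. With $\varphi_{\mu_X}(a^-)=\lim_{z\uparrow a}\varphi_{\mu_X}(z)$, the threshold is $\underline\theta=(-\varphi_{\mu_X}(a^-))^{-1}$, with the convention $(+\infty)^{-1}=0$. For a vector $x$ and a subspace $F$, $\langle x,F\rangle$ denotes the norm of the orthogonal projection of $x$ onto $F$. Left and right unit singular vectors $\widetilde u,\widetilde v$ associated with $\sigma$ form a matching pair: $\widetilde X_n\widetilde v=\sigma\widetilde u$, $\widetilde X_n^*\widetilde u=\sigma\widetilde v$. *)

theory Defs
  imports "HOL-Probability.Probability" "Jordan_Normal_Form.Schur_Decomposition"
begin

unbundle no vec_syntax and no inner_syntax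

section \<open>The scalar field\<close>

text \<open>
  The class below has exactly the models \<open>\<real>\<close> and \<open>\<complex>\<close>, with their usual absolute value and conjugation;
  this is the content of the instances and of the classification lemma. The inherited
  \<^class>\<open>euclidean_space\<close> structure identifies \<open>\<complex>\<close> with \<open>\<real>\<^sup>2\<close>.
\<close>

class real_or_complex = real_normed_field + euclidean_space + conjugatable_field +
  assumes mult_conjugate_scaleR: "x * conjugate x = (norm x)\<^sup>2 *\<^sub>R 1"

lemma mult_conjugate: "x * conjugate x = of_real ((norm x)\<^sup>2)" for x :: "'a :: real_or_complex"
  by (simp add: mult_conjugate_scaleR of_real_def)

instance real :: real_or_complex
  by standard (simp add: power2_eq_square flip: abs_mult)

instance complex :: real_or_complex
  by standard (simp add: scaleR_conv_of_real flip: complex_norm_square)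

lemma real_or_complex_cases:
  "(\<forall>x :: 'a :: real_or_complex. \<exists>s. x = of_real s \<and> conjugate x = x) \<or>
   (\<exists>j :: 'a. j * j = -1 \<and>
     (\<forall>x. \<exists>s t. x = of_real s + of_real t * j \<and> conjugate x = of_real s - of_real t * j \<and>
               norm x = cmod (Complex s t)))"
proof -
  have conj1: "conjugate (1 :: 'a) = 1"
    using mult_conjugate[of "1 :: 'a"] by simp
  have conj_real: "conjugate (of_real s :: 'a) = of_real s" for s
  proof (cases "s = 0")
    case False
    have "(of_real s :: 'a) * conjugate (of_real s) = of_real s * of_real s"
      using mult_conjugate[of "of_real s :: 'a"] by (simp add: power2_eq_square flip: of_real_mult)
    with False show ?thesis by simp
  qed simp
  have trace: "\<exists>t. x + conjugate x = of_real t" for x :: 'a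
  proof -
    have "(1 + x) * conjugate (1 + x) = of_real ((norm (1 + x))\<^sup>2)" by (rule mult_conjugate)
    moreover have "(1 + x) * conjugate (1 + x) = 1 + (x + conjugate x) + x * conjugate x"
      by (simp add: conjugate_dist_add conj1 algebra_simps)
    ultimately have "x + conjugate x = of_real ((norm (1 + x))\<^sup>2 - 1 - (norm x)\<^sup>2)"
      by (simp add: mult_conjugate algebra_simps)
    then show ?thesis by blast
  qed
  have split: "\<exists>s y. x = of_real s + y \<and> conjugate y = - y \<and> y * y = - of_real ((norm y)\<^sup>2)" for x :: 'a
  proof -
    obtain t where t: "x + conjugate x = of_real t" using trace by blast
    define y where "y = x - of_real (t / 2)"
    have "x = of_real (t / 2) + y" by (simp add: y_def)
    moreover have cy: "conjugate y = - y"
    proof -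
      have "conjugate x = conjugate (of_real (t / 2)) + conjugate y"
        by (metis \<open>x = of_real (t / 2) + y\<close> conjugate_dist_add)
      then have "conjugate x = of_real (t / 2) + conjugate y" by (simp only: conj_real)
      with t have "of_real (t / 2) + y + (of_real (t / 2) + conjugate y) = of_real t"
        by (simp add: y_def)
      moreover have "(of_real (t / 2) + of_real (t / 2) :: 'a) = of_real t"
        by (simp flip: of_real_add)
      ultimately have "y + conjugate y = 0"
        by (metis (no_types, lifting) add.assoc add.commute add_cancel_right_right)
      then show ?thesis by (simp add: eq_neg_iff_add_eq_0 add.commute)
    qed
    moreover have "y * y = - of_real ((norm y)\<^sup>2)"
      using mult_conjugate[of y] by (metis cy minus_minus mult_minus_right)
    ultimately show ?thesis by blast
  qed
  show ?thesis
  proof (cases "\<exists>y :: 'a. y \<noteq> 0 \<and> conjugate y = - y \<and> y * y = - of_real ((norm y)\<^sup>2)")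
    case False
    have "\<exists>s. x = of_real s \<and> conjugate x = x" for x :: 'a
      using split[of x] False conj_real by fastforce
    then show ?thesis by blast
  next
    case True
    then obtain y :: 'a where y: "y \<noteq> 0" "conjugate y = - y" "y * y = - of_real ((norm y)\<^sup>2)"
      by blast
    define j where "j = of_real (1 / norm y) * y"
    have jj: "j * j = -1"
    proof -
      have "j * j = of_real (1 / norm y) * of_real (1 / norm y) * (y * y)"
        by (simp add: j_def algebra_simps)
      also have "\<dots> = - of_real (1 / norm y * (1 / norm y) * (norm y)\<^sup>2)"
        unfolding y(3) by (simp only: of_real_mult mult_minus_right)
      also have "1 / norm y * (1 / norm y) * (norm y)\<^sup>2 = 1"
        using y(1) by (simp add: power2_eq_square)
      finally show ?thesis by simp
    qed
    have cj: "conjugate j = - j"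
      unfolding j_def by (simp only: conjugate_dist_mul y(2) conj_real mult_minus_right)
    have "\<exists>s t. x = of_real s + of_real t * j \<and> conjugate x = of_real s - of_real t * j \<and>
                norm x = cmod (Complex s t)" for x
    proof -
      obtain s z where z: "x = of_real s + z" "z * z = - of_real ((norm z)\<^sup>2)"
        using split by blast
      define w where "w = of_real (norm z) * j"
      have "w * w = z * z"
      proof -
        have "w * w = of_real (norm z) * of_real (norm z) * (j * j)"
          by (simp add: w_def algebra_simps)
        also have "\<dots> = z * z" unfolding jj z(2) by (simp add: power2_eq_square)
        finally show ?thesis .
      qed
      then have "z = w \<or> z = - w" by (auto simp: square_eq_iff)
      then have "\<exists>t. z = of_real t * j"
        unfolding w_def by (metis mult_minus_left of_real_minus)
      then obtain t where t: "z = of_real t * j" by blast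
      have x: "x = of_real s + of_real t * j" using z(1) t by simp
      have cx: "conjugate x = of_real s - of_real t * j"
        by (simp add: x conjugate_dist_add conjugate_dist_mul cj conj_real)
      have "of_real ((norm x)\<^sup>2) = x * conjugate x" by (simp add: mult_conjugate)
      also have "\<dots> = of_real s * of_real s - of_real t * of_real t * (j * j)"
        unfolding cx by (simp add: x algebra_simps)
      also have "\<dots> = of_real (s\<^sup>2 + t\<^sup>2)" by (simp add: jj power2_eq_square)
      finally have "(norm x)\<^sup>2 = s\<^sup>2 + t\<^sup>2" by (simp only: of_real_eq_iff)
      then have "norm x = cmod (Complex s t)"
        by (simp add: cmod_def real_sqrt_unique)
      with x cx show ?thesis by blast
    qed
    with jj show ?thesis by blast
  qed
qed


section \<open>Vectors and matrices of varying dimension\<close>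

definition l2norm :: "'a :: real_or_complex vec \<Rightarrow> real" where
  "l2norm x = sqrt (\<Sum>i<dim_vec x. (norm (x $ i))\<^sup>2)"

text \<open>The linear span in \<open>\<bbbK>\<^sup>n\<close>; the dimension is needed for the span of the empty set.\<close>

definition vspan :: "nat \<Rightarrow> 'a :: real_or_complex vec set \<Rightarrow> 'a vec set" where
  "vspan n S = module.span class_ring (module_vec TYPE('a) n) S"

definition orth_proj :: "'a :: real_or_complex vec set \<Rightarrow> 'a vec \<Rightarrow> 'a vec" where
  "orth_proj F x = (THE p. p \<in> F \<and> (\<forall>f\<in>F. (x - p) \<bullet>c f = 0))"

text \<open>The quantity written \<open>\<langle>x, F\<rangle>\<close>.\<close>

definition proj_norm :: "'a :: real_or_complex vec \<Rightarrow> 'a vec set \<Rightarrow> real" where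
  "proj_norm x F = l2norm (orth_proj F x)"

text \<open>
  Singular values of a square matrix in decreasing order and with multiplicity. The eigenvalues of
  \<open>A\<^sup>* A\<close> are nonnegative reals inside \<open>\<bbbK>\<close>, which \<^const>\<open>norm\<close> merely converts to type \<^typ>\<open>real\<close>.
\<close>

definition singular_values :: "'a :: real_or_complex mat \<Rightarrow> real list" where
  "singular_values A = rev (sorted_list_of_multiset
     (image_mset (\<lambda>x. sqrt (norm x)) (proots (char_poly (mat_adjoint A * A)))))"

text \<open>\<open>singular_value k A\<close> is \<open>\<sigma>\<^sub>k(A)\<close>, counted from 1 (the largest).\<close>

definition singular_value :: "nat \<Rightarrow> 'a :: real_or_complex mat \<Rightarrow> real" where
  "singular_value k A = singular_values A ! (k - 1)"

definition singular_vector_pair ::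
    "'a :: real_or_complex mat \<Rightarrow> real \<Rightarrow> 'a vec \<Rightarrow> 'a vec \<Rightarrow> bool" where
  "singular_vector_pair A s u v \<longleftrightarrow>
     u \<in> carrier_vec (dim_row A) \<and> v \<in> carrier_vec (dim_col A) \<and> l2norm u = 1 \<and> l2norm v = 1 \<and>
     A *\<^sub>v v = of_real s \<cdot>\<^sub>v u \<and> mat_adjoint A *\<^sub>v u = of_real s \<cdot>\<^sub>v v"

text \<open>
  \<open>n\<^sup>-\<^sup>1 \<Sum>\<^sub>k \<delta>\<^bsub>\<sigma>\<^sub>k(A)\<^esub>\<close>, as the image of the uniform distribution on \<open>{1..n}\<close> under \<open>k \<mapsto> \<sigma>\<^sub>k(A)\<close>.
\<close>

definition empirical_singular_measure :: "'a :: real_or_complex mat \<Rightarrow> real measure" where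
  "empirical_singular_measure A =
     distr (uniform_count_measure {1..dim_row A}) borel (\<lambda>k. singular_value k A)"


section \<open>The perturbation\<close>

text \<open>Vectors are indexed from 1, columns of a matrix from 0.\<close>

definition iid_vector :: "'a :: real_or_complex mat \<Rightarrow> nat \<Rightarrow> 'a vec" where
  "iid_vector G i = of_real (1 / sqrt (real (dim_row G))) \<cdot>\<^sub>v col G (i - 1)"

text \<open>
  \<^const>\<open>gram_schmidt\<close> only orthogonalises, hence the normalisation. If the columns of \<open>G\<close> are linearly
  dependent, which happens with probability tending to 0, some of these vectors are 0.
\<close>

definition orthonormalized_vector :: "'a :: real_or_complex mat \<Rightarrow> nat \<Rightarrow> 'a vec" where
  "orthonormalized_vector G i =
     (let w = gram_schmidt (dim_row G) (cols G) ! (i - 1) in of_real (1 / l2norm w) \<cdot>\<^sub>v w)"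

text \<open>\<open>\<Sum>\<^sub>i \<theta>\<^sub>i u\<^sub>i v\<^sub>i\<^sup>*\<close>, an \<open>n \<times> n\<close> matrix\<close>

definition perturbation ::
    "nat \<Rightarrow> nat \<Rightarrow> (nat \<Rightarrow> real) \<Rightarrow> (nat \<Rightarrow> 'a :: real_or_complex vec) \<Rightarrow> (nat \<Rightarrow> 'a vec) \<Rightarrow> 'a mat" where
  "perturbation n r \<theta> u v =
     Matrix.mat n n (\<lambda>(j, k). \<Sum>i=1..r. of_real (\<theta> i) * (u i $ j) * conjugate (v i $ k))"


section \<open>Measures\<close>

text \<open>
  The \<open>\<sigma>\<close>-algebra generated by a family of random variables; \<open>prob_space.indep_var\<close> cannot be used for
  two families whose index sets have different types.
\<close>

definition generated_sigma :: "'w measure \<Rightarrow> ('w \<Rightarrow> 'b :: topological_space) set \<Rightarrow> 'w set set" where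
  "generated_sigma M F = sigma_sets (space M) {f -` A \<inter> space M | f A. f \<in> F \<and> A \<in> sets borel}"

definition measure_support :: "real measure \<Rightarrow> real set" where
  "measure_support \<mu> = {x. \<forall>U. open U \<longrightarrow> x \<in> U \<longrightarrow> emeasure \<mu> U > 0}"

text \<open>
  Only functions with \<open>\<integral> |\<nabla>f|\<^sup>2 d\<nu> < \<infinity>\<close> matter. The integrand on the left is bounded below, so the inequality forces its integrability, which has to be stated because
  the Bochner integral of a non-integrable function is 0. The convention \<open>0 log 0 = 0\<close> is built in.
\<close>

definition log_sobolev :: "'a :: real_or_complex measure \<Rightarrow> bool" where
  "log_sobolev \<nu> \<longleftrightarrow> (\<exists>C>0. \<forall>f g.
     (\<forall>x. GDERIV f x :> g x) \<longrightarrow> continuous_on UNIV g \<longrightarrow>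
     integrable \<nu> (\<lambda>x. (f x)\<^sup>2) \<longrightarrow> integrable \<nu> (\<lambda>x. (norm (g x))\<^sup>2) \<longrightarrow>
     integrable \<nu> (\<lambda>x. (f x)\<^sup>2 * ln ((f x)\<^sup>2 / (\<integral>y. (f y)\<^sup>2 \<partial>\<nu>))) \<and>
     (\<integral>x. (f x)\<^sup>2 * ln ((f x)\<^sup>2 / (\<integral>y. (f y)\<^sup>2 \<partial>\<nu>)) \<partial>\<nu>) \<le> 2 * C * (\<integral>x. (norm (g x))\<^sup>2 \<partial>\<nu>))"

definition phi :: "real measure \<Rightarrow> real \<Rightarrow> real" where
  "phi \<mu> z = (\<integral>t. z / (z\<^sup>2 - t\<^sup>2) \<partial>\<mu>)"

text \<open>
  The limit may be \<open>-\<infinity>\<close>; in \<^typ>\<open>ereal\<close> the inverse of \<open>\<infinity>\<close> is 0.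
\<close>

definition threshold :: "real measure \<Rightarrow> real \<Rightarrow> ereal" where
  "threshold \<mu> a = inverse (- Lim (at_left a) (\<lambda>z. ereal (phi \<mu> z)))"

definition phi_inv :: "real measure \<Rightarrow> real \<Rightarrow> real \<Rightarrow> real" where
  "phi_inv \<mu> a = the_inv_into {0<..<a} (phi \<mu>)"

end

theory Submission
  imports Defs
begin

text \<open>
  Let \<open>\<alpha>\<^sub>i\<close> and \<open>\<beta>\<^sub>i\<close> be the coordinates of \<open>u\<^sub>i\<close> and \<open>v\<^sub>i\<close> in bases of left and right singular vectors of
  \<open>X\<^sub>n\<close>, with singular values \<open>s\<^sub>c\<close>. The log-Sobolev inequality bounds the eighth moment of \<open>\<nu>\<close>; fourth-moment
  bounds for quadratic forms in independent variables and the first Borel-Cantelli lemma then give, almost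
  surely, \<open>\<Sum>\<^sub>c h(s\<^sub>c) \<alpha>\<^sub>i\<^sub>c conj(\<alpha>\<^sub>j\<^sub>c) \<rightarrow> \<delta>\<^sub>i\<^sub>j \<integral>h d\<mu>\<close> (and the same for \<open>\<beta>\<close>), while mixed sums with an odd weight
  tend to 0. It is enough to show this for powers of \<open>1 / (1 + t\<^sup>2)\<close>, that is, for powers of a resolvent, by
  the Weierstrass theorem. Gram-Schmidt orthonormalisation moves the vectors by \<open>o(1)\<close> only.

  The rest is deterministic. In coordinates the equations for a pair of singular vectors with singular value
  \<open>\<sigma> \<rightarrow> z < a\<close> can be solved for the vectors; with \<open>x\<^sub>j = \<langle>u', u\<^sub>j\<rangle>\<close> and \<open>y\<^sub>j = \<langle>v', v\<^sub>j\<rangle>\<close> this gives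
  \<open>x\<^sub>j - \<phi>(z) \<theta>\<^sub>j y\<^sub>j \<rightarrow> 0\<close>, \<open>y\<^sub>j - \<phi>(z) \<theta>\<^sub>j x\<^sub>j \<rightarrow> 0\<close> and, from the normalisation,
  \<open>-\<phi>'(z) \<Sum>\<^sub>j \<theta>\<^sub>j\<^sup>2 (|x\<^sub>j|\<^sup>2 + |y\<^sub>j|\<^sup>2) \<rightarrow> 2\<close>. So the part of the perturbation with indices \<open>\<ge> i0\<close> creates no singular
  value below \<open>\<rho>\<close>, and interlacing bounds the \<open>i0\<close>-th smallest singular value from below; test vectors built from
  the solved equations bound it from above. At \<open>z = \<rho>\<close> the relations annihilate the overlaps with \<open>\<theta>\<^sub>j \<noteq> \<theta>\<^sub>i\<^sub>0\<close>,
  force \<open>x\<^sub>j + y\<^sub>j \<rightarrow> 0\<close> for the others, and the normalisation determines the limit.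
\<close>

section \<open>Inner products\<close>

text \<open>Nothing bounds the largest singular value of \<open>X n\<close>, so test functions are
  taken in the variable 1 / (1 + t^2), which maps the half-line into [0,1]; polynomial approximation
  then needs no compactness of the spectra. The singular bases are chosen for each outcome
  separately and are not known to be measurable. All probability is therefore done with matrix
  entries of powers of the resolvent, and the passage to singular coordinates is made outcome by
  outcome. Only the countably many powers need exceptional null sets; continuous weights, and
  weights that move with the singular value, are then handled deterministically. Fourth moments of
  the forms are used because they decay like n^-2, which is summable; the diagonal terms |x|^2 - 1
  of a form turn them into eighth moments of the entries. The argument stays below \<open>a\<close>
  because there the kernels z / (t^2 - z^2) and t / (t^2 - z^2) are bounded: the smallest singular
  value converges to \<open>a\<close>, so every pole z < a is eventually separated from the
  spectrum.\<close>

lemma norm_conjugate [simp]: "norm (conjugate x) = norm x" for x :: "'a :: real_or_complex"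
proof (cases "x = 0")
  case False
  have "norm x * norm (conjugate x) = norm x * norm x"
    using arg_cong[OF mult_conjugate[of x], of norm] by (simp add: norm_mult power2_eq_square)
  with False show ?thesis by simp
qed simp

lemma conjugate_of_real [simp]: "conjugate (of_real s :: 'a :: real_or_complex) = of_real s"
proof (cases "s = 0")
  case False
  have "(of_real s :: 'a) * conjugate (of_real s) = of_real s * of_real s"
    using mult_conjugate[of "of_real s :: 'a"] by (simp add: power2_eq_square flip: of_real_mult)
  with False show ?thesis by simp
qed simp

lemma conjugate_one [simp]: "conjugate (1 :: 'a :: real_or_complex) = 1"
  using conjugate_of_real[of 1, where 'a = 'a] by simp

lemma conjugate_diff: "conjugate (x - y) = conjugate x - conjugate y" for x :: "'a :: real_or_complex"
  using conjugate_dist_add[of x "- y"] by (simp add: conjugate_neg)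

lemma conjugate_mult_self: "conjugate x * x = of_real ((norm x)\<^sup>2)" for x :: "'a :: real_or_complex"
  using mult_conjugate[of x] by (simp add: mult.commute)

lemma bounded_linear_conjugate: "bounded_linear (conjugate :: 'a :: real_or_complex \<Rightarrow> 'a)"
proof (rule bounded_linear_intro[where K = 1])
  fix r :: real and x :: 'a
  show "conjugate (r *\<^sub>R x) = r *\<^sub>R conjugate x"
    by (simp add: scaleR_conv_of_real conjugate_dist_mul)
qed (simp_all add: conjugate_dist_add)

text \<open>Vectors are total functions read only on an index set, so that one type serves all
  dimensions and the coordinates in a singular basis are again vectors of the same kind. Values
  outside \<open>K\<close> are arbitrary; \<open>ip_cong\<close> and \<open>nsq_cong\<close> absorb
  them.\<close>

definition ip :: "'k set \<Rightarrow> ('k \<Rightarrow> 'a :: real_or_complex) \<Rightarrow> ('k \<Rightarrow> 'a) \<Rightarrow> 'a" where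
  "ip K x y = (\<Sum>k\<in>K. x k * conjugate (y k))"

definition nsq :: "'k set \<Rightarrow> ('k \<Rightarrow> 'a :: real_or_complex) \<Rightarrow> real" where
  "nsq K x = (\<Sum>k\<in>K. (norm (x k))\<^sup>2)"

lemma nsq_nonneg [simp]: "0 \<le> nsq K x"
  by (simp add: nsq_def sum_nonneg)

lemma ip_self: "ip K x x = of_real (nsq K x)"
  by (simp add: ip_def nsq_def mult_conjugate del: of_real_power)

lemma ip_cong: "(\<And>k. k \<in> K \<Longrightarrow> x k = x' k) \<Longrightarrow> (\<And>k. k \<in> K \<Longrightarrow> y k = y' k) \<Longrightarrow> ip K x y = ip K x' y'"
  by (simp add: ip_def)

lemma nsq_cong: "(\<And>k. k \<in> K \<Longrightarrow> x k = x' k) \<Longrightarrow> nsq K x = nsq K x'"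
  by (simp add: nsq_def)

lemma ip_commute: "ip K y x = conjugate (ip K x y)"
  by (cases "finite K") (simp_all add: ip_def sum_conjugate conjugate_dist_mul mult.commute)

lemma ip_add_left: "ip K (\<lambda>k. x k + y k) z = ip K x z + ip K y z"
  by (simp add: ip_def distrib_right sum.distrib)

lemma ip_add_right: "ip K z (\<lambda>k. x k + y k) = ip K z x + ip K z y"
  by (simp add: ip_def conjugate_dist_add distrib_left sum.distrib)

lemma ip_diff_left: "ip K (\<lambda>k. x k - y k) z = ip K x z - ip K y z"
  by (simp add: ip_def left_diff_distrib sum_subtractf)

lemma ip_diff_right: "ip K z (\<lambda>k. x k - y k) = ip K z x - ip K z y"
  by (simp add: ip_def conjugate_diff right_diff_distrib sum_subtractf)

lemma ip_mult_left: "ip K (\<lambda>k. c * x k) z = c * ip K x z"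
  by (simp add: ip_def sum_distrib_left mult.assoc)

lemma ip_mult_right: "ip K z (\<lambda>k. c * x k) = conjugate c * ip K z x"
  by (simp add: ip_def sum_distrib_left conjugate_dist_mul mult_ac)

lemma ip_zero [simp]: "ip K (\<lambda>k. 0) z = 0" "ip K z (\<lambda>k. 0) = 0"
  by (simp_all add: ip_def)

lemma ip_sum_left: "ip K (\<lambda>k. \<Sum>i\<in>I. x i k) z = (\<Sum>i\<in>I. ip K (x i) z)"
  unfolding ip_def sum_distrib_right by (rule sum.swap)

lemma ip_sum_right: "ip K z (\<lambda>k. \<Sum>i\<in>I. x i k) = (\<Sum>i\<in>I. ip K z (x i))"
proof (cases "finite I")
  case True
  show ?thesis
    unfolding ip_def sum_conjugate[OF True] sum_distrib_left by (rule sum.swap)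
qed simp

lemma nsq_mult: "nsq K (\<lambda>k. c * x k) = (norm c)\<^sup>2 * nsq K x"
  by (simp add: nsq_def norm_mult power_mult_distrib sum_distrib_left)

lemma nsq_eq_0_iff: "finite K \<Longrightarrow> nsq K x = 0 \<longleftrightarrow> (\<forall>k\<in>K. x k = 0)"
  by (simp add: nsq_def sum_nonneg_eq_0_iff)

lemma nsq_add: "of_real (nsq K (\<lambda>k. x k + y k)) = of_real (nsq K x) + ip K x y + conjugate (ip K x y) + of_real (nsq K y)"
  unfolding ip_self[symmetric] ip_commute[of K y x, symmetric] by (simp add: ip_add_left ip_add_right)

lemma norm_ip_le: "norm (ip K x y) \<le> sqrt (nsq K x) * sqrt (nsq K y)"
proof -
  have "norm (ip K x y) \<le> (\<Sum>k\<in>K. \<bar>norm (x k)\<bar> * \<bar>norm (y k)\<bar>)"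
    unfolding ip_def by (rule order_trans[OF norm_sum]) (simp add: norm_mult)
  also have "\<dots> \<le> L2_set (\<lambda>k. norm (x k)) K * L2_set (\<lambda>k. norm (y k)) K"
    by (rule L2_set_mult_ineq)
  finally show ?thesis by (simp add: L2_set_def nsq_def)
qed

lemma sqrt_nsq_add_le: "sqrt (nsq K (\<lambda>k. x k + y k)) \<le> sqrt (nsq K x) + sqrt (nsq K y)"
proof -
  have "sqrt (nsq K (\<lambda>k. x k + y k)) \<le> L2_set (\<lambda>k. norm (x k) + norm (y k)) K"
    unfolding nsq_def L2_set_def by (intro real_sqrt_le_mono sum_mono power_mono norm_triangle_ineq) auto
  also have "\<dots> \<le> L2_set (\<lambda>k. norm (x k)) K + L2_set (\<lambda>k. norm (y k)) K"
    by (rule L2_set_triangle_ineq)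
  finally show ?thesis by (simp add: L2_set_def nsq_def)
qed

lemma nsq_uminus: "nsq K (\<lambda>k. - x k) = nsq K x"
  by (simp add: nsq_def)

text \<open>Gaussian elimination, one equation at a time. This is the dimension count behind
  orthonormal completeness, the constrained maximiser and both interlacing bounds.\<close>

lemma homogeneous_system:
  fixes A :: "'s \<Rightarrow> 'k \<Rightarrow> 'a :: field"
  assumes "finite S" "finite K" "card S < card K"
  shows "\<exists>c. (\<exists>k\<in>K. c k \<noteq> 0) \<and> (\<forall>s\<in>S. (\<Sum>k\<in>K. A s k * c k) = 0)"
  using assms
proof (induction S arbitrary: K A rule: finite_induct)
  case empty
  then have "K \<noteq> {}" by auto
  then show ?case by (intro exI[of _ "\<lambda>_. 1"]) auto
next
  case (insert s S)
  show ?case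
  proof (cases "\<forall>k\<in>K. A s k = 0")
    case True
    have "card S < card K" using insert by simp
    from insert.IH[OF insert.prems(1) this, of A] obtain c
      where "\<exists>k\<in>K. c k \<noteq> 0" "\<forall>s\<in>S. (\<Sum>k\<in>K. A s k * c k) = 0" by blast
    with True show ?thesis by (intro exI[of _ c]) auto
  next
    case False
    then obtain k0 where k0: "k0 \<in> K" "A s k0 \<noteq> 0" by blast
    \<comment> \<open>The remaining equations after the unknown \<open>k0\<close> has been
      eliminated with the pivot equation \<open>s\<close>; its value is recovered from that equation
      in \<open>c'\<close>.\<close>
    define B where "B t k = A t k - A t k0 * A s k / A s k0" for t k
    have fin: "finite (K - {k0})" using insert.prems by simp
    have "card S < card (K - {k0})"
      using insert.prems insert.hyps k0 by simp
    from insert.IH[OF fin this, of B] obtain c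
      where c: "\<exists>k\<in>K - {k0}. c k \<noteq> 0" "\<forall>s\<in>S. (\<Sum>k\<in>K - {k0}. B s k * c k) = 0" by blast
    define c' where "c' = c(k0 := - (\<Sum>k\<in>K - {k0}. A s k * c k) / A s k0)"
    have split: "(\<Sum>k\<in>K. A t k * c' k) = A t k0 * c' k0 + (\<Sum>k\<in>K - {k0}. A t k * c k)" for t
      unfolding sum.remove[OF insert.prems(1) k0(1)] by (intro arg_cong2[where f = "(+)"] refl sum.cong) (auto simp: c'_def)
    have "(\<Sum>k\<in>K. A s k * c' k) = 0"
      unfolding split using k0 by (simp add: c'_def)
    moreover have "(\<Sum>k\<in>K. A t k * c' k) = 0" if "t \<in> S" for t
    proof -
      have "(\<Sum>k\<in>K - {k0}. B t k * c k) = (\<Sum>k\<in>K - {k0}. A t k * c k - A t k0 / A s k0 * (A s k * c k))"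
        by (intro sum.cong refl) (simp add: B_def algebra_simps)
      also have "\<dots> = (\<Sum>k\<in>K - {k0}. A t k * c k) - A t k0 / A s k0 * (\<Sum>k\<in>K - {k0}. A s k * c k)"
        by (simp add: sum_subtractf sum_distrib_left)
      finally show ?thesis
        unfolding split using c(2) that by (simp add: c'_def)
    qed
    moreover have "\<exists>k\<in>K. c' k \<noteq> 0" using c(1) by (auto simp: c'_def)
    ultimately show ?thesis by (intro exI[of _ c']) auto
  qed
qed

text \<open>If the identity failed at \<open>j\<close>, the residual \<open>w\<close> of the unit
  vector at \<open>j\<close> would be nonzero and orthogonal to every \<open>e l\<close>. Together
  with the \<open>e l\<close> it would give more independent vectors than there are
  coordinates.\<close>

lemma orthonormal_complete:
  fixes e :: "'l \<Rightarrow> 'k \<Rightarrow> 'a :: real_or_complex"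
  assumes fin: "finite K" "finite L" and card: "card L = card K"
    and on: "\<And>l m. l \<in> L \<Longrightarrow> m \<in> L \<Longrightarrow> ip K (e l) (e m) = (if l = m then 1 else 0)"
    and ij: "i \<in> K" "j \<in> K"
  shows "(\<Sum>l\<in>L. e l i * conjugate (e l j)) = (if i = j then 1 else 0)"
proof (rule ccontr)
  assume neq: "\<not> ?thesis"
  define w where "w k = (if k = j then 1 else 0) - (\<Sum>l\<in>L. conjugate (e l j) * e l k)" for k
  have w_i: "w i \<noteq> 0" using neq by (simp add: w_def mult.commute)
  have w_orth: "ip K w (e m) = 0" if "m \<in> L" for m
  proof -
    have "ip K (\<lambda>k. if k = j then 1 else 0) (e m) = conjugate (e m j)"
      using fin(1) ij(2) by (simp add: ip_def if_distrib[of "\<lambda>x. x * _"] cong: if_cong)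
    moreover have "ip K (\<lambda>k. \<Sum>l\<in>L. conjugate (e l j) * e l k) (e m) = conjugate (e m j)"
      using fin(2) that by (simp add: ip_sum_left ip_mult_left on if_distrib[of "\<lambda>x. _ * x"] cong: if_cong)
    ultimately show ?thesis by (simp add: w_def[abs_def] ip_diff_left)
  qed
  define E where "E k o' = (case o' of None \<Rightarrow> w k | Some l \<Rightarrow> e l k)" for k o'
  have "card K < card (insert None (Some ` L))"
    using fin(2) card by (simp add: card_image)
  from homogeneous_system[OF fin(1) _ this, of E] fin(2) obtain c
    where c: "\<exists>o'\<in>insert None (Some ` L). c o' \<noteq> 0"
      "\<And>k. k \<in> K \<Longrightarrow> (\<Sum>o'\<in>insert None (Some ` L). E k o' * c o') = 0" by auto
  have eq: "c None * w k + (\<Sum>l\<in>L. c (Some l) * e l k) = 0" if "k \<in> K" for k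
    using c(2)[OF that] fin(2) by (simp add: sum.reindex E_def mult.commute)
  have cS: "c (Some m) = 0" if m: "m \<in> L" for m
  proof -
    have "0 = ip K (\<lambda>k. c None * w k + (\<Sum>l\<in>L. c (Some l) * e l k)) (e m)"
      by (subst ip_cong[of K _ "\<lambda>k. 0" "e m" "e m"]) (auto simp: eq)
    also have "\<dots> = (\<Sum>l\<in>L. c (Some l) * ip K (e l) (e m))"
      by (simp add: ip_add_left ip_mult_left w_orth m ip_sum_left)
    also have "\<dots> = c (Some m)"
      using fin(2) m by (simp add: on if_distrib[of "\<lambda>x. _ * x"] cong: if_cong)
    finally show ?thesis by simp
  qed
  then have "c None * w i = 0" using eq[OF ij(1)] by simp
  with w_i have "c None = 0" by simp
  with cS c(1) show False by auto
qed

locale orthonormal_basis =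
  fixes K :: "'k set" and L :: "'l set" and e :: "'l \<Rightarrow> 'k \<Rightarrow> 'a :: real_or_complex"
  assumes finite_K: "finite K" and finite_L: "finite L" and card_L: "card L = card K"
    and orthonormal: "\<And>l m. l \<in> L \<Longrightarrow> m \<in> L \<Longrightarrow> ip K (e l) (e m) = (if l = m then 1 else 0)"
begin

lemma complete: "i \<in> K \<Longrightarrow> j \<in> K \<Longrightarrow> (\<Sum>l\<in>L. e l i * conjugate (e l j)) = (if i = j then 1 else 0)"
  by (rule orthonormal_complete[OF finite_K finite_L card_L orthonormal])

lemma expansion: "k \<in> K \<Longrightarrow> (\<Sum>l\<in>L. ip K x (e l) * e l k) = x k"
proof -
  assume k: "k \<in> K"
  have "(\<Sum>l\<in>L. ip K x (e l) * e l k) = (\<Sum>l\<in>L. \<Sum>j\<in>K. x j * (e l k * conjugate (e l j)))"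
    unfolding ip_def sum_distrib_right by (simp add: mult_ac)
  also have "\<dots> = (\<Sum>j\<in>K. x j * (\<Sum>l\<in>L. e l k * conjugate (e l j)))"
    unfolding sum_distrib_left by (rule sum.swap)
  also have "\<dots> = (\<Sum>j\<in>K. x j * (if k = j then 1 else 0))"
    by (intro sum.cong refl) (simp add: complete k)
  also have "\<dots> = x k" using k finite_K by (simp add: if_distrib[of "\<lambda>x. _ * x"] cong: if_cong)
  finally show ?thesis .
qed

lemma parseval: "ip L (\<lambda>l. ip K x (e l)) (\<lambda>l. ip K y (e l)) = ip K x y"
proof -
  have "ip L (\<lambda>l. ip K x (e l)) (\<lambda>l. ip K y (e l)) = (\<Sum>l\<in>L. ip K x (e l) * ip K (e l) y)"
    by (simp add: ip_def[of L] ip_commute[of K "e _" y])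
  also have "\<dots> = ip K (\<lambda>k. \<Sum>l\<in>L. ip K x (e l) * e l k) y"
    by (simp add: ip_sum_left ip_mult_left)
  also have "\<dots> = ip K x y" by (rule ip_cong) (simp_all add: expansion)
  finally show ?thesis .
qed

lemma parseval_nsq: "nsq L (\<lambda>l. ip K x (e l)) = nsq K x"
  using parseval[of x x] unfolding ip_self of_real_eq_iff .

end

section \<open>Singular value decomposition\<close>

definition mv :: "'k set \<Rightarrow> ('j \<Rightarrow> 'k \<Rightarrow> 'a :: real_or_complex) \<Rightarrow> ('k \<Rightarrow> 'a) \<Rightarrow> 'j \<Rightarrow> 'a" where
  "mv K X x j = (\<Sum>k\<in>K. X j k * x k)"

definition adj :: "('j \<Rightarrow> 'k \<Rightarrow> 'a :: real_or_complex) \<Rightarrow> 'k \<Rightarrow> 'j \<Rightarrow> 'a" where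
  "adj X k j = conjugate (X j k)"

lemma adj_adj [simp]: "adj (adj X) = X"
  by (simp add: adj_def fun_eq_iff)

lemma mv_add: "mv K X (\<lambda>k. x k + y k) = (\<lambda>j. mv K X x j + mv K X y j)"
  by (simp add: mv_def fun_eq_iff distrib_left sum.distrib)

lemma mv_mult: "mv K X (\<lambda>k. c * x k) = (\<lambda>j. c * mv K X x j)"
  by (simp add: mv_def fun_eq_iff sum_distrib_left mult_ac)

lemma mv_cong: "(\<And>k. k \<in> K \<Longrightarrow> x k = y k) \<Longrightarrow> mv K X x = mv K X y"
  by (simp add: mv_def fun_eq_iff)

lemma ip_mv: "finite K \<Longrightarrow> ip J (mv K X x) y = ip K x (mv J (adj X) y)"
  unfolding ip_def mv_def adj_def sum_distrib_right
  by (subst sum.swap) (simp add: ip_def conjugate_dist_mul sum_distrib_left mult_ac,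
      cases "finite J", simp_all add: sum_conjugate conjugate_dist_mul sum_distrib_left mult_ac)

text \<open>Prescribing zero outside \<open>K\<close> makes the sphere a closed subset of a product
  of balls and points, which is compact by Tychonoff although the index type may be
  infinite.\<close>

lemma compact_unit_sphere_orthogonal:
  fixes q :: "'l \<Rightarrow> 'k \<Rightarrow> 'a :: real_or_complex"
  assumes K: "finite K"
  shows "compact {x. (\<forall>k. k \<notin> K \<longrightarrow> x k = 0) \<and> nsq K x = 1 \<and> (\<forall>l\<in>L. ip K x (q l) = 0)}"
    (is "compact ?S")
proof -
  define B where "B = PiE UNIV (\<lambda>k. if k \<in> K then cball (0 :: 'a) 1 else {0})"
  have "compactin (product_topology (\<lambda>i. euclidean) UNIV) B"
    unfolding B_def compactin_PiE by auto
  then have B: "compact B"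
    unfolding euclidean_product_topology by simp
  have "?S = {x. \<forall>k. k \<notin> K \<longrightarrow> x k = 0} \<inter> {x. nsq K x = 1} \<inter> {x. \<forall>l\<in>L. ip K x (q l) = 0}" by auto
  moreover have "closed {x :: 'k \<Rightarrow> 'a. \<forall>k. k \<notin> K \<longrightarrow> x k = 0}"
    by (intro closed_Collect_all closed_Collect_imp closed_Collect_eq continuous_intros continuous_on_product_coordinates open_Collect_const)
  moreover have "closed {x :: 'k \<Rightarrow> 'a. nsq K x = 1}"
    unfolding nsq_def by (intro closed_Collect_eq continuous_intros continuous_on_product_coordinates)
  moreover have "closed {x :: 'k \<Rightarrow> 'a. \<forall>l\<in>L. ip K x (q l) = 0}"
    unfolding ip_def Ball_def
    by (intro closed_Collect_all closed_Collect_imp closed_Collect_eq continuous_intros continuous_on_product_coordinates open_Collect_const)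
  ultimately have "closed ?S" by (simp add: closed_Int)
  moreover have "?S \<subseteq> B"
  proof
    fix x assume x: "x \<in> ?S"
    have "norm (x k) \<le> 1" if "k \<in> K" for k
    proof -
      have "(norm (x k))\<^sup>2 \<le> nsq K x"
        unfolding nsq_def by (rule member_le_sum[OF that]) (auto simp: K)
      then show ?thesis using x by (simp add: power_le_one_iff abs_square_le_1)
    qed
    with x show "x \<in> B" by (auto simp: B_def)
  qed
  ultimately show ?thesis
    using compact_Int_closed[OF B, of ?S] by (simp add: Int_absorb1)
qed

text \<open>Fewer constraints than coordinates leave a unit vector, compactness gives a maximiser,
  and homogeneity extends the inequality to all admissible \<open>y\<close>, including those with
  nonzero values outside \<open>K\<close>.\<close>

lemma maximizer_exists:
  fixes q :: "'l \<Rightarrow> 'k \<Rightarrow> 'a :: real_or_complex" and X :: "'j \<Rightarrow> 'k \<Rightarrow> 'a"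
  assumes K: "finite K" and L: "finite L" "card L < card K"
  shows "\<exists>x. nsq K x = 1 \<and> (\<forall>l\<in>L. ip K x (q l) = 0) \<and>
    (\<forall>y. (\<forall>l\<in>L. ip K y (q l) = 0) \<longrightarrow> nsq J (mv K X y) \<le> nsq J (mv K X x) * nsq K y)"
proof -
  let ?S = "{x. (\<forall>k. k \<notin> K \<longrightarrow> x k = 0) \<and> nsq K x = 1 \<and> (\<forall>l\<in>L. ip K x (q l) = 0)}"
  have normalize: "(\<lambda>k. if k \<in> K then of_real (1 / sqrt (nsq K y)) * y k else 0) \<in> ?S"
    if "nsq K y \<noteq> 0" "\<And>l. l \<in> L \<Longrightarrow> ip K y (q l) = 0" for y
  proof -
    have "nsq K (\<lambda>k. if k \<in> K then of_real (1 / sqrt (nsq K y)) * y k else 0)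
        = nsq K (\<lambda>k. of_real (1 / sqrt (nsq K y)) * y k)" by (rule nsq_cong) simp
    also have "\<dots> = 1" unfolding nsq_mult using that(1) by (simp add: power_divide norm_divide)
    finally have "nsq K (\<lambda>k. if k \<in> K then of_real (1 / sqrt (nsq K y)) * y k else 0) = 1" .
    moreover have "ip K (\<lambda>k. if k \<in> K then of_real (1 / sqrt (nsq K y)) * y k else 0) (q l) = 0" if "l \<in> L" for l
    proof -
      have "ip K (\<lambda>k. if k \<in> K then of_real (1 / sqrt (nsq K y)) * y k else 0) (q l)
          = ip K (\<lambda>k. of_real (1 / sqrt (nsq K y)) * y k) (q l)" by (rule ip_cong) simp_all
      then show ?thesis using \<open>\<And>l. l \<in> L \<Longrightarrow> ip K y (q l) = 0\<close>[OF that] by (simp only: ip_mult_left mult_zero_right)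
    qed
    ultimately show ?thesis by simp
  qed
  have "\<exists>c. (\<exists>k\<in>K. c k \<noteq> 0) \<and> (\<forall>l\<in>L. (\<Sum>k\<in>K. conjugate (q l k) * c k) = 0)"
    by (rule homogeneous_system[OF L(1) K L(2)])
  then obtain c where c: "\<exists>k\<in>K. c k \<noteq> 0" "\<forall>l\<in>L. (\<Sum>k\<in>K. conjugate (q l k) * c k) = 0" by blast
  have ne: "?S \<noteq> {}"
    using normalize[of c] c by (auto simp: nsq_eq_0_iff[OF K] ip_def mult.commute simp del: mem_Collect_eq)
  have cont: "continuous_on ?S (\<lambda>x. nsq J (mv K X x))"
    unfolding nsq_def mv_def
    by (intro continuous_intros continuous_on_subset[OF continuous_on_product_coordinates]) simp_all
  have "\<exists>x\<in>?S. \<forall>y\<in>?S. nsq J (mv K X y) \<le> nsq J (mv K X x)"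
    by (rule continuous_attains_sup[OF compact_unit_sphere_orthogonal[OF K] ne cont])
  then obtain x where x: "x \<in> ?S" "\<forall>y\<in>?S. nsq J (mv K X y) \<le> nsq J (mv K X x)"
    by (elim bexE) (rule that)
  show ?thesis
  proof (intro exI[of _ x] conjI allI impI)
    show "nsq K x = 1" "\<forall>l\<in>L. ip K x (q l) = 0" using x(1) by simp_all
  next
    fix y assume y': "\<forall>l\<in>L. ip K y (q l) = 0"
    then have y: "ip K y (q l) = 0" if "l \<in> L" for l using that by simp
    show "nsq J (mv K X y) \<le> nsq J (mv K X x) * nsq K y"
    proof (cases "nsq K y = 0")
      case True
      then have "mv K X y = mv K X (\<lambda>_. 0)"
        by (intro mv_cong) (simp add: nsq_eq_0_iff[OF K])
      then show ?thesis by (simp add: True nsq_def[of J] mv_def)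
    next
      case False
      let ?z = "\<lambda>k. if k \<in> K then of_real (1 / sqrt (nsq K y)) * y k else 0"
      have "mv K X ?z = mv K X (\<lambda>k. of_real (1 / sqrt (nsq K y)) * y k)" by (rule mv_cong) simp
      then have "nsq J (mv K X ?z) = nsq J (mv K X y) / nsq K y"
        by (simp only: mv_mult nsq_mult) (simp add: power_divide norm_divide)
      moreover have "nsq J (mv K X ?z) \<le> nsq J (mv K X x)"
        by (rule bspec[OF x(2) normalize[OF False y]])
      ultimately show ?thesis using False nsq_nonneg[of K y] by (simp add: divide_le_eq del: nsq_nonneg)
    qed
  qed
qed

text \<open>First-order condition: a step in the direction of \<open>ip J a b\<close> raises the
  left side by a term linear in the step, while the right side allows only a quadratic one.\<close>

lemma stationary_at_maximum:
  assumes le: "\<And>t. nsq J (\<lambda>j. a j + t * b j) \<le> nsq J a * (1 + (norm t)\<^sup>2 * m)" and m: "0 \<le> m"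
  shows "ip J a b = (0 :: 'a :: real_or_complex)"
proof (rule ccontr)
  define c where "c = ip J a b"
  assume "ip J a b \<noteq> 0"
  then have c: "c \<noteq> 0" by (simp add: c_def)
  \<comment> \<open>Step length for which the quadratic allowance is at most d |c|^2, half of the
    linear gain 2 d |c|^2.\<close>
  define d where "d = 1 / (1 + nsq J a * m)"
  have d: "0 < d" using m by (simp add: d_def add_pos_nonneg)
  then have normd: "norm (of_real d * c) = d * norm c" by (simp add: norm_mult)
  have "of_real (nsq J (\<lambda>j. a j + of_real d * c * b j)) =
      (of_real (nsq J a) + conjugate (of_real d * c) * c + conjugate (conjugate (of_real d * c) * c)
       + of_real (nsq J (\<lambda>j. of_real d * c * b j)) :: 'a)"
    by (simp only: nsq_add ip_mult_right c_def)
  also have "conjugate (of_real d * c) * c = of_real (d * (norm c)\<^sup>2)"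
    by (simp add: conjugate_dist_mul mult.assoc conjugate_mult_self del: of_real_power)
  finally have "nsq J (\<lambda>j. a j + of_real d * c * b j) = nsq J a + 2 * (d * (norm c)\<^sup>2) + nsq J (\<lambda>j. of_real d * c * b j)"
    unfolding conjugate_of_real of_real_add[symmetric] of_real_eq_iff by simp
  with le[of "of_real d * c"] nsq_nonneg[of J "\<lambda>j. of_real d * c * b j"]
  have "nsq J a + 2 * (d * (norm c)\<^sup>2) \<le> nsq J a * (1 + (norm (of_real d * c))\<^sup>2 * m)" by linarith
  then have "2 * (d * (norm c)\<^sup>2) \<le> (d * (norm c)\<^sup>2) * (d * (nsq J a * m))"
    unfolding normd by (simp add: power_mult_distrib power2_eq_square algebra_simps)
  moreover have "0 < d * (norm c)\<^sup>2" using c d by simp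
  moreover have "d * (nsq J a * m) \<le> 1"
    using m by (simp add: d_def divide_le_eq add_pos_nonneg)
  ultimately show False
    by (smt (verit) mult_left_le)
qed

text \<open>The singular vectors are found one after another, in decreasing order of the singular values, by maximising
  \<open>|Xx|\<close> over the unit vectors orthogonal to the right singular vectors already found.\<close>

lemma partial_svd:
  fixes X :: "'k \<Rightarrow> 'k \<Rightarrow> 'a :: real_or_complex"
  assumes K: "finite K" and m: "m \<le> card K"
  shows "\<exists>s p q. (\<forall>i<m. \<forall>j<m. ip K (p i) (p j) = (if i = j then 1 else 0)) \<and>
      (\<forall>i<m. \<forall>j<m. ip K (q i) (q j) = (if i = j then 1 else 0)) \<and>
      (\<forall>i<m. 0 \<le> s i \<and> (\<forall>k\<in>K. mv K X (q i) k = of_real (s i) * p i k) \<and>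
             (\<forall>k\<in>K. mv K (adj X) (p i) k = of_real (s i) * q i k))"
  using m
proof (induction m)
  case (Suc m)
  obtain s p q where IH: "(\<forall>i<m. \<forall>j<m. ip K (p i) (p j) = (if i = j then 1 else 0)) \<and>
      (\<forall>i<m. \<forall>j<m. ip K (q i) (q j) = (if i = j then 1 else 0)) \<and>
      (\<forall>i<m. 0 \<le> s i \<and> (\<forall>k\<in>K. mv K X (q i) k = of_real (s i) * p i k) \<and>
             (\<forall>k\<in>K. mv K (adj X) (p i) k = of_real (s i) * q i k))"
    using Suc.IH[OF Suc_leD[OF Suc.prems]] by (elim exE) (rule that)
  from IH have p: "ip K (p i) (p j) = (if i = j then 1 else 0)" if "i < m" "j < m" for i j using that by blast
  from IH have q: "ip K (q i) (q j) = (if i = j then 1 else 0)" if "i < m" "j < m" for i j using that by blast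
  from IH have s: "0 \<le> s i" if "i < m" for i using that by blast
  from IH have Xq: "mv K X (q i) k = of_real (s i) * p i k" if "i < m" "k \<in> K" for i k using that by blast
  from IH have Xp: "mv K (adj X) (p i) k = of_real (s i) * q i k" if "i < m" "k \<in> K" for i k using that by blast
  have card: "card {..<m} < card K" using Suc.prems by simp
  obtain x where x': "nsq K x = 1 \<and> (\<forall>l\<in>{..<m}. ip K x (q l) = 0) \<and>
    (\<forall>y. (\<forall>l\<in>{..<m}. ip K y (q l) = 0) \<longrightarrow> nsq K (mv K X y) \<le> nsq K (mv K X x) * nsq K y)"
    using maximizer_exists[OF K finite_lessThan card, where J = K and X = X and q = q] by (elim exE) (rule that)
  then have x: "nsq K x = 1" "\<And>l. l < m \<Longrightarrow> ip K x (q l) = 0"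
    "\<And>y. (\<And>l. l < m \<Longrightarrow> ip K y (q l) = 0) \<Longrightarrow> nsq K (mv K X y) \<le> nsq K (mv K X x) * nsq K y"
    by auto
  define S where "S = nsq K (mv K X x)"
  have S0: "0 \<le> S" by (simp add: S_def)
  have orth: "ip K (mv K X y) (p l) = of_real (s l) * ip K y (q l)" if "l < m" for y l
  proof -
    have "ip K (mv K X y) (p l) = ip K y (\<lambda>k. of_real (s l) * q l k)"
      unfolding ip_mv[OF K] by (rule ip_cong) (simp_all add: Xp that)
    then show ?thesis by (simp add: ip_mult_right)
  qed
  have orth': "ip K (mv K (adj X) y) (q l) = of_real (s l) * ip K y (p l)" if "l < m" for y l
  proof -
    have "ip K (mv K (adj X) y) (q l) = ip K y (\<lambda>k. of_real (s l) * p l k)"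
      unfolding ip_mv[OF K] adj_adj by (rule ip_cong) (simp_all add: Xq that)
    then show ?thesis by (simp add: ip_mult_right)
  qed
  \<comment> \<open>Moving the maximiser in an admissible direction orthogonal to it changes its
    norm only to second order.\<close>
  have stat: "ip K (mv K X x) (mv K X y) = 0"
    if y: "\<And>l. l < m \<Longrightarrow> ip K y (q l) = 0" "ip K x y = 0" for y
  proof (rule stationary_at_maximum[where m = "nsq K y"])
    fix t
    have "nsq K (\<lambda>k. mv K X x k + t * mv K X y k) = nsq K (mv K X (\<lambda>k. x k + t * y k))"
      by (simp add: mv_add mv_mult)
    also have "\<dots> \<le> S * nsq K (\<lambda>k. x k + t * y k)"
      unfolding S_def by (rule x(3)) (simp add: ip_add_left ip_mult_left x(2) y(1))
    also have "nsq K (\<lambda>k. x k + t * y k) = 1 + (norm t)\<^sup>2 * nsq K y"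
    proof -
      have "(of_real (nsq K (\<lambda>k. x k + t * y k)) :: 'a) = of_real (1 + (norm t)\<^sup>2 * nsq K y)"
        by (simp only: nsq_add ip_mult_right y(2) x(1) nsq_mult) simp
      then show ?thesis unfolding of_real_eq_iff .
    qed
    finally show "nsq K (\<lambda>k. mv K X x k + t * mv K X y k) \<le> nsq K (mv K X x) * (1 + (norm t)\<^sup>2 * nsq K y)"
      by (simp add: S_def)
  qed simp
  \<comment> \<open>The residual \<open>y\<close> of the eigenvalue equation is itself an admissible
    direction orthogonal to \<open>x\<close>, so stationarity applied to it gives ip y y =
    0.\<close>
  have XXx: "mv K (adj X) (mv K X x) k = of_real S * x k" if k: "k \<in> K" for k
  proof -
    define y where "y k = mv K (adj X) (mv K X x) k - of_real S * x k" for k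
    have "ip K x (mv K (adj X) (mv K X x)) = of_real S"
      unfolding ip_mv[OF K, symmetric] by (simp add: ip_self S_def)
    then have xy: "ip K x y = 0"
      by (simp add: y_def[abs_def] ip_diff_right ip_mult_right ip_self x(1))
    have yq: "ip K y (q l) = 0" if "l < m" for l
      using that by (simp add: y_def[abs_def] ip_diff_left ip_mult_left orth' orth x(2))
    have "ip K (mv K (adj X) (mv K X x)) y = 0"
      using stat[OF yq xy] ip_mv[OF K, of K "adj X" "mv K X x" y] by simp
    then have "ip K y y = 0"
      using xy by (simp add: y_def[abs_def] ip_diff_left ip_mult_left)
    then have "y k = 0" using k nsq_eq_0_iff[OF K, of y] by (simp add: ip_self)
    then show ?thesis by (simp add: y_def)
  qed
  obtain P where P: "nsq K P = 1" "\<And>l. l < m \<Longrightarrow> ip K P (p l) = 0"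
    "\<And>k. k \<in> K \<Longrightarrow> mv K X x k = of_real (sqrt S) * P k"
    "\<And>k. k \<in> K \<Longrightarrow> mv K (adj X) P k = of_real (sqrt S) * x k"
  proof (cases "S = 0")
    case False
    define P where "P k = of_real (1 / sqrt S) * mv K X x k" for k
    have PP: "P = (\<lambda>k. of_real (1 / sqrt S) * mv K X x k)" by (simp add: P_def fun_eq_iff)
    show thesis
    proof (rule that[of P])
      show "nsq K P = 1"
        unfolding PP nsq_mult S_def[symmetric] using False S0 by (simp add: power_divide norm_divide)
      show "ip K P (p l) = 0" if "l < m" for l
        unfolding PP ip_mult_left using that by (simp add: orth x(2))
      show "mv K X x k = of_real (sqrt S) * P k" for k
        using False by (simp add: P_def)
      show "mv K (adj X) P k = of_real (sqrt S) * x k" if "k \<in> K" for k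
      proof -
        have "mv K (adj X) P k = of_real (1 / sqrt S * S) * x k"
          unfolding PP mv_mult XXx[OF that] by simp
        also have "1 / sqrt S * S = sqrt S"
          using real_sqrt_mult_self[of S] S0 False by (simp add: field_simps del: real_sqrt_mult_self)
        finally show ?thesis .
      qed
    qed
  next
    \<comment> \<open>With S = 0 the matrix vanishes on the whole remaining space. Any unit
      \<open>P\<close> orthogonal to the earlier left vectors serves: z = adj X P is admissible, so
      X z = 0 and |z|^2 = ip P (X z) = 0.\<close>
    case True
    obtain P where P': "nsq K P = 1 \<and> (\<forall>l\<in>{..<m}. ip K P (p l) = 0) \<and>
      (\<forall>y. (\<forall>l\<in>{..<m}. ip K y (p l) = 0) \<longrightarrow> nsq K (mv K X y) \<le> nsq K (mv K X P) * nsq K y)"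
      using maximizer_exists[OF K finite_lessThan card, where J = K and X = X and q = p] by (elim exE) (rule that)
    then have P: "nsq K P = 1" "\<And>l. l < m \<Longrightarrow> ip K P (p l) = 0" by auto
    define z where "z = mv K (adj X) P"
    have zq: "ip K z (q l) = 0" if "l < m" for l using that P by (simp add: z_def orth')
    have "nsq K (mv K X z) \<le> S * nsq K z" unfolding S_def by (rule x(3)) (simp add: zq)
    then have "nsq K (mv K X z) \<le> 0" using True by simp
    then have "nsq K (mv K X z) = 0" by (rule antisym) simp
    then have "ip K P (mv K X z) = ip K P (\<lambda>_. 0)"
      by (intro ip_cong) (simp_all add: nsq_eq_0_iff[OF K])
    then have "ip K z z = 0"
      unfolding z_def ip_mv[OF K] adj_adj by simp
    then have z0: "\<forall>k\<in>K. z k = 0" using nsq_eq_0_iff[OF K, of z] by (simp add: ip_self)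
    have "\<forall>k\<in>K. mv K X x k = 0" using True nsq_eq_0_iff[OF K, of "mv K X x"] by (simp add: S_def)
    with z0 P True show thesis by (intro that[of P]) (auto simp: z_def)
  qed
  have Pp: "ip K (p l) P = 0" if "l < m" for l using P(2)[OF that] ip_commute[of K "p l" P] by simp
  have xq: "ip K (q l) x = 0" if "l < m" for l using x(2)[of l] ip_commute[of K "q l" x] that by simp
  have "ip K ((p(m := P)) i) ((p(m := P)) j) = (if i = j then 1 else 0)" if "i < Suc m" "j < Suc m" for i j
    using that p P(1,2) Pp by (cases "i = m"; cases "j = m") (simp_all add: less_Suc_eq ip_self)
  moreover have "ip K ((q(m := x)) i) ((q(m := x)) j) = (if i = j then 1 else 0)" if "i < Suc m" "j < Suc m" for i j
    using that q x(1,2) xq by (cases "i = m"; cases "j = m") (simp_all add: less_Suc_eq ip_self)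
  moreover have "0 \<le> (s(m := sqrt S)) i" if "i < Suc m" for i
    using that s S0 by (cases "i = m") (simp_all add: less_Suc_eq)
  moreover have "mv K X ((q(m := x)) i) k = of_real ((s(m := sqrt S)) i) * (p(m := P)) i k" if "i < Suc m" "k \<in> K" for i k
    using that Xq P(3) by (cases "i = m") (simp_all add: less_Suc_eq)
  moreover have "mv K (adj X) ((p(m := P)) i) k = of_real ((s(m := sqrt S)) i) * (q(m := x)) i k" if "i < Suc m" "k \<in> K" for i k
    using that Xp P(4) by (cases "i = m") (simp_all add: less_Suc_eq)
  ultimately show ?case
    by - (rule exI[of _ "s(m := sqrt S)"], rule exI[of _ "p(m := P)"], rule exI[of _ "q(m := x)"], intro conjI allI impI ballI)
qed simp

text \<open>The values \<open>s\<close> come in no particular order; the comparison with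
  \<open>singular_value\<close> goes through sorting and counting.\<close>

definition is_svd :: "nat \<Rightarrow> (nat \<Rightarrow> nat \<Rightarrow> 'a :: real_or_complex) \<Rightarrow> (nat \<Rightarrow> real) \<Rightarrow> (nat \<Rightarrow> nat \<Rightarrow> 'a) \<Rightarrow> (nat \<Rightarrow> nat \<Rightarrow> 'a) \<Rightarrow> bool" where
  "is_svd n X s p q \<longleftrightarrow> orthonormal_basis {..<n} {..<n} p \<and> orthonormal_basis {..<n} {..<n} q \<and>
     (\<forall>i<n. 0 \<le> s i \<and> (\<forall>k<n. mv {..<n} X (q i) k = of_real (s i) * p i k) \<and>
             (\<forall>k<n. mv {..<n} (adj X) (p i) k = of_real (s i) * q i k))"

lemma svd_exists: "\<exists>s p q. is_svd n X s p q"
proof -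
  have "\<exists>s p q. (\<forall>i<n. \<forall>j<n. ip {..<n} (p i) (p j) = (if i = j then 1 else 0)) \<and>
      (\<forall>i<n. \<forall>j<n. ip {..<n} (q i) (q j) = (if i = j then 1 else 0)) \<and>
      (\<forall>i<n. 0 \<le> s i \<and> (\<forall>k\<in>{..<n}. mv {..<n} X (q i) k = of_real (s i) * p i k) \<and>
             (\<forall>k\<in>{..<n}. mv {..<n} (adj X) (p i) k = of_real (s i) * q i k))"
    by (rule partial_svd) auto
  then obtain s p q where *: "(\<forall>i<n. \<forall>j<n. ip {..<n} (p i) (p j) = (if i = j then 1 else 0)) \<and>
      (\<forall>i<n. \<forall>j<n. ip {..<n} (q i) (q j) = (if i = j then 1 else 0)) \<and>
      (\<forall>i<n. 0 \<le> s i \<and> (\<forall>k\<in>{..<n}. mv {..<n} X (q i) k = of_real (s i) * p i k) \<and>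
             (\<forall>k\<in>{..<n}. mv {..<n} (adj X) (p i) k = of_real (s i) * q i k))"
    by (elim exE) (rule that)
  have "is_svd n X s p q"
    unfolding is_svd_def
  proof (intro conjI)
    show "orthonormal_basis {..<n} {..<n} p" "orthonormal_basis {..<n} {..<n} q"
      using * by (unfold_locales; simp)+
  qed (use * in simp)
  then show ?thesis by (intro exI)
qed

section \<open>Singular values of matrices\<close>

definition entries :: "'a mat \<Rightarrow> nat \<Rightarrow> nat \<Rightarrow> 'a" where
  "entries A i j = A $$ (i, j)"

lemma mat_adjoint_carrier: "A \<in> carrier_mat n m \<Longrightarrow> mat_adjoint A \<in> carrier_mat m n"
  unfolding mat_adjoint_def using mat_of_rows_carrier(1)[of n "map conjugate (cols A)"] by simp

lemma mat_adjoint_index: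
  "A \<in> carrier_mat n m \<Longrightarrow> i < m \<Longrightarrow> j < n \<Longrightarrow> mat_adjoint A $$ (i, j) = conjugate (A $$ (j, i))"
  unfolding mat_adjoint_def by (auto simp: mat_of_rows_index)

text \<open>The right singular vectors diagonalise adj A times A with eigenvalues (s i)^2, so its
  characteristic polynomial splits even over the reals and its roots are known with
  multiplicity.\<close>

lemma singular_values_svd:
  assumes A: "A \<in> carrier_mat n n" and svd: "is_svd n (entries A) s p q"
  shows "singular_values A = rev (sort (map s [0..<n]))"
proof -
  interpret q: orthonormal_basis "{..<n}" "{..<n}" q using svd by (simp add: is_svd_def)
  have s: "0 \<le> s k" if "k < n" for k using svd that by (simp add: is_svd_def)
  define Q where "Q = Matrix.mat n n (\<lambda>(i, k). q k i)"
  define Q' where "Q' = Matrix.mat n n (\<lambda>(k, i). conjugate (q k i))"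
  define D where "D = Matrix.mat n n (\<lambda>(i, j). if i = j then of_real ((s i)\<^sup>2) else (0 :: 'a))"
  have carr: "Q \<in> carrier_mat n n" "Q' \<in> carrier_mat n n" "D \<in> carrier_mat n n"
    "mat_adjoint A \<in> carrier_mat n n"
    using mat_adjoint_carrier[OF A] by (auto simp: Q_def Q'_def D_def)
  have QQ': "Q * Q' = 1\<^sub>m n"
    by (rule eq_matI) (auto simp: Q_def Q'_def scalar_prod_def q.complete atLeast0LessThan)
  have Q'Q: "Q' * Q = 1\<^sub>m n"
    by (rule mat_mult_left_right_inverse[OF carr(1,2) QQ'])
  have AAQ: "mat_adjoint A * A * Q = Q * D"
  proof (rule eq_matI)
    fix i k assume "i < dim_row (Q * D)" "k < dim_col (Q * D)"
    then have ik: "i < n" "k < n" using carr by auto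
    have "(mat_adjoint A * A * Q) $$ (i, k) = (mat_adjoint A * (A * Q)) $$ (i, k)"
      using assoc_mult_mat[OF carr(4) A carr(1)] by simp
    also have "\<dots> = (\<Sum>j<n. conjugate (A $$ (j, i)) * (\<Sum>l<n. A $$ (j, l) * q k l))"
      using A carr ik
      by (auto simp: scalar_prod_def atLeast0LessThan mat_adjoint_index Q_def intro!: sum.cong)
    also have "\<dots> = mv {..<n} (adj (entries A)) (mv {..<n} (entries A) (q k)) i"
      by (simp add: mv_def adj_def entries_def)
    also have "\<dots> = mv {..<n} (adj (entries A)) (\<lambda>j. of_real (s k) * p k j) i"
      by (rule arg_cong[where f = "\<lambda>f. f i"], rule mv_cong) (use svd ik in \<open>simp add: is_svd_def\<close>)
    also have "\<dots> = of_real ((s k)\<^sup>2) * q k i"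
      unfolding mv_mult using svd ik by (simp add: is_svd_def power2_eq_square)
    also have "\<dots> = (Q * D) $$ (i, k)"
      using ik by (simp add: Q_def D_def scalar_prod_def if_distrib[of "\<lambda>x. _ * x"] atLeast0LessThan
          sum.delta mult.commute cong: if_cong)
    finally show "(mat_adjoint A * A * Q) $$ (i, k) = (Q * D) $$ (i, k)" .
  qed (use carr A in auto)
  have "mat_adjoint A * A = mat_adjoint A * A * (Q * Q')"
    unfolding QQ' using carr A by simp
  also have "\<dots> = mat_adjoint A * A * Q * Q'"
    using carr A by (subst assoc_mult_mat[of _ n n _ n _ n]) auto
  finally have "mat_adjoint A * A = Q * D * Q'" unfolding AAQ .
  then have "similar_mat (mat_adjoint A * A) D"
    unfolding similar_mat_def using carr A
    by (intro exI[of _ Q] exI[of _ Q'] similar_mat_witI[OF QQ' Q'Q]) auto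
  then have "char_poly (mat_adjoint A * A) = char_poly D" by (rule char_poly_similar)
  also have "\<dots> = (\<Prod>a\<leftarrow>diag_mat D. [:- a, 1:])"
    by (rule char_poly_upper_triangular[OF carr(3)]) (auto simp: D_def)
  also have "diag_mat D = map (\<lambda>i. of_real ((s i)\<^sup>2)) [0..<n]"
    by (simp add: diag_mat_def D_def)
  finally have cp: "char_poly (mat_adjoint A * A) = (\<Prod>i\<leftarrow>[0..<n]. [:- of_real ((s i)\<^sup>2), 1:])"
    by (simp add: comp_def)
  have "proots (\<Prod>i\<leftarrow>xs. [:- of_real ((s i)\<^sup>2), 1:]) = image_mset (\<lambda>i. of_real ((s i)\<^sup>2) :: 'a) (mset xs)" for xs
  proof (induction xs)
    case (Cons x xs)
    have "(\<Prod>i\<leftarrow>xs. [:- of_real ((s i)\<^sup>2), 1 :: 'a:]) \<noteq> 0" by (auto simp: prod_list_zero_iff)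
    then have "proots ([:- of_real ((s x)\<^sup>2), 1:] * (\<Prod>i\<leftarrow>xs. [:- of_real ((s i)\<^sup>2), 1 :: 'a:]))
       = {#of_real ((s x)\<^sup>2)#} + image_mset (\<lambda>i. of_real ((s i)\<^sup>2)) (mset xs)"
      unfolding Cons[symmetric] by (subst proots_mult) (auto simp del: of_real_power)
    then show ?case by (simp del: of_real_power mult_pCons_left)
  qed simp
  then have "image_mset (\<lambda>x. sqrt (norm x)) (proots (char_poly (mat_adjoint A * A)))
      = image_mset (\<lambda>i. sqrt (norm (of_real ((s i)\<^sup>2) :: 'a))) (mset [0..<n])"
    unfolding cp by (simp add: image_mset.compositionality comp_def)
  also have "\<dots> = image_mset s (mset [0..<n])"
    by (intro image_mset_cong) (use s in \<open>auto simp: norm_power\<close>)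
  also have "\<dots> = mset (map s [0..<n])" by (simp only: mset_map)
  finally show ?thesis
    unfolding singular_values_def by (simp only: sorted_list_of_multiset_mset)
qed

context
  fixes A :: "'a :: real_or_complex mat" and n s p q
  assumes A: "A \<in> carrier_mat n n" and svd: "is_svd n (entries A) s p q"
begin

private lemma sv_nth:
  assumes "1 \<le> i" "i \<le> n"
  shows "singular_value (n + 1 - i) A = sort (map s [0..<n]) ! (i - 1)"
proof -
  have "n - i < n" using assms by auto
  then show ?thesis
    unfolding singular_value_def singular_values_svd[OF A svd] using assms
    by (simp add: rev_nth)
qed

private lemma card_filter: "card {k. k < n \<and> P (s k)} = card {k. k < n \<and> P (sort (map s [0..<n]) ! k)}"
proof -
  have "length (filter P (map s [0..<n])) = length (filter P (sort (map s [0..<n])))"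
    by (metis mset_filter mset_sort size_mset)
  then show ?thesis
    unfolding length_filter_conv_card by (simp cong: conj_cong)
qed

text \<open>This bound and the next locate the i-th smallest singular value by counts. Counts do not
  see the order of \<open>s\<close>, so they hold for every decomposition of the matrix.\<close>

lemma card_svd_less_singular_value:
  assumes i: "1 \<le> i" "i \<le> n"
  shows "card {k. k < n \<and> s k < singular_value (n + 1 - i) A} < i"
proof -
  let ?t = "singular_value (n + 1 - i) A"
  have "card {k. k < n \<and> s k < ?t} \<le> card {..<i - 1}"
    unfolding card_filter[of "\<lambda>x. x < ?t"]
  proof (rule card_mono)
    show "{k. k < n \<and> sort (map s [0..<n]) ! k < ?t} \<subseteq> {..<i - 1}"
    proof
      fix k assume k: "k \<in> {k. k < n \<and> sort (map s [0..<n]) ! k < ?t}"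
      show "k \<in> {..<i - 1}"
      proof (rule ccontr)
        assume "k \<notin> {..<i - 1}"
        then have "sort (map s [0..<n]) ! (i - 1) \<le> sort (map s [0..<n]) ! k"
          using k i by (intro sorted_nth_mono) auto
        then show False using k sv_nth[OF i] by simp
      qed
    qed
  qed simp
  then show ?thesis using i by simp
qed

lemma card_svd_le_singular_value:
  assumes i: "1 \<le> i" "i \<le> n"
  shows "i \<le> card {k. k < n \<and> s k \<le> singular_value (n + 1 - i) A}"
proof -
  let ?t = "singular_value (n + 1 - i) A"
  have "card {..<i} \<le> card {k. k < n \<and> s k \<le> ?t}"
    unfolding card_filter[of "\<lambda>x. x \<le> ?t"]
  proof (rule card_mono)
    show "{..<i} \<subseteq> {k. k < n \<and> sort (map s [0..<n]) ! k \<le> ?t}"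
      using i unfolding sv_nth[OF i] by (auto intro!: sorted_nth_mono)
  qed simp
  then show ?thesis by simp
qed

lemma smallest_singular_value_le:
  assumes "k < n"
  shows "singular_value n A \<le> s k"
proof (rule ccontr)
  assume "\<not> ?thesis"
  then have "k \<in> {k. k < n \<and> s k < singular_value (n + 1 - 1) A}"
    using assms by auto
  moreover have "card {k. k < n \<and> s k < singular_value (n + 1 - 1) A} < 1"
    by (rule card_svd_less_singular_value) (use assms in auto)
  then have "card {k. k < n \<and> s k < singular_value (n + 1 - 1) A} = 0" by simp
  then have "{k. k < n \<and> s k < singular_value (n + 1 - 1) A} = {}"
    by (subst (asm) card_0_eq) auto
  ultimately show False by blast
qed

lemma sum_singular_value: "(\<Sum>k\<in>{1..n}. f (singular_value k A)) = (\<Sum>k<n. f (s k))"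
proof -
  have "(\<Sum>k\<in>{1..n}. f (singular_value k A)) = (\<Sum>k<n. f (singular_values A ! k))"
    by (rule sum.reindex_bij_witness[of _ Suc "\<lambda>k. k - 1"]) (auto simp: singular_value_def)
  also have "\<dots> = sum_list (map f (singular_values A))"
    unfolding sum_list_sum_nth by (simp add: singular_values_svd[OF A svd] atLeast0LessThan)
  also have "\<dots> = sum_mset (image_mset f (mset (singular_values A)))"
    by (simp only: sum_mset_sum_list flip: mset_map)
  also have "mset (singular_values A) = mset (map s [0..<n])"
    by (simp add: singular_values_svd[OF A svd])
  also have "sum_mset (image_mset f (mset (map s [0..<n]))) = sum_list (map f (map s [0..<n]))"
    by (simp only: sum_mset_sum_list flip: mset_map)
  also have "\<dots> = (\<Sum>k<n. f (s k))"
    by (simp add: sum_list_sum_nth atLeast0LessThan)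
  finally show ?thesis .
qed

lemma integral_empirical_singular_measure:
  assumes f: "f \<in> borel_measurable borel"
  shows "(\<integral>t. f t \<partial>empirical_singular_measure A) = (\<Sum>k<n. f (s k)) / (real n :: real)"
proof -
  have n: "dim_row A = n" using A by simp
  have "(\<integral>t. f t \<partial>empirical_singular_measure A) = (\<integral>k. f (singular_value k A) \<partial>uniform_count_measure {1..n})"
    unfolding empirical_singular_measure_def n by (rule integral_distr) (auto simp: f)
  also have "\<dots> = (\<Sum>k<n. f (s k)) / real n"
    by (simp only: integral_uniform_count_measure finite_atLeastAtMost sum_singular_value card_atLeastAtMost) simp
  finally show ?thesis .
qed

end

lemma real_distribution_empirical_singular_measure:
  assumes "0 < dim_row A"
  shows "real_distribution (empirical_singular_measure A)"
proof -
  interpret prob_space "uniform_count_measure {1..dim_row A}"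
    by (rule prob_space_uniform_count_measure) (use assms in auto)
  show ?thesis
    unfolding empirical_singular_measure_def by (rule real_distribution_distr) (auto simp: real_distribution_axioms_def)
qed

section \<open>Moments from the log-Sobolev inequality\<close>

text \<open>Jensen's inequality for -ln and the function 1/f under the probability f^2 d\<nu> / S.
  Its pointwise form is the tangent bound ln t \<ge> 1 - 1/t.\<close>

lemma entropy_inequality:
  fixes f :: "'b \<Rightarrow> real"
  assumes "prob_space \<nu>" and m: "integrable \<nu> f" "(\<integral>x. f x \<partial>\<nu>) = m" "m > 0"
    and S: "integrable \<nu> (\<lambda>x. (f x)\<^sup>2)" "(\<integral>x. (f x)\<^sup>2 \<partial>\<nu>) = S" "S > 0"
    and int: "integrable \<nu> (\<lambda>x. (f x)\<^sup>2 * ln ((f x)\<^sup>2 / S))"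
    and pos: "\<And>x. f x > 0"
  shows "S * ln (S / m\<^sup>2) \<le> (\<integral>x. (f x)\<^sup>2 * ln ((f x)\<^sup>2 / S) \<partial>\<nu>)"
proof -
  have "2 * (f x)\<^sup>2 - 2 * (S / m) * f x + ln (S / m\<^sup>2) * (f x)\<^sup>2 \<le> (f x)\<^sup>2 * ln ((f x)\<^sup>2 / S)" for x
  proof -
    \<comment> \<open>Normalised so that 1/t has mean 1 under f^2 d\<nu> / S; the two correction
      terms then cancel after integration.\<close>
    define t where "t = f x * m / S"
    have t: "t > 0" unfolding t_def by (intro divide_pos_pos mult_pos_pos pos m(3) S(3))
    have tS: "t * S = f x * m" using S(3) unfolding t_def by simp
    have "(f x)\<^sup>2 * m\<^sup>2 = t\<^sup>2 * S\<^sup>2" unfolding power_mult_distrib[symmetric] tS ..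
    then have "(f x)\<^sup>2 / S = t\<^sup>2 * (S / m\<^sup>2)"
      using m(3) S(3) by (simp add: frac_eq_eq power2_eq_square[of S] mult.assoc)
    then have "ln ((f x)\<^sup>2 / S) = ln (t\<^sup>2) + ln (S / m\<^sup>2)"
      using t m(3) S(3) by (simp only:) (rule ln_mult_pos, simp_all)
    then have L: "ln ((f x)\<^sup>2 / S) = 2 * ln t + ln (S / m\<^sup>2)"
      using t by (simp add: ln_realpow)
    have "ln (1 / t) \<le> 1 / t - 1" by (rule ln_le_minus_one) (use t in simp)
    then have "1 - 1 / t \<le> ln t" using t by (simp add: ln_div)
    then have "(f x)\<^sup>2 * (1 - 1 / t) \<le> (f x)\<^sup>2 * ln t" by (intro mult_left_mono) auto
    moreover have "(f x)\<^sup>2 * (1 - 1 / t) = (f x)\<^sup>2 - S / m * f x"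
    proof -
      have "(f x)\<^sup>2 * (1 / t) = S / m * f x"
        using pos[of x] m(3) S(3) unfolding t_def by (simp add: power2_eq_square)
      then show ?thesis by (simp only: right_diff_distrib mult_1_right)
    qed
    ultimately have "2 * ((f x)\<^sup>2 - S / m * f x) \<le> 2 * ((f x)\<^sup>2 * ln t)" by simp
    then show ?thesis unfolding L distrib_left by (simp add: algebra_simps)
  qed
  then have "(\<integral>x. 2 * (f x)\<^sup>2 - 2 * (S / m) * f x + ln (S / m\<^sup>2) * (f x)\<^sup>2 \<partial>\<nu>) \<le> (\<integral>x. (f x)\<^sup>2 * ln ((f x)\<^sup>2 / S) \<partial>\<nu>)"
    by (intro integral_mono int Bochner_Integration.integrable_add Bochner_Integration.integrable_diff
        integrable_mult_right m S)
  moreover have "(\<integral>x. 2 * (f x)\<^sup>2 - 2 * (S / m) * f x + ln (S / m\<^sup>2) * (f x)\<^sup>2 \<partial>\<nu>)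
      = 2 * S - 2 * (S / m) * m + ln (S / m\<^sup>2) * S"
    using m(1) S(1) by (simp add: m(2) S(2))
  ultimately show ?thesis using m(3) by (simp add: mult.commute)
qed

text \<open>With w = 1 + |x|^2 this is w / (1 + w/T): smooth, bounded by T, and increasing to w as T
  grows. The summand 1 keeps it positive, as the entropy bound requires.\<close>

definition truncated :: "real \<Rightarrow> 'a :: real_inner \<Rightarrow> real" where
  "truncated T x = (1 + (norm x)\<^sup>2) / (1 + (1 + (norm x)\<^sup>2) / T)"

context
  fixes \<nu> :: "'a :: real_or_complex measure"
  assumes prob: "prob_space \<nu>" and sets_borel [measurable_cong]: "sets \<nu> = sets borel"
    and var: "integrable \<nu> (\<lambda>x. (norm x)\<^sup>2)" "(\<integral>x. (norm x)\<^sup>2 \<partial>\<nu>) = 1"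
    and lsi: "log_sobolev \<nu>"
begin

interpretation prob_space \<nu> by (rule prob)

private lemma denominator_pos: "T > 0 \<Longrightarrow> 0 < 1 + (1 + (norm x)\<^sup>2) / T"
  by (simp add: add_pos_nonneg)

private lemma denominator_nz: "T > 0 \<Longrightarrow> 1 + (1 + (norm x)\<^sup>2) / T \<noteq> 0"
  using denominator_pos[of T x] by simp

private lemma denominator_continuous: "continuous_on UNIV (\<lambda>x :: 'a. 1 + (1 + (norm x)\<^sup>2) / T)"
  unfolding divide_inverse by (intro continuous_intros)

private lemma truncated_pos: "T > 0 \<Longrightarrow> truncated T x > 0"
  unfolding truncated_def by (intro divide_pos_pos denominator_pos) (auto simp: add_pos_nonneg)

private lemma truncated_le: "T > 0 \<Longrightarrow> truncated T x \<le> 1 + (norm x)\<^sup>2"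
  using divide_left_mono[of 1 "1 + (1 + (norm x)\<^sup>2) / T" "1 + (norm x)\<^sup>2"] denominator_pos[of T x]
  unfolding truncated_def by (simp add: add_nonneg_nonneg)

private lemma truncated_bound: "T > 0 \<Longrightarrow> truncated T x \<le> T"
  unfolding truncated_def using denominator_pos[of T x]
  by (simp add: divide_le_eq) (simp add: field_simps)

private lemma truncated_gderiv:
  fixes x :: 'a
  assumes T: "T > 0"
  shows "GDERIV (truncated T) x :> (2 / (1 + (1 + (norm x)\<^sup>2) / T)\<^sup>2) *\<^sub>R x"
proof -
  have w: "GDERIV (\<lambda>x. 1 + (norm x)\<^sup>2) x :> 2 *\<^sub>R x" for x :: 'a
    unfolding gderiv_def power2_norm_eq_inner
    by (auto intro!: derivative_eq_intros simp: inner_commute)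
  have d: "DERIV (\<lambda>w. w / (1 + w / T)) w :> 1 / (1 + w / T)\<^sup>2" if "1 + w / T \<noteq> 0" for w
    using T that by (auto intro!: derivative_eq_intros simp: power2_eq_square field_simps)
  have "GDERIV (truncated T) x :> (1 / (1 + (1 + (norm x)\<^sup>2) / T)\<^sup>2) *\<^sub>R (2 *\<^sub>R x)"
    unfolding truncated_def[abs_def]
    by (rule GDERIV_DERIV_compose[where f = "\<lambda>x. 1 + (norm x)\<^sup>2" and g = "\<lambda>w. w / (1 + w / T)", OF w d]) (use denominator_pos[OF T, of x] in auto)
  then show ?thesis by simp
qed

text \<open>The squared gradient is controlled by the function itself, uniformly in
  \<open>T\<close>. This turns a bound on one moment into a bound on the next.\<close>

private lemma truncated_gradient_bound:
  assumes T: "T > 0"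
  shows "(norm ((2 / (1 + (1 + (norm x)\<^sup>2) / T)\<^sup>2) *\<^sub>R x))\<^sup>2 \<le> 4 * truncated T x"
proof -
  define D where "D = 1 + (1 + (norm x)\<^sup>2) / T"
  have D: "D \<ge> 1" using T by (simp add: D_def)
  have "(norm ((2 / D\<^sup>2) *\<^sub>R x))\<^sup>2 = 4 * (norm x)\<^sup>2 / (D * D ^ 3)"
    using D by (simp add: power_mult_distrib power_divide power2_eq_square power3_eq_cube)
  also have "\<dots> \<le> 4 * (1 + (norm x)\<^sup>2) / (D * 1)"
    using D by (intro frac_le mult_left_mono one_le_power) (auto simp: add_nonneg_pos)
  finally show ?thesis by (simp add: D_def truncated_def)
qed

private lemma truncated_continuous: "T > 0 \<Longrightarrow> continuous_on UNIV (truncated T :: 'a \<Rightarrow> real)"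
  unfolding truncated_def[abs_def]
  by (rule continuous_on_divide[OF _ denominator_continuous]) (intro continuous_intros, rule ballI, rule denominator_nz)

private lemma truncated_measurable: "T > 0 \<Longrightarrow> (truncated T :: 'a \<Rightarrow> real) \<in> borel_measurable \<nu>"
  unfolding measurable_cong_sets[OF sets_borel refl] by (intro borel_measurable_continuous_onI truncated_continuous)

private lemma truncated_power_integrable:
  assumes T: "T > 0"
  shows "integrable \<nu> (\<lambda>x. (truncated T x) ^ k)"
proof (rule integrable_const_bound[where B = "T ^ k"])
  show "AE x in \<nu>. norm (truncated T x ^ k) \<le> T ^ k"
  proof (rule AE_I2)
    fix x :: 'a
    have "0 \<le> truncated T x" using truncated_pos[OF T, of x] by simp
    moreover from this have "truncated T x ^ k \<le> T ^ k" by (intro power_mono truncated_bound T)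
    ultimately show "norm (truncated T x ^ k) \<le> T ^ k" by simp
  qed
  show "(\<lambda>x. truncated T x ^ k) \<in> borel_measurable \<nu>"
    using truncated_measurable[OF T] by measurable
qed

private lemma integral_positive: "integrable \<nu> h \<Longrightarrow> (\<And>x. 0 < h x) \<Longrightarrow> 0 < (\<integral>x. h x \<partial>\<nu>)" for h :: "'a \<Rightarrow> real"
  by (rule expectation_greater) (auto intro: AE_I2)

text \<open>Log-Sobolev with the entropy replaced by its lower bound: the second moment of a
  positive \<open>f\<close> can exceed the square of its mean only as far as its energy
  permits.\<close>

private lemma lsi_moment:
  obtains C where "C > 0" "\<And>f g. \<lbrakk>\<And>x. f x > 0; \<And>x. GDERIV f x :> g x; continuous_on UNIV g; integrable \<nu> f; integrable \<nu> (\<lambda>x. (f x)\<^sup>2);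
     integrable \<nu> (\<lambda>x. (norm (g x))\<^sup>2)\<rbrakk> \<Longrightarrow>
     (\<integral>x. (f x)\<^sup>2 \<partial>\<nu>) * ln ((\<integral>x. (f x)\<^sup>2 \<partial>\<nu>) / (\<integral>x. f x \<partial>\<nu>)\<^sup>2) \<le> 2 * C * (\<integral>x. (norm (g x))\<^sup>2 \<partial>\<nu>)"
proof -
  obtain C where C: "C > 0" and C': "\<forall>f g. (\<forall>x. GDERIV f x :> g x) \<longrightarrow> continuous_on UNIV g \<longrightarrow>
     integrable \<nu> (\<lambda>x. (f x)\<^sup>2) \<longrightarrow> integrable \<nu> (\<lambda>x. (norm (g x))\<^sup>2) \<longrightarrow>
     integrable \<nu> (\<lambda>x. (f x)\<^sup>2 * ln ((f x)\<^sup>2 / (\<integral>y. (f y)\<^sup>2 \<partial>\<nu>))) \<and>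
     (\<integral>x. (f x)\<^sup>2 * ln ((f x)\<^sup>2 / (\<integral>y. (f y)\<^sup>2 \<partial>\<nu>)) \<partial>\<nu>) \<le> 2 * C * (\<integral>x. (norm (g x))\<^sup>2 \<partial>\<nu>)"
    using lsi unfolding log_sobolev_def by (elim exE conjE) (rule that)
  show thesis
  proof (rule that[OF C])
    fix f :: "'a \<Rightarrow> real" and g
    assume pos: "\<And>x. f x > 0" and g: "\<And>x. GDERIV f x :> g x" "continuous_on UNIV g"
      and int: "integrable \<nu> f" "integrable \<nu> (\<lambda>x. (f x)\<^sup>2)" "integrable \<nu> (\<lambda>x. (norm (g x))\<^sup>2)"
    note L = C'[rule_format, OF g int(2,3)]
    have "(\<integral>x. (f x)\<^sup>2 \<partial>\<nu>) * ln ((\<integral>x. (f x)\<^sup>2 \<partial>\<nu>) / (\<integral>x. f x \<partial>\<nu>)\<^sup>2)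
      \<le> (\<integral>x. (f x)\<^sup>2 * ln ((f x)\<^sup>2 / (\<integral>y. (f y)\<^sup>2 \<partial>\<nu>)) \<partial>\<nu>)"
      using L by (intro entropy_inequality[OF prob int(1) refl _ int(2) refl] integral_positive int pos zero_less_power) simp
    with L show "(\<integral>x. (f x)\<^sup>2 \<partial>\<nu>) * ln ((\<integral>x. (f x)\<^sup>2 \<partial>\<nu>) / (\<integral>x. f x \<partial>\<nu>)\<^sup>2) \<le> 2 * C * (\<integral>x. (norm (g x))\<^sup>2 \<partial>\<nu>)"
      by linarith
  qed
qed

text \<open>Two rounds of \<open>lsi_moment\<close>: applied to the truncation it bounds the second
  moment of the truncation, applied to its square it bounds the fourth, which corresponds to the
  eighth moment of the entries. All constants are independent of \<open>T\<close>.\<close>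

private lemma eighth_moment_truncated: "\<exists>B. \<forall>T>0. (\<integral>x. (truncated T x) ^ 4 \<partial>\<nu>) \<le> B"
proof -
  obtain C where C: "C > 0" "\<And>f g. \<lbrakk>\<And>x. f x > 0; \<And>x. GDERIV f x :> g x; continuous_on UNIV g; integrable \<nu> f; integrable \<nu> (\<lambda>x. (f x)\<^sup>2);
     integrable \<nu> (\<lambda>x. (norm (g x))\<^sup>2)\<rbrakk> \<Longrightarrow>
     (\<integral>x. (f x)\<^sup>2 \<partial>\<nu>) * ln ((\<integral>x. (f x)\<^sup>2 \<partial>\<nu>) / (\<integral>x. f x \<partial>\<nu>)\<^sup>2) \<le> 2 * C * (\<integral>x. (norm (g x))\<^sup>2 \<partial>\<nu>)"
    using lsi_moment by metis
  \<comment> \<open>If S > K, then S / m^2 \<ge> e because m \<le> 2, so the logarithm is at least 1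
    and S \<le> 16 C, a contradiction.\<close>
  define K where "K = 4 * exp 1 + 16 * C"
  have K0: "K > 0" using C by (simp add: K_def add_pos_pos)
  define G where "G T x = (2 / (1 + (1 + (norm x)\<^sup>2) / T)\<^sup>2) *\<^sub>R x" for T :: real and x :: 'a
  have G: "GDERIV (truncated T) x :> G T x" "(norm (G T x))\<^sup>2 \<le> 4 * truncated T x" if "T > 0" for T x
    unfolding G_def using truncated_gderiv[OF that] truncated_gradient_bound[OF that] by auto
  have Gc: "continuous_on UNIV (G T)" if "T > 0" for T
    unfolding G_def[abs_def]
    by (rule continuous_on_scaleR[OF continuous_on_divide[OF continuous_on_const continuous_on_power[OF denominator_continuous]] continuous_on_id])
      (use denominator_nz[OF that] in auto)
  have Gm: "G T \<in> borel_measurable \<nu>" if "T > 0" for T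
    unfolding measurable_cong_sets[OF sets_borel refl] by (rule borel_measurable_continuous_onI[OF Gc[OF that]])
  have second: "(\<integral>x. (truncated T x)\<^sup>2 \<partial>\<nu>) \<le> K" if T: "T > 0" for T
  proof (rule ccontr)
    define S where "S = (\<integral>x. (truncated T x)\<^sup>2 \<partial>\<nu>)"
    define m where "m = (\<integral>x. truncated T x \<partial>\<nu>)"
    assume "\<not> (\<integral>x. (truncated T x)\<^sup>2 \<partial>\<nu>) \<le> K"
    then have S: "S > K" by (simp add: S_def)
    note it = truncated_power_integrable[OF T]
    have i1: "integrable \<nu> (truncated T)" using it[of 1] by simp
    have m0: "0 < m" unfolding m_def by (rule integral_positive[OF i1 truncated_pos[OF T]])
    have m2: "m \<le> 2"
    proof -
      have "m \<le> (\<integral>x. 1 + (norm x)\<^sup>2 \<partial>\<nu>)"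
        unfolding m_def by (intro integral_mono i1 Bochner_Integration.integrable_add var truncated_le T) auto
      also have "\<dots> = 2" using var by (simp add: prob_space)
      finally show ?thesis .
    qed
    have iG: "integrable \<nu> (\<lambda>x. (norm (G T x))\<^sup>2)"
    proof (rule Bochner_Integration.integrable_bound[OF integrable_mult_right[OF i1, of 4]])
      show "(\<lambda>x. (norm (G T x))\<^sup>2) \<in> borel_measurable \<nu>"
        by (intro borel_measurable_power measurable_compose[OF Gm borel_measurable_norm] T)
      show "AE x in \<nu>. norm ((norm (G T x))\<^sup>2) \<le> norm (4 * truncated T x)"
      proof (rule AE_I2)
        fix x :: 'a
        have "0 < truncated T x" by (rule truncated_pos[OF T])
        then show "norm ((norm (G T x))\<^sup>2) \<le> norm (4 * truncated T x)" using G(2)[OF T, of x] by simp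
      qed
    qed
    have "(\<integral>x. (norm (G T x))\<^sup>2 \<partial>\<nu>) \<le> (\<integral>x. 4 * truncated T x \<partial>\<nu>)"
      by (intro integral_mono iG integrable_mult_right i1 G(2) T)
    then have "(\<integral>x. (norm (G T x))\<^sup>2 \<partial>\<nu>) \<le> 8" using m2 by (simp add: m_def)
    moreover have "S * ln (S / m\<^sup>2) \<le> 2 * C * (\<integral>x. (norm (G T x))\<^sup>2 \<partial>\<nu>)"
      unfolding S_def m_def by (rule C(2)[OF truncated_pos[OF T] G(1)[OF T] Gc[OF T] i1 it iG])
    ultimately have "S * ln (S / m\<^sup>2) \<le> 16 * C"
      using C(1) mult_left_mono[of "\<integral>x. (norm (G T x))\<^sup>2 \<partial>\<nu>" 8 "2 * C"] by linarith
    moreover have "1 \<le> ln (S / m\<^sup>2)"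
    proof -
      have "m\<^sup>2 \<le> 4" using m2 m0 power_mono[of m 2 2] by simp
      then have "exp 1 * m\<^sup>2 \<le> exp 1 * 4" by simp
      also have "\<dots> \<le> S" using S C by (simp add: K_def)
      finally have "exp 1 \<le> S / m\<^sup>2" using m0 by (simp add: field_simps)
      then show ?thesis by (metis exp_gt_zero ln_exp ln_mono order_less_le_trans)
    qed
    then have "S * 1 \<le> S * ln (S / m\<^sup>2)" using S K0 by (intro mult_left_mono) auto
    ultimately show False using S by (simp add: K_def) (smt (verit) exp_gt_zero)
  qed
  \<comment> \<open>The first entry ensures S \<ge> m, so that the energy bound 16 m + 16 S is at
    most 32 S; the second is what ln (S / m^2) \<le> 64 C and m \<le> K leave.\<close>
  define B where "B = max K (K\<^sup>2 * exp (64 * C))"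
  have "(\<integral>x. (truncated T x) ^ 4 \<partial>\<nu>) \<le> B" if T: "T > 0" for T
  proof (rule ccontr)
    define S where "S = (\<integral>x. (truncated T x) ^ 4 \<partial>\<nu>)"
    define m where "m = (\<integral>x. (truncated T x)\<^sup>2 \<partial>\<nu>)"
    assume "\<not> (\<integral>x. (truncated T x) ^ 4 \<partial>\<nu>) \<le> B"
    then have S: "S > K" "S > K\<^sup>2 * exp (64 * C)" by (auto simp: S_def B_def)
    note it = truncated_power_integrable[OF T]
    have i4: "integrable \<nu> (\<lambda>x. ((truncated T x)\<^sup>2)\<^sup>2)" using it[of 4] by (simp flip: power_mult)
    have m0: "0 < m" unfolding m_def by (rule integral_positive[OF it zero_less_power[OF truncated_pos[OF T]]])
    have mK: "m \<le> K" unfolding m_def by (rule second[OF T])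
    define g where "g x = truncated T x *\<^sub>R G T x + truncated T x *\<^sub>R G T x" for x
    have gD: "GDERIV (\<lambda>x. (truncated T x)\<^sup>2) x :> g x" for x
      unfolding power2_eq_square g_def by (rule GDERIV_mult[OF G(1)[OF T] G(1)[OF T]])
    have gc: "continuous_on UNIV g"
      unfolding g_def by (intro continuous_intros Gc[OF T] truncated_continuous[OF T])
    have gm: "g \<in> borel_measurable \<nu>"
      unfolding g_def using Gm[OF T] truncated_measurable[OF T] by measurable
    have gb: "(norm (g x))\<^sup>2 \<le> 16 * (truncated T x)\<^sup>2 + 16 * (truncated T x) ^ 4" for x
    proof -
      have "g x = (2 * truncated T x) *\<^sub>R G T x" by (simp add: g_def flip: scaleR_add_left)
      then have "(norm (g x))\<^sup>2 = 4 * (truncated T x)\<^sup>2 * (norm (G T x))\<^sup>2"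
        by (simp add: power_mult_distrib)
      also have "\<dots> \<le> 4 * (truncated T x)\<^sup>2 * (4 * truncated T x)"
        by (intro mult_left_mono G(2) T) auto
      also have "\<dots> = 16 * (truncated T x)\<^sup>2 * truncated T x" by simp
      also have "\<dots> \<le> 16 * (truncated T x)\<^sup>2 * (1 + (truncated T x)\<^sup>2)"
      proof (rule mult_left_mono)
        have "(truncated T x - 1)\<^sup>2 = 1 + (truncated T x)\<^sup>2 - 2 * truncated T x"
          by (simp add: power2_eq_square algebra_simps)
        then show "truncated T x \<le> 1 + (truncated T x)\<^sup>2"
          using zero_le_power2[of "truncated T x - 1"] truncated_pos[OF T, of x] by linarith
      qed simp
      finally show ?thesis by (simp add: algebra_simps flip: power_add)
    qed
    have iR: "integrable \<nu> (\<lambda>x. 16 * (truncated T x)\<^sup>2 + 16 * (truncated T x) ^ 4)"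
      using it by (intro Bochner_Integration.integrable_add integrable_mult_right)
    have ig: "integrable \<nu> (\<lambda>x. (norm (g x))\<^sup>2)"
    proof (rule Bochner_Integration.integrable_bound[OF iR])
      show "(\<lambda>x. (norm (g x))\<^sup>2) \<in> borel_measurable \<nu>"
        by (intro borel_measurable_power measurable_compose[OF gm borel_measurable_norm])
      show "AE x in \<nu>. norm ((norm (g x))\<^sup>2) \<le> norm (16 * (truncated T x)\<^sup>2 + 16 * (truncated T x) ^ 4)"
      proof (rule AE_I2)
        fix x
        show "norm ((norm (g x))\<^sup>2) \<le> norm (16 * (truncated T x)\<^sup>2 + 16 * (truncated T x) ^ 4)"
          using gb[of x] by simp
      qed
    qed
    have "(\<integral>x. (norm (g x))\<^sup>2 \<partial>\<nu>) \<le> (\<integral>x. 16 * (truncated T x)\<^sup>2 + 16 * (truncated T x) ^ 4 \<partial>\<nu>)"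
      by (intro integral_mono ig iR gb)
    also have "\<dots> = 16 * m + 16 * S" using it by (simp add: m_def S_def)
    also have "\<dots> \<le> 32 * S" using mK S by simp
    finally have D: "(\<integral>x. (norm (g x))\<^sup>2 \<partial>\<nu>) \<le> 32 * S" .
    have "(\<integral>x. ((truncated T x)\<^sup>2)\<^sup>2 \<partial>\<nu>) * ln ((\<integral>x. ((truncated T x)\<^sup>2)\<^sup>2 \<partial>\<nu>) / (\<integral>x. (truncated T x)\<^sup>2 \<partial>\<nu>)\<^sup>2)
        \<le> 2 * C * (\<integral>x. (norm (g x))\<^sup>2 \<partial>\<nu>)"
      by (rule C(2)[OF zero_less_power[OF truncated_pos[OF T]] gD gc it i4 ig])
    then have "S * ln (S / m\<^sup>2) \<le> 2 * C * (\<integral>x. (norm (g x))\<^sup>2 \<partial>\<nu>)"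
      by (simp add: S_def m_def flip: power_mult)
    also have "\<dots> \<le> 2 * C * (32 * S)" using D C by (intro mult_left_mono) auto
    finally have "S * ln (S / m\<^sup>2) \<le> S * (64 * C)" by (simp add: algebra_simps)
    then have "ln (S / m\<^sup>2) \<le> 64 * C" using S K0 by simp
    then have "exp (ln (S / m\<^sup>2)) \<le> exp (64 * C)" by simp
    then have "S / m\<^sup>2 \<le> exp (64 * C)" using S K0 m0 by simp
    then have "S \<le> m\<^sup>2 * exp (64 * C)" using m0 by (simp add: field_simps)
    also have "\<dots> \<le> K\<^sup>2 * exp (64 * C)" using mK m0 by (intro mult_right_mono power_mono) auto
    finally show False using S by simp
  qed
  then show ?thesis by blast
qed

text \<open>Fatou's lemma along T = 1, 2, ..., where the fourth power of the truncation tends to (1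
  + |x|^2)^4.\<close>

lemma eighth_moment_finite: "(\<integral>\<^sup>+x. ennreal (norm x ^ 8) \<partial>\<nu>) < \<infinity>"
proof -
  obtain B where B: "\<And>T. T > 0 \<Longrightarrow> (\<integral>x. (truncated T x) ^ 4 \<partial>\<nu>) \<le> B"
    using eighth_moment_truncated by blast
  let ?q = "\<lambda>k x. truncated (real (Suc k)) x ^ 4"
  have lim: "(\<lambda>k. ?q k x) \<longlonglongrightarrow> (1 + (norm x)\<^sup>2) ^ 4" for x :: 'a
  proof -
    have "(\<lambda>k. (1 + (norm x)\<^sup>2) / (1 + (1 + (norm x)\<^sup>2) * inverse (real (Suc k)))) \<longlonglongrightarrow> (1 + (norm x)\<^sup>2) / (1 + (1 + (norm x)\<^sup>2) * 0)"
      by (intro tendsto_intros LIMSEQ_inverse_real_of_nat) auto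
    then show ?thesis
      unfolding truncated_def by (intro tendsto_power) (simp add: divide_inverse)
  qed
  have "(\<integral>\<^sup>+x. ennreal (norm x ^ 8) \<partial>\<nu>) \<le> (\<integral>\<^sup>+x. liminf (\<lambda>k. ennreal (?q k x)) \<partial>\<nu>)"
  proof (rule nn_integral_mono)
    fix x :: 'a
    have "norm x ^ 8 = ((norm x)\<^sup>2) ^ 4" by (simp flip: power_mult)
    also have "\<dots> \<le> (1 + (norm x)\<^sup>2) ^ 4" by (intro power_mono) auto
    finally have "ennreal (norm x ^ 8) \<le> ennreal ((1 + (norm x)\<^sup>2) ^ 4)" by (rule ennreal_leI)
    also have "\<dots> = liminf (\<lambda>k. ennreal (?q k x))"
      by (rule lim_imp_Liminf[symmetric, OF _ tendsto_ennrealI[OF lim]]) simp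
    finally show "ennreal (norm x ^ 8) \<le> liminf (\<lambda>k. ennreal (?q k x))" .
  qed
  also have "\<dots> \<le> liminf (\<lambda>k. \<integral>\<^sup>+x. ennreal (?q k x) \<partial>\<nu>)"
    by (intro nn_integral_liminf measurable_compose[OF _ measurable_ennreal] borel_measurable_power truncated_measurable) simp
  also have "\<dots> \<le> liminf (\<lambda>k :: nat. ennreal B)"
  proof (rule Liminf_mono, rule always_eventually, rule allI)
    fix k
    have "(\<integral>\<^sup>+x. ennreal (?q k x) \<partial>\<nu>) = ennreal (\<integral>x. ?q k x \<partial>\<nu>)"
      by (rule nn_integral_eq_integral[OF truncated_power_integrable]) auto
    also have "\<dots> \<le> ennreal B" using B by (intro ennreal_leI) auto
    finally show "(\<integral>\<^sup>+x. ennreal (?q k x) \<partial>\<nu>) \<le> ennreal B" .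
  qed
  also have "\<dots> < \<infinity>" by (simp add: Liminf_const)
  finally show ?thesis .
qed

end

section \<open>Fourth moments of quadratic forms\<close>

text \<open>The mixed term kept exactly is linear in \<open>d\<close> and disappears when a centred
  \<open>d\<close> is integrated. Cauchy-Schwarz and 2ab \<le> a^2 + b^2 absorb the others, with 2 +
  4 + 2 = 8 and 1 + 2 = 3.\<close>

lemma norm_add_power4_le:
  fixes q d :: "'a :: euclidean_space"
  shows "norm (q + d) ^ 4 \<le> norm q ^ 4 + 4 * (norm q)\<^sup>2 * inner q d + 8 * (norm q)\<^sup>2 * (norm d)\<^sup>2 + 3 * norm d ^ 4"
proof -
  define P N c where "P = norm q" and "N = norm d" and "c = inner q d"
  have c: "\<bar>c\<bar> \<le> P * N" unfolding P_def N_def c_def by (rule Cauchy_Schwarz_ineq2)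
  have "norm (q + d) ^ 4 = ((norm (q + d))\<^sup>2)\<^sup>2" by (simp flip: power_mult)
  also have "(norm (q + d))\<^sup>2 = P\<^sup>2 + 2 * c + N\<^sup>2"
    by (simp add: P_def N_def c_def power2_norm_eq_inner inner_simps inner_commute)
  also have "(P\<^sup>2 + 2 * c + N\<^sup>2)\<^sup>2 = P ^ 4 + 4 * P\<^sup>2 * c + 2 * P\<^sup>2 * N\<^sup>2 + 4 * c\<^sup>2 + 4 * c * N\<^sup>2 + N ^ 4"
    by (simp add: power2_eq_square power4_eq_xxxx algebra_simps)
  finally have eq: "norm (q + d) ^ 4 = P ^ 4 + 4 * P\<^sup>2 * c + 2 * P\<^sup>2 * N\<^sup>2 + 4 * c\<^sup>2 + 4 * c * N\<^sup>2 + N ^ 4" .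
  have "c\<^sup>2 \<le> (P * N)\<^sup>2" using c by (metis abs_ge_zero power2_abs power_mono)
  then have 1: "c\<^sup>2 \<le> P\<^sup>2 * N\<^sup>2" by (simp only: power_mult_distrib)
  have 2: "c * N\<^sup>2 \<le> (P * N) * N\<^sup>2" using c by (intro mult_right_mono) auto
  have "(P * N - N\<^sup>2)\<^sup>2 = P\<^sup>2 * N\<^sup>2 - 2 * ((P * N) * N\<^sup>2) + N ^ 4"
    by (simp add: power2_eq_square power4_eq_xxxx algebra_simps)
  then have 3: "2 * ((P * N) * N\<^sup>2) \<le> P\<^sup>2 * N\<^sup>2 + N ^ 4"
    using zero_le_power2[of "P * N - N\<^sup>2"] by linarith
  show ?thesis
    unfolding eq unfolding P_def[symmetric] N_def[symmetric] c_def[symmetric]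
    using 1 2 3 by (simp only: mult.assoc)
qed

text \<open>\<open>e\<close> bounds the root of the fourth moment of \<open>D\<close>, hence also
  its second moment, because the variance of |D|^2 is nonnegative.\<close>

lemma (in prob_space) fourth_moment_add_le:
  fixes q :: "'b :: euclidean_space" and D :: "'a \<Rightarrow> 'b"
  assumes [measurable]: "D \<in> borel_measurable M" and D0: "integrable M D" "(\<integral>y. D y \<partial>M) = 0"
    and e: "e \<ge> 0" "(\<integral>\<^sup>+y. ennreal (norm (D y) ^ 4) \<partial>M) \<le> ennreal (e\<^sup>2)"
  shows "(\<integral>\<^sup>+y. ennreal (norm (q + D y) ^ 4) \<partial>M) \<le> ennreal (norm q ^ 4 + 8 * (norm q)\<^sup>2 * e + 3 * e\<^sup>2)"
proof -
  have i4: "integrable M (\<lambda>y. norm (D y) ^ 4)"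
  proof (rule integrableI_bounded)
    have "(\<integral>\<^sup>+y. ennreal (norm (norm (D y) ^ 4)) \<partial>M) = (\<integral>\<^sup>+y. ennreal (norm (D y) ^ 4) \<partial>M)" by simp
    also have "\<dots> < \<infinity>" using e(2) by (rule order.strict_trans1) simp
    finally show "(\<integral>\<^sup>+y. ennreal (norm (norm (D y) ^ 4)) \<partial>M) < \<infinity>" .
  qed measurable
  then have d4: "(\<integral>y. norm (D y) ^ 4 \<partial>M) \<le> e\<^sup>2"
    using e(2) by (subst (asm) nn_integral_eq_integral) (auto simp: ennreal_le_iff)
  have i2: "integrable M (\<lambda>y. (norm (D y))\<^sup>2)"
  proof (rule Bochner_Integration.integrable_bound[of _ "\<lambda>y. 1 + norm (D y) ^ 4"])
    show "AE y in M. norm ((norm (D y))\<^sup>2) \<le> norm (1 + norm (D y) ^ 4)"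
    proof (rule AE_I2)
      fix y
      have "((norm (D y))\<^sup>2 - 1)\<^sup>2 = 1 + norm (D y) ^ 4 - 2 * (norm (D y))\<^sup>2"
        by (simp add: power2_eq_square power4_eq_xxxx algebra_simps)
      then have "2 * (norm (D y))\<^sup>2 \<le> 1 + norm (D y) ^ 4"
        using zero_le_power2[of "(norm (D y))\<^sup>2 - 1"] by linarith
      moreover have "norm ((norm (D y))\<^sup>2) = (norm (D y))\<^sup>2" "norm (1 + norm (D y) ^ 4) = 1 + norm (D y) ^ 4" by simp_all
      moreover have "0 \<le> (norm (D y))\<^sup>2" by simp
      ultimately show "norm ((norm (D y))\<^sup>2) \<le> norm (1 + norm (D y) ^ 4)" by linarith
    qed
  qed (use i4 in auto)
  have d2: "(\<integral>y. (norm (D y))\<^sup>2 \<partial>M) \<le> e"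
  proof -
    have "(\<integral>y. (norm (D y))\<^sup>2 \<partial>M)\<^sup>2 \<le> (\<integral>y. ((norm (D y))\<^sup>2)\<^sup>2 \<partial>M)"
      using variance_positive[of "\<lambda>y. (norm (D y))\<^sup>2"] i2 i4 by (subst (asm) variance_eq) (auto simp flip: power_mult)
    also have "\<dots> \<le> e\<^sup>2" using d4 by (simp flip: power_mult)
    finally show ?thesis using e(1) by (rule power2_le_imp_le)
  qed
  let ?R = "\<lambda>y. norm q ^ 4 + 4 * (norm q)\<^sup>2 * inner q (D y) + 8 * (norm q)\<^sup>2 * (norm (D y))\<^sup>2 + 3 * norm (D y) ^ 4"
  have iR: "integrable M ?R" using i4 i2 D0(1) by auto
  have R0: "0 \<le> ?R y" for y using norm_add_power4_le[of q "D y"] zero_le_power[of "norm (q + D y)" 4] by (smt (verit) norm_ge_zero)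
  have "(\<integral>\<^sup>+y. ennreal (norm (q + D y) ^ 4) \<partial>M) \<le> (\<integral>\<^sup>+y. ennreal (?R y) \<partial>M)"
    by (intro nn_integral_mono ennreal_leI norm_add_power4_le)
  also have "\<dots> = ennreal (\<integral>y. ?R y \<partial>M)"
    by (rule nn_integral_eq_integral[OF iR]) (use R0 in auto)
  also have "(\<integral>y. ?R y \<partial>M) = norm q ^ 4 + 8 * (norm q)\<^sup>2 * (\<integral>y. (norm (D y))\<^sup>2 \<partial>M) + 3 * (\<integral>y. norm (D y) ^ 4 \<partial>M)"
    using i4 i2 D0 by (simp add: prob_space)
  also have "\<dots> \<le> norm q ^ 4 + 8 * (norm q)\<^sup>2 * e + 3 * e\<^sup>2"
    using d2 d4 by (intro add_mono mult_left_mono) auto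
  finally show ?thesis by (simp add: ennreal_leI)
qed

lemma nn_integral_mult_le:
  assumes [measurable]: "f \<in> borel_measurable M" "g \<in> borel_measurable M"
    and "(\<integral>\<^sup>+x. (f x)\<^sup>2 \<partial>M) \<le> ennreal (A\<^sup>2)" "(\<integral>\<^sup>+x. (g x)\<^sup>2 \<partial>M) \<le> ennreal (B\<^sup>2)" "A \<ge> 0" "B \<ge> 0"
  shows "(\<integral>\<^sup>+x. f x * g x \<partial>M) \<le> ennreal (A * B)"
proof -
  have "(\<integral>\<^sup>+x. f x * g x \<partial>M)\<^sup>2 \<le> (\<integral>\<^sup>+x. (f x)\<^sup>2 \<partial>M) * (\<integral>\<^sup>+x. (g x)\<^sup>2 \<partial>M)"
    by (rule Cauchy_Schwarz_nn_integral) measurable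
  also have "\<dots> \<le> ennreal (A\<^sup>2) * ennreal (B\<^sup>2)" by (intro mult_mono assms) auto
  also have "\<dots> = (ennreal (A * B))\<^sup>2"
    using assms by (simp add: power_mult_distrib ennreal_power flip: ennreal_mult)
  finally have le: "(\<integral>\<^sup>+x. f x * g x \<partial>M)\<^sup>2 \<le> (ennreal (A * B))\<^sup>2" .
  show ?thesis
  proof (cases "\<integral>\<^sup>+x. f x * g x \<partial>M" rule: ennreal_cases)
    case (real l)
    then have "ennreal (l\<^sup>2) \<le> ennreal ((A * B)\<^sup>2)" using le assms(5,6) by (simp add: ennreal_power)
    then have "l\<^sup>2 \<le> (A * B)\<^sup>2" by (subst (asm) ennreal_le_iff) auto
    then have "l \<le> A * B" by (rule power2_le_imp_le) (use assms in auto)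
    then show ?thesis unfolding real by (rule ennreal_leI)
  next
    case top
    then show ?thesis using le by (simp add: top_unique ennreal_mult_eq_top_iff power2_eq_square)
  qed
qed

lemma ennreal_mult_add3:
  "0 \<le> c \<Longrightarrow> 0 \<le> x \<Longrightarrow> 0 \<le> y \<Longrightarrow> 0 \<le> z \<Longrightarrow> ennreal (c * (x + y + z)) = ennreal c * (ennreal x + ennreal y + ennreal z)"
  by (simp add: ennreal_mult ennreal_plus)

text \<open>The root of the fourth moment grows at most additively under centred increments, since
  A^2 + 8AB + 3B^2 \<le> (A + 4B)^2. Additivity keeps the inductions below linear in the squared
  coefficients.\<close>

lemma fourth_moment_martingale_step:
  fixes Q :: "'x \<Rightarrow> 'a :: euclidean_space" and D :: "'x \<Rightarrow> 'y \<Rightarrow> 'a"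
  assumes N: "prob_space N"
    and [measurable]: "Q \<in> borel_measurable M" "case_prod D \<in> borel_measurable (M \<Otimes>\<^sub>M N)" "e \<in> borel_measurable M"
    and D0: "\<And>x. x \<in> space M \<Longrightarrow> integrable N (D x)" "\<And>x. x \<in> space M \<Longrightarrow> (\<integral>y. D x y \<partial>N) = 0"
    and e: "\<And>x. x \<in> space M \<Longrightarrow> e x \<ge> 0"
      "\<And>x. x \<in> space M \<Longrightarrow> (\<integral>\<^sup>+y. ennreal (norm (D x y) ^ 4) \<partial>N) \<le> ennreal ((e x)\<^sup>2)"
    and A: "A \<ge> 0" "(\<integral>\<^sup>+x. ennreal (norm (Q x) ^ 4) \<partial>M) \<le> ennreal (A\<^sup>2)"
    and B: "B \<ge> 0" "(\<integral>\<^sup>+x. ennreal ((e x)\<^sup>2) \<partial>M) \<le> ennreal (B\<^sup>2)"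
  shows "(\<integral>\<^sup>+x. \<integral>\<^sup>+y. ennreal (norm (Q x + D x y) ^ 4) \<partial>N \<partial>M) \<le> ennreal ((A + 4 * B)\<^sup>2)"
proof -
  interpret N: prob_space N by (rule N)
  have "(\<integral>\<^sup>+x. \<integral>\<^sup>+y. ennreal (norm (Q x + D x y) ^ 4) \<partial>N \<partial>M)
      \<le> (\<integral>\<^sup>+x. ennreal (norm (Q x) ^ 4) + 8 * (ennreal ((norm (Q x))\<^sup>2) * ennreal (e x)) + 3 * ennreal ((e x)\<^sup>2) \<partial>M)"
  proof (rule nn_integral_mono)
    fix x assume x: "x \<in> space M"
    have [measurable]: "D x \<in> borel_measurable N"
      using measurable_Pair2[OF assms(3) x] by simp
    have "(\<integral>\<^sup>+y. ennreal (norm (Q x + D x y) ^ 4) \<partial>N) \<le> ennreal (norm (Q x) ^ 4 + 8 * (norm (Q x))\<^sup>2 * e x + 3 * (e x)\<^sup>2)"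
      by (rule N.fourth_moment_add_le) (use D0 e x in auto)
    also have "\<dots> = ennreal (norm (Q x) ^ 4) + 8 * (ennreal ((norm (Q x))\<^sup>2) * ennreal (e x)) + 3 * ennreal ((e x)\<^sup>2)"
      using e(1)[OF x] by (simp add: ennreal_plus ennreal_mult mult.assoc)
    finally show "(\<integral>\<^sup>+y. ennreal (norm (Q x + D x y) ^ 4) \<partial>N)
      \<le> ennreal (norm (Q x) ^ 4) + 8 * (ennreal ((norm (Q x))\<^sup>2) * ennreal (e x)) + 3 * ennreal ((e x)\<^sup>2)" .
  qed
  also have "\<dots> = (\<integral>\<^sup>+x. ennreal (norm (Q x) ^ 4) \<partial>M) + 8 * (\<integral>\<^sup>+x. ennreal ((norm (Q x))\<^sup>2) * ennreal (e x) \<partial>M)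
      + 3 * (\<integral>\<^sup>+x. ennreal ((e x)\<^sup>2) \<partial>M)"
    by (simp add: nn_integral_add nn_integral_cmult)
  also have "\<dots> \<le> ennreal (A\<^sup>2) + 8 * ennreal (A * B) + 3 * ennreal (B\<^sup>2)"
  proof (intro add_mono mult_left_mono A(2) B(2) nn_integral_mult_le)
    show "(\<integral>\<^sup>+x. (ennreal ((norm (Q x))\<^sup>2))\<^sup>2 \<partial>M) \<le> ennreal (A\<^sup>2)"
      using A(2) by (simp add: ennreal_power flip: power_mult)
    have "(\<integral>\<^sup>+x. (ennreal (e x))\<^sup>2 \<partial>M) = (\<integral>\<^sup>+x. ennreal ((e x)\<^sup>2) \<partial>M)"
      by (rule nn_integral_cong) (simp add: ennreal_power e)
    then show "(\<integral>\<^sup>+x. (ennreal (e x))\<^sup>2 \<partial>M) \<le> ennreal (B\<^sup>2)" using B(2) by simp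
  qed (use A B in auto)
  also have "\<dots> = ennreal (A\<^sup>2 + 8 * (A * B) + 3 * B\<^sup>2)"
    using A B by (simp add: ennreal_plus ennreal_mult)
  also have "\<dots> \<le> ennreal ((A + 4 * B)\<^sup>2)"
    by (rule ennreal_leI) (simp add: power2_eq_square algebra_simps)
  finally show ?thesis .
qed

text \<open>\<open>\<kappa>\<close> dominates the root of the fourth moment of both kinds of centred
  term in a quadratic form: the variable itself and |x|^2 - 1.\<close>

locale iid_coordinates = prob_space \<nu> for \<nu> :: "'a :: real_or_complex measure" +
  fixes \<kappa> :: real
  assumes sets_borel [measurable_cong]: "sets \<nu> = sets borel"
    and mean: "integrable \<nu> (\<lambda>x. x)" "(\<integral>x. x \<partial>\<nu>) = 0"
    and var: "integrable \<nu> (\<lambda>x. (norm x)\<^sup>2)" "(\<integral>x. (norm x)\<^sup>2 \<partial>\<nu>) = 1"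
    and \<kappa>: "0 \<le> \<kappa>" "(\<integral>\<^sup>+x. ennreal (norm x ^ 4) \<partial>\<nu>) \<le> ennreal (\<kappa>\<^sup>2)"
      "(\<integral>\<^sup>+x. ennreal (((norm x)\<^sup>2 - 1) ^ 4) \<partial>\<nu>) \<le> ennreal (\<kappa>\<^sup>2)"
begin

sublocale PP: product_prob_space "\<lambda>_ :: 'i. \<nu>" I for I :: "'i set" by unfold_locales

lemma conjugate_measurable [measurable]: "(conjugate :: 'a \<Rightarrow> 'a) \<in> borel_measurable borel"
  by (intro borel_measurable_continuous_onI linear_continuous_on bounded_linear_conjugate)

lemma mean_conjugate: "integrable \<nu> (\<lambda>x. conjugate x)" "(\<integral>x. conjugate x \<partial>\<nu>) = 0"
  using mean integrable_bounded_linear[OF bounded_linear_conjugate mean(1)]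
    integral_bounded_linear[OF bounded_linear_conjugate mean(1)] by auto

text \<open>\<open>h\<close> stands for the identity or the conjugation: the increment of a
  quadratic form contains a linear form of each kind.\<close>

lemma fourth_moment_linear:
  fixes h :: "'a \<Rightarrow> 'a" and a :: "'i \<Rightarrow> 'a"
  assumes I: "finite I" and h: "h \<in> borel_measurable borel" "\<And>x. norm (h x) = norm x"
    and hi: "integrable \<nu> h" "(\<integral>x. h x \<partial>\<nu>) = 0"
  shows "(\<integral>\<^sup>+x. ennreal (norm (\<Sum>i\<in>I. a i * h (x i)) ^ 4) \<partial>PiM I (\<lambda>_. \<nu>)) \<le> ennreal ((4 * \<kappa> * nsq I a)\<^sup>2)"
  using I
proof (induction I rule: finite_induct)
  case empty
  then show ?case by (simp add: nsq_def)
next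
  case (insert k S)
  note [measurable] = h(1)
  have ne: "i \<noteq> k" if "i \<in> S" for i using insert that by auto
  have "(\<integral>\<^sup>+x. ennreal (norm (\<Sum>i\<in>insert k S. a i * h (x i)) ^ 4) \<partial>PiM (insert k S) (\<lambda>_. \<nu>)) =
    (\<integral>\<^sup>+x. \<integral>\<^sup>+y. ennreal (norm (\<Sum>i\<in>insert k S. a i * h ((x(k := y)) i)) ^ 4) \<partial>\<nu> \<partial>PiM S (\<lambda>_. \<nu>))"
    by (rule PP.product_nn_integral_insert[OF insert(1,2)]) measurable
  also have "\<dots> = (\<integral>\<^sup>+x. \<integral>\<^sup>+y. ennreal (norm ((\<Sum>i\<in>S. a i * h (x i)) + a k * h y) ^ 4) \<partial>\<nu> \<partial>PiM S (\<lambda>_. \<nu>))"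
    using insert ne by (intro nn_integral_cong arg_cong[where f = "\<lambda>z. ennreal (norm z ^ 4)"]) (simp add: add.commute)
  also have "\<dots> \<le> ennreal ((4 * \<kappa> * nsq S a + 4 * (\<kappa> * (norm (a k))\<^sup>2))\<^sup>2)"
  proof (rule fourth_moment_martingale_step[where e = "\<lambda>_. \<kappa> * (norm (a k))\<^sup>2"])
    show "prob_space \<nu>" by (rule prob_space_axioms)
    have "(\<integral>\<^sup>+y. ennreal (norm (a k * h y) ^ 4) \<partial>\<nu>) = ennreal (norm (a k) ^ 4) * (\<integral>\<^sup>+y. ennreal (norm y ^ 4) \<partial>\<nu>)"
      by (subst nn_integral_cmult[symmetric]) (auto simp: norm_mult power_mult_distrib h(2) ennreal_mult)
    also have "\<dots> \<le> ennreal (norm (a k) ^ 4) * ennreal (\<kappa>\<^sup>2)" by (intro mult_left_mono \<kappa>) auto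
    also have "\<dots> = ennreal ((\<kappa> * (norm (a k))\<^sup>2)\<^sup>2)"
      by (simp add: power_mult_distrib mult.commute flip: ennreal_mult power_mult)
    finally show "(\<integral>\<^sup>+y. ennreal (norm (a k * h y) ^ 4) \<partial>\<nu>) \<le> ennreal ((\<kappa> * (norm (a k))\<^sup>2)\<^sup>2)" .
    have PiM1: "emeasure (PiM S (\<lambda>_. \<nu>)) (space (PiM S (\<lambda>_. \<nu>))) = 1"
      by (intro prob_space.emeasure_space_1 prob_space_PiM prob_space_axioms)
    show "(\<integral>\<^sup>+x. ennreal ((\<kappa> * (norm (a k))\<^sup>2)\<^sup>2) \<partial>PiM S (\<lambda>_. \<nu>)) \<le> ennreal ((\<kappa> * (norm (a k))\<^sup>2)\<^sup>2)"
      by (simp add: PiM1)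
  qed (use \<kappa>(1) hi insert.IH in auto)
  also have "4 * \<kappa> * nsq S a + 4 * (\<kappa> * (norm (a k))\<^sup>2) = 4 * \<kappa> * nsq (insert k S) a"
    using insert by (simp add: nsq_def algebra_simps)
  finally show ?case .
qed

text \<open>The inequality (a + b + c)^2 \<le> 3 (a^2 + b^2 + c^2) is used twice, which gives 9 * 3
  = 27.\<close>

lemma norm_add3_power4_le: "norm (x + y + z) ^ 4 \<le> 27 * (norm x ^ 4 + norm y ^ 4 + norm z ^ 4)" for x y z :: 'a
proof -
  define a b c where "a = norm x" and "b = norm y" and "c = norm z"
  have sq: "(u + v + w)\<^sup>2 \<le> 3 * (u\<^sup>2 + v\<^sup>2 + w\<^sup>2)" for u v w :: real
  proof -
    have "3 * (u\<^sup>2 + v\<^sup>2 + w\<^sup>2) = (u + v + w)\<^sup>2 + ((u - v)\<^sup>2 + (v - w)\<^sup>2 + (u - w)\<^sup>2)"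
      by (simp add: power2_eq_square algebra_simps)
    moreover have "0 \<le> (u - v)\<^sup>2 + (v - w)\<^sup>2 + (u - w)\<^sup>2" by simp
    ultimately show ?thesis by linarith
  qed
  have "norm (x + y + z) \<le> a + b + c"
    unfolding a_def b_def c_def by (metis add_mono_thms_linordered_semiring(3) norm_triangle_ineq order_trans)
  then have "norm (x + y + z) ^ 4 \<le> (a + b + c) ^ 4" by (intro power_mono) auto
  also have "\<dots> = ((a + b + c)\<^sup>2)\<^sup>2" by (simp flip: power_mult)
  also have "\<dots> \<le> (3 * (a\<^sup>2 + b\<^sup>2 + c\<^sup>2))\<^sup>2" by (intro power_mono sq) auto
  also have "\<dots> = 9 * (a\<^sup>2 + b\<^sup>2 + c\<^sup>2)\<^sup>2" by (simp only: power_mult_distrib) simp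
  also have "\<dots> \<le> 9 * (3 * ((a\<^sup>2)\<^sup>2 + (b\<^sup>2)\<^sup>2 + (c\<^sup>2)\<^sup>2))" by (intro mult_left_mono sq) auto
  finally show ?thesis by (simp add: a_def b_def c_def flip: power_mult)
qed

text \<open>The coordinates are added one at a time. The increment due to coordinate
  \<open>k\<close> is centred given the earlier ones, and its conditional fourth moment is governed
  by one diagonal term and two linear forms.\<close>

lemma fourth_moment_quadratic:
  fixes b :: "'i \<Rightarrow> 'i \<Rightarrow> 'a"
  assumes I: "finite I"
  shows "(\<integral>\<^sup>+x. ennreal (norm ((\<Sum>i\<in>I. \<Sum>j\<in>I. b i j * (x i * conjugate (x j))) - (\<Sum>i\<in>I. b i i)) ^ 4) \<partial>PiM I (\<lambda>_. \<nu>))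
    \<le> ennreal ((24 * \<kappa> * (1 + 4 * \<kappa>) * (\<Sum>i\<in>I. nsq I (b i)))\<^sup>2)"
  using I
proof (induction I rule: finite_induct)
  case empty
  then show ?case by simp
next
  case (insert k S)
  define Q where "Q x = (\<Sum>i\<in>S. \<Sum>j\<in>S. b i j * (x i * conjugate (x j))) - (\<Sum>i\<in>S. b i i)" for x :: "'i \<Rightarrow> 'a"
  define l1 where "l1 x = (\<Sum>j\<in>S. b k j * conjugate (x j))" for x :: "'i \<Rightarrow> 'a"
  define l2 where "l2 x = (\<Sum>i\<in>S. b i k * x i)" for x :: "'i \<Rightarrow> 'a"
  define D where "D x y = b k k * (of_real ((norm y)\<^sup>2 - 1)) + y * l1 x + conjugate y * l2 x" for x y
  \<comment> \<open>Chosen so that c^2 is at least 27 \<kappa>^2, the constant of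
    \<open>norm_add3_power4_le\<close>; four times it is the 24 \<kappa> of the statement.\<close>
  define c where "c = 6 * \<kappa>"
  define e where "e x = c * sqrt (norm (b k k) ^ 4 + norm (l1 x) ^ 4 + norm (l2 x) ^ 4)" for x
  \<comment> \<open>Squared coefficients in the row and the column that coordinate \<open>k\<close>
    adds.\<close>
  define w where "w = (norm (b k k))\<^sup>2 + nsq S (b k) + nsq S (\<lambda>i. b i k)"
  have c0: "c \<ge> 0" using \<kappa> by (simp add: c_def)
  have w0: "w \<ge> 0" by (simp add: w_def)
  have ne: "i \<noteq> k" if "i \<in> S" for i using insert that by auto
  have [measurable]: "Q \<in> borel_measurable (PiM S (\<lambda>_. \<nu>))" "l1 \<in> borel_measurable (PiM S (\<lambda>_. \<nu>))" "l2 \<in> borel_measurable (PiM S (\<lambda>_. \<nu>))"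
    unfolding Q_def l1_def l2_def by measurable
  have split: "(\<Sum>i\<in>insert k S. \<Sum>j\<in>insert k S. b i j * ((x(k := y)) i * conjugate ((x(k := y)) j))) - (\<Sum>i\<in>insert k S. b i i)
      = Q x + D x y" for x y
  proof -
    let ?z = "x(k := y)"
    have "(\<Sum>i\<in>insert k S. \<Sum>j\<in>insert k S. b i j * (?z i * conjugate (?z j)))
       = (b k k * (y * conjugate y) + (\<Sum>j\<in>S. b k j * (y * conjugate (?z j))))
         + ((\<Sum>i\<in>S. b i k * (?z i * conjugate y)) + (\<Sum>i\<in>S. \<Sum>j\<in>S. b i j * (?z i * conjugate (?z j))))"
      using insert by (simp add: sum.distrib)
    also have "(\<Sum>j\<in>S. b k j * (y * conjugate (?z j))) = y * l1 x"
      unfolding l1_def sum_distrib_left using ne by (intro sum.cong) auto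
    also have "(\<Sum>i\<in>S. b i k * (?z i * conjugate y)) = conjugate y * l2 x"
      unfolding l2_def sum_distrib_left using ne by (intro sum.cong) auto
    also have "(\<Sum>i\<in>S. \<Sum>j\<in>S. b i j * (?z i * conjugate (?z j))) = (\<Sum>i\<in>S. \<Sum>j\<in>S. b i j * (x i * conjugate (x j)))"
      using ne by (intro sum.cong) auto
    also have "b k k * (y * conjugate y) = b k k * of_real ((norm y)\<^sup>2 - 1) + b k k"
      by (simp add: mult_conjugate algebra_simps)
    finally show ?thesis
      using insert by (simp add: Q_def D_def algebra_simps)
  qed
  have "(\<integral>\<^sup>+x. ennreal (norm ((\<Sum>i\<in>insert k S. \<Sum>j\<in>insert k S. b i j * (x i * conjugate (x j))) - (\<Sum>i\<in>insert k S. b i i)) ^ 4) \<partial>PiM (insert k S) (\<lambda>_. \<nu>)) =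
    (\<integral>\<^sup>+x. \<integral>\<^sup>+y. ennreal (norm (Q x + D x y) ^ 4) \<partial>\<nu> \<partial>PiM S (\<lambda>_. \<nu>))"
    unfolding split[symmetric] by (rule PP.product_nn_integral_insert[OF insert(1,2)]) measurable
  also have "\<dots> \<le> ennreal ((24 * \<kappa> * (1 + 4 * \<kappa>) * (\<Sum>i\<in>S. nsq S (b i)) + 4 * (c * (1 + 4 * \<kappa>) * w))\<^sup>2)"
  proof (rule fourth_moment_martingale_step[where e = e])
    show "prob_space \<nu>" by (rule prob_space_axioms)
    show "(\<lambda>(x, y). D x y) \<in> borel_measurable (PiM S (\<lambda>_. \<nu>) \<Otimes>\<^sub>M \<nu>)" unfolding D_def by measurable
    show "e \<in> borel_measurable (PiM S (\<lambda>_. \<nu>))" unfolding e_def by measurable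
    have i1: "integrable \<nu> (\<lambda>y. of_real ((norm y)\<^sup>2 - 1) :: 'a)"
      by (intro integrable_of_real Bochner_Integration.integrable_diff var integrable_const)
    have "(\<integral>y. of_real ((norm y)\<^sup>2 - 1) \<partial>\<nu>) = (of_real (\<integral>y. (norm y)\<^sup>2 - 1 \<partial>\<nu>) :: 'a)"
      by (intro integral_of_real Bochner_Integration.integrable_diff var integrable_const)
    also have "(\<integral>y. (norm y)\<^sup>2 - 1 \<partial>\<nu>) = 0" using var by (simp add: prob_space)
    finally have z1: "(\<integral>y. of_real ((norm y)\<^sup>2 - 1) \<partial>\<nu>) = (0 :: 'a)" by simp
    show "integrable \<nu> (D x)" for x
      unfolding D_def using i1 mean mean_conjugate by (intro Bochner_Integration.integrable_add integrable_mult_right integrable_mult_left)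
    show "(\<integral>y. D x y \<partial>\<nu>) = 0" for x
    proof -
      have "(\<integral>y. D x y \<partial>\<nu>) = (\<integral>y. b k k * of_real ((norm y)\<^sup>2 - 1) \<partial>\<nu>) + (\<integral>y. y * l1 x \<partial>\<nu>) + (\<integral>y. conjugate y * l2 x \<partial>\<nu>)"
        unfolding D_def using i1 mean mean_conjugate
        by (simp add: Bochner_Integration.integral_add del: integral_mult_right_zero integral_mult_left_zero of_real_diff of_real_power)
      then show ?thesis using z1 mean mean_conjugate by (simp del: of_real_diff of_real_power)
    qed
    show "0 \<le> e x" for x using c0 by (simp add: e_def)
    show "(\<integral>\<^sup>+y. ennreal (norm (D x y) ^ 4) \<partial>\<nu>) \<le> ennreal ((e x)\<^sup>2)" for x
    proof -
      have "(\<integral>\<^sup>+y. ennreal (norm (D x y) ^ 4) \<partial>\<nu>)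
        \<le> (\<integral>\<^sup>+y. ennreal (27 * norm (b k k) ^ 4) * ennreal (((norm y)\<^sup>2 - 1) ^ 4)
             + ennreal (27 * (norm (l1 x) ^ 4 + norm (l2 x) ^ 4)) * ennreal (norm y ^ 4) \<partial>\<nu>)"
      proof (rule nn_integral_mono)
        fix y
        have "norm (D x y) ^ 4 \<le> 27 * (norm (b k k * of_real ((norm y)\<^sup>2 - 1)) ^ 4 + norm (y * l1 x) ^ 4 + norm (conjugate y * l2 x) ^ 4)"
          unfolding D_def by (rule norm_add3_power4_le)
        also have "\<dots> = 27 * norm (b k k) ^ 4 * ((norm y)\<^sup>2 - 1) ^ 4 + 27 * (norm (l1 x) ^ 4 + norm (l2 x) ^ 4) * norm y ^ 4"
          by (simp add: norm_mult power_mult_distrib algebra_simps power_even_abs del: of_real_diff of_real_power)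
        finally have "ennreal (norm (D x y) ^ 4) \<le> ennreal (27 * norm (b k k) ^ 4 * ((norm y)\<^sup>2 - 1) ^ 4 + 27 * (norm (l1 x) ^ 4 + norm (l2 x) ^ 4) * norm y ^ 4)"
          by (rule ennreal_leI)
        also have "\<dots> = ennreal (27 * norm (b k k) ^ 4 * ((norm y)\<^sup>2 - 1) ^ 4) + ennreal (27 * (norm (l1 x) ^ 4 + norm (l2 x) ^ 4) * norm y ^ 4)"
          by (rule ennreal_plus) auto
        also have "\<dots> = ennreal (27 * norm (b k k) ^ 4) * ennreal (((norm y)\<^sup>2 - 1) ^ 4)
             + ennreal (27 * (norm (l1 x) ^ 4 + norm (l2 x) ^ 4)) * ennreal (norm y ^ 4)"
          by (intro arg_cong2[where f = "(+)"] ennreal_mult) auto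
        finally show "ennreal (norm (D x y) ^ 4) \<le> ennreal (27 * norm (b k k) ^ 4) * ennreal (((norm y)\<^sup>2 - 1) ^ 4)
             + ennreal (27 * (norm (l1 x) ^ 4 + norm (l2 x) ^ 4)) * ennreal (norm y ^ 4)" .
      qed
      also have "\<dots> = ennreal (27 * norm (b k k) ^ 4) * (\<integral>\<^sup>+y. ennreal (((norm y)\<^sup>2 - 1) ^ 4) \<partial>\<nu>)
             + ennreal (27 * (norm (l1 x) ^ 4 + norm (l2 x) ^ 4)) * (\<integral>\<^sup>+y. ennreal (norm y ^ 4) \<partial>\<nu>)"
        by (simp add: nn_integral_add nn_integral_cmult)
      also have "\<dots> \<le> ennreal (27 * norm (b k k) ^ 4) * ennreal (\<kappa>\<^sup>2) + ennreal (27 * (norm (l1 x) ^ 4 + norm (l2 x) ^ 4)) * ennreal (\<kappa>\<^sup>2)"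
        by (intro add_mono mult_left_mono \<kappa>) auto
      also have "\<dots> = ennreal (27 * norm (b k k) ^ 4 * \<kappa>\<^sup>2 + 27 * (norm (l1 x) ^ 4 + norm (l2 x) ^ 4) * \<kappa>\<^sup>2)"
        by (subst ennreal_plus) (auto simp: ennreal_mult)
      also have "\<dots> \<le> ennreal ((e x)\<^sup>2)"
      proof (rule ennreal_leI)
        define Z where "Z = norm (b k k) ^ 4 + norm (l1 x) ^ 4 + norm (l2 x) ^ 4"
        have Z: "0 \<le> Z" by (simp add: Z_def)
        have "(e x)\<^sup>2 = 36 * \<kappa>\<^sup>2 * Z"
          using Z by (simp add: e_def c_def power_mult_distrib Z_def[symmetric])
        moreover have "27 * norm (b k k) ^ 4 * \<kappa>\<^sup>2 + 27 * (norm (l1 x) ^ 4 + norm (l2 x) ^ 4) * \<kappa>\<^sup>2 = 27 * \<kappa>\<^sup>2 * Z"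
          by (simp add: Z_def algebra_simps)
        moreover have "27 * \<kappa>\<^sup>2 * Z \<le> 36 * \<kappa>\<^sup>2 * Z" using Z by (intro mult_right_mono) auto
        ultimately show "27 * norm (b k k) ^ 4 * \<kappa>\<^sup>2 + 27 * (norm (l1 x) ^ 4 + norm (l2 x) ^ 4) * \<kappa>\<^sup>2 \<le> (e x)\<^sup>2" by simp
      qed
      finally show ?thesis .
    qed
    show "(\<integral>\<^sup>+x. ennreal (norm (Q x) ^ 4) \<partial>PiM S (\<lambda>_. \<nu>)) \<le> ennreal ((24 * \<kappa> * (1 + 4 * \<kappa>) * (\<Sum>i\<in>S. nsq S (b i)))\<^sup>2)"
      unfolding Q_def by (rule insert.IH)
    show "0 \<le> 24 * \<kappa> * (1 + 4 * \<kappa>) * (\<Sum>i\<in>S. nsq S (b i))"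
      using \<kappa>(1) by (auto intro!: mult_nonneg_nonneg sum_nonneg)
    show "0 \<le> c * (1 + 4 * \<kappa>) * w" using \<kappa>(1) c0 w0 by auto
    have PiM1: "emeasure (PiM S (\<lambda>_. \<nu>)) (space (PiM S (\<lambda>_. \<nu>))) = 1"
      by (intro prob_space.emeasure_space_1 prob_space_PiM prob_space_axioms)
    have "(\<integral>\<^sup>+x. ennreal ((e x)\<^sup>2) \<partial>PiM S (\<lambda>_. \<nu>))
      = (\<integral>\<^sup>+x. ennreal (c\<^sup>2) * (ennreal (norm (b k k) ^ 4) + ennreal (norm (l1 x) ^ 4) + ennreal (norm (l2 x) ^ 4)) \<partial>PiM S (\<lambda>_. \<nu>))"
      by (intro nn_integral_cong) (simp add: e_def power_mult_distrib ennreal_mult ennreal_plus)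
    also have "\<dots> = ennreal (c\<^sup>2) * (ennreal (norm (b k k) ^ 4) + (\<integral>\<^sup>+x. ennreal (norm (l1 x) ^ 4) \<partial>PiM S (\<lambda>_. \<nu>)) + (\<integral>\<^sup>+x. ennreal (norm (l2 x) ^ 4) \<partial>PiM S (\<lambda>_. \<nu>)))"
      by (simp add: nn_integral_cmult nn_integral_add PiM1)
    also have "\<dots> \<le> ennreal (c\<^sup>2) * (ennreal (norm (b k k) ^ 4) + ennreal ((4 * \<kappa> * nsq S (b k))\<^sup>2) + ennreal ((4 * \<kappa> * nsq S (\<lambda>i. b i k))\<^sup>2))"
      unfolding l1_def l2_def
      by (intro mult_left_mono add_mono order_refl fourth_moment_linear insert.hyps mean mean_conjugate conjugate_measurable measurable_ident_sets norm_conjugate refl zero_le)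
    also have "\<dots> = ennreal (c\<^sup>2 * (norm (b k k) ^ 4 + (4 * \<kappa> * nsq S (b k))\<^sup>2 + (4 * \<kappa> * nsq S (\<lambda>i. b i k))\<^sup>2))"
      by (intro ennreal_mult_add3[symmetric] zero_le_power2 zero_le_power norm_ge_zero)
    also have "\<dots> \<le> ennreal ((c * (1 + 4 * \<kappa>) * w)\<^sup>2)"
    proof (rule ennreal_leI)
      define p1 p2 p3 where "p1 = (norm (b k k))\<^sup>2" and "p2 = nsq S (b k)" and "p3 = nsq S (\<lambda>i. b i k)"
      have p: "0 \<le> p1" "0 \<le> p2" "0 \<le> p3" by (auto simp: p1_def p2_def p3_def)
      let ?L = "1 + 4 * \<kappa>"
      have "p1\<^sup>2 + (4 * \<kappa> * p2)\<^sup>2 + (4 * \<kappa> * p3)\<^sup>2 \<le> (?L * p1)\<^sup>2 + (?L * p2)\<^sup>2 + (?L * p3)\<^sup>2"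
        using p \<kappa>(1) by (intro add_mono power_mono mult_right_mono) (auto simp: mult_le_cancel_right1 algebra_simps)
      also have "\<dots> \<le> (?L * p1 + ?L * p2 + ?L * p3)\<^sup>2"
      proof -
        have "0 \<le> ?L * p1" "0 \<le> ?L * p2" "0 \<le> ?L * p3" using p \<kappa> by auto
        then have "0 \<le> (?L * p1) * (?L * p2)" "0 \<le> (?L * p1) * (?L * p3)" "0 \<le> (?L * p2) * (?L * p3)" by (simp_all only: mult_nonneg_nonneg)
        moreover have "(x + y + z)\<^sup>2 = x\<^sup>2 + y\<^sup>2 + z\<^sup>2 + 2 * (x * y) + 2 * (x * z) + 2 * (y * z)" for x y z :: real
          by (simp add: power2_eq_square algebra_simps)
        ultimately show ?thesis by (simp only:)
      qed
      also have "?L * p1 + ?L * p2 + ?L * p3 = ?L * w" by (simp add: w_def p1_def p2_def p3_def algebra_simps)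
      finally have "c\<^sup>2 * (p1\<^sup>2 + (4 * \<kappa> * p2)\<^sup>2 + (4 * \<kappa> * p3)\<^sup>2) \<le> c\<^sup>2 * (?L * w)\<^sup>2" by (intro mult_left_mono) auto
      moreover have "p1\<^sup>2 = norm (b k k) ^ 4" by (simp add: p1_def flip: power_mult)
      ultimately show "c\<^sup>2 * (norm (b k k) ^ 4 + (4 * \<kappa> * nsq S (b k))\<^sup>2 + (4 * \<kappa> * nsq S (\<lambda>i. b i k))\<^sup>2) \<le> (c * (1 + 4 * \<kappa>) * w)\<^sup>2"
        by (simp add: p2_def p3_def power_mult_distrib mult.assoc)
    qed
    finally show "(\<integral>\<^sup>+x. ennreal ((e x)\<^sup>2) \<partial>PiM S (\<lambda>_. \<nu>)) \<le> ennreal ((c * (1 + 4 * \<kappa>) * w)\<^sup>2)" .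
  qed (use insert in auto)
  also have "24 * \<kappa> * (1 + 4 * \<kappa>) * (\<Sum>i\<in>S. nsq S (b i)) + 4 * (c * (1 + 4 * \<kappa>) * w)
     = 24 * \<kappa> * (1 + 4 * \<kappa>) * (\<Sum>i\<in>insert k S. nsq (insert k S) (b i))"
  proof -
    have "(\<Sum>i\<in>insert k S. nsq (insert k S) (b i)) = (\<Sum>i\<in>S. nsq S (b i)) + w"
      using insert by (simp add: nsq_def w_def sum.distrib)
    then show ?thesis by (simp add: c_def algebra_simps)
  qed
  finally show ?case .
qed

end

section \<open>Forms whose coefficients are random but independent of the variables\<close>

definition centred_form :: "'i set \<Rightarrow> ('i \<Rightarrow> 'i \<Rightarrow> 'a :: real_or_complex) \<Rightarrow> ('i \<Rightarrow> 'a) \<Rightarrow> 'a" where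
  "centred_form I b x = (\<Sum>i\<in>I. \<Sum>j\<in>I. b i j * (x i * conjugate (x j))) - (\<Sum>i\<in>I. b i i)"

lemma centred_form_cong:
  "(\<And>i j. i \<in> I \<Longrightarrow> j \<in> I \<Longrightarrow> b i j = b' i j) \<Longrightarrow> (\<And>i. i \<in> I \<Longrightarrow> x i = x' i) \<Longrightarrow> centred_form I b x = centred_form I b' x'"
  by (simp add: centred_form_def)

context iid_coordinates
begin

text \<open>Conditionally on the \<open>\<sigma>\<close>-algebra \<open>N\<close>, with respect to which \<open>B\<close> is measurable, the coordinates are still i.i.d.\<close>

lemma fourth_moment_random_form:
  fixes g :: "'i \<Rightarrow> 'w \<Rightarrow> 'a" and B :: "'w \<Rightarrow> 'i \<Rightarrow> 'i \<Rightarrow> 'a"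
  assumes M: "prob_space M" and I: "finite I" "I \<noteq> {}"
    and g: "prob_space.indep_vars M (\<lambda>_. borel) g I" "\<And>i. i \<in> I \<Longrightarrow> distr M borel (g i) = \<nu>"
    and N: "space N = space M" "sets N \<subseteq> sets M"
    and indep: "prob_space.indep_set M (sigma_sets (space M) {g i -` A \<inter> space M | i A. i \<in> I \<and> A \<in> sets borel}) (sets N)"
    and B: "\<And>i j. i \<in> I \<Longrightarrow> j \<in> I \<Longrightarrow> (\<lambda>\<omega>. B \<omega> i j) \<in> borel_measurable N"
    and c: "\<And>\<omega>. \<omega> \<in> space M \<Longrightarrow> (\<Sum>i\<in>I. nsq I (B \<omega> i)) \<le> c"
  shows "(\<integral>\<^sup>+\<omega>. ennreal (norm (centred_form I (B \<omega>) (\<lambda>i. g i \<omega>)) ^ 4) \<partial>M) \<le> ennreal ((24 * \<kappa> * (1 + 4 * \<kappa>) * c)\<^sup>2)"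
proof -
  interpret M: prob_space M by (rule M)
  define G where "G \<omega> = (\<lambda>i\<in>I. g i \<omega>)" for \<omega>
  define Bf where "Bf \<omega> = (\<lambda>p\<in>I \<times> I. B \<omega> (fst p) (snd p))" for \<omega>
  let ?PB = "PiM (I \<times> I) (\<lambda>_. borel :: 'a measure)"
  let ?PG = "PiM I (\<lambda>_. borel :: 'a measure)"
  let ?\<nu> = "PiM I (\<lambda>_. \<nu>)"
  have rv: "g i \<in> borel_measurable M" if "i \<in> I" for i using g(1) that by (simp add: M.indep_vars_def)
  have G: "G \<in> measurable M ?PG" unfolding G_def by (rule measurable_restrict) (rule rv)
  have Bf_N: "Bf \<in> measurable N ?PB"
    unfolding Bf_def by (rule measurable_restrict) (auto intro: B)
  have Bf: "Bf \<in> measurable M ?PB"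
    using Bf_N N by (auto simp: measurable_def)
  have dG: "distr M ?PG G = ?\<nu>"
  proof -
    have "distr M ?PG (\<lambda>x. \<lambda>i\<in>I. g i x) = PiM I (\<lambda>i. distr M borel (g i))"
      using M.indep_vars_iff_distr_eq_PiM'[where M' = "\<lambda>_. borel" and X = g, OF I(2) rv] g(1) by simp
    also have "\<dots> = ?\<nu>" by (rule PiM_cong) (auto simp: g(2))
    finally show ?thesis by (simp add: G_def[abs_def])
  qed
  let ?SG = "sigma_sets (space M) {g i -` A \<inter> space M | i A. i \<in> I \<and> A \<in> sets borel}"
  have sub: "{g i -` A \<inter> space M | i A. i \<in> I \<and> A \<in> sets borel} \<subseteq> Pow (space M)" by auto
  have gS: "G \<in> measurable (sigma (space M) {g i -` A \<inter> space M | i A. i \<in> I \<and> A \<in> sets borel}) ?PG"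
    unfolding G_def
  proof (rule measurable_restrict, rule measurableI)
    fix i and A :: "'a set" assume "i \<in> I" "A \<in> sets borel"
    then have "g i -` A \<inter> space M \<in> ?SG" by (intro sigma_sets.Basic) blast
    then show "g i -` A \<inter> space (sigma (space M) {g i -` A \<inter> space M | i A. i \<in> I \<and> A \<in> sets borel})
        \<in> sets (sigma (space M) {g i -` A \<inter> space M | i A. i \<in> I \<and> A \<in> sets borel})"
      unfolding sets_measure_of[OF sub] space_measure_of[OF sub] .
  qed simp
  have setsPG: "sets ?\<nu> = sets ?PG" by (rule sets_PiM_cong) (auto simp: sets_borel)
  have prob_PiM: "prob_space ?\<nu>" by (intro prob_space_PiM prob_space_axioms)
  then have sf: "sigma_finite_measure ?\<nu>" by (rule prob_space_imp_sigma_finite)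
  \<comment> \<open>Independence of the two \<sigma>-algebras becomes a product law for coefficients
    and variables, so that Fubini allows the coefficients to be frozen.\<close>
  have joint: "distr M ?PB Bf \<Otimes>\<^sub>M ?\<nu> = distr M (?PB \<Otimes>\<^sub>M ?PG) (\<lambda>\<omega>. (Bf \<omega>, G \<omega>))"
  proof (rule pair_measure_eqI[OF _ sf])
    show "sigma_finite_measure (distr M ?PB Bf)"
      by (intro prob_space_imp_sigma_finite M.prob_space_distr Bf)
    show "sets (distr M ?PB Bf \<Otimes>\<^sub>M ?\<nu>) = sets (distr M (?PB \<Otimes>\<^sub>M ?PG) (\<lambda>\<omega>. (Bf \<omega>, G \<omega>)))"
      unfolding sets_distr by (rule sets_pair_measure_cong) (simp_all add: setsPG)
    fix A C assume A: "A \<in> sets (distr M ?PB Bf)" and C: "C \<in> sets ?\<nu>"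
    then have AC: "A \<in> sets ?PB" "C \<in> sets ?PG" by (simp_all add: setsPG)
    have a: "Bf -` A \<inter> space M \<in> sets N" using measurable_sets[OF Bf_N AC(1)] N(1) by simp
    have c: "G -` C \<inter> space M \<in> ?SG"
      using measurable_sets[OF gS AC(2)] unfolding sets_measure_of[OF sub] space_measure_of[OF sub] .
    have "emeasure (distr M ?PB Bf) A * emeasure ?\<nu> C = emeasure M (Bf -` A \<inter> space M) * emeasure M (G -` C \<inter> space M)"
      unfolding dG[symmetric] by (simp add: emeasure_distr Bf G AC)
    also have "\<dots> = ennreal (M.prob (Bf -` A \<inter> space M) * M.prob (G -` C \<inter> space M))"
      by (simp add: M.emeasure_eq_measure ennreal_mult)
    also have "M.prob (Bf -` A \<inter> space M) * M.prob (G -` C \<inter> space M) = M.prob ((G -` C \<inter> space M) \<inter> (Bf -` A \<inter> space M))"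
      using M.indep_setD[OF indep c a] by (simp add: mult.commute)
    also have "(G -` C \<inter> space M) \<inter> (Bf -` A \<inter> space M) = (\<lambda>\<omega>. (Bf \<omega>, G \<omega>)) -` (A \<times> C) \<inter> space M" by auto
    also have "ennreal (M.prob ((\<lambda>\<omega>. (Bf \<omega>, G \<omega>)) -` (A \<times> C) \<inter> space M)) = emeasure (distr M (?PB \<Otimes>\<^sub>M ?PG) (\<lambda>\<omega>. (Bf \<omega>, G \<omega>))) (A \<times> C)"
      by (subst emeasure_distr) (use Bf G AC in \<open>auto simp: M.emeasure_eq_measure\<close>)
    finally show "emeasure (distr M ?PB Bf) A * emeasure ?\<nu> C = emeasure (distr M (?PB \<Otimes>\<^sub>M ?PG) (\<lambda>\<omega>. (Bf \<omega>, G \<omega>))) (A \<times> C)" .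
  qed
  define h where "h p = ennreal (norm (centred_form I (\<lambda>i j. fst p (i, j)) (snd p)) ^ 4)" for p :: "('i \<times> 'i \<Rightarrow> 'a) \<times> ('i \<Rightarrow> 'a)"
  have h [measurable]: "h \<in> borel_measurable (?PB \<Otimes>\<^sub>M ?PG)"
    unfolding h_def centred_form_def by measurable
  have h': "h \<in> borel_measurable (distr M ?PB Bf \<Otimes>\<^sub>M ?\<nu>)"
  proof -
    have "sets (distr M ?PB Bf \<Otimes>\<^sub>M ?\<nu>) = sets (?PB \<Otimes>\<^sub>M ?PG)"
      by (rule sets_pair_measure_cong) (simp_all add: setsPG)
    then show ?thesis using h measurable_cong_sets by blast
  qed
  have cfm: "(\<lambda>x. ennreal (norm (centred_form I b x) ^ 4)) \<in> borel_measurable ?\<nu>" for b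
    unfolding centred_form_def by measurable
  have "(\<integral>\<^sup>+\<omega>. ennreal (norm (centred_form I (B \<omega>) (\<lambda>i. g i \<omega>)) ^ 4) \<partial>M) = (\<integral>\<^sup>+\<omega>. h (Bf \<omega>, G \<omega>) \<partial>M)"
    unfolding h_def by (intro nn_integral_cong arg_cong[where f = "\<lambda>z. ennreal (norm z ^ 4)"] centred_form_cong) (auto simp: Bf_def G_def)
  also have "\<dots> = (\<integral>\<^sup>+p. h p \<partial>distr M (?PB \<Otimes>\<^sub>M ?PG) (\<lambda>\<omega>. (Bf \<omega>, G \<omega>)))"
    by (subst nn_integral_distr) (use Bf G in auto)
  also have "\<dots> = (\<integral>\<^sup>+b. \<integral>\<^sup>+x. h (b, x) \<partial>?\<nu> \<partial>distr M ?PB Bf)"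
    unfolding joint[symmetric] by (rule sigma_finite_measure.nn_integral_fst[OF sf, symmetric]) (rule h')
  also have "\<dots> = (\<integral>\<^sup>+\<omega>. \<integral>\<^sup>+x. h (Bf \<omega>, x) \<partial>?\<nu> \<partial>M)"
    by (rule nn_integral_distr[OF Bf]) (use sigma_finite_measure.borel_measurable_nn_integral_fst[OF sf h'] in simp)
  also have "\<dots> \<le> (\<integral>\<^sup>+\<omega>. ennreal ((24 * \<kappa> * (1 + 4 * \<kappa>) * c)\<^sup>2) \<partial>M)"
  proof (rule nn_integral_mono)
    fix \<omega> assume \<omega>: "\<omega> \<in> space M"
    have "(\<integral>\<^sup>+x. h (Bf \<omega>, x) \<partial>?\<nu>) = (\<integral>\<^sup>+x. ennreal (norm (centred_form I (B \<omega>) x) ^ 4) \<partial>?\<nu>)"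
      unfolding h_def by (intro nn_integral_cong arg_cong[where f = "\<lambda>z. ennreal (norm z ^ 4)"] centred_form_cong) (auto simp: Bf_def)
    also have "\<dots> \<le> ennreal ((24 * \<kappa> * (1 + 4 * \<kappa>) * (\<Sum>i\<in>I. nsq I (B \<omega> i)))\<^sup>2)"
      unfolding centred_form_def by (rule fourth_moment_quadratic[OF I(1)])
    also have "\<dots> \<le> ennreal ((24 * \<kappa> * (1 + 4 * \<kappa>) * c)\<^sup>2)"
      using c[OF \<omega>] \<kappa>(1) by (intro ennreal_leI power_mono mult_left_mono mult_nonneg_nonneg sum_nonneg) auto
    finally show "(\<integral>\<^sup>+x. h (Bf \<omega>, x) \<partial>?\<nu>) \<le> ennreal ((24 * \<kappa> * (1 + 4 * \<kappa>) * c)\<^sup>2)" .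
  qed
  also have "\<dots> = ennreal ((24 * \<kappa> * (1 + 4 * \<kappa>) * c)\<^sup>2)" by (simp add: M.emeasure_space_1)
  finally show ?thesis .
qed

end

text \<open>Summable fourth moments make the sum of |T n|^4 integrable, hence almost surely finite,
  so its terms vanish. At n = 0 the bound reads 0 by the convention 1 / 0 = 0.\<close>

lemma AE_tendsto_0_of_fourth_moment:
  fixes T :: "nat \<Rightarrow> 'w \<Rightarrow> 'a :: euclidean_space"
  assumes [measurable]: "\<And>n. T n \<in> borel_measurable M"
    and le: "\<And>n. (\<integral>\<^sup>+\<omega>. ennreal (norm (T n \<omega>) ^ 4) \<partial>M) \<le> ennreal (C * (1 / real n)\<^sup>2)" and C: "0 \<le> C"
  shows "AE \<omega> in M. (\<lambda>n. T n \<omega>) \<longlonglongrightarrow> 0"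
proof -
  have sm: "summable (\<lambda>n. C * (1 / real n)\<^sup>2)"
    using inverse_power_summable[of 2, where 'a = real] by (intro summable_mult) (simp add: power_divide divide_inverse power_inverse)
  have "(\<integral>\<^sup>+\<omega>. (\<Sum>n. ennreal (norm (T n \<omega>) ^ 4)) \<partial>M) = (\<Sum>n. \<integral>\<^sup>+\<omega>. ennreal (norm (T n \<omega>) ^ 4) \<partial>M)"
    by (rule nn_integral_suminf) measurable
  also have "\<dots> \<le> (\<Sum>n. ennreal (C * (1 / real n)\<^sup>2))" by (intro suminf_le le) auto
  also have "\<dots> < \<infinity>" using sm C by (subst suminf_ennreal2) auto
  finally have "AE \<omega> in M. (\<Sum>n. ennreal (norm (T n \<omega>) ^ 4)) \<noteq> \<infinity>"
    by (intro nn_integral_PInf_AE) auto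
  then show ?thesis
  proof (rule AE_mp, intro AE_I2 impI)
    fix \<omega> assume fin: "(\<Sum>n. ennreal (norm (T n \<omega>) ^ 4)) \<noteq> \<infinity>"
    have "summable (\<lambda>n. norm (T n \<omega>) ^ 4)" by (rule summable_suminf_not_top) (use fin in auto)
    then have "(\<lambda>n. norm (T n \<omega>) ^ 4) \<longlonglongrightarrow> 0" by (rule summable_LIMSEQ_zero)
    then have "(\<lambda>n. root 4 (norm (T n \<omega>) ^ 4)) \<longlonglongrightarrow> root 4 0" by (intro tendsto_real_root)
    then have "(\<lambda>n. norm (T n \<omega>)) \<longlonglongrightarrow> 0" by (simp add: real_root_power_cancel)
    then show "(\<lambda>n. T n \<omega>) \<longlonglongrightarrow> 0" by (rule tendsto_norm_zero_cancel)
  qed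
qed

text \<open>The independent family is indexed by side, row and column of the entries. A form in two
  of the columns is treated as a form on the whole family whose coefficients vanish elsewhere; this
  lemma and the next undo that extension.\<close>

lemma sum_block:
  fixes h :: "nat \<Rightarrow> 'b :: comm_monoid_add" and k r :: nat
  assumes "k < r"
  shows "(\<Sum>a\<in>(UNIV :: bool set) \<times> {..<n} \<times> {..<r}. if fst a = b \<and> snd (snd a) = k then h (fst (snd a)) else 0) = (\<Sum>i<n. h i)"
proof -
  have "(\<Sum>a\<in>(UNIV :: bool set) \<times> {..<n} \<times> {..<r}. if fst a = b \<and> snd (snd a) = k then h (fst (snd a)) else 0)
      = (\<Sum>a\<in>(\<lambda>i. (b, i, k)) ` {..<n}. if fst a = b \<and> snd (snd a) = k then h (fst (snd a)) else 0)"
    by (rule sum.mono_neutral_right) (use assms in \<open>auto intro!: finite_cartesian_product\<close>)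
  also have "\<dots> = (\<Sum>i<n. h i)"
    by (subst sum.reindex) (auto simp: inj_on_def)
  finally show ?thesis .
qed

lemma sum_block2:
  fixes h :: "nat \<Rightarrow> nat \<Rightarrow> 'b :: comm_monoid_add" and k l r :: nat
  assumes "k < r" "l < r"
  shows "(\<Sum>p\<in>(UNIV :: bool set) \<times> {..<n} \<times> {..<r}. \<Sum>q\<in>(UNIV :: bool set) \<times> {..<n} \<times> {..<r}.
     if fst p = b \<and> snd (snd p) = k then if fst q = b' \<and> snd (snd q) = l then h (fst (snd p)) (fst (snd q)) else 0 else 0)
     = (\<Sum>i<n. \<Sum>j<n. h i j)"
proof -
  have "(\<Sum>q\<in>(UNIV :: bool set) \<times> {..<n} \<times> {..<r}.
     if fst p = b \<and> snd (snd p) = k then if fst q = b' \<and> snd (snd q) = l then h (fst (snd p)) (fst (snd q)) else 0 else 0)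
     = (if fst p = b \<and> snd (snd p) = k then \<Sum>j<n. h (fst (snd p)) j else 0)" for p
    using sum_block[OF assms(2), where n = n and b = b' and h = "h (fst (snd p))"] by simp
  then show ?thesis
    using sum_block[OF assms(1), where n = n and b = b and h = "\<lambda>i. \<Sum>j<n. h i j"] by simp
qed

text \<open>The null set is fixed before the growth constant \<open>C\<close> is chosen, so the
  coefficients may be bounded by a constant depending on the outcome. Dividing by the random factor
  \<open>d\<close> frees the moment bound from any such hypothesis.\<close>

lemma (in iid_coordinates) quadratic_form_AE:
  fixes g :: "nat \<Rightarrow> bool \<times> nat \<times> nat \<Rightarrow> 'w \<Rightarrow> 'a" and B :: "nat \<Rightarrow> 'w \<Rightarrow> nat \<Rightarrow> nat \<Rightarrow> 'a"
  defines "I \<equiv> \<lambda>n r. (UNIV :: bool set) \<times> {..<n} \<times> {..<r}"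
  assumes M: "prob_space M"
    and g: "\<And>n. prob_space.indep_vars M (\<lambda>_. borel) (g n) (I n r)" "\<And>n i. i \<in> I n r \<Longrightarrow> distr M borel (g n i) = \<nu>"
    and N: "space N = space M" "sets N \<subseteq> sets M"
    and indep: "\<And>n. prob_space.indep_set M (sigma_sets (space M) {g n i -` A \<inter> space M | i A. i \<in> I n r \<and> A \<in> sets borel}) (sets N)"
    and B: "\<And>n i j. i < n \<Longrightarrow> j < n \<Longrightarrow> (\<lambda>\<omega>. B n \<omega> i j) \<in> borel_measurable N"
    and kl: "k < r" "l < r"
  shows "AE \<omega> in M. \<forall>C. (\<forall>\<^sub>F n in sequentially. (\<Sum>i<n. nsq {..<n} (B n \<omega> i)) \<le> C * real n) \<longrightarrow>
    (\<lambda>n. ((\<Sum>i<n. \<Sum>j<n. B n \<omega> i j * (g n (b, i, k) \<omega> * conjugate (g n (b', j, l) \<omega>)))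
           - (if b = b' \<and> k = l then \<Sum>i<n. B n \<omega> i i else 0)) / of_nat n) \<longlonglongrightarrow> 0"
proof -
  interpret M: prob_space M by (rule M)
  define F where "F n \<omega> = (\<Sum>i<n. nsq {..<n} (B n \<omega> i))" for n \<omega>
  \<comment> \<open>With this normaliser the squared coefficients sum to F / (n + F) \<le> 1. It is
    measurable with respect to \<open>N\<close>, so it can join the coefficients.\<close>
  define d where "d n \<omega> = sqrt (real n + F n \<omega>)" for n \<omega>
  define Z where "Z n \<omega> = (\<Sum>i<n. \<Sum>j<n. B n \<omega> i j * (g n (b, i, k) \<omega> * conjugate (g n (b', j, l) \<omega>)))
           - (if b = b' \<and> k = l then \<Sum>i<n. B n \<omega> i i else 0)" for n \<omega>
  define BB where "BB n \<omega> p q = (if fst p = b \<and> snd (snd p) = k then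
      (if fst q = b' \<and> snd (snd q) = l then of_real (1 / d n \<omega>) * B n \<omega> (fst (snd p)) (fst (snd q)) else 0) else 0)"
    for n \<omega> and p q :: "bool \<times> nat \<times> nat"
  \<comment> \<open>The factor 1 / sqrt n supplies the summable n^-2 in the fourth moment. Wherever
    F \<le> C n, the quotient Z / n is at most a constant times T.\<close>
  define T where "T n \<omega> = of_real (1 / sqrt (real n)) * centred_form (I n r) (BB n \<omega>) (\<lambda>i. g n i \<omega>)" for n \<omega>
  define K where "K = 24 * \<kappa> * (1 + 4 * \<kappa>)"
  have F0: "0 \<le> F n \<omega>" for n \<omega> by (simp add: F_def sum_nonneg)
  have fin: "finite (I n r)" for n by (simp add: I_def)
  have g_meas: "g n i \<in> borel_measurable M" if "i \<in> I n r" for n i using g(1)[of n] that by (simp add: M.indep_vars_def)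
  have F_meas: "F n \<in> borel_measurable N" for n
    unfolding F_def[abs_def] nsq_def
    by (intro borel_measurable_sum borel_measurable_power measurable_compose[OF _ borel_measurable_norm] B) auto
  have BB_meas: "(\<lambda>\<omega>. BB n \<omega> p q) \<in> borel_measurable N" if "p \<in> I n r" "q \<in> I n r" for n p q
  proof -
    have "(\<lambda>\<omega>. B n \<omega> (fst (snd p)) (fst (snd q))) \<in> borel_measurable N" using that by (intro B) (auto simp: I_def)
    then show ?thesis
      unfolding BB_def d_def using F_meas[of n] by measurable
  qed
  have N_M: "f \<in> borel_measurable M" if "f \<in> borel_measurable N" for f :: "'w \<Rightarrow> 'a"
    using that N by (auto simp: measurable_def)
  have cf: "centred_form (I n r) (BB n \<omega>) (\<lambda>i. g n i \<omega>) = of_real (1 / d n \<omega>) * Z n \<omega>" for n \<omega>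
  proof -
    have "(\<Sum>p\<in>I n r. \<Sum>q\<in>I n r. BB n \<omega> p q * (g n p \<omega> * conjugate (g n q \<omega>)))
      = (\<Sum>p\<in>I n r. \<Sum>q\<in>I n r. if fst p = b \<and> snd (snd p) = k then if fst q = b' \<and> snd (snd q) = l then
          of_real (1 / d n \<omega>) * (B n \<omega> (fst (snd p)) (fst (snd q)) * (g n (b, fst (snd p), k) \<omega> * conjugate (g n (b', fst (snd q), l) \<omega>))) else 0 else 0)"
      unfolding BB_def by (intro sum.cong refl) (auto simp: mult.assoc)
    also have "\<dots> = (\<Sum>i<n. \<Sum>j<n. of_real (1 / d n \<omega>) * (B n \<omega> i j * (g n (b, i, k) \<omega> * conjugate (g n (b', j, l) \<omega>))))"
      unfolding I_def by (rule sum_block2[OF kl])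
    also have "\<dots> = of_real (1 / d n \<omega>) * (\<Sum>i<n. \<Sum>j<n. B n \<omega> i j * (g n (b, i, k) \<omega> * conjugate (g n (b', j, l) \<omega>)))"
      unfolding sum_distrib_left ..
    finally have 1: "(\<Sum>p\<in>I n r. \<Sum>q\<in>I n r. BB n \<omega> p q * (g n p \<omega> * conjugate (g n q \<omega>)))
       = of_real (1 / d n \<omega>) * (\<Sum>i<n. \<Sum>j<n. B n \<omega> i j * (g n (b, i, k) \<omega> * conjugate (g n (b', j, l) \<omega>)))" .
    have 2: "(\<Sum>p\<in>I n r. BB n \<omega> p p) = of_real (1 / d n \<omega>) * (if b = b' \<and> k = l then \<Sum>i<n. B n \<omega> i i else 0)"
    proof (cases "b = b' \<and> k = l")
      case True
      have "(\<Sum>p\<in>I n r. BB n \<omega> p p) = (\<Sum>p\<in>I n r. if fst p = b \<and> snd (snd p) = k then of_real (1 / d n \<omega>) * B n \<omega> (fst (snd p)) (fst (snd p)) else 0)"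
        unfolding BB_def using True by (intro sum.cong refl) auto
      also have "\<dots> = (\<Sum>i<n. of_real (1 / d n \<omega>) * B n \<omega> i i)"
        unfolding I_def by (rule sum_block[OF kl(1)])
      also have "\<dots> = of_real (1 / d n \<omega>) * (\<Sum>i<n. B n \<omega> i i)"
        unfolding sum_distrib_left ..
      finally show ?thesis using True by simp
    next
      case False
      then have "(\<Sum>p\<in>I n r. BB n \<omega> p p) = (\<Sum>p\<in>I n r. 0)"
        unfolding BB_def by (intro sum.cong refl) auto
      then show ?thesis unfolding if_not_P[OF False] by simp
    qed
    show ?thesis unfolding centred_form_def 1 2 Z_def by (simp add: right_diff_distrib)
  qed
  have "AE \<omega> in M. (\<lambda>n. T n \<omega>) \<longlonglongrightarrow> 0"
  proof (rule AE_tendsto_0_of_fourth_moment)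
    show "0 \<le> K\<^sup>2" by simp
    show "T n \<in> borel_measurable M" for n
      unfolding T_def centred_form_def
      by (intro borel_measurable_times borel_measurable_const borel_measurable_diff borel_measurable_sum N_M[OF BB_meas] g_meas
          measurable_compose[OF g_meas conjugate_measurable])
    show "(\<integral>\<^sup>+\<omega>. ennreal (norm (T n \<omega>) ^ 4) \<partial>M) \<le> ennreal (K\<^sup>2 * (1 / real n)\<^sup>2)" for n
    proof (cases "n = 0")
      case False
      have ne: "I n r \<noteq> {}" using False kl by (auto simp: I_def)
      have "(\<Sum>p\<in>I n r. nsq (I n r) (BB n \<omega> p)) \<le> 1" for \<omega>
      proof -
        have "(\<Sum>p\<in>I n r. nsq (I n r) (BB n \<omega> p)) = (\<Sum>p\<in>I n r. \<Sum>q\<in>I n r. if fst p = b \<and> snd (snd p) = k then if fst q = b' \<and> snd (snd q) = l then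
            (1 / d n \<omega>)\<^sup>2 * (norm (B n \<omega> (fst (snd p)) (fst (snd q))))\<^sup>2 else 0 else 0)"
          unfolding nsq_def BB_def
          by (intro sum.cong refl) (auto simp: norm_mult norm_divide power_mult_distrib power_divide)
        also have "\<dots> = (\<Sum>i<n. \<Sum>j<n. (1 / d n \<omega>)\<^sup>2 * (norm (B n \<omega> i j))\<^sup>2)"
          unfolding I_def by (rule sum_block2[OF kl])
        also have "\<dots> = (1 / d n \<omega>)\<^sup>2 * F n \<omega>"
          unfolding F_def nsq_def sum_distrib_left ..
        also have "\<dots> = F n \<omega> / (real n + F n \<omega>)"
          using F0[of n \<omega>] by (simp add: d_def power_divide)
        also have "\<dots> \<le> 1" using F0[of n \<omega>] by (simp add: divide_le_eq)
        finally show ?thesis .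
      qed
      then have b1: "(\<integral>\<^sup>+\<omega>. ennreal (norm (centred_form (I n r) (BB n \<omega>) (\<lambda>i. g n i \<omega>)) ^ 4) \<partial>M) \<le> ennreal ((24 * \<kappa> * (1 + 4 * \<kappa>) * 1)\<^sup>2)"
        by (intro fourth_moment_random_form[OF M fin ne g N indep BB_meas]) auto
      have "(\<integral>\<^sup>+\<omega>. ennreal (norm (T n \<omega>) ^ 4) \<partial>M) = (\<integral>\<^sup>+\<omega>. ennreal ((1 / real n)\<^sup>2) * ennreal (norm (centred_form (I n r) (BB n \<omega>) (\<lambda>i. g n i \<omega>)) ^ 4) \<partial>M)"
      proof (rule nn_integral_cong)
        fix \<omega>
        have "(1 / sqrt (real n)) ^ 4 = (1 / real n)\<^sup>2"
        proof -
          have "sqrt (real n) ^ 4 = (real n)\<^sup>2" using power_mult[of "sqrt (real n)" 2 2] by simp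
          then show ?thesis by (simp add: power_divide)
        qed
        then have "norm (T n \<omega>) ^ 4 = (1 / real n)\<^sup>2 * norm (centred_form (I n r) (BB n \<omega>) (\<lambda>i. g n i \<omega>)) ^ 4"
          unfolding T_def norm_mult power_mult_distrib norm_of_real by simp
        then show "ennreal (norm (T n \<omega>) ^ 4) = ennreal ((1 / real n)\<^sup>2) * ennreal (norm (centred_form (I n r) (BB n \<omega>) (\<lambda>i. g n i \<omega>)) ^ 4)"
          by (simp only: ennreal_mult zero_le_power2 zero_le_power norm_ge_zero)
      qed
      also have "\<dots> = ennreal ((1 / real n)\<^sup>2) * (\<integral>\<^sup>+\<omega>. ennreal (norm (centred_form (I n r) (BB n \<omega>) (\<lambda>i. g n i \<omega>)) ^ 4) \<partial>M)"
      proof (rule nn_integral_cmult)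
        show "(\<lambda>\<omega>. ennreal (norm (centred_form (I n r) (BB n \<omega>) (\<lambda>i. g n i \<omega>)) ^ 4)) \<in> borel_measurable M"
          unfolding centred_form_def
          by (intro measurable_compose[OF _ measurable_ennreal] borel_measurable_power measurable_compose[OF _ borel_measurable_norm] borel_measurable_times borel_measurable_diff borel_measurable_sum N_M[OF BB_meas] g_meas
              measurable_compose[OF g_meas conjugate_measurable])
      qed
      also have "\<dots> \<le> ennreal ((1 / real n)\<^sup>2) * ennreal (K\<^sup>2)"
        using b1 by (intro mult_left_mono) (auto simp: K_def)
      also have "\<dots> = ennreal (K\<^sup>2 * (1 / real n)\<^sup>2)" by (simp add: mult.commute flip: ennreal_mult)
      finally show ?thesis .
    qed (simp add: T_def)
  qed
  then show ?thesis
  proof (rule AE_mp, intro AE_I2 impI allI)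
    fix \<omega> C assume T: "(\<lambda>n. T n \<omega>) \<longlonglongrightarrow> 0" and C: "\<forall>\<^sub>F n in sequentially. (\<Sum>i<n. nsq {..<n} (B n \<omega> i)) \<le> C * real n"
    have "(\<lambda>n. sqrt (1 + \<bar>C\<bar>) * norm (T n \<omega>)) \<longlonglongrightarrow> sqrt (1 + \<bar>C\<bar>) * 0"
      by (intro tendsto_intros tendsto_norm_zero T)
    then have lim0: "(\<lambda>n. sqrt (1 + \<bar>C\<bar>) * norm (T n \<omega>)) \<longlonglongrightarrow> 0" by simp
    have "(\<lambda>n. Z n \<omega> / of_nat n) \<longlonglongrightarrow> 0"
    proof (rule Lim_null_comparison[OF _ lim0])
      show "\<forall>\<^sub>F n in sequentially. norm (Z n \<omega> / of_nat n) \<le> sqrt (1 + \<bar>C\<bar>) * norm (T n \<omega>)"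
        using C eventually_gt_at_top[of 0]
      proof eventually_elim
        case (elim n)
        have F: "F n \<omega> \<le> \<bar>C\<bar> * real n" using elim by (simp add: F_def) (smt (verit) mult_right_mono of_nat_0_le_iff)
        have dpos: "0 < d n \<omega>" using elim F0[of n \<omega>] by (simp add: d_def add_pos_nonneg)
        have "d n \<omega> \<le> sqrt ((1 + \<bar>C\<bar>) * real n)" unfolding d_def using F by (intro real_sqrt_le_mono) (simp add: algebra_simps)
        then have dle: "d n \<omega> \<le> sqrt (1 + \<bar>C\<bar>) * sqrt (real n)" by (simp add: real_sqrt_mult)
        have "norm (T n \<omega>) = norm (Z n \<omega>) / (sqrt (real n) * d n \<omega>)"
          unfolding T_def cf norm_mult norm_of_real using dpos by simp
        then have "norm (Z n \<omega>) = sqrt (real n) * d n \<omega> * norm (T n \<omega>)" using dpos elim by simp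
        also have "\<dots> \<le> sqrt (real n) * (sqrt (1 + \<bar>C\<bar>) * sqrt (real n)) * norm (T n \<omega>)"
          using dle by (intro mult_right_mono mult_left_mono) auto
        also have "\<dots> = real n * (sqrt (1 + \<bar>C\<bar>) * norm (T n \<omega>))" by (simp add: mult_ac)
        finally show ?case using elim by (simp add: norm_divide divide_le_eq mult_ac)
      qed
    qed
    then show "(\<lambda>n. ((\<Sum>i<n. \<Sum>j<n. B n \<omega> i j * (g n (b, i, k) \<omega> * conjugate (g n (b', j, l) \<omega>)))
           - (if b = b' \<and> k = l then \<Sum>i<n. B n \<omega> i i else 0)) / of_nat n) \<longlonglongrightarrow> 0"
      by (simp add: Z_def)
  qed
qed

section \<open>Powers of the resolvent\<close>

definition mat_prod :: "nat \<Rightarrow> (nat \<Rightarrow> nat \<Rightarrow> 'a :: real_or_complex) \<Rightarrow> (nat \<Rightarrow> nat \<Rightarrow> 'a) \<Rightarrow> nat \<Rightarrow> nat \<Rightarrow> 'a" where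
  "mat_prod n A B i j = (\<Sum>k<n. A i k * B k j)"

text \<open>The product of the matrix with columns \<open>p l\<close>, the diagonal matrix of
  \<open>f\<close>, and the adjoint of the matrix with columns \<open>q l\<close>.\<close>

definition spectral :: "nat \<Rightarrow> (nat \<Rightarrow> real) \<Rightarrow> (nat \<Rightarrow> nat \<Rightarrow> 'a :: real_or_complex) \<Rightarrow> (nat \<Rightarrow> nat \<Rightarrow> 'a) \<Rightarrow> nat \<Rightarrow> nat \<Rightarrow> 'a" where
  "spectral n f p q i j = (\<Sum>l<n. of_real (f l) * (p l i * conjugate (q l j)))"

text \<open>Reciprocal of 1 plus the squared Hilbert-Schmidt norm. It is at most 1 / (1 + s^2) for
  every singular value s, so 1 - shrink (1 + s^2) lies in [0,1) and the Neumann series converges for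
  every matrix.\<close>

definition shrink :: "nat \<Rightarrow> (nat \<Rightarrow> nat \<Rightarrow> 'a :: real_or_complex) \<Rightarrow> real" where
  "shrink n X = 1 / (1 + (\<Sum>i<n. nsq {..<n} (X i)))"

primrec neumann_power :: "nat \<Rightarrow> (nat \<Rightarrow> nat \<Rightarrow> 'a :: real_or_complex) \<Rightarrow> nat \<Rightarrow> nat \<Rightarrow> nat \<Rightarrow> 'a" where
  "neumann_power n X 0 = (\<lambda>i j. if i = j then 1 else 0)"
| "neumann_power n X (Suc m) = mat_prod n (\<lambda>i j. (if i = j then of_real (1 - shrink n X) else 0)
      - of_real (shrink n X) * mat_prod n X (adj X) i j) (neumann_power n X m)"

text \<open>The resolvent \<open>(1 + X X\<^sup>*)\<^sup>-\<^sup>1\<close>; writing it as a Neumann series makes its measurability obvious.\<close>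

definition resolvent :: "nat \<Rightarrow> (nat \<Rightarrow> nat \<Rightarrow> 'a :: real_or_complex) \<Rightarrow> nat \<Rightarrow> nat \<Rightarrow> 'a" where
  "resolvent n X i j = (\<Sum>m. of_real (shrink n X) * neumann_power n X m i j)"

primrec resolvent_power :: "nat \<Rightarrow> (nat \<Rightarrow> nat \<Rightarrow> 'a :: real_or_complex) \<Rightarrow> nat \<Rightarrow> nat \<Rightarrow> nat \<Rightarrow> 'a" where
  "resolvent_power n X 0 = (\<lambda>i j. if i = j then 1 else 0)"
| "resolvent_power n X (Suc m) = mat_prod n (resolvent n X) (resolvent_power n X m)"

lemma mat_prod_cong:
  "(\<And>k. k < n \<Longrightarrow> A i k = A' i k) \<Longrightarrow> (\<And>k. k < n \<Longrightarrow> B k j = B' k j) \<Longrightarrow> mat_prod n A B i j = mat_prod n A' B' i j"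
  by (simp add: mat_prod_def)

lemma spectral_mat_prod:
  assumes q: "orthonormal_basis {..<n} {..<n} q"
  shows "mat_prod n (spectral n f p q) (spectral n g q t) i j = spectral n (\<lambda>l. f l * g l) p t i j"
proof -
  interpret q: orthonormal_basis "{..<n}" "{..<n}" q by (rule q)
  have "mat_prod n (spectral n f p q) (spectral n g q t) i j
      = (\<Sum>l<n. \<Sum>m<n. of_real (f l) * of_real (g m) * (p l i * conjugate (t m j)) * ip {..<n} (q m) (q l))"
  proof -
    have "mat_prod n (spectral n f p q) (spectral n g q t) i j
      = (\<Sum>k<n. \<Sum>l<n. \<Sum>m<n. of_real (f l) * of_real (g m) * (p l i * conjugate (t m j)) * (q m k * conjugate (q l k)))"
      unfolding mat_prod_def spectral_def sum_product by (intro sum.cong refl) (simp add: mult_ac)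
    also have "\<dots> = (\<Sum>l<n. \<Sum>k<n. \<Sum>m<n. of_real (f l) * of_real (g m) * (p l i * conjugate (t m j)) * (q m k * conjugate (q l k)))"
      by (rule sum.swap)
    also have "\<dots> = (\<Sum>l<n. \<Sum>m<n. \<Sum>k<n. of_real (f l) * of_real (g m) * (p l i * conjugate (t m j)) * (q m k * conjugate (q l k)))"
      by (intro sum.cong refl sum.swap)
    finally show ?thesis unfolding ip_def sum_distrib_left .
  qed
  also have "\<dots> = (\<Sum>l<n. \<Sum>m<n. if m = l then of_real (f l) * of_real (g m) * (p l i * conjugate (t m j)) else 0)"
    by (intro sum.cong refl) (auto simp: q.orthonormal)
  also have "\<dots> = spectral n (\<lambda>l. f l * g l) p t i j"
    unfolding spectral_def by (intro sum.cong refl) (simp add: sum.delta)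
  finally show ?thesis .
qed

lemma spectral_one:
  assumes p: "orthonormal_basis {..<n} {..<n} p" and "i < n" "j < n"
  shows "spectral n (\<lambda>_. 1) p p i j = (if i = j then 1 else 0)"
proof -
  interpret p: orthonormal_basis "{..<n}" "{..<n}" p by (rule p)
  show ?thesis unfolding spectral_def using p.complete[of i j] assms by simp
qed

lemma spectral_linear:
  "a * spectral n f p q i j + b * spectral n g p q i j = (\<Sum>l<n. (a * of_real (f l) + b * of_real (g l)) * (p l i * conjugate (q l j)))"
  unfolding spectral_def sum_distrib_left sum.distrib[symmetric] by (simp add: algebra_simps)

text \<open>Unitary invariance of the Hilbert-Schmidt norm: the squared norm of a row is a diagonal
  entry of the product with the adjoint, and the trace is taken in the basis
  \<open>p\<close>.\<close>

lemma frobenius_spectral: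
  assumes p: "orthonormal_basis {..<n} {..<n} p" and q: "orthonormal_basis {..<n} {..<n} q"
  shows "(\<Sum>i<n. nsq {..<n} (spectral n f p q i)) = (\<Sum>l<n. (f l)\<^sup>2)"
proof -
  interpret p: orthonormal_basis "{..<n}" "{..<n}" p by (rule p)
  have row: "of_real (nsq {..<n} (spectral n f p q i)) = (spectral n (\<lambda>l. f l * f l) p p i i :: 'a)" if "i < n" for i
  proof -
    have "of_real (nsq {..<n} (spectral n f p q i)) = mat_prod n (spectral n f p q) (spectral n f q p) i i"
      unfolding ip_self[symmetric] ip_def mat_prod_def
      by (intro sum.cong refl arg_cong2[where f = "(*)"])
        (simp add: spectral_def sum_conjugate conjugate_dist_mul mult_ac)
    then show ?thesis by (simp only: spectral_mat_prod[OF q])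
  qed
  have "of_real (\<Sum>i<n. nsq {..<n} (spectral n f p q i)) = (\<Sum>i<n. spectral n (\<lambda>l. f l * f l) p p i i :: 'a)"
    unfolding of_real_sum by (intro sum.cong refl row) simp
  also have "\<dots> = (\<Sum>l<n. of_real (f l * f l) * ip {..<n} (p l) (p l))"
    unfolding spectral_def ip_def sum_distrib_left by (rule sum.swap)
  also have "\<dots> = of_real (\<Sum>l<n. (f l)\<^sup>2)"
    by (simp add: p.orthonormal power2_eq_square)
  finally show ?thesis unfolding of_real_eq_iff .
qed

lemma svd_spectral:
  assumes svd: "is_svd n X s p q" and ij: "i < n" "j < n"
  shows "X i j = spectral n s p q i j"
proof -
  interpret q: orthonormal_basis "{..<n}" "{..<n}" q using svd by (simp add: is_svd_def)
  have "spectral n s p q i j = (\<Sum>l<n. mv {..<n} X (q l) i * conjugate (q l j))"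
    unfolding spectral_def using svd ij by (intro sum.cong refl) (simp add: is_svd_def mult.assoc)
  also have "\<dots> = (\<Sum>k<n. X i k * (\<Sum>l<n. q l k * conjugate (q l j)))"
    unfolding mv_def sum_distrib_right sum_distrib_left by (subst sum.swap) (simp add: mult.assoc)
  also have "\<dots> = (\<Sum>k<n. if k = j then X i k else 0)"
    using ij by (intro sum.cong refl) (simp add: q.complete)
  also have "\<dots> = X i j" using ij by (simp add: sum.delta)
  finally show ?thesis by simp
qed

lemma is_svd_adj: "is_svd n X s p q \<Longrightarrow> is_svd n (adj X) s q p"
  by (simp add: is_svd_def)

text \<open>On each singular direction the Neumann series is geometric with ratio y = 1 - x0 (1 +
  s^2).\<close>

lemma resolvent_spectral:
  assumes svd: "is_svd n X s p q" and ij: "i < n" "j < n"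
  shows "resolvent n X i j = spectral n (\<lambda>l. 1 / (1 + (s l)\<^sup>2)) p p i j"
proof -
  have p: "orthonormal_basis {..<n} {..<n} p" and q: "orthonormal_basis {..<n} {..<n} q"
    using svd by (auto simp: is_svd_def)
  define x0 where "x0 = shrink n X"
  define y where "y l = 1 - x0 * (1 + (s l)\<^sup>2)" for l
  have frob: "(\<Sum>i<n. nsq {..<n} (X i)) = (\<Sum>l<n. (s l)\<^sup>2)"
  proof -
    have "(\<Sum>i<n. nsq {..<n} (X i)) = (\<Sum>i<n. nsq {..<n} (spectral n s p q i))"
      by (intro sum.cong refl nsq_cong) (simp add: svd_spectral[OF svd])
    then show ?thesis by (simp add: frobenius_spectral[OF p q])
  qed
  have x0: "x0 = 1 / (1 + (\<Sum>l<n. (s l)\<^sup>2))" by (simp add: x0_def shrink_def frob)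
  have S0: "0 \<le> (\<Sum>l<n. (s l)\<^sup>2)" by (simp add: sum_nonneg)
  have x0pos: "0 < x0" unfolding x0 using S0 by (simp add: add_pos_nonneg)
  have y: "0 \<le> y l" "y l < 1" if "l < n" for l
  proof -
    have "(s l)\<^sup>2 \<le> (\<Sum>l<n. (s l)\<^sup>2)" by (rule member_le_sum) (use that in auto)
    then have "x0 * (1 + (s l)\<^sup>2) \<le> 1" unfolding x0 using S0 by (simp add: divide_le_eq add_pos_nonneg)
    then show "0 \<le> y l" by (simp add: y_def)
    have "0 < x0 * (1 + (s l)\<^sup>2)" by (intro mult_pos_pos x0pos add_pos_nonneg) auto
    then show "y l < 1" by (simp add: y_def)
  qed
  have gram: "mat_prod n X (adj X) i j = spectral n (\<lambda>l. s l * s l) p p i j" if "i < n" "j < n" for i j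
  proof -
    have "mat_prod n X (adj X) i j = mat_prod n (spectral n s p q) (spectral n s q p) i j"
      by (rule mat_prod_cong) (use svd_spectral[OF svd] svd_spectral[OF is_svd_adj[OF svd]] that in auto)
    then show ?thesis by (simp add: spectral_mat_prod[OF q])
  qed
  have step: "(if i = j then of_real (1 - x0) else 0) - of_real x0 * mat_prod n X (adj X) i j = spectral n y p p i j"
    if "i < n" "j < n" for i j
  proof -
    have "(if i = j then of_real (1 - x0) else 0) - of_real x0 * mat_prod n X (adj X) i j
      = of_real (1 - x0) * spectral n (\<lambda>_. 1) p p i j + (- of_real x0) * spectral n (\<lambda>l. s l * s l) p p i j"
      using that by (simp add: gram spectral_one[OF p])
    also have "\<dots> = spectral n y p p i j"
      unfolding spectral_linear unfolding spectral_def
      by (intro sum.cong refl arg_cong2[where f = "(*)"]) (simp add: y_def power2_eq_square algebra_simps)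
    finally show ?thesis .
  qed
  have np: "neumann_power n X m i j = spectral n (\<lambda>l. y l ^ m) p p i j" if "i < n" "j < n" for m i j
    using that
  proof (induction m arbitrary: i j)
    case 0
    then show ?case by (simp add: spectral_one[OF p])
  next
    case (Suc m)
    have "neumann_power n X (Suc m) i j = mat_prod n (spectral n y p p) (spectral n (\<lambda>l. y l ^ m) p p) i j"
      unfolding neumann_power.simps x0_def[symmetric] by (rule mat_prod_cong) (use step Suc in auto)
    then show ?case by (simp add: spectral_mat_prod[OF p])
  qed
  have "(\<lambda>m. of_real x0 * neumann_power n X m i j) sums (\<Sum>l<n. of_real (x0 * (1 / (1 - y l))) * (p l i * conjugate (p l j)))"
  proof -
    have "(\<lambda>m. \<Sum>l<n. of_real (x0 * y l ^ m) * (p l i * conjugate (p l j)))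
        sums (\<Sum>l<n. of_real (x0 * (1 / (1 - y l))) * (p l i * conjugate (p l j)))"
      by (intro sums_sum sums_mult2 sums_of_real sums_mult geometric_sums) (use y in auto)
    moreover have "(\<Sum>l<n. of_real (x0 * y l ^ m) * (p l i * conjugate (p l j))) = of_real x0 * neumann_power n X m i j" for m
      unfolding np[OF ij] spectral_def sum_distrib_left by (simp add: mult.assoc)
    ultimately show ?thesis by simp
  qed
  then have "resolvent n X i j = (\<Sum>l<n. of_real (x0 * (1 / (1 - y l))) * (p l i * conjugate (p l j)))"
    unfolding resolvent_def x0_def[symmetric] by (rule sums_unique[symmetric])
  also have "\<dots> = spectral n (\<lambda>l. 1 / (1 + (s l)\<^sup>2)) p p i j"
    unfolding spectral_def
  proof (intro sum.cong refl arg_cong2[where f = "(*)"] arg_cong[where f = of_real])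
    fix l
    show "x0 * (1 / (1 - y l)) = 1 / (1 + (s l)\<^sup>2)" using x0pos by (simp add: y_def)
  qed
  finally show ?thesis .
qed

lemma resolvent_power_spectral:
  assumes svd: "is_svd n X s p q" and ij: "i < n" "j < n"
  shows "resolvent_power n X m i j = spectral n (\<lambda>l. (1 / (1 + (s l)\<^sup>2)) ^ m) p p i j"
  using ij
proof (induction m arbitrary: i j)
  case 0
  then show ?case using svd by (simp add: spectral_one is_svd_def)
next
  case (Suc m)
  have p: "orthonormal_basis {..<n} {..<n} p" using svd by (simp add: is_svd_def)
  have "resolvent_power n X (Suc m) i j = mat_prod n (spectral n (\<lambda>l. 1 / (1 + (s l)\<^sup>2)) p p) (spectral n (\<lambda>l. (1 / (1 + (s l)\<^sup>2)) ^ m) p p) i j"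
    unfolding resolvent_power.simps by (rule mat_prod_cong) (use resolvent_spectral[OF svd] Suc in auto)
  then show ?case unfolding spectral_mat_prod[OF p] by simp
qed

lemma resolvent_power_mult_spectral:
  assumes svd: "is_svd n X s p q" and ij: "i < n" "j < n"
  shows "mat_prod n (resolvent_power n X m) X i j = spectral n (\<lambda>l. (1 / (1 + (s l)\<^sup>2)) ^ m * s l) p q i j"
proof -
  have p: "orthonormal_basis {..<n} {..<n} p" using svd by (simp add: is_svd_def)
  have "mat_prod n (resolvent_power n X m) X i j = mat_prod n (spectral n (\<lambda>l. (1 / (1 + (s l)\<^sup>2)) ^ m) p p) (spectral n s p q) i j"
    by (rule mat_prod_cong) (use resolvent_power_spectral[OF svd] svd_spectral[OF svd] ij in auto)
  then show ?thesis unfolding spectral_mat_prod[OF p] .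
qed

text \<open>Bridge between two descriptions: on the left the coefficients are matrix entries, which
  depend measurably on the matrix; on the right stand the singular coordinates of the
  vectors.\<close>

lemma spectral_form:
  "(\<Sum>i<n. \<Sum>j<n. conjugate (spectral n f p q i j) * (u i * conjugate (v j)))
    = (\<Sum>l<n. of_real (f l) * (ip {..<n} u (p l) * conjugate (ip {..<n} v (q l))))"
proof -
  have "(\<Sum>i<n. \<Sum>j<n. conjugate (spectral n f p q i j) * (u i * conjugate (v j)))
    = (\<Sum>i<n. \<Sum>j<n. \<Sum>l<n. of_real (f l) * ((u i * conjugate (p l i)) * (conjugate (v j) * q l j)))"
    unfolding spectral_def by (intro sum.cong refl) (simp add: sum_conjugate conjugate_dist_mul sum_distrib_left sum_distrib_right mult_ac)
  also have "\<dots> = (\<Sum>i<n. \<Sum>l<n. \<Sum>j<n. of_real (f l) * ((u i * conjugate (p l i)) * (conjugate (v j) * q l j)))"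
    by (intro sum.cong refl sum.swap)
  also have "\<dots> = (\<Sum>l<n. \<Sum>i<n. \<Sum>j<n. of_real (f l) * ((u i * conjugate (p l i)) * (conjugate (v j) * q l j)))"
    by (rule sum.swap)
  also have "\<dots> = (\<Sum>l<n. of_real (f l) * (ip {..<n} u (p l) * conjugate (ip {..<n} v (q l))))"
    by (intro sum.cong refl)
      (simp only: ip_def sum_conjugate[OF finite_lessThan] conjugate_dist_mul conjugate_id sum_distrib_left[symmetric] sum_distrib_right[symmetric])
  finally show ?thesis .
qed

lemma spectral_trace:
  assumes p: "orthonormal_basis {..<n} {..<n} p"
  shows "(\<Sum>i<n. conjugate (spectral n f p p i i)) = of_real (\<Sum>l<n. f l)"
proof -
  interpret p: orthonormal_basis "{..<n}" "{..<n}" p by (rule p)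
  have "(\<Sum>i<n. conjugate (spectral n f p p i i)) = (\<Sum>i<n. \<Sum>l<n. of_real (f l) * (p l i * conjugate (p l i)))"
    unfolding spectral_def by (intro sum.cong refl) (simp add: sum_conjugate conjugate_dist_mul mult.commute)
  also have "\<dots> = (\<Sum>l<n. of_real (f l) * ip {..<n} (p l) (p l))"
    unfolding ip_def sum_distrib_left by (rule sum.swap)
  also have "\<dots> = of_real (\<Sum>l<n. f l)" by (simp add: p.orthonormal)
  finally show ?thesis .
qed

lemma frobenius_conjugate: "nsq K (\<lambda>j. conjugate (x j)) = nsq K x"
  by (simp add: nsq_def)

section \<open>Measurability\<close>

lemma measurable_conjugate: "f \<in> borel_measurable M \<Longrightarrow> (\<lambda>x. conjugate (f x)) \<in> borel_measurable M"
  for f :: "'w \<Rightarrow> 'a :: real_or_complex"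
  by (rule measurable_compose[OF _ borel_measurable_continuous_onI]) (auto intro: linear_continuous_on bounded_linear_conjugate)

lemma measurable_mat_prod:
  fixes A B :: "'w \<Rightarrow> nat \<Rightarrow> nat \<Rightarrow> 'a :: real_or_complex"
  assumes "\<And>i k. i < n \<Longrightarrow> k < n \<Longrightarrow> (\<lambda>\<omega>. A \<omega> i k) \<in> borel_measurable M"
    "\<And>k j. k < n \<Longrightarrow> j < n \<Longrightarrow> (\<lambda>\<omega>. B \<omega> k j) \<in> borel_measurable M" "i < n" "j < n"
  shows "(\<lambda>\<omega>. mat_prod n (A \<omega>) (B \<omega>) i j) \<in> borel_measurable M"
  unfolding mat_prod_def using assms by (intro borel_measurable_sum borel_measurable_times) auto

context
  fixes X :: "'w \<Rightarrow> nat \<Rightarrow> nat \<Rightarrow> 'a :: real_or_complex" and M :: "'w measure" and n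
  assumes X: "\<And>i j. i < n \<Longrightarrow> j < n \<Longrightarrow> (\<lambda>\<omega>. X \<omega> i j) \<in> borel_measurable M"
begin

lemma measurable_shrink: "(\<lambda>\<omega>. shrink n (X \<omega>)) \<in> borel_measurable M"
  unfolding shrink_def nsq_def
  by (intro borel_measurable_divide borel_measurable_add borel_measurable_const borel_measurable_sum borel_measurable_power
      measurable_compose[OF X borel_measurable_norm]) auto

lemma measurable_neumann_power: "i < n \<Longrightarrow> j < n \<Longrightarrow> (\<lambda>\<omega>. neumann_power n (X \<omega>) m i j) \<in> borel_measurable M"
proof (induction m arbitrary: i j)
  case (Suc m)
  have o: "(\<lambda>\<omega>. of_real (f \<omega>) :: 'a) \<in> borel_measurable M" if "f \<in> borel_measurable M" for f
    using that by (rule measurable_compose[OF _ borel_measurable_continuous_onI]) (intro continuous_intros)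
  have gram: "(\<lambda>\<omega>. mat_prod n (X \<omega>) (adj (X \<omega>)) i k) \<in> borel_measurable M" if "i < n" "k < n" for i k
    by (rule measurable_mat_prod) (use that in \<open>auto simp: adj_def intro: X measurable_conjugate\<close>)
  have "(\<lambda>\<omega>. (if i = k then of_real (1 - shrink n (X \<omega>)) else 0) - of_real (shrink n (X \<omega>)) * mat_prod n (X \<omega>) (adj (X \<omega>)) i k) \<in> borel_measurable M"
    if "i < n" "k < n" for i k
    using that by (cases "i = k") (auto intro!: borel_measurable_diff borel_measurable_times o measurable_shrink gram borel_measurable_const)
  then show ?case
    unfolding neumann_power.simps using Suc by (intro measurable_mat_prod) auto
qed simp

lemma measurable_resolvent: "i < n \<Longrightarrow> j < n \<Longrightarrow> (\<lambda>\<omega>. resolvent n (X \<omega>) i j) \<in> borel_measurable M"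
proof -
  assume ij: "i < n" "j < n"
  have o: "(\<lambda>\<omega>. of_real (f \<omega>) :: 'a) \<in> borel_measurable M" if "f \<in> borel_measurable M" for f
    using that by (rule measurable_compose[OF _ borel_measurable_continuous_onI]) (intro continuous_intros)
  show ?thesis
    unfolding resolvent_def
    by (intro borel_measurable_suminf borel_measurable_times o measurable_shrink measurable_neumann_power ij)
qed

lemma measurable_resolvent_power: "i < n \<Longrightarrow> j < n \<Longrightarrow> (\<lambda>\<omega>. resolvent_power n (X \<omega>) m i j) \<in> borel_measurable M"
proof (induction m arbitrary: i j)
  case (Suc m)
  then show ?case unfolding resolvent_power.simps by (intro measurable_mat_prod measurable_resolvent) auto
qed simp

end

section \<open>Almost sure convergence of the quadratic forms\<close>

text \<open>\<open>s\<close>, \<open>p\<close> and \<open>q\<close> are arbitrary choices at each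
  outcome; measurability is required of the entries of \<open>X\<close> alone. The odd weight
  carries at least one resolvent factor because t / (1 + t^2) is bounded while t is not.\<close>

lemma (in iid_coordinates) resolvent_forms_AE:
  fixes g :: "nat \<Rightarrow> bool \<times> nat \<times> nat \<Rightarrow> 'w \<Rightarrow> 'a" and X :: "nat \<Rightarrow> 'w \<Rightarrow> nat \<Rightarrow> nat \<Rightarrow> 'a"
  assumes M: "prob_space M"
    and g: "\<And>n. prob_space.indep_vars M (\<lambda>_. borel) (g n) (UNIV \<times> {..<n} \<times> {..<r})"
      "\<And>n i. i \<in> UNIV \<times> {..<n} \<times> {..<r} \<Longrightarrow> distr M borel (g n i) = \<nu>"
    and N: "space N = space M" "sets N \<subseteq> sets M"
    and indep: "\<And>n. prob_space.indep_set M (sigma_sets (space M) {g n i -` A \<inter> space M | i A. i \<in> UNIV \<times> {..<n} \<times> {..<r} \<and> A \<in> sets borel}) (sets N)"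
    and X: "\<And>n i j. i < n \<Longrightarrow> j < n \<Longrightarrow> (\<lambda>\<omega>. X n \<omega> i j) \<in> borel_measurable N"
    and svd: "\<And>n \<omega>. \<omega> \<in> space M \<Longrightarrow> is_svd n (X n \<omega>) (s n \<omega>) (p n \<omega>) (q n \<omega>)"
    and weak: "AE \<omega> in M. \<forall>m. (\<lambda>n. (\<Sum>c<n. (1 / (1 + (s n \<omega> c)\<^sup>2)) ^ m) / real n) \<longlonglongrightarrow> I m"
  shows "AE \<omega> in M. \<forall>m. \<forall>k<r. \<forall>l<r.
     (\<lambda>n. (\<Sum>c<n. of_real ((1 / (1 + (s n \<omega> c)\<^sup>2)) ^ m) * (ip {..<n} (\<lambda>i. g n (True, i, k) \<omega>) (p n \<omega> c)
         * conjugate (ip {..<n} (\<lambda>i. g n (True, i, l) \<omega>) (p n \<omega> c)))) / of_nat n) \<longlonglongrightarrow> of_real (if k = l then I m else 0) \<and>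
     (\<lambda>n. (\<Sum>c<n. of_real ((1 / (1 + (s n \<omega> c)\<^sup>2)) ^ m) * (ip {..<n} (\<lambda>i. g n (False, i, k) \<omega>) (q n \<omega> c)
         * conjugate (ip {..<n} (\<lambda>i. g n (False, i, l) \<omega>) (q n \<omega> c)))) / of_nat n) \<longlonglongrightarrow> of_real (if k = l then I m else 0) \<and>
     (\<lambda>n. (\<Sum>c<n. of_real ((1 / (1 + (s n \<omega> c)\<^sup>2)) ^ Suc m * s n \<omega> c) * (ip {..<n} (\<lambda>i. g n (True, i, k) \<omega>) (p n \<omega> c)
         * conjugate (ip {..<n} (\<lambda>i. g n (False, i, l) \<omega>) (q n \<omega> c)))) / of_nat n) \<longlonglongrightarrow> 0"
proof -
  have x1: "0 \<le> 1 / (1 + t\<^sup>2)" "1 / (1 + t\<^sup>2) \<le> 1" "\<bar>1 / (1 + t\<^sup>2) * t\<bar> \<le> 1" for t :: real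
  proof -
    have pos: "0 < 1 + t\<^sup>2" by (simp add: add_pos_nonneg)
    then show "0 \<le> 1 / (1 + t\<^sup>2)" "1 / (1 + t\<^sup>2) \<le> 1" by (simp_all add: divide_le_eq)
    have "(\<bar>t\<bar> - 1)\<^sup>2 = 1 + t\<^sup>2 - 2 * \<bar>t\<bar>" by (simp add: power2_eq_square algebra_simps)
    then have "\<bar>t\<bar> \<le> 1 + t\<^sup>2" using zero_le_power2[of "\<bar>t\<bar> - 1"] by linarith
    then show "\<bar>1 / (1 + t\<^sup>2) * t\<bar> \<le> 1" using pos by (simp add: abs_mult divide_le_eq)
  qed
  have sq1: "(\<Sum>c<n. (f c)\<^sup>2) \<le> 1 * real n" if "\<And>c. \<bar>f c\<bar> \<le> 1" for n and f :: "nat \<Rightarrow> real"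
  proof -
    have "(\<Sum>c<n. (f c)\<^sup>2) \<le> (\<Sum>c<n. 1)" by (intro sum_mono) (use that in \<open>simp add: abs_square_le_1\<close>)
    then show ?thesis by simp
  qed
  have trace: "(\<lambda>n. Z n / of_nat n) \<longlonglongrightarrow> of_real (if c then J else 0)"
    if "(\<lambda>n. (Z n - (if c then of_real (T n) else 0)) / of_nat n) \<longlonglongrightarrow> 0" "(\<lambda>n. T n / real n) \<longlonglongrightarrow> J"
    for Z :: "nat \<Rightarrow> 'a" and T J c
  proof (cases c)
    case True
    have "(\<lambda>n. (Z n - of_real (T n)) / of_nat n + of_real (T n / real n)) \<longlonglongrightarrow> 0 + of_real J"
      by (intro tendsto_add tendsto_of_real that(2)) (use that(1) True in simp)
    then show ?thesis using True by (simp add: diff_divide_distrib)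
  qed (use that(1) in simp)
  have F: "(\<Sum>i<n. nsq {..<n} (\<lambda>j. conjugate (A i j))) \<le> 1 * real n"
    if "\<And>i j. i < n \<Longrightarrow> j < n \<Longrightarrow> A i j = spectral n f p q i j" "orthonormal_basis {..<n} {..<n} p" "orthonormal_basis {..<n} {..<n} q"
      "\<And>c. \<bar>f c\<bar> \<le> 1" for n A f and p q :: "nat \<Rightarrow> nat \<Rightarrow> 'a"
  proof -
    have "(\<Sum>i<n. nsq {..<n} (\<lambda>j. conjugate (A i j))) = (\<Sum>i<n. nsq {..<n} (spectral n f p q i))"
      unfolding frobenius_conjugate by (intro sum.cong refl nsq_cong) (simp add: that)
    also have "\<dots> \<le> 1 * real n" unfolding frobenius_spectral[OF that(2,3)] by (rule sq1[OF that(4)])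
    finally show ?thesis .
  qed
  have p: "orthonormal_basis {..<n} {..<n} (p n \<omega>)" "orthonormal_basis {..<n} {..<n} (q n \<omega>)" if "\<omega> \<in> space M" for n \<omega>
    using svd[OF that, of n] by (auto simp: is_svd_def)
  have Xadj: "(\<lambda>\<omega>. adj (X n \<omega>) i j) \<in> borel_measurable N" if "i < n" "j < n" for n i j
    unfolding adj_def using that by (intro measurable_conjugate X)
  have Q: "AE \<omega> in M. \<forall>C. (\<forall>\<^sub>F n in sequentially. (\<Sum>i<n. nsq {..<n} (B n \<omega> i)) \<le> C * real n) \<longrightarrow>
    (\<lambda>n. ((\<Sum>i<n. \<Sum>j<n. B n \<omega> i j * (g n (b, i, k) \<omega> * conjugate (g n (b', j, l) \<omega>)))
           - (if b = b' \<and> k = l then \<Sum>i<n. B n \<omega> i i else 0)) / of_nat n) \<longlonglongrightarrow> 0"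
    if "\<forall>n i j. i < n \<longrightarrow> j < n \<longrightarrow> (\<lambda>\<omega>. B n \<omega> i j) \<in> borel_measurable N" "k < r" "l < r" for B :: "nat \<Rightarrow> 'w \<Rightarrow> nat \<Rightarrow> nat \<Rightarrow> 'a" and k l b b'
    by (rule quadratic_form_AE[OF M g(1) g(2) N indep]) (use that in simp_all)
  have pow1: "\<bar>(1 / (1 + t\<^sup>2)) ^ m\<bar> \<le> 1" for t :: real and m
    using x1(1,2)[of t] by (simp add: power_le_one)
  have pow2: "\<bar>(1 / (1 + t\<^sup>2)) ^ Suc m * t\<bar> \<le> 1" for t :: real and m
  proof -
    have "\<bar>(1 / (1 + t\<^sup>2)) ^ Suc m * t\<bar> = \<bar>(1 / (1 + t\<^sup>2)) ^ m\<bar> * \<bar>1 / (1 + t\<^sup>2) * t\<bar>"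
      unfolding abs_mult[symmetric] by (simp add: mult_ac)
    also have "\<dots> \<le> 1" by (rule mult_le_one[OF pow1 abs_ge_zero x1(3)])
    finally show ?thesis .
  qed
  have A1: "AE \<omega> in M. (\<lambda>n. (\<Sum>c<n. of_real ((1 / (1 + (s n \<omega> c)\<^sup>2)) ^ m) * (ip {..<n} (\<lambda>i. g n (True, i, k) \<omega>) (p n \<omega> c)
         * conjugate (ip {..<n} (\<lambda>i. g n (True, i, l) \<omega>) (p n \<omega> c)))) / of_nat n) \<longlonglongrightarrow> of_real (if k = l then I m else 0)"
    if kl: "k < r" "l < r" for m k l
  proof -
    have B: "\<forall>n i j. i < n \<longrightarrow> j < n \<longrightarrow> (\<lambda>\<omega>. conjugate (resolvent_power n (X n \<omega>) m i j)) \<in> borel_measurable N"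
      by (intro allI impI measurable_conjugate measurable_resolvent_power X)
    from Q[OF B kl, of True True] weak AE_space
    show ?thesis
    proof eventually_elim
      case (elim \<omega>)
      note R = resolvent_power_spectral[OF svd[OF elim(3)], of _ _ _ m]
      have "(\<Sum>i<n. nsq {..<n} (\<lambda>j. conjugate (resolvent_power n (X n \<omega>) m i j))) \<le> 1 * real n" for n
        by (rule F[OF R p(1)[OF elim(3)] p(1)[OF elim(3)] pow1])
      with elim(1)[rule_format, of 1]
      have lim: "(\<lambda>n. ((\<Sum>i<n. \<Sum>j<n. conjugate (resolvent_power n (X n \<omega>) m i j) * (g n (True, i, k) \<omega> * conjugate (g n (True, j, l) \<omega>)))
           - (if True = True \<and> k = l then \<Sum>i<n. conjugate (resolvent_power n (X n \<omega>) m i i) else 0)) / of_nat n) \<longlonglongrightarrow> 0" by simp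
      have 1: "(\<Sum>i<n. \<Sum>j<n. conjugate (resolvent_power n (X n \<omega>) m i j) * (g n (True, i, k) \<omega> * conjugate (g n (True, j, l) \<omega>)))
        = (\<Sum>c<n. of_real ((1 / (1 + (s n \<omega> c)\<^sup>2)) ^ m) * (ip {..<n} (\<lambda>i. g n (True, i, k) \<omega>) (p n \<omega> c)
         * conjugate (ip {..<n} (\<lambda>i. g n (True, i, l) \<omega>) (p n \<omega> c))))" for n
        unfolding spectral_form[symmetric] by (intro sum.cong refl) (simp add: R)
      have 2: "(\<Sum>i<n. conjugate (resolvent_power n (X n \<omega>) m i i)) = of_real (\<Sum>c<n. (1 / (1 + (s n \<omega> c)\<^sup>2)) ^ m)" for n
        unfolding spectral_trace[OF p(1)[OF elim(3)], symmetric] by (intro sum.cong refl) (simp add: R)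
      show ?case
        by (rule trace[OF lim[unfolded 1 2 simp_thms]]) (use elim(2) in blast)
    qed
  qed
  have A2: "AE \<omega> in M. (\<lambda>n. (\<Sum>c<n. of_real ((1 / (1 + (s n \<omega> c)\<^sup>2)) ^ m) * (ip {..<n} (\<lambda>i. g n (False, i, k) \<omega>) (q n \<omega> c)
         * conjugate (ip {..<n} (\<lambda>i. g n (False, i, l) \<omega>) (q n \<omega> c)))) / of_nat n) \<longlonglongrightarrow> of_real (if k = l then I m else 0)"
    if kl: "k < r" "l < r" for m k l
  proof -
    \<comment> \<open>On the side of \<open>v\<close> the resolvent of the adjoint is used; its
      eigenvectors are the right singular vectors.\<close>
    have B: "\<forall>n i j. i < n \<longrightarrow> j < n \<longrightarrow> (\<lambda>\<omega>. conjugate (resolvent_power n (adj (X n \<omega>)) m i j)) \<in> borel_measurable N"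
      by (intro allI impI measurable_conjugate measurable_resolvent_power Xadj)
    from Q[OF B kl, of False False] weak AE_space
    show ?thesis
    proof eventually_elim
      case (elim \<omega>)
      note R = resolvent_power_spectral[OF is_svd_adj[OF svd[OF elim(3)]], of _ _ _ m]
      have "(\<Sum>i<n. nsq {..<n} (\<lambda>j. conjugate (resolvent_power n (adj (X n \<omega>)) m i j))) \<le> 1 * real n" for n
        by (rule F[OF R p(2)[OF elim(3)] p(2)[OF elim(3)] pow1])
      with elim(1)[rule_format, of 1]
      have lim: "(\<lambda>n. ((\<Sum>i<n. \<Sum>j<n. conjugate (resolvent_power n (adj (X n \<omega>)) m i j) * (g n (False, i, k) \<omega> * conjugate (g n (False, j, l) \<omega>)))
           - (if False = False \<and> k = l then \<Sum>i<n. conjugate (resolvent_power n (adj (X n \<omega>)) m i i) else 0)) / of_nat n) \<longlonglongrightarrow> 0" by simp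
      have 1: "(\<Sum>i<n. \<Sum>j<n. conjugate (resolvent_power n (adj (X n \<omega>)) m i j) * (g n (False, i, k) \<omega> * conjugate (g n (False, j, l) \<omega>)))
        = (\<Sum>c<n. of_real ((1 / (1 + (s n \<omega> c)\<^sup>2)) ^ m) * (ip {..<n} (\<lambda>i. g n (False, i, k) \<omega>) (q n \<omega> c)
         * conjugate (ip {..<n} (\<lambda>i. g n (False, i, l) \<omega>) (q n \<omega> c))))" for n
        unfolding spectral_form[symmetric] by (intro sum.cong refl) (simp add: R)
      have 2: "(\<Sum>i<n. conjugate (resolvent_power n (adj (X n \<omega>)) m i i)) = of_real (\<Sum>c<n. (1 / (1 + (s n \<omega> c)\<^sup>2)) ^ m)" for n
        unfolding spectral_trace[OF p(2)[OF elim(3)], symmetric] by (intro sum.cong refl) (simp add: R)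
      show ?case
        by (rule trace[OF lim[unfolded 1 2 simp_thms]]) (use elim(2) in blast)
    qed
  qed
  have A3: "AE \<omega> in M. (\<lambda>n. (\<Sum>c<n. of_real ((1 / (1 + (s n \<omega> c)\<^sup>2)) ^ Suc m * s n \<omega> c) * (ip {..<n} (\<lambda>i. g n (True, i, k) \<omega>) (p n \<omega> c)
         * conjugate (ip {..<n} (\<lambda>i. g n (False, i, l) \<omega>) (q n \<omega> c)))) / of_nat n) \<longlonglongrightarrow> 0"
    if kl: "k < r" "l < r" for m k l
  proof -
    have B: "\<forall>n i j. i < n \<longrightarrow> j < n \<longrightarrow> (\<lambda>\<omega>. conjugate (mat_prod n (resolvent_power n (X n \<omega>) (Suc m)) (X n \<omega>) i j)) \<in> borel_measurable N"
      by (intro allI impI measurable_conjugate measurable_mat_prod measurable_resolvent_power X)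
    \<comment> \<open>The two columns lie on different sides, so no trace is subtracted and the
      limit is 0.\<close>
    from Q[OF B kl, of True False] AE_space
    show ?thesis
    proof eventually_elim
      case (elim \<omega>)
      note R = resolvent_power_mult_spectral[OF svd[OF elim(2)], of _ _ _ "Suc m"]
      have "(\<Sum>i<n. nsq {..<n} (\<lambda>j. conjugate (mat_prod n (resolvent_power n (X n \<omega>) (Suc m)) (X n \<omega>) i j))) \<le> 1 * real n" for n
        by (rule F[OF R p(1)[OF elim(2)] p(2)[OF elim(2)] pow2])
      with elim(1)[rule_format, of 1]
      have lim: "(\<lambda>n. (\<Sum>i<n. \<Sum>j<n. conjugate (mat_prod n (resolvent_power n (X n \<omega>) (Suc m)) (X n \<omega>) i j) * (g n (True, i, k) \<omega> * conjugate (g n (False, j, l) \<omega>)))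
           / of_nat n) \<longlonglongrightarrow> 0" by (simp del: resolvent_power.simps)
      have 1: "(\<Sum>i<n. \<Sum>j<n. conjugate (mat_prod n (resolvent_power n (X n \<omega>) (Suc m)) (X n \<omega>) i j) * (g n (True, i, k) \<omega> * conjugate (g n (False, j, l) \<omega>)))
        = (\<Sum>c<n. of_real ((1 / (1 + (s n \<omega> c)\<^sup>2)) ^ Suc m * s n \<omega> c) * (ip {..<n} (\<lambda>i. g n (True, i, k) \<omega>) (p n \<omega> c)
         * conjugate (ip {..<n} (\<lambda>i. g n (False, i, l) \<omega>) (q n \<omega> c))))" for n
        unfolding spectral_form[symmetric] by (intro sum.cong refl) (simp add: R del: resolvent_power.simps)
      show ?case using lim unfolding 1 .
    qed
  qed
  \<comment> \<open>Exponents and column indices are countable, so the exceptional null sets can be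
    united.\<close>
  have "AE \<omega> in M. \<forall>m. \<forall>k. k < r \<longrightarrow> (\<forall>l. l < r \<longrightarrow>
     (\<lambda>n. (\<Sum>c<n. of_real ((1 / (1 + (s n \<omega> c)\<^sup>2)) ^ m) * (ip {..<n} (\<lambda>i. g n (True, i, k) \<omega>) (p n \<omega> c)
         * conjugate (ip {..<n} (\<lambda>i. g n (True, i, l) \<omega>) (p n \<omega> c)))) / of_nat n) \<longlonglongrightarrow> of_real (if k = l then I m else 0) \<and>
     (\<lambda>n. (\<Sum>c<n. of_real ((1 / (1 + (s n \<omega> c)\<^sup>2)) ^ m) * (ip {..<n} (\<lambda>i. g n (False, i, k) \<omega>) (q n \<omega> c)
         * conjugate (ip {..<n} (\<lambda>i. g n (False, i, l) \<omega>) (q n \<omega> c)))) / of_nat n) \<longlonglongrightarrow> of_real (if k = l then I m else 0) \<and>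
     (\<lambda>n. (\<Sum>c<n. of_real ((1 / (1 + (s n \<omega> c)\<^sup>2)) ^ Suc m * s n \<omega> c) * (ip {..<n} (\<lambda>i. g n (True, i, k) \<omega>) (p n \<omega> c)
         * conjugate (ip {..<n} (\<lambda>i. g n (False, i, l) \<omega>) (q n \<omega> c)))) / of_nat n) \<longlonglongrightarrow> 0)"
    by (intro AE_all_countable[THEN iffD2] allI AE_impI AE_conjI A1 A2 A3)
  then show ?thesis by simp
qed

text \<open>Polynomials in \<open>x\<close> follow from the powers by linearity, and the Weierstrass
  remainder costs at most its sup norm times the two vector norms. The weight \<open>w\<close> and
  the factor \<open>d\<close> let one statement cover the even forms, with \<open>d\<close> a
  Kronecker symbol, and the odd ones, with d = 0.\<close>

lemma form_limit_weierstrass: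
  fixes \<alpha> \<beta> :: "nat \<Rightarrow> nat \<Rightarrow> 'a :: real_or_complex" and x w :: "nat \<Rightarrow> nat \<Rightarrow> real"
  assumes \<mu>: "prob_space \<mu>" "h \<in> borel_measurable \<mu>" "\<And>t. 0 \<le> h t" "\<And>t. h t \<le> 1"
    and x: "\<And>n c. 0 \<le> x n c" "\<And>n c. x n c \<le> 1" and w: "\<And>n c. \<bar>w n c\<bar> \<le> 1"
    and C: "\<forall>\<^sub>F n in sequentially. sqrt (nsq {..<n} (\<alpha> n)) * sqrt (nsq {..<n} (\<beta> n)) \<le> C" and d: "\<bar>d\<bar> \<le> 1"
    and lim: "\<And>m. (\<lambda>n. \<Sum>c<n. of_real (w n c * x n c ^ m) * (\<alpha> n c * conjugate (\<beta> n c)))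
         \<longlonglongrightarrow> of_real (d * (\<integral>t. h t ^ m \<partial>\<mu>))"
    and F: "continuous_on {0..1 :: real} F"
  shows "(\<lambda>n. \<Sum>c<n. of_real (w n c * F (x n c)) * (\<alpha> n c * conjugate (\<beta> n c))) \<longlonglongrightarrow> of_real (d * (\<integral>t. F (h t) \<partial>\<mu>))"
proof (rule tendstoI)
  fix e :: real assume e: "0 < e"
  interpret \<mu>: prob_space \<mu> by (rule \<mu>)
  \<comment> \<open>The remainder enters twice, as \<epsilon> |C| in the forms and as \<epsilon> in
    the integral; both must be at most e / 3.\<close>
  define \<epsilon> where "\<epsilon> = e / (3 * (1 + \<bar>C\<bar>))"
  have \<epsilon>: "0 < \<epsilon>" "\<epsilon> * \<bar>C\<bar> \<le> e / 3" "\<epsilon> \<le> e / 3"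
    using e by (simp_all add: \<epsilon>_def divide_le_eq field_simps)
  obtain G where G: "real_polynomial_function G" "\<And>y. y \<in> {0..1} \<Longrightarrow> \<bar>F y - G y\<bar> < \<epsilon>"
    using Stone_Weierstrass_real_polynomial_function[OF compact_Icc F \<epsilon>(1)] by blast
  obtain a k where Gak: "G = (\<lambda>y. \<Sum>i\<le>k. a i * y ^ i)" using G(1) unfolding real_polynomial_function_iff_sum by blast
  have pow_int: "integrable \<mu> (\<lambda>t. h t ^ i)" for i
    by (rule \<mu>.integrable_const_bound[where B = 1]) (use \<mu> in \<open>auto intro!: AE_I2 power_le_one\<close>)
  have G_int: "integrable \<mu> (\<lambda>t. G (h t))"
    unfolding Gak using pow_int by (intro Bochner_Integration.integrable_sum integrable_mult_right)
  have F_meas: "(\<lambda>t. F (h t)) \<in> borel_measurable \<mu>"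
  proof (rule measurable_compose_rev[of F "restrict_space borel {0..1}"])
    show "F \<in> borel_measurable (restrict_space borel {0..1})"
      by (rule borel_measurable_continuous_on_restrict[OF F])
    show "h \<in> measurable \<mu> (restrict_space borel {0..1})"
      by (rule measurable_restrict_space2) (use \<mu> in auto)
  qed
  have diff: "\<bar>F (h t) - G (h t)\<bar> < \<epsilon>" for t using G(2) \<mu>(3,4) by simp
  have F_int: "integrable \<mu> (\<lambda>t. F (h t))"
  proof (rule Bochner_Integration.integrable_bound)
    show "integrable \<mu> (\<lambda>t. \<bar>G (h t)\<bar> + \<epsilon>)" using G_int by auto
    show "(\<lambda>t. F (h t)) \<in> borel_measurable \<mu>" by (rule F_meas)
    show "AE t in \<mu>. norm (F (h t)) \<le> norm (\<bar>G (h t)\<bar> + \<epsilon>)"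
    proof (rule AE_I2)
      fix t
      show "norm (F (h t)) \<le> norm (\<bar>G (h t)\<bar> + \<epsilon>)" using diff[of t] \<epsilon>(1) by (simp add: abs_if split: if_splits)
    qed
  qed
  have "(\<lambda>n. \<Sum>i\<le>k. of_real (a i) * (\<Sum>c<n. of_real (w n c * x n c ^ i) * (\<alpha> n c * conjugate (\<beta> n c))))
     \<longlonglongrightarrow> (\<Sum>i\<le>k. of_real (a i) * of_real (d * (\<integral>t. h t ^ i \<partial>\<mu>)))"
    by (intro tendsto_sum tendsto_mult tendsto_const lim)
  moreover have "(\<Sum>i\<le>k. of_real (a i) * (\<Sum>c<n. of_real (w n c * x n c ^ i) * (\<alpha> n c * conjugate (\<beta> n c))))
     = (\<Sum>c<n. of_real (w n c * G (x n c)) * (\<alpha> n c * conjugate (\<beta> n c)))" for n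
    unfolding sum_distrib_left by (subst sum.swap) (simp add: Gak sum_distrib_left sum_distrib_right mult_ac)
  moreover have "(\<Sum>i\<le>k. of_real (a i) * of_real (d * (\<integral>t. h t ^ i \<partial>\<mu>))) = (of_real (d * (\<integral>t. G (h t) \<partial>\<mu>)) :: 'a)"
    unfolding Gak using pow_int by (simp add: Bochner_Integration.integral_sum sum_distrib_left mult_ac)
  ultimately have limG: "(\<lambda>n. \<Sum>c<n. of_real (w n c * G (x n c)) * (\<alpha> n c * conjugate (\<beta> n c))) \<longlonglongrightarrow> of_real (d * (\<integral>t. G (h t) \<partial>\<mu>))"
    by simp
  have int_diff: "norm (of_real (d * (\<integral>t. G (h t) \<partial>\<mu>)) - of_real (d * (\<integral>t. F (h t) \<partial>\<mu>)) :: 'a) \<le> \<epsilon>"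
  proof -
    have "\<bar>(\<integral>t. G (h t) \<partial>\<mu>) - (\<integral>t. F (h t) \<partial>\<mu>)\<bar> = \<bar>\<integral>t. G (h t) - F (h t) \<partial>\<mu>\<bar>"
      using G_int F_int by simp
    also have "\<dots> \<le> (\<integral>t. \<bar>G (h t) - F (h t)\<bar> \<partial>\<mu>)" by (rule integral_abs_bound)
    also have "\<dots> \<le> (\<integral>t. \<epsilon> \<partial>\<mu>)"
    proof (rule integral_mono)
      show "integrable \<mu> (\<lambda>t. \<bar>G (h t) - F (h t)\<bar>)" using G_int F_int by auto
      show "\<bar>G (h t) - F (h t)\<bar> \<le> \<epsilon>" for t using diff[of t] by (simp add: abs_minus_commute)
    qed simp
    also have "\<dots> = \<epsilon>" by (simp add: \<mu>.prob_space)
    finally have 1: "\<bar>(\<integral>t. G (h t) \<partial>\<mu>) - (\<integral>t. F (h t) \<partial>\<mu>)\<bar> \<le> \<epsilon>" .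
    have "norm (of_real (d * (\<integral>t. G (h t) \<partial>\<mu>)) - of_real (d * (\<integral>t. F (h t) \<partial>\<mu>)) :: 'a)
       = \<bar>d\<bar> * \<bar>(\<integral>t. G (h t) \<partial>\<mu>) - (\<integral>t. F (h t) \<partial>\<mu>)\<bar>"
      unfolding of_real_diff[symmetric] norm_of_real right_diff_distrib[symmetric] abs_mult ..
    also have "\<dots> \<le> 1 * \<epsilon>" by (rule mult_mono[OF d 1]) auto
    finally show ?thesis by simp
  qed
  have form_diff: "norm ((\<Sum>c<n. of_real (w n c * F (x n c)) * (\<alpha> n c * conjugate (\<beta> n c)))
      - (\<Sum>c<n. of_real (w n c * G (x n c)) * (\<alpha> n c * conjugate (\<beta> n c)))) \<le> \<epsilon> * (sqrt (nsq {..<n} (\<alpha> n)) * sqrt (nsq {..<n} (\<beta> n)))" for n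
  proof -
    have "norm ((\<Sum>c<n. of_real (w n c * F (x n c)) * (\<alpha> n c * conjugate (\<beta> n c)))
      - (\<Sum>c<n. of_real (w n c * G (x n c)) * (\<alpha> n c * conjugate (\<beta> n c))))
      = norm (\<Sum>c<n. of_real (w n c * (F (x n c) - G (x n c))) * (\<alpha> n c * conjugate (\<beta> n c)))"
      unfolding sum_subtractf[symmetric] by (simp add: algebra_simps)
    also have "\<dots> \<le> (\<Sum>c<n. \<epsilon> * (\<bar>norm (\<alpha> n c)\<bar> * \<bar>norm (\<beta> n c)\<bar>))"
    proof (rule sum_norm_le)
      fix c
      have "\<bar>w n c\<bar> * \<bar>F (x n c) - G (x n c)\<bar> \<le> 1 * \<epsilon>"
        by (rule mult_mono[OF w]) (use G(2)[of "x n c"] x in \<open>auto intro: less_imp_le\<close>)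
      then have "\<bar>w n c * (F (x n c) - G (x n c))\<bar> * (norm (\<alpha> n c) * norm (\<beta> n c)) \<le> \<epsilon> * (norm (\<alpha> n c) * norm (\<beta> n c))"
        by (intro mult_right_mono) (auto simp: abs_mult)
      then show "norm (of_real (w n c * (F (x n c) - G (x n c))) * (\<alpha> n c * conjugate (\<beta> n c))) \<le> \<epsilon> * (\<bar>norm (\<alpha> n c)\<bar> * \<bar>norm (\<beta> n c)\<bar>)"
        by (simp only: norm_mult norm_of_real norm_conjugate abs_norm_cancel)
    qed
    also have "\<dots> \<le> \<epsilon> * (sqrt (nsq {..<n} (\<alpha> n)) * sqrt (nsq {..<n} (\<beta> n)))"
      unfolding sum_distrib_left[symmetric] using \<epsilon>(1) L2_set_mult_ineq[of "\<lambda>c. norm (\<alpha> n c)" "\<lambda>c. norm (\<beta> n c)" "{..<n}"]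
      by (intro mult_left_mono) (simp_all add: L2_set_def nsq_def)
    finally show ?thesis .
  qed
  have "0 < e / 3" using e by simp
  from tendstoD[OF limG this] C
  show "\<forall>\<^sub>F n in sequentially. dist (\<Sum>c<n. of_real (w n c * F (x n c)) * (\<alpha> n c * conjugate (\<beta> n c))) (of_real (d * (\<integral>t. F (h t) \<partial>\<mu>))) < e"
  proof eventually_elim
    case (elim n)
    have le: "\<epsilon> * (sqrt (nsq {..<n} (\<alpha> n)) * sqrt (nsq {..<n} (\<beta> n))) \<le> \<epsilon> * \<bar>C\<bar>"
      using elim(2) \<epsilon>(1) by (intro mult_left_mono) auto
    define fF where "fF = (\<Sum>c<n. of_real (w n c * F (x n c)) * (\<alpha> n c * conjugate (\<beta> n c)))"
    define fG where "fG = (\<Sum>c<n. of_real (w n c * G (x n c)) * (\<alpha> n c * conjugate (\<beta> n c)))"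
    have 1: "norm (fF - fG) \<le> e / 3"
      unfolding fF_def fG_def using form_diff[of n] le \<epsilon>(2) by linarith
    define LG where "LG = (of_real (d * (\<integral>t. G (h t) \<partial>\<mu>)) :: 'a)"
    define LF where "LF = (of_real (d * (\<integral>t. F (h t) \<partial>\<mu>)) :: 'a)"
    have 2: "norm (fG - LG) < e / 3" using elim(1) by (simp only: dist_norm fG_def LG_def)
    have 3: "norm (LG - LF) \<le> e / 3" unfolding LG_def LF_def using int_diff \<epsilon>(3) by (rule order_trans)
    have "norm (fF - LF) \<le> norm (fF - fG) + (norm (fG - LG) + norm (LG - LF))"
      using norm_triangle_ineq[of "fF - fG" "fG - LF"] norm_triangle_ineq[of "fG - LG" "LG - LF"] by simp
    then show ?case
      unfolding dist_norm fF_def[symmetric] LF_def[symmetric] using 1 2 3 by linarith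
  qed
qed

section \<open>Limits of weighted forms\<close>

definition wform :: "nat \<Rightarrow> (nat \<Rightarrow> real) \<Rightarrow> (nat \<Rightarrow> 'a :: real_or_complex) \<Rightarrow> (nat \<Rightarrow> 'a) \<Rightarrow> 'a" where
  "wform n w x y = (\<Sum>c<n. of_real (w c) * (x c * conjugate (y c)))"

lemma wform_conjugate: "conjugate (wform n w x y) = wform n w y x"
  by (simp add: wform_def sum_conjugate conjugate_dist_mul mult_ac)

lemma wform_sum_left: "finite I \<Longrightarrow> wform n w (\<lambda>c. \<Sum>i\<in>I. a i * x i c) y = (\<Sum>i\<in>I. a i * wform n w (x i) y)"
  unfolding wform_def sum_distrib_left sum_distrib_right by (subst sum.swap) (simp add: mult_ac)

lemma wform_sum_right: "finite I \<Longrightarrow> wform n w y (\<lambda>c. \<Sum>i\<in>I. a i * x i c) = (\<Sum>i\<in>I. conjugate (a i) * wform n w y (x i))"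
  using wform_sum_left[of I n w a x y] by (metis (mono_tags, lifting) wform_conjugate sum_conjugate conjugate_dist_mul sum.cong)

lemma norm_wform_le:
  assumes "\<And>c. c < n \<Longrightarrow> \<bar>w c\<bar> \<le> \<epsilon>" "0 \<le> \<epsilon>"
  shows "norm (wform n w x y) \<le> \<epsilon> * (sqrt (nsq {..<n} x) * sqrt (nsq {..<n} y))"
proof -
  have "norm (wform n w x y) \<le> (\<Sum>c<n. \<epsilon> * (\<bar>norm (x c)\<bar> * \<bar>norm (y c)\<bar>))"
    unfolding wform_def
  proof (rule sum_norm_le)
    fix c assume "c \<in> {..<n}"
    then have "\<bar>w c\<bar> * (norm (x c) * norm (y c)) \<le> \<epsilon> * (norm (x c) * norm (y c))"
      by (intro mult_right_mono assms(1)) auto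
    then show "norm (of_real (w c) * (x c * conjugate (y c))) \<le> \<epsilon> * (\<bar>norm (x c)\<bar> * \<bar>norm (y c)\<bar>)"
      by (simp only: norm_mult norm_of_real norm_conjugate abs_norm_cancel)
  qed
  also have "\<dots> \<le> \<epsilon> * (sqrt (nsq {..<n} x) * sqrt (nsq {..<n} y))"
    unfolding sum_distrib_left[symmetric] using assms(2) L2_set_mult_ineq[of "\<lambda>c. norm (x c)" "\<lambda>c. norm (y c)" "{..<n}"]
    by (intro mult_left_mono) (simp_all add: L2_set_def nsq_def)
  finally show ?thesis .
qed

text \<open>The weight moves with \<open>z k\<close>, while limits are known for fixed weights.
  Uniform continuity of \<open>G\<close> on the compact rectangle makes the two weights uniformly
  close. The index map \<open>N\<close> admits subsequences, which are needed while convergence of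
  the singular values is still open.\<close>

lemma moving_limit:
  fixes \<gamma> \<delta> :: "nat \<Rightarrow> nat \<Rightarrow> 'a :: real_or_complex" and z :: "nat \<Rightarrow> real" and G :: "real \<Rightarrow> real \<Rightarrow> real"
  assumes x: "\<And>n c. 0 \<le> x n c" "\<And>n c. x n c \<le> 1" and w: "\<And>n c. \<bar>w n c\<bar> \<le> (1 :: real)"
    and C: "\<forall>\<^sub>F n in sequentially. sqrt (nsq {..<n} (\<gamma> n)) * sqrt (nsq {..<n} (\<delta> n)) \<le> C"
    and lim: "\<And>F. continuous_on {0..1 :: real} F \<Longrightarrow> (\<lambda>n. wform n (\<lambda>c. w n c * F (x n c)) (\<gamma> n) (\<delta> n)) \<longlonglongrightarrow> L F"
    and G: "continuous_on ({0..z1} \<times> {0..1}) (\<lambda>(z, y). G z y)"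
    and N: "filterlim N at_top sequentially"
    and z: "z \<longlonglongrightarrow> z0" "\<forall>\<^sub>F k in sequentially. 0 \<le> z k \<and> z k \<le> z1" "0 \<le> z0" "z0 \<le> z1"
    and f: "\<forall>\<^sub>F k in sequentially. \<forall>c<N k. f k c = w (N k) c * G (z k) (x (N k) c)"
  shows "(\<lambda>k. wform (N k) (f k) (\<gamma> (N k)) (\<delta> (N k))) \<longlonglongrightarrow> L (G z0)"
proof -
  have fixed: "(\<lambda>k. wform (N k) (\<lambda>c. w (N k) c * G z0 (x (N k) c)) (\<gamma> (N k)) (\<delta> (N k))) \<longlonglongrightarrow> L (G z0)"
  proof (rule filterlim_compose[OF lim N])
    have "continuous_on {0..1} (\<lambda>y. (\<lambda>(z, y). G z y) (z0, y))"
      by (rule continuous_on_compose2[OF G]) (use z in \<open>auto intro!: continuous_intros\<close>)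
    then show "continuous_on {0..1} (G z0)" by simp
  qed
  have "(\<lambda>k. wform (N k) (f k) (\<gamma> (N k)) (\<delta> (N k)) - wform (N k) (\<lambda>c. w (N k) c * G z0 (x (N k) c)) (\<gamma> (N k)) (\<delta> (N k))) \<longlonglongrightarrow> 0"
  proof (rule tendstoI)
    fix e :: real assume e: "0 < e"
    define \<epsilon> where "\<epsilon> = e / (2 * (1 + \<bar>C\<bar>))"
    have "0 < e * \<bar>C\<bar> + e * 2" using e by (intro add_nonneg_pos) simp_all
    then have \<epsilon>: "0 < \<epsilon>" "\<epsilon> * \<bar>C\<bar> < e"
      using e by (simp_all add: \<epsilon>_def divide_less_eq add_pos_nonneg distrib_left)
    have "compact ({0..z1} \<times> {0..1 :: real})" by (intro compact_Times compact_Icc)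
    then have "uniformly_continuous_on ({0..z1} \<times> {0..1}) (\<lambda>(z, y). G z y)"
      by (rule compact_uniformly_continuous[OF G])
    then obtain d where d: "0 < d" "\<And>p q. p \<in> {0..z1} \<times> {0..1} \<Longrightarrow> q \<in> {0..z1} \<times> {0..1} \<Longrightarrow> dist q p < d \<Longrightarrow>
        dist ((\<lambda>(z, y). G z y) q) ((\<lambda>(z, y). G z y) p) < \<epsilon>"
      using \<epsilon>(1) unfolding uniformly_continuous_on_def by metis
    have "\<forall>\<^sub>F k in sequentially. sqrt (nsq {..<N k} (\<gamma> (N k))) * sqrt (nsq {..<N k} (\<delta> (N k))) \<le> C"
      using filterlim_iff[THEN iffD1, OF N] C by blast
    from this f z(2) tendstoD[OF z(1) d(1)]
    show "\<forall>\<^sub>F k in sequentially. dist (wform (N k) (f k) (\<gamma> (N k)) (\<delta> (N k)) - wform (N k) (\<lambda>c. w (N k) c * G z0 (x (N k) c)) (\<gamma> (N k)) (\<delta> (N k))) 0 < e"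
    proof eventually_elim
      case (elim k)
      have "wform (N k) (f k) (\<gamma> (N k)) (\<delta> (N k)) - wform (N k) (\<lambda>c. w (N k) c * G z0 (x (N k) c)) (\<gamma> (N k)) (\<delta> (N k))
        = wform (N k) (\<lambda>c. w (N k) c * (G (z k) (x (N k) c) - G z0 (x (N k) c))) (\<gamma> (N k)) (\<delta> (N k))"
        unfolding wform_def sum_subtractf[symmetric] using elim(2) by (intro sum.cong refl) (simp add: algebra_simps)
      also have "norm \<dots> \<le> \<epsilon> * (sqrt (nsq {..<N k} (\<gamma> (N k))) * sqrt (nsq {..<N k} (\<delta> (N k))))"
      proof (rule norm_wform_le)
        fix c
        have "dist (z k, x (N k) c) (z0, x (N k) c) < d" using elim(4) by (simp add: dist_prod_def)
        then have "\<bar>G (z k) (x (N k) c) - G z0 (x (N k) c)\<bar> < \<epsilon>"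
          using d(2)[of "(z0, x (N k) c)" "(z k, x (N k) c)"] elim(3) z x by (auto simp: dist_real_def)
        then have "\<bar>w (N k) c\<bar> * \<bar>G (z k) (x (N k) c) - G z0 (x (N k) c)\<bar> \<le> 1 * \<epsilon>"
          by (intro mult_mono w) auto
        then show "\<bar>w (N k) c * (G (z k) (x (N k) c) - G z0 (x (N k) c))\<bar> \<le> \<epsilon>" by (simp add: abs_mult)
      qed (use \<epsilon> in auto)
      also have "\<dots> \<le> \<epsilon> * \<bar>C\<bar>" using elim(1) \<epsilon>(1) by (intro mult_left_mono) auto
      also have "\<dots> < e" by (rule \<epsilon>(2))
      finally show ?case by (simp add: dist_norm)
    qed
  qed
  from tendsto_add[OF this fixed] show ?thesis by simp
qed

text \<open>Minus the derivative of \<open>phi\<close>, by \<open>phi_DERIV\<close>. It arises as a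
  limit of squared norms.\<close>

definition psi2 :: "real measure \<Rightarrow> real \<Rightarrow> real" where
  "psi2 \<mu> z = (\<integral>t. (t\<^sup>2 + z\<^sup>2) / (t\<^sup>2 - z\<^sup>2)\<^sup>2 \<partial>\<mu>)"

locale distribution_above = real_distribution \<mu> for \<mu> :: "real measure" +
  fixes a :: real
  assumes supp: "AE t in \<mu>. a \<le> t" and a_pos: "0 < a"

text \<open>What is used of one realisation: the spectrum stays above every c < a, even weighted
  forms have diagonal limits, and odd mixed forms vanish. The factor 1 in \<open>EA\<close> and
  \<open>EB\<close> matches the weight pattern of \<open>moving_limit\<close>.\<close>

locale limit_forms = distribution_above \<mu> a for \<mu> a +
  fixes s :: "nat \<Rightarrow> nat \<Rightarrow> real" and \<alpha> \<beta> :: "nat \<Rightarrow> nat \<Rightarrow> nat \<Rightarrow> 'a :: real_or_complex"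
    and J :: "nat set"
  assumes s_low: "\<And>c. c < a \<Longrightarrow> \<forall>\<^sub>F n in sequentially. \<forall>k<n. c < s n k"
    and EA: "\<And>F i j. continuous_on {0..1} F \<Longrightarrow> i \<in> J \<Longrightarrow> j \<in> J \<Longrightarrow>
      (\<lambda>n. wform n (\<lambda>c. 1 * F (1 / (1 + (s n c)\<^sup>2))) (\<alpha> n i) (\<alpha> n j)) \<longlonglongrightarrow> of_real ((if i = j then 1 else 0) * (\<integral>t. F (1 / (1 + t\<^sup>2)) \<partial>\<mu>))"
    and EB: "\<And>F i j. continuous_on {0..1} F \<Longrightarrow> i \<in> J \<Longrightarrow> j \<in> J \<Longrightarrow>
      (\<lambda>n. wform n (\<lambda>c. 1 * F (1 / (1 + (s n c)\<^sup>2))) (\<beta> n i) (\<beta> n j)) \<longlonglongrightarrow> of_real ((if i = j then 1 else 0) * (\<integral>t. F (1 / (1 + t\<^sup>2)) \<partial>\<mu>))"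
    and OC: "\<And>F i j. continuous_on {0..1} F \<Longrightarrow> i \<in> J \<Longrightarrow> j \<in> J \<Longrightarrow>
      (\<lambda>n. wform n (\<lambda>c. (1 / (1 + (s n c)\<^sup>2) * s n c) * F (1 / (1 + (s n c)\<^sup>2))) (\<alpha> n i) (\<beta> n j)) \<longlonglongrightarrow> 0"
begin

lemma gram:
  assumes "i \<in> J" "j \<in> J"
  shows "(\<lambda>n. ip {..<n} (\<alpha> n i) (\<alpha> n j)) \<longlonglongrightarrow> (if i = j then 1 else 0)"
    and "(\<lambda>n. ip {..<n} (\<beta> n i) (\<beta> n j)) \<longlonglongrightarrow> (if i = j then 1 else 0)"
proof -
  have p1: "prob UNIV = 1" using prob_space by simp
  show "(\<lambda>n. ip {..<n} (\<alpha> n i) (\<alpha> n j)) \<longlonglongrightarrow> (if i = j then 1 else 0)"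
    using EA[of "\<lambda>_. 1", OF _ assms] by (cases "i = j") (simp_all add: wform_def ip_def p1)
  show "(\<lambda>n. ip {..<n} (\<beta> n i) (\<beta> n j)) \<longlonglongrightarrow> (if i = j then 1 else 0)"
    using EB[of "\<lambda>_. 1", OF _ assms] by (cases "i = j") (simp_all add: wform_def ip_def p1)
qed

lemma nsq_lim:
  assumes "i \<in> J"
  shows "(\<lambda>n. nsq {..<n} (\<alpha> n i)) \<longlonglongrightarrow> 1" and "(\<lambda>n. nsq {..<n} (\<beta> n i)) \<longlonglongrightarrow> 1"
proof -
  have "(\<lambda>n. of_real (nsq {..<n} (\<alpha> n i)) :: 'a) \<longlonglongrightarrow> of_real 1" "(\<lambda>n. of_real (nsq {..<n} (\<beta> n i)) :: 'a) \<longlonglongrightarrow> of_real 1"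
    using gram[OF assms assms] unfolding ip_self by simp_all
  then show "(\<lambda>n. nsq {..<n} (\<alpha> n i)) \<longlonglongrightarrow> 1" "(\<lambda>n. nsq {..<n} (\<beta> n i)) \<longlonglongrightarrow> 1"
    unfolding tendsto_of_real_iff by simp_all
qed

lemma nsq_bounded:
  assumes "i \<in> J"
  shows "\<forall>\<^sub>F n in sequentially. sqrt (nsq {..<n} (\<alpha> n i)) \<le> 2" and "\<forall>\<^sub>F n in sequentially. sqrt (nsq {..<n} (\<beta> n i)) \<le> 2"
proof -
  have "sqrt x \<le> 2" if "x < 4" for x using real_sqrt_less_mono[OF that] by simp
  note * = this
  show "\<forall>\<^sub>F n in sequentially. sqrt (nsq {..<n} (\<alpha> n i)) \<le> 2"
    by (rule eventually_mono[OF order_tendstoD(2)[OF nsq_lim(1)[OF assms], of 4] *]) simp_all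
  show "\<forall>\<^sub>F n in sequentially. sqrt (nsq {..<n} (\<beta> n i)) \<le> 2"
    by (rule eventually_mono[OF order_tendstoD(2)[OF nsq_lim(2)[OF assms], of 4] *]) simp_all
qed

lemma nsq_prod_bounded:
  assumes "i \<in> J" "j \<in> J"
  shows "\<forall>\<^sub>F n in sequentially. sqrt (nsq {..<n} (\<alpha> n i)) * sqrt (nsq {..<n} (\<alpha> n j)) \<le> 4"
    and "\<forall>\<^sub>F n in sequentially. sqrt (nsq {..<n} (\<beta> n i)) * sqrt (nsq {..<n} (\<beta> n j)) \<le> 4"
    and "\<forall>\<^sub>F n in sequentially. sqrt (nsq {..<n} (\<alpha> n i)) * sqrt (nsq {..<n} (\<beta> n j)) \<le> 4"
proof -
  have *: "x * y \<le> 4" if "0 \<le> x" "0 \<le> y" "x \<le> 2" "y \<le> 2" for x y :: real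
    using mult_mono[OF that(3,4)] that by simp
  show "\<forall>\<^sub>F n in sequentially. sqrt (nsq {..<n} (\<alpha> n i)) * sqrt (nsq {..<n} (\<alpha> n j)) \<le> 4"
    using nsq_bounded(1)[OF assms(1)] nsq_bounded(1)[OF assms(2)] by eventually_elim (rule *; simp)
  show "\<forall>\<^sub>F n in sequentially. sqrt (nsq {..<n} (\<beta> n i)) * sqrt (nsq {..<n} (\<beta> n j)) \<le> 4"
    using nsq_bounded(2)[OF assms(1)] nsq_bounded(2)[OF assms(2)] by eventually_elim (rule *; simp)
  show "\<forall>\<^sub>F n in sequentially. sqrt (nsq {..<n} (\<alpha> n i)) * sqrt (nsq {..<n} (\<beta> n j)) \<le> 4"
    using nsq_bounded(1)[OF assms(1)] nsq_bounded(2)[OF assms(2)] by eventually_elim (rule *; simp)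
qed

lemma x_bounds: "0 \<le> 1 / (1 + t\<^sup>2)" "1 / (1 + t\<^sup>2) \<le> 1" "\<bar>1 / (1 + t\<^sup>2) * t\<bar> \<le> 1" for t :: real
proof -
  have pos: "0 < 1 + t\<^sup>2" by (simp add: add_pos_nonneg)
  then show "0 \<le> 1 / (1 + t\<^sup>2)" "1 / (1 + t\<^sup>2) \<le> 1" by (simp_all add: divide_le_eq)
  have "(\<bar>t\<bar> - 1)\<^sup>2 = 1 + t\<^sup>2 - 2 * \<bar>t\<bar>" by (simp add: power2_eq_square algebra_simps)
  then have "\<bar>t\<bar> \<le> 1 + t\<^sup>2" using zero_le_power2[of "\<bar>t\<bar> - 1"] by linarith
  then show "\<bar>1 / (1 + t\<^sup>2) * t\<bar> \<le> 1" using pos by (simp add: abs_mult divide_le_eq)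
qed

context
  fixes z1 c0 :: real and N :: "nat \<Rightarrow> nat" and z :: "nat \<Rightarrow> real" and z0 :: real and G :: "real \<Rightarrow> real \<Rightarrow> real"
    and f :: "real \<Rightarrow> real \<Rightarrow> real"
  assumes c0: "c0 < a"
    and G: "continuous_on ({0..z1} \<times> {0..1}) (\<lambda>(z, y). G z y)"
    and N: "filterlim N at_top sequentially"
    and z: "z \<longlonglongrightarrow> z0" "\<forall>\<^sub>F k in sequentially. 0 \<le> z k \<and> z k \<le> z1" "0 \<le> z0" "z0 \<le> z1"
begin

private lemma s_low_N: "\<forall>\<^sub>F k in sequentially. \<forall>c<N k. c0 < s (N k) c"
  using filterlim_iff[THEN iffD1, OF N] s_low[OF c0] by blast

text \<open>The kernel \<open>f\<close> may have poles, but only t \<ge> c0 matters: the singular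
  values eventually lie there and \<mu> is concentrated there. It may therefore be replaced by a
  \<open>G\<close> that is continuous on the whole rectangle.\<close>

lemma even_limit:
  assumes f: "\<And>z t. 0 \<le> z \<Longrightarrow> z \<le> z1 \<Longrightarrow> c0 \<le> t \<Longrightarrow> f z t = G z (1 / (1 + t\<^sup>2))"
    and fm: "f z0 \<in> borel_measurable borel" and ij: "i \<in> J" "j \<in> J"
  shows "(\<lambda>k. wform (N k) (\<lambda>c. f (z k) (s (N k) c)) (\<alpha> (N k) i) (\<alpha> (N k) j)) \<longlonglongrightarrow> (if i = j then of_real (\<integral>t. f z0 t \<partial>\<mu>) else 0)"
    and "(\<lambda>k. wform (N k) (\<lambda>c. f (z k) (s (N k) c)) (\<beta> (N k) i) (\<beta> (N k) j)) \<longlonglongrightarrow> (if i = j then of_real (\<integral>t. f z0 t \<partial>\<mu>) else 0)"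
proof -
  have "continuous_on {0..1} (\<lambda>y. (\<lambda>(z, y). G z y) (z0, y))"
    by (rule continuous_on_compose2[OF G]) (use z in \<open>auto intro!: continuous_intros\<close>)
  then have cG: "continuous_on {0..1} (G z0)" by simp
  have "(\<integral>t. G z0 (1 / (1 + t\<^sup>2)) \<partial>\<mu>) = (\<integral>t. f z0 t \<partial>\<mu>)"
  proof -
    have m1: "(\<lambda>t. 1 / (1 + t\<^sup>2)) \<in> measurable \<mu> (restrict_space borel {0..1 :: real})"
      by (rule measurable_restrict_space2) (use x_bounds in auto)
    have m2: "G z0 \<in> borel_measurable (restrict_space borel {0..1})"
      by (rule borel_measurable_continuous_on_restrict[OF cG])
    note mG = measurable_compose[OF m1 m2]
    have mf: "f z0 \<in> borel_measurable \<mu>" using fm by simp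
    have "AE t in \<mu>. G z0 (1 / (1 + t\<^sup>2)) = f z0 t"
      using supp
    proof eventually_elim
      case (elim t)
      then show ?case using f[OF z(3,4), of t] c0 by simp
    qed
    then show ?thesis by (rule integral_cong_AE[OF mG mf])
  qed
  then have I: "of_real ((if i = j then 1 else 0) * (\<integral>t. G z0 (1 / (1 + t\<^sup>2)) \<partial>\<mu>)) = (if i = j then of_real (\<integral>t. f z0 t \<partial>\<mu>) else (0 :: 'a))"
    by simp
  have ff: "\<forall>\<^sub>F k in sequentially. \<forall>c<N k. f (z k) (s (N k) c) = 1 * G (z k) (1 / (1 + (s (N k) c)\<^sup>2))"
    using s_low_N z(2)
  proof eventually_elim
    case (elim k)
    show ?case
    proof (intro allI impI)
      fix c assume "c < N k"
      then have "c0 \<le> s (N k) c" using elim(1) by (simp add: less_imp_le)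
      then show "f (z k) (s (N k) c) = 1 * G (z k) (1 / (1 + (s (N k) c)\<^sup>2))" using f[of "z k" "s (N k) c"] elim by simp
    qed
  qed
  show "(\<lambda>k. wform (N k) (\<lambda>c. f (z k) (s (N k) c)) (\<alpha> (N k) i) (\<alpha> (N k) j)) \<longlonglongrightarrow> (if i = j then of_real (\<integral>t. f z0 t \<partial>\<mu>) else 0)"
    unfolding I[symmetric]
    by (rule moving_limit[OF x_bounds(1) x_bounds(2) _ nsq_prod_bounded(1)[OF ij] EA[OF _ ij] G N z ff]) simp_all
  show "(\<lambda>k. wform (N k) (\<lambda>c. f (z k) (s (N k) c)) (\<beta> (N k) i) (\<beta> (N k) j)) \<longlonglongrightarrow> (if i = j then of_real (\<integral>t. f z0 t \<partial>\<mu>) else 0)"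
    unfolding I[symmetric]
    by (rule moving_limit[OF x_bounds(1) x_bounds(2) _ nsq_prod_bounded(2)[OF ij] EB[OF _ ij] G N z ff]) simp_all
qed

lemma odd_limit:
  assumes f: "\<And>z t. 0 \<le> z \<Longrightarrow> z \<le> z1 \<Longrightarrow> c0 \<le> t \<Longrightarrow> f z t = 1 / (1 + t\<^sup>2) * t * G z (1 / (1 + t\<^sup>2))" and ij: "i \<in> J" "j \<in> J"
  shows "(\<lambda>k. wform (N k) (\<lambda>c. f (z k) (s (N k) c)) (\<alpha> (N k) i) (\<beta> (N k) j)) \<longlonglongrightarrow> 0"
    and "(\<lambda>k. wform (N k) (\<lambda>c. f (z k) (s (N k) c)) (\<beta> (N k) i) (\<alpha> (N k) j)) \<longlonglongrightarrow> 0"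
proof -
  have ff: "\<forall>\<^sub>F k in sequentially. \<forall>c<N k. f (z k) (s (N k) c) = 1 / (1 + (s (N k) c)\<^sup>2) * s (N k) c * G (z k) (1 / (1 + (s (N k) c)\<^sup>2))"
    using s_low_N z(2)
  proof eventually_elim
    case (elim k)
    show ?case
    proof (intro allI impI)
      fix c assume "c < N k"
      then have "c0 \<le> s (N k) c" using elim(1) by (simp add: less_imp_le)
      then show "f (z k) (s (N k) c) = 1 / (1 + (s (N k) c)\<^sup>2) * s (N k) c * G (z k) (1 / (1 + (s (N k) c)\<^sup>2))" using f[of "z k" "s (N k) c"] elim by simp
    qed
  qed
  have *: "(\<lambda>k. wform (N k) (\<lambda>c. f (z k) (s (N k) c)) (\<alpha> (N k) i) (\<beta> (N k) j)) \<longlonglongrightarrow> 0" if ij: "i \<in> J" "j \<in> J" for i j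
    by (rule moving_limit[OF x_bounds(1) x_bounds(2) x_bounds(3) nsq_prod_bounded(3)[OF ij] OC[OF _ ij] G N z ff])
  show "(\<lambda>k. wform (N k) (\<lambda>c. f (z k) (s (N k) c)) (\<alpha> (N k) i) (\<beta> (N k) j)) \<longlonglongrightarrow> 0" by (rule *[OF ij])
  have "(\<lambda>k. conjugate (wform (N k) (\<lambda>c. f (z k) (s (N k) c)) (\<alpha> (N k) j) (\<beta> (N k) i))) \<longlonglongrightarrow> conjugate 0"
    by (rule bounded_linear.tendsto[OF bounded_linear_conjugate *[OF ij(2,1)]])
  then show "(\<lambda>k. wform (N k) (\<lambda>c. f (z k) (s (N k) c)) (\<beta> (N k) i) (\<alpha> (N k) j)) \<longlonglongrightarrow> 0"
    by (simp add: wform_conjugate)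
qed

end

end

section \<open>The function phi\<close>

context distribution_above
begin

lemma phi_neg: "(\<integral>t. z / (t\<^sup>2 - z\<^sup>2) \<partial>\<mu>) = - phi \<mu> z"
proof -
  have "z / (t\<^sup>2 - z\<^sup>2) = - (z / (z\<^sup>2 - t\<^sup>2))" for t
    by (metis minus_diff_eq minus_divide_right)
  then show ?thesis unfolding phi_def by (simp add: integral_minus)
qed

text \<open>The bound is relative to t^2 and not absolute, so that quotients by products of such
  differences are bounded uniformly in t.\<close>

lemma gap:
  assumes "\<bar>z\<bar> \<le> c0" "c0 < a" "a \<le> t"
  shows "(1 - (c0 / a)\<^sup>2) * t\<^sup>2 \<le> t\<^sup>2 - z\<^sup>2"
proof -
  have "z\<^sup>2 \<le> c0\<^sup>2" using assms by (metis abs_ge_zero power2_abs power_mono)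
  also have "c0\<^sup>2 = (c0 / a)\<^sup>2 * a\<^sup>2" using a_pos by (simp add: power_divide)
  also have "\<dots> \<le> (c0 / a)\<^sup>2 * t\<^sup>2" using assms a_pos by (intro mult_left_mono power_mono) auto
  finally show ?thesis by (simp add: algebra_simps)
qed

lemma gap_const:
  assumes "\<bar>z\<bar> \<le> c0" "c0 < a"
  shows "0 < 1 - (c0 / a)\<^sup>2"
proof -
  have "0 \<le> c0 / a" "c0 / a < 1" using assms a_pos by auto
  then have "(c0 / a)\<^sup>2 < 1" by (simp add: power_less_one_iff)
  then show ?thesis by simp
qed

lemma square_gap: "\<bar>z\<bar> < a \<Longrightarrow> a \<le> t \<Longrightarrow> 0 < t\<^sup>2 - z\<^sup>2"
  using gap[of z "\<bar>z\<bar>" t] gap_const[of z "\<bar>z\<bar>"] a_pos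
  by (smt (verit, best) mult_pos_pos zero_less_power)

text \<open>The quotient is the divided difference in z of z / (t^2 - z^2); this is the domination
  needed to differentiate under the integral.\<close>

lemma ratio_bounded:
  assumes z: "\<bar>z\<bar> \<le> c0" "\<bar>w\<bar> \<le> c0" and c0: "c0 < a" and t: "a \<le> t"
  shows "\<bar>(t\<^sup>2 + z * w) / ((t\<^sup>2 - z\<^sup>2) * (t\<^sup>2 - w\<^sup>2))\<bar> \<le> 2 / ((1 - (c0 / a)\<^sup>2)\<^sup>2 * a\<^sup>2)"
proof -
  define \<delta> where "\<delta> = 1 - (c0 / a)\<^sup>2"
  have \<delta>: "0 < \<delta>" unfolding \<delta>_def by (rule gap_const[OF z(1) c0])
  have t0: "0 < t" using t a_pos by simp
  have "\<bar>z * w\<bar> \<le> t * t"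
    unfolding abs_mult using z c0 t by (intro mult_mono) auto
  then have num: "\<bar>t\<^sup>2 + z * w\<bar> \<le> 2 * t\<^sup>2" by (simp add: power2_eq_square)
  have den: "\<delta> * t\<^sup>2 * (\<delta> * t\<^sup>2) \<le> (t\<^sup>2 - z\<^sup>2) * (t\<^sup>2 - w\<^sup>2)"
  proof (rule mult_mono)
    show "\<delta> * t\<^sup>2 \<le> t\<^sup>2 - z\<^sup>2" "\<delta> * t\<^sup>2 \<le> t\<^sup>2 - w\<^sup>2"
      unfolding \<delta>_def using gap[OF z(1) c0 t] gap[OF z(2) c0 t] by auto
    show "0 \<le> t\<^sup>2 - z\<^sup>2" by (rule less_imp_le[OF square_gap]) (use z c0 t in auto)
  qed (use \<delta> in simp)
  have pos: "0 < \<delta> * t\<^sup>2 * (\<delta> * t\<^sup>2)" using \<delta> t0 by simp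
  have "\<bar>(t\<^sup>2 + z * w) / ((t\<^sup>2 - z\<^sup>2) * (t\<^sup>2 - w\<^sup>2))\<bar> = \<bar>t\<^sup>2 + z * w\<bar> / ((t\<^sup>2 - z\<^sup>2) * (t\<^sup>2 - w\<^sup>2))"
    using pos den by (simp only: abs_divide)
  also have "\<dots> \<le> 2 * t\<^sup>2 / (\<delta> * t\<^sup>2 * (\<delta> * t\<^sup>2))" by (intro frac_le num den pos) simp
  also have "\<dots> = 2 / (\<delta>\<^sup>2 * t\<^sup>2)" using t0 by (simp add: power2_eq_square)
  also have "\<dots> \<le> 2 / (\<delta>\<^sup>2 * a\<^sup>2)" using \<delta> t a_pos by (intro frac_le mult_left_mono power_mono) auto
  finally show ?thesis by (simp add: \<delta>_def)
qed

lemma kernel_integrable: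
  assumes z: "\<bar>z\<bar> < a"
  shows "integrable \<mu> (\<lambda>t. z / (t\<^sup>2 - z\<^sup>2))"
proof (rule integrable_const_bound[where B = "\<bar>z\<bar> / (a\<^sup>2 - z\<^sup>2)"])
  show "AE t in \<mu>. norm (z / (t\<^sup>2 - z\<^sup>2)) \<le> \<bar>z\<bar> / (a\<^sup>2 - z\<^sup>2)"
    using supp
  proof eventually_elim
    case (elim t)
    have "a\<^sup>2 \<le> t\<^sup>2" using elim a_pos by (intro power_mono) auto
    then show ?case using square_gap[OF z order_refl] by (simp add: abs_divide frac_le)
  qed
qed simp

lemma ratio_integrable:
  assumes z: "\<bar>z\<bar> < a" "\<bar>w\<bar> < a"
  shows "integrable \<mu> (\<lambda>t. (t\<^sup>2 + z * w) / ((t\<^sup>2 - z\<^sup>2) * (t\<^sup>2 - w\<^sup>2)))"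
proof (rule integrable_const_bound)
  show "AE t in \<mu>. norm ((t\<^sup>2 + z * w) / ((t\<^sup>2 - z\<^sup>2) * (t\<^sup>2 - w\<^sup>2))) \<le> 2 / ((1 - (max \<bar>z\<bar> \<bar>w\<bar> / a)\<^sup>2)\<^sup>2 * a\<^sup>2)"
    using supp by eventually_elim (unfold real_norm_def, rule ratio_bounded, use z in auto)
qed simp

lemma phi_DERIV:
  assumes z: "\<bar>z\<bar> < a"
  shows "(phi \<mu> has_field_derivative - psi2 \<mu> z) (at z)"
proof -
  define c0 where "c0 = (\<bar>z\<bar> + a) / 2"
  have c0: "\<bar>z\<bar> < c0" "c0 < a" using z by (simp_all add: c0_def)
  let ?S = "{- c0 <..< c0}"
  have zS: "z \<in> ?S" using c0 by auto
  have quot: "(phi \<mu> w - phi \<mu> z) / (w - z) = - (\<integral>t. (t\<^sup>2 + z * w) / ((t\<^sup>2 - z\<^sup>2) * (t\<^sup>2 - w\<^sup>2)) \<partial>\<mu>)"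
    if w: "w \<in> ?S" "w \<noteq> z" for w
  proof -
    have wa: "\<bar>w\<bar> < a" using w c0 by auto
    have "phi \<mu> z - phi \<mu> w = (\<integral>t. w / (t\<^sup>2 - w\<^sup>2) \<partial>\<mu>) - (\<integral>t. z / (t\<^sup>2 - z\<^sup>2) \<partial>\<mu>)"
      unfolding phi_neg by simp
    also have "\<dots> = (\<integral>t. w / (t\<^sup>2 - w\<^sup>2) - z / (t\<^sup>2 - z\<^sup>2) \<partial>\<mu>)"
      by (rule Bochner_Integration.integral_diff[symmetric, OF kernel_integrable[OF wa] kernel_integrable[OF z]])
    also have "\<dots> = (\<integral>t. (w - z) * ((t\<^sup>2 + z * w) / ((t\<^sup>2 - z\<^sup>2) * (t\<^sup>2 - w\<^sup>2))) \<partial>\<mu>)"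
    proof (rule integral_cong_AE)
      show "AE t in \<mu>. w / (t\<^sup>2 - w\<^sup>2) - z / (t\<^sup>2 - z\<^sup>2) = (w - z) * ((t\<^sup>2 + z * w) / ((t\<^sup>2 - z\<^sup>2) * (t\<^sup>2 - w\<^sup>2)))"
        using supp
      proof eventually_elim
        case (elim t)
        have nz: "t\<^sup>2 - w\<^sup>2 \<noteq> 0" "t\<^sup>2 - z\<^sup>2 \<noteq> 0" using square_gap[OF wa elim] square_gap[OF z elim] by auto
        have "w * (t\<^sup>2 - z\<^sup>2) - z * (t\<^sup>2 - w\<^sup>2) = (w - z) * (t\<^sup>2 + z * w)"
          by (simp add: power2_eq_square algebra_simps)
        then show ?case using nz by (simp add: diff_frac_eq mult.commute)
      qed
    qed simp_all
    finally have "phi \<mu> z - phi \<mu> w = (w - z) * (\<integral>t. (t\<^sup>2 + z * w) / ((t\<^sup>2 - z\<^sup>2) * (t\<^sup>2 - w\<^sup>2)) \<partial>\<mu>)" by (simp only: integral_mult_right_zero)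
    then show ?thesis using w(2) by (simp add: field_simps)
  qed
  have "((\<lambda>w. (phi \<mu> w - phi \<mu> z) / (w - z)) \<longlongrightarrow> - psi2 \<mu> z) (at z within ?S)"
    unfolding tendsto_at_iff_sequentially
  proof (intro allI impI)
    fix X :: "nat \<Rightarrow> real" assume X: "\<forall>i. X i \<in> ?S - {z}" "X \<longlonglongrightarrow> z"
    have "(\<lambda>i. \<integral>t. (t\<^sup>2 + z * X i) / ((t\<^sup>2 - z\<^sup>2) * (t\<^sup>2 - (X i)\<^sup>2)) \<partial>\<mu>) \<longlonglongrightarrow> (\<integral>t. (t\<^sup>2 + z\<^sup>2) / (t\<^sup>2 - z\<^sup>2)\<^sup>2 \<partial>\<mu>)"
    proof (rule integral_dominated_convergence[where w = "\<lambda>_. 2 / ((1 - (c0 / a)\<^sup>2)\<^sup>2 * a\<^sup>2)"])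
      show "AE t in \<mu>. (\<lambda>i. (t\<^sup>2 + z * X i) / ((t\<^sup>2 - z\<^sup>2) * (t\<^sup>2 - (X i)\<^sup>2))) \<longlonglongrightarrow> (t\<^sup>2 + z\<^sup>2) / (t\<^sup>2 - z\<^sup>2)\<^sup>2"
        using supp
      proof eventually_elim
        case (elim t)
        have nz: "t\<^sup>2 - z\<^sup>2 \<noteq> 0" using square_gap[OF z elim] by simp
        have "(\<lambda>i. (t\<^sup>2 + z * X i) / ((t\<^sup>2 - z\<^sup>2) * (t\<^sup>2 - (X i)\<^sup>2))) \<longlonglongrightarrow> (t\<^sup>2 + z * z) / ((t\<^sup>2 - z\<^sup>2) * (t\<^sup>2 - z\<^sup>2))"
          by (intro tendsto_intros X(2)) (use nz in simp)
        then show ?case by (simp add: power2_eq_square)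
      qed
      show "AE t in \<mu>. norm ((t\<^sup>2 + z * X i) / ((t\<^sup>2 - z\<^sup>2) * (t\<^sup>2 - (X i)\<^sup>2))) \<le> 2 / ((1 - (c0 / a)\<^sup>2)\<^sup>2 * a\<^sup>2)" for i
        using supp
      proof eventually_elim
        case (elim t)
        have "\<bar>X i\<bar> \<le> c0" using X(1)[rule_format, of i] by auto
        then show ?case unfolding real_norm_def using c0 elim by (intro ratio_bounded) auto
      qed
    qed simp_all
    then have "(\<lambda>i. - (\<integral>t. (t\<^sup>2 + z * X i) / ((t\<^sup>2 - z\<^sup>2) * (t\<^sup>2 - (X i)\<^sup>2)) \<partial>\<mu>)) \<longlonglongrightarrow> - psi2 \<mu> z"
      unfolding psi2_def by (rule tendsto_minus)
    moreover have "((\<lambda>w. (phi \<mu> w - phi \<mu> z) / (w - z)) \<circ> X) = (\<lambda>i. - (\<integral>t. (t\<^sup>2 + z * X i) / ((t\<^sup>2 - z\<^sup>2) * (t\<^sup>2 - (X i)\<^sup>2)) \<partial>\<mu>))"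
      using quot X(1) by (auto simp: fun_eq_iff)
    ultimately show "((\<lambda>w. (phi \<mu> w - phi \<mu> z) / (w - z)) \<circ> X) \<longlonglongrightarrow> - psi2 \<mu> z" by simp
  qed
  then show ?thesis
    unfolding has_field_derivative_iff using at_within_open[OF zS] by simp
qed

lemma psi2_pos:
  assumes z: "\<bar>z\<bar> < a"
  shows "0 < psi2 \<mu> z"
  unfolding psi2_def
proof (rule expectation_greater)
  show "integrable \<mu> (\<lambda>t. (t\<^sup>2 + z\<^sup>2) / (t\<^sup>2 - z\<^sup>2)\<^sup>2)"
    using ratio_integrable[OF z z] by (simp add: power2_eq_square)
  show "AE t in \<mu>. 0 < (t\<^sup>2 + z\<^sup>2) / (t\<^sup>2 - z\<^sup>2)\<^sup>2"
    using supp
  proof eventually_elim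
    case (elim t)
    have "0 < (t\<^sup>2 - z\<^sup>2)\<^sup>2" using square_gap[OF z elim] by simp
    moreover have "0 < t\<^sup>2 + z\<^sup>2" using elim a_pos by (intro add_pos_nonneg) auto
    ultimately show ?case by simp
  qed
qed

lemma phi_strict_decreasing:
  assumes "- a < z" "z < w" "w < a"
  shows "phi \<mu> w < phi \<mu> z"
proof (rule DERIV_neg_imp_decreasing[OF assms(2)])
  fix x assume "z \<le> x" "x \<le> w"
  then have "\<bar>x\<bar> < a" using assms by auto
  then show "\<exists>y. (phi \<mu> has_real_derivative y) (at x) \<and> y < 0"
    using phi_DERIV psi2_pos by (intro exI[of _ "- psi2 \<mu> x"]) auto
qed

lemma phi_0 [simp]: "phi \<mu> 0 = 0"
  by (simp add: phi_def)

lemma phi_nonpos: "0 \<le> z \<Longrightarrow> z < a \<Longrightarrow> phi \<mu> z \<le> 0"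
  using phi_strict_decreasing[of 0 z] a_pos by (cases "z = 0") auto

lemma phi_root:
  assumes z: "0 < z" "z < a" and y: "phi \<mu> z \<le> y" "y < 0"
  shows "\<exists>x. 0 < x \<and> x \<le> z \<and> phi \<mu> x = y"
proof -
  have "isCont (phi \<mu>) x" if "0 \<le> x" "x \<le> z" for x
    using phi_DERIV[of x] that z by (auto intro: DERIV_isCont)
  then have "\<exists>x\<ge>0. x \<le> z \<and> phi \<mu> x = y"
    using z y by (intro IVT2) auto
  then obtain x where "0 \<le> x" "x \<le> z" "phi \<mu> x = y" by blast
  moreover have "x \<noteq> 0" using calculation y by auto
  ultimately show ?thesis by (intro exI[of _ x]) auto
qed

lemma phi_inv_eq:
  assumes "0 < x" "x < a"
  shows "phi_inv \<mu> a (phi \<mu> x) = x"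
proof -
  have "inj_on (phi \<mu>) {0<..<a}"
  proof (rule inj_onI)
    fix x y assume "x \<in> {0<..<a}" "y \<in> {0<..<a}" "phi \<mu> x = phi \<mu> y"
    then show "x = y"
      using phi_strict_decreasing[of x y] phi_strict_decreasing[of y x] a_pos by (cases x y rule: linorder_cases) auto
  qed
  then show ?thesis unfolding phi_inv_def using assms by (intro the_inv_into_f_f) auto
qed

text \<open>Otherwise \<open>phi\<close> would stay above -1/\<theta> on the whole interval. Being
  decreasing, it would have a finite left limit of at least -1/\<theta> at \<open>a\<close>, and the
  threshold would be at least \<theta>.\<close>

lemma threshold_imp_large:
  assumes \<theta>: "0 < \<theta>" and th: "threshold \<mu> a < ereal \<theta>"
  shows "\<exists>z. 0 < z \<and> z < a \<and> phi \<mu> z < - 1 / \<theta>"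
proof (rule ccontr)
  assume "\<not> ?thesis"
  then have ge: "- 1 / \<theta> \<le> phi \<mu> z" if "0 < z" "z < a" for z using that by (meson not_le)
  define L where "L = (INF z\<in>{0<..<a}. ereal (phi \<mu> z))"
  have Lle: "L \<le> ereal (phi \<mu> z)" if "0 < z" "z < a" for z
    unfolding L_def using that by (intro INF_lower) auto
  have Lge: "ereal (- 1 / \<theta>) \<le> L"
    unfolding L_def by (rule INF_greatest) (use ge in auto)
  have "((\<lambda>z. ereal (phi \<mu> z)) \<longlongrightarrow> L) (at_left a)"
  proof (rule order_tendstoI)
    fix y assume y: "y < L"
    show "\<forall>\<^sub>F z in at_left a. y < ereal (phi \<mu> z)"
      using eventually_at_left_real[OF a_pos]
      by eventually_elim (use y Lle in \<open>auto intro: less_le_trans\<close>)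
  next
    fix y assume "L < y"
    then obtain w where w: "0 < w" "w < a" "ereal (phi \<mu> w) < y"
      unfolding L_def INF_less_iff by auto
    show "\<forall>\<^sub>F z in at_left a. ereal (phi \<mu> z) < y"
      using eventually_at_left_real[OF w(2)]
    proof eventually_elim
      case (elim z)
      then have "phi \<mu> z < phi \<mu> w" using w(1) a_pos by (intro phi_strict_decreasing) auto
      then have "ereal (phi \<mu> z) < ereal (phi \<mu> w)" by simp
      then show ?case using w(3) by (rule less_trans)
    qed
  qed
  then have Lim: "Lim (at_left a) (\<lambda>z. ereal (phi \<mu> z)) = L"
    by (rule tendsto_Lim[OF trivial_limit_at_left_real])
  have half: "0 < a / 2" "a / 2 < a" using a_pos by auto
  have neg: "phi \<mu> (a / 2) < 0" using phi_strict_decreasing[of 0 "a / 2"] a_pos by simp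
  \<comment> \<open>The limit lies between -1/\<theta> and a negative value, so the inverse in the
    threshold is that of a finite positive number.\<close>
  obtain l where l: "L = ereal l"
    using Lge Lle[OF half] by (cases L) auto
  have "- 1 / \<theta> \<le> l" "l < 0" using Lge Lle[OF half] neg unfolding l by auto
  then have "\<theta> \<le> inverse (- l)" using \<theta> by (simp add: field_simps)
  moreover have "threshold \<mu> a = ereal (inverse (- l))"
    unfolding threshold_def Lim l using \<open>l < 0\<close> by simp
  ultimately show False using th by simp
qed

end

section \<open>Overlaps of singular vectors\<close>

lemma bounded_double_sum_null:
  fixes p q :: "nat \<Rightarrow> 'i \<Rightarrow> 'a :: real_normed_field"
  assumes "\<And>i j. i \<in> I \<Longrightarrow> j \<in> I \<Longrightarrow> (\<lambda>k. E k i j) \<longlonglongrightarrow> 0"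
    and p: "\<And>i. i \<in> I \<Longrightarrow> \<forall>\<^sub>F k in sequentially. norm (p k i) \<le> B"
    and q: "\<And>i. i \<in> I \<Longrightarrow> \<forall>\<^sub>F k in sequentially. norm (q k i) \<le> B"
  shows "(\<lambda>k. \<Sum>i\<in>I. \<Sum>j\<in>I. p k i * (q k j * E k i j)) \<longlonglongrightarrow> 0"
proof -
  have "(\<lambda>k. p k i * (q k j * E k i j)) \<longlonglongrightarrow> 0" if "i \<in> I" "j \<in> I" for i j
    by (rule lim_null_mult_left_bounded[OF p[OF that(1)] lim_null_mult_left_bounded[OF q[OF that(2)] assms(1)[OF that]]])
  then have "(\<lambda>k. \<Sum>i\<in>I. \<Sum>j\<in>I. p k i * (q k j * E k i j)) \<longlonglongrightarrow> (\<Sum>i\<in>I. \<Sum>j\<in>I. 0)"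
    by (intro tendsto_sum) auto
  then show ?thesis by simp
qed

context limit_forms
begin

text \<open>With y = 1 / (1 + t^2) one has (1 + t^2) / (t^2 - z^2) = 1 / (1 - (1 + z^2) y). Capping
  y at its value for t = c0 removes the pole and changes nothing for t \<ge> c0, so the kernels
  below become continuous functions of z and y, up to the odd factor t / (1 + t^2).\<close>

lemma inverse_gap_continuous:
  fixes z1 c0 :: real
  assumes "0 \<le> z1" "z1 < c0"
  shows "continuous_on ({0..z1} \<times> {0..1}) (\<lambda>p. 1 / (1 - (1 + (fst p)\<^sup>2) * min (snd p) (1 / (1 + c0\<^sup>2))))"
proof (intro continuous_intros ballI)
  fix p assume "p \<in> {0..z1} \<times> {0..1 :: real}"
  then have p: "0 \<le> fst p" "fst p \<le> z1" by auto
  have "(fst p)\<^sup>2 \<le> z1\<^sup>2" using p by (intro power_mono) auto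
  moreover have "z1\<^sup>2 < c0\<^sup>2" using assms by (intro power_strict_mono) auto
  ultimately have lt: "1 + (fst p)\<^sup>2 < 1 + c0\<^sup>2" by simp
  have pos: "0 < 1 + c0\<^sup>2" by (simp add: add_pos_nonneg)
  have "(1 + (fst p)\<^sup>2) * min (snd p) (1 / (1 + c0\<^sup>2)) \<le> (1 + (fst p)\<^sup>2) * (1 / (1 + c0\<^sup>2))"
    by (intro mult_left_mono) (auto simp: add_nonneg_nonneg)
  also have "\<dots> < 1" using lt pos by simp
  finally show "1 - (1 + (fst p)\<^sup>2) * min (snd p) (1 / (1 + c0\<^sup>2)) \<noteq> 0" by simp
qed

lemma inverse_gap_eq:
  fixes z t c0 :: real
  assumes "0 \<le> z" "z < c0" "c0 \<le> t"
  shows "1 / (1 - (1 + z\<^sup>2) * min (1 / (1 + t\<^sup>2)) (1 / (1 + c0\<^sup>2))) = (1 + t\<^sup>2) / (t\<^sup>2 - z\<^sup>2)"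
    and "0 < t\<^sup>2 - z\<^sup>2"
proof -
  have "c0\<^sup>2 \<le> t\<^sup>2" "z\<^sup>2 < c0\<^sup>2" using assms by (auto intro!: power_mono power_strict_mono)
  then show gap: "0 < t\<^sup>2 - z\<^sup>2" by simp
  have pos: "0 < 1 + c0\<^sup>2" "0 < 1 + t\<^sup>2" by (simp_all add: add_pos_nonneg)
  have "1 / (1 + t\<^sup>2) \<le> 1 / (1 + c0\<^sup>2)" using \<open>c0\<^sup>2 \<le> t\<^sup>2\<close> pos by (simp add: frac_le)
  then have "min (1 / (1 + t\<^sup>2)) (1 / (1 + c0\<^sup>2)) = 1 / (1 + t\<^sup>2)" by (rule min_absorb1)
  moreover have "1 - (1 + z\<^sup>2) * (1 / (1 + t\<^sup>2)) = (t\<^sup>2 - z\<^sup>2) / (1 + t\<^sup>2)"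
    using pos by (simp add: field_simps)
  ultimately show "1 / (1 - (1 + z\<^sup>2) * min (1 / (1 + t\<^sup>2)) (1 / (1 + c0\<^sup>2))) = (1 + t\<^sup>2) / (t\<^sup>2 - z\<^sup>2)" by simp
qed

context
  fixes N :: "nat \<Rightarrow> nat" and z :: "nat \<Rightarrow> real" and z0 :: real
  assumes N: "filterlim N at_top sequentially" and z: "z \<longlonglongrightarrow> z0" "\<And>k. 0 \<le> z k" "z0 < a"
begin

text \<open>The points one third and two thirds of the way from \<open>z0\<close> to
  \<open>a\<close>: eventually the moving argument stays below \<open>z1\<close> and the spectrum
  above \<open>c0\<close>.\<close>

private definition "z1 = z0 + (a - z0) / 3"
private definition "c0 = z0 + 2 * (a - z0) / 3"

private lemma z0: "0 \<le> z0"
  by (rule LIMSEQ_le_const[OF z(1)]) (use z(2) in auto)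

private lemma order: "0 \<le> z1" "z1 < c0" "c0 < a" "z0 < z1" "z0 \<le> z1"
  using z0 z(3) by (auto simp: z1_def c0_def field_simps)

private lemma z_ev: "\<forall>\<^sub>F k in sequentially. 0 \<le> z k \<and> z k \<le> z1"
  using order_tendstoD(2)[OF z(1) order(4)] by eventually_elim (use z(2) in auto)

private definition ig :: "real \<Rightarrow> real \<Rightarrow> real" where "ig w y = 1 / (1 - (1 + w\<^sup>2) * min y (1 / (1 + c0\<^sup>2)))"

private lemma ig_cont: "continuous_on ({0..z1} \<times> {0..1}) (\<lambda>p. ig (fst p) (snd p))"
  unfolding ig_def by (rule inverse_gap_continuous[OF order(1,2)])

private lemma ig_eq:
  assumes "0 \<le> w" "w \<le> z1" "c0 \<le> t"
  shows "ig w (1 / (1 + t\<^sup>2)) = (1 + t\<^sup>2) / (t\<^sup>2 - w\<^sup>2)" "t\<^sup>2 - w\<^sup>2 \<noteq> 0" "1 + t\<^sup>2 \<noteq> 0"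
proof -
  have "w < c0" using assms order by simp
  from inverse_gap_eq[OF assms(1) this assms(3)]
  show "ig w (1 / (1 + t\<^sup>2)) = (1 + t\<^sup>2) / (t\<^sup>2 - w\<^sup>2)" "t\<^sup>2 - w\<^sup>2 \<noteq> 0" by (simp_all add: ig_def)
  have "0 < 1 + t\<^sup>2" by (simp add: add_pos_nonneg)
  then show "1 + t\<^sup>2 \<noteq> 0" by simp
qed

lemma kernel_even_limit:
  assumes ij: "i \<in> J" "j \<in> J"
  shows "(\<lambda>k. wform (N k) (\<lambda>c. z k / ((s (N k) c)\<^sup>2 - (z k)\<^sup>2)) (\<alpha> (N k) i) (\<alpha> (N k) j)) \<longlonglongrightarrow> (if i = j then of_real (- phi \<mu> z0) else 0)"
    and "(\<lambda>k. wform (N k) (\<lambda>c. z k / ((s (N k) c)\<^sup>2 - (z k)\<^sup>2)) (\<beta> (N k) i) (\<beta> (N k) j)) \<longlonglongrightarrow> (if i = j then of_real (- phi \<mu> z0) else 0)"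
proof -
  have c: "continuous_on ({0..z1} \<times> {0..1}) (\<lambda>(z, y). z * y * ig z y)"
    unfolding case_prod_beta by (intro continuous_intros ig_cont)
  have f: "z / (t\<^sup>2 - z\<^sup>2) = z * (1 / (1 + t\<^sup>2)) * ig z (1 / (1 + t\<^sup>2))" if "0 \<le> z" "z \<le> z1" "c0 \<le> t" for z t
    using ig_eq[OF that] by simp
  have m: "(\<lambda>t. z0 / (t\<^sup>2 - z0\<^sup>2)) \<in> borel_measurable borel" by measurable
  note L = even_limit[OF order(3) c N z(1) z_ev z0 order(5) f m ij]
  show "(\<lambda>k. wform (N k) (\<lambda>c. z k / ((s (N k) c)\<^sup>2 - (z k)\<^sup>2)) (\<alpha> (N k) i) (\<alpha> (N k) j)) \<longlonglongrightarrow> (if i = j then of_real (- phi \<mu> z0) else 0)"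
    using L(1) unfolding phi_neg .
  show "(\<lambda>k. wform (N k) (\<lambda>c. z k / ((s (N k) c)\<^sup>2 - (z k)\<^sup>2)) (\<beta> (N k) i) (\<beta> (N k) j)) \<longlonglongrightarrow> (if i = j then of_real (- phi \<mu> z0) else 0)"
    using L(2) unfolding phi_neg .
qed

lemma kernel_odd_limit:
  assumes ij: "i \<in> J" "j \<in> J"
  shows "(\<lambda>k. wform (N k) (\<lambda>c. s (N k) c / ((s (N k) c)\<^sup>2 - (z k)\<^sup>2)) (\<alpha> (N k) i) (\<beta> (N k) j)) \<longlonglongrightarrow> 0"
    and "(\<lambda>k. wform (N k) (\<lambda>c. s (N k) c / ((s (N k) c)\<^sup>2 - (z k)\<^sup>2)) (\<beta> (N k) i) (\<alpha> (N k) j)) \<longlonglongrightarrow> 0"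
proof -
  have c: "continuous_on ({0..z1} \<times> {0..1}) (\<lambda>(z, y). ig z y)"
    unfolding case_prod_beta by (rule ig_cont)
  have f: "t / (t\<^sup>2 - z\<^sup>2) = 1 / (1 + t\<^sup>2) * t * ig z (1 / (1 + t\<^sup>2))" if "0 \<le> z" "z \<le> z1" "c0 \<le> t" for z t
    using ig_eq[OF that] by simp
  note L = odd_limit[OF order(3) c N z(1) z_ev z0 order(5) f ij]
  show "(\<lambda>k. wform (N k) (\<lambda>c. s (N k) c / ((s (N k) c)\<^sup>2 - (z k)\<^sup>2)) (\<alpha> (N k) i) (\<beta> (N k) j)) \<longlonglongrightarrow> 0" by (rule L(1))
  show "(\<lambda>k. wform (N k) (\<lambda>c. s (N k) c / ((s (N k) c)\<^sup>2 - (z k)\<^sup>2)) (\<beta> (N k) i) (\<alpha> (N k) j)) \<longlonglongrightarrow> 0" by (rule L(2))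
qed

text \<open>The weights here and in the next lemma are the sum of squares and the product of the two
  preceding kernels; they come from the squared norms of the solved vectors.\<close>

lemma kernel2_even_limit:
  assumes ij: "i \<in> J" "j \<in> J"
  shows "(\<lambda>k. wform (N k) (\<lambda>c. ((s (N k) c)\<^sup>2 + (z k)\<^sup>2) / ((s (N k) c)\<^sup>2 - (z k)\<^sup>2)\<^sup>2) (\<alpha> (N k) i) (\<alpha> (N k) j)) \<longlonglongrightarrow> (if i = j then of_real (psi2 \<mu> z0) else 0)"
    and "(\<lambda>k. wform (N k) (\<lambda>c. ((s (N k) c)\<^sup>2 + (z k)\<^sup>2) / ((s (N k) c)\<^sup>2 - (z k)\<^sup>2)\<^sup>2) (\<beta> (N k) i) (\<beta> (N k) j)) \<longlonglongrightarrow> (if i = j then of_real (psi2 \<mu> z0) else 0)"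
proof -
  have c: "continuous_on ({0..z1} \<times> {0..1}) (\<lambda>(z, y). ((1 - y) * y + z\<^sup>2 * y\<^sup>2) * (ig z y)\<^sup>2)"
    unfolding case_prod_beta by (intro continuous_intros ig_cont)
  have f: "(t\<^sup>2 + z\<^sup>2) / (t\<^sup>2 - z\<^sup>2)\<^sup>2 = ((1 - 1 / (1 + t\<^sup>2)) * (1 / (1 + t\<^sup>2)) + z\<^sup>2 * (1 / (1 + t\<^sup>2))\<^sup>2) * (ig z (1 / (1 + t\<^sup>2)))\<^sup>2"
    if "0 \<le> z" "z \<le> z1" "c0 \<le> t" for z t
  proof -
    define w d where "w = 1 + t\<^sup>2" and "d = t\<^sup>2 - z\<^sup>2"
    have wd: "w \<noteq> 0" "d \<noteq> 0" "ig z (1 / w) = w / d" using ig_eq[OF that] by (auto simp: w_def d_def)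
    have "(1 - 1 / w) * (1 / w) + z\<^sup>2 * (1 / w)\<^sup>2 = (w - 1 + z\<^sup>2) / w\<^sup>2"
      using wd by (simp add: field_simps power2_eq_square)
    then have "((1 - 1 / w) * (1 / w) + z\<^sup>2 * (1 / w)\<^sup>2) * (ig z (1 / w))\<^sup>2 = (w - 1 + z\<^sup>2) / d\<^sup>2"
      using wd by (simp add: power_divide)
    then show ?thesis by (simp add: w_def d_def)
  qed
  have m: "(\<lambda>t. (t\<^sup>2 + z0\<^sup>2) / (t\<^sup>2 - z0\<^sup>2)\<^sup>2) \<in> borel_measurable borel" by measurable
  note L = even_limit[OF order(3) c N z(1) z_ev z0 order(5) f m ij]
  show "(\<lambda>k. wform (N k) (\<lambda>c. ((s (N k) c)\<^sup>2 + (z k)\<^sup>2) / ((s (N k) c)\<^sup>2 - (z k)\<^sup>2)\<^sup>2) (\<alpha> (N k) i) (\<alpha> (N k) j)) \<longlonglongrightarrow> (if i = j then of_real (psi2 \<mu> z0) else 0)"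
    using L(1) unfolding psi2_def .
  show "(\<lambda>k. wform (N k) (\<lambda>c. ((s (N k) c)\<^sup>2 + (z k)\<^sup>2) / ((s (N k) c)\<^sup>2 - (z k)\<^sup>2)\<^sup>2) (\<beta> (N k) i) (\<beta> (N k) j)) \<longlonglongrightarrow> (if i = j then of_real (psi2 \<mu> z0) else 0)"
    using L(2) unfolding psi2_def .
qed

lemma kernel2_odd_limit:
  assumes ij: "i \<in> J" "j \<in> J"
  shows "(\<lambda>k. wform (N k) (\<lambda>c. z k * s (N k) c / ((s (N k) c)\<^sup>2 - (z k)\<^sup>2)\<^sup>2) (\<alpha> (N k) i) (\<beta> (N k) j)) \<longlonglongrightarrow> 0"
    and "(\<lambda>k. wform (N k) (\<lambda>c. z k * s (N k) c / ((s (N k) c)\<^sup>2 - (z k)\<^sup>2)\<^sup>2) (\<beta> (N k) i) (\<alpha> (N k) j)) \<longlonglongrightarrow> 0"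
proof -
  have c: "continuous_on ({0..z1} \<times> {0..1}) (\<lambda>(z, y). z * y * (ig z y)\<^sup>2)"
    unfolding case_prod_beta by (intro continuous_intros ig_cont)
  have f: "z * t / (t\<^sup>2 - z\<^sup>2)\<^sup>2 = 1 / (1 + t\<^sup>2) * t * (z * (1 / (1 + t\<^sup>2)) * (ig z (1 / (1 + t\<^sup>2)))\<^sup>2)" if "0 \<le> z" "z \<le> z1" "c0 \<le> t" for z t
    using ig_eq[OF that] by (simp add: power_divide power2_eq_square[of "1 + t\<^sup>2"])
  note L = odd_limit[OF order(3) c N z(1) z_ev z0 order(5) f ij]
  show "(\<lambda>k. wform (N k) (\<lambda>c. z k * s (N k) c / ((s (N k) c)\<^sup>2 - (z k)\<^sup>2)\<^sup>2) (\<alpha> (N k) i) (\<beta> (N k) j)) \<longlonglongrightarrow> 0" by (rule L(1))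
  show "(\<lambda>k. wform (N k) (\<lambda>c. z k * s (N k) c / ((s (N k) c)\<^sup>2 - (z k)\<^sup>2)\<^sup>2) (\<beta> (N k) i) (\<alpha> (N k) j)) \<longlonglongrightarrow> 0" by (rule L(2))
qed

text \<open>Solving the singular vector equations for \<open>U\<close> and \<open>V\<close> and taking inner products gives a closed system for the overlaps.\<close>

context
  fixes I :: "nat set" and \<theta> :: "nat \<Rightarrow> real" and U V :: "nat \<Rightarrow> nat \<Rightarrow> 'a" and x y :: "nat \<Rightarrow> nat \<Rightarrow> 'a"
  assumes I: "finite I" "I \<subseteq> J"
    and x_def: "\<And>k i. x k i = ip {..<N k} (U k) (\<alpha> (N k) i)"
    and y_def: "\<And>k i. y k i = ip {..<N k} (V k) (\<beta> (N k) i)"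
    and eq1: "\<And>k c. c < N k \<Longrightarrow> of_real (s (N k) c) * V k c + (\<Sum>i\<in>I. of_real (\<theta> i) * y k i * \<alpha> (N k) i c) = of_real (z k) * U k c"
    and eq2: "\<And>k c. c < N k \<Longrightarrow> of_real (s (N k) c) * U k c + (\<Sum>i\<in>I. of_real (\<theta> i) * x k i * \<beta> (N k) i c) = of_real (z k) * V k c"
    and unit: "\<And>k. nsq {..<N k} (U k) = 1" "\<And>k. nsq {..<N k} (V k) = 1"
begin

private definition "A k c = (\<Sum>i\<in>I. (of_real (\<theta> i) * y k i) * \<alpha> (N k) i c)"
private definition "B k c = (\<Sum>i\<in>I. (of_real (\<theta> i) * x k i) * \<beta> (N k) i c)"

text \<open>For each \<open>c\<close> the two equations form a linear system in \<open>U k c\<close>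
  and \<open>V k c\<close> with determinant s^2 - z^2 up to sign; the formulas are Cramer's
  rule.\<close>

private lemma solved:
  assumes c: "c < N k" and gap: "(s (N k) c)\<^sup>2 - (z k)\<^sup>2 \<noteq> 0"
  shows "U k c = - (of_real (z k / ((s (N k) c)\<^sup>2 - (z k)\<^sup>2)) * A k c + of_real (s (N k) c / ((s (N k) c)\<^sup>2 - (z k)\<^sup>2)) * B k c)"
    and "V k c = - (of_real (s (N k) c / ((s (N k) c)\<^sup>2 - (z k)\<^sup>2)) * A k c + of_real (z k / ((s (N k) c)\<^sup>2 - (z k)\<^sup>2)) * B k c)"
proof -
  define S Z D where "S = (of_real (s (N k) c) :: 'a)" and "Z = (of_real (z k) :: 'a)" and "D = (of_real ((s (N k) c)\<^sup>2 - (z k)\<^sup>2) :: 'a)"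
  have e1: "S * V k c + A k c = Z * U k c" and e2: "S * U k c + B k c = Z * V k c"
    using eq1[OF c] eq2[OF c] by (simp_all add: S_def Z_def A_def B_def)
  have D: "D = S * S - Z * Z" "D \<noteq> 0"
    using gap by (auto simp: D_def S_def Z_def power2_eq_square simp flip: of_real_mult of_real_diff)
  have h1: "Z * (Z * U k c) = S * (Z * V k c) + Z * A k c"
    unfolding e1[symmetric] by (simp add: algebra_simps)
  have "S * (Z * V k c) = S * (S * U k c) + S * B k c"
    unfolding e2[symmetric] by (simp add: algebra_simps)
  then have h2: "S * (S * U k c) = S * (Z * V k c) - S * B k c" by simp
  have "D * U k c = S * (S * U k c) - Z * (Z * U k c)" unfolding D(1) by (simp add: algebra_simps)
  then have "D * U k c = - (Z * A k c + S * B k c)" unfolding h1 h2 by simp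
  then have "U k c = - (Z / D * A k c + S / D * B k c)" using D(2) by (simp add: field_simps)
  then show "U k c = - (of_real (z k / ((s (N k) c)\<^sup>2 - (z k)\<^sup>2)) * A k c + of_real (s (N k) c / ((s (N k) c)\<^sup>2 - (z k)\<^sup>2)) * B k c)"
    by (simp only: of_real_divide Z_def S_def D_def)
  have h1: "Z * (Z * V k c) = S * (Z * U k c) + Z * B k c"
    unfolding e2[symmetric] by (simp add: algebra_simps)
  have "S * (Z * U k c) = S * (S * V k c) + S * A k c"
    unfolding e1[symmetric] by (simp add: algebra_simps)
  then have h2: "S * (S * V k c) = S * (Z * U k c) - S * A k c" by simp
  have "D * V k c = S * (S * V k c) - Z * (Z * V k c)" unfolding D(1) by (simp add: algebra_simps)
  then have "D * V k c = - (S * A k c + Z * B k c)" unfolding h1 h2 by simp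
  then have "V k c = - (S / D * A k c + Z / D * B k c)" using D(2) by (simp add: field_simps)
  then show "V k c = - (of_real (s (N k) c / ((s (N k) c)\<^sup>2 - (z k)\<^sup>2)) * A k c + of_real (z k / ((s (N k) c)\<^sup>2 - (z k)\<^sup>2)) * B k c)"
    by (simp only: of_real_divide Z_def S_def D_def)
qed

private lemma ev_gap: "\<forall>\<^sub>F k in sequentially. \<forall>c<N k. (s (N k) c)\<^sup>2 - (z k)\<^sup>2 \<noteq> 0"
proof -
  have "\<forall>\<^sub>F k in sequentially. \<forall>c<N k. c0 < s (N k) c"
    using filterlim_iff[THEN iffD1, OF N] s_low[OF order(3)] by blast
  from this z_ev show ?thesis
  proof eventually_elim
    case (elim k)
    show ?case
    proof (intro allI impI)
      fix c assume "c < N k"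
      then have "z k < s (N k) c" using elim order by force
      then have "(z k)\<^sup>2 < (s (N k) c)\<^sup>2" using z(2) by (intro power_strict_mono) auto
      then show "(s (N k) c)\<^sup>2 - (z k)\<^sup>2 \<noteq> 0" by simp
    qed
  qed
qed

private lemma overlap_bounded:
  assumes "i \<in> I"
  shows "\<forall>\<^sub>F k in sequentially. norm (x k i) \<le> 2" "\<forall>\<^sub>F k in sequentially. norm (y k i) \<le> 2"
proof -
  have iJ: "i \<in> J" using assms I by auto
  have "\<forall>\<^sub>F k in sequentially. sqrt (nsq {..<N k} (\<alpha> (N k) i)) \<le> 2"
    using filterlim_iff[THEN iffD1, OF N] nsq_bounded(1)[OF iJ] by blast
  then show "\<forall>\<^sub>F k in sequentially. norm (x k i) \<le> 2"
  proof eventually_elim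
    case (elim k)
    have "norm (x k i) \<le> sqrt (nsq {..<N k} (U k)) * sqrt (nsq {..<N k} (\<alpha> (N k) i))"
      by (simp only: x_def norm_ip_le)
    then show ?case using elim by (simp add: unit)
  qed
  have "\<forall>\<^sub>F k in sequentially. sqrt (nsq {..<N k} (\<beta> (N k) i)) \<le> 2"
    using filterlim_iff[THEN iffD1, OF N] nsq_bounded(2)[OF iJ] by blast
  then show "\<forall>\<^sub>F k in sequentially. norm (y k i) \<le> 2"
  proof eventually_elim
    case (elim k)
    have "norm (y k i) \<le> sqrt (nsq {..<N k} (V k)) * sqrt (nsq {..<N k} (\<beta> (N k) i))"
      by (simp only: y_def norm_ip_le)
    then show ?case using elim by (simp add: unit)
  qed
qed

private lemma scaled_overlap_bounded:
  assumes "i \<in> I"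
  shows "\<forall>\<^sub>F k in sequentially. norm (of_real (\<theta> i) * x k i) \<le> 2 * (\<Sum>i\<in>I. \<bar>\<theta> i\<bar>)"
    "\<forall>\<^sub>F k in sequentially. norm (of_real (\<theta> i) * y k i) \<le> 2 * (\<Sum>i\<in>I. \<bar>\<theta> i\<bar>)"
proof -
  have le: "\<bar>\<theta> i\<bar> \<le> (\<Sum>i\<in>I. \<bar>\<theta> i\<bar>)" by (rule member_le_sum) (use assms I in auto)
  have *: "norm (of_real (\<theta> i) * w) \<le> 2 * (\<Sum>i\<in>I. \<bar>\<theta> i\<bar>)" if "norm w \<le> 2" for w :: 'a
    using mult_mono[OF le that] by (simp add: norm_mult mult.commute sum_nonneg)
  show "\<forall>\<^sub>F k in sequentially. norm (of_real (\<theta> i) * x k i) \<le> 2 * (\<Sum>i\<in>I. \<bar>\<theta> i\<bar>)"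
    using overlap_bounded(1)[OF assms] by eventually_elim (rule *)
  show "\<forall>\<^sub>F k in sequentially. norm (of_real (\<theta> i) * y k i) \<le> 2 * (\<Sum>i\<in>I. \<bar>\<theta> i\<bar>)"
    using overlap_bounded(2)[OF assms] by eventually_elim (rule *)
qed

text \<open>The solved vectors are paired with \<alpha> and \<beta>. The even kernel contributes
  only its diagonal limit, minus \<open>phi\<close>, the odd one contributes nothing, and
  boundedness of the overlaps keeps the errors null.\<close>

lemma overlap_relation:
  assumes j: "j \<in> I"
  shows "(\<lambda>k. x k j - of_real (phi \<mu> z0 * \<theta> j) * y k j) \<longlonglongrightarrow> 0"
    and "(\<lambda>k. y k j - of_real (phi \<mu> z0 * \<theta> j) * x k j) \<longlonglongrightarrow> 0"
proof -
  let ?e = "\<lambda>k c. z k / ((s (N k) c)\<^sup>2 - (z k)\<^sup>2)" and ?o = "\<lambda>k c. s (N k) c / ((s (N k) c)\<^sup>2 - (z k)\<^sup>2)"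
  have jJ: "j \<in> J" using I j by auto
  have null: "(\<lambda>k. \<Sum>i\<in>I. p k i * E k i) \<longlonglongrightarrow> 0"
    if "\<And>i. i \<in> I \<Longrightarrow> (\<lambda>k. E k i) \<longlonglongrightarrow> 0" "\<And>i. i \<in> I \<Longrightarrow> \<forall>\<^sub>F k in sequentially. norm (p k i) \<le> C" for E p :: "nat \<Rightarrow> nat \<Rightarrow> 'a" and C
  proof -
    have "(\<lambda>k. \<Sum>i\<in>I. p k i * E k i) \<longlonglongrightarrow> (\<Sum>i\<in>I. 0)"
      by (intro tendsto_sum lim_null_mult_left_bounded[OF that(2) that(1)])
    then show ?thesis by simp
  qed
  have diag: "(\<Sum>i\<in>I. p i * (if i = j then w else 0)) = p j * w" for p and w :: 'a
    using I(1) j by (simp add: if_distrib[of "\<lambda>x. _ * x"] cong: if_cong)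
  have lim1: "(\<lambda>k. (\<Sum>i\<in>I. (of_real (\<theta> i) * y k i) * (wform (N k) (?e k) (\<alpha> (N k) i) (\<alpha> (N k) j) - (if i = j then of_real (- phi \<mu> z0) else 0)))
     + (\<Sum>i\<in>I. (of_real (\<theta> i) * x k i) * wform (N k) (?o k) (\<beta> (N k) i) (\<alpha> (N k) j))) \<longlonglongrightarrow> 0 + 0"
    using I jJ by (intro tendsto_add null[OF _ scaled_overlap_bounded(2)] null[OF _ scaled_overlap_bounded(1)]
       LIM_zero kernel_even_limit(1) kernel_odd_limit(2)) auto
  have "\<forall>\<^sub>F k in sequentially. - ((\<Sum>i\<in>I. (of_real (\<theta> i) * y k i) * (wform (N k) (?e k) (\<alpha> (N k) i) (\<alpha> (N k) j) - (if i = j then of_real (- phi \<mu> z0) else 0)))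
     + (\<Sum>i\<in>I. (of_real (\<theta> i) * x k i) * wform (N k) (?o k) (\<beta> (N k) i) (\<alpha> (N k) j))) = x k j - of_real (phi \<mu> z0 * \<theta> j) * y k j"
    using ev_gap
  proof eventually_elim
    case (elim k)
    have xs: "x k j = (\<Sum>c<N k. U k c * conjugate (\<alpha> (N k) j c))" by (simp only: x_def ip_def)
    have "x k j = - (wform (N k) (?e k) (A k) (\<alpha> (N k) j) + wform (N k) (?o k) (B k) (\<alpha> (N k) j))"
      unfolding xs wform_def sum.distrib[symmetric] sum_negf[symmetric]
    proof (intro sum.cong refl)
      fix c assume "c \<in> {..<N k}"
      then have Uc: "U k c = - (of_real (?e k c) * A k c + of_real (?o k c) * B k c)" using elim by (intro solved(1)) auto
      show "U k c * conjugate (\<alpha> (N k) j c) = - (of_real (?e k c) * (A k c * conjugate (\<alpha> (N k) j c)) + of_real (?o k c) * (B k c * conjugate (\<alpha> (N k) j c)))"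
        unfolding Uc by (simp add: algebra_simps)
    qed
    then have "x k j = - ((\<Sum>i\<in>I. (of_real (\<theta> i) * y k i) * wform (N k) (?e k) (\<alpha> (N k) i) (\<alpha> (N k) j))
       + (\<Sum>i\<in>I. (of_real (\<theta> i) * x k i) * wform (N k) (?o k) (\<beta> (N k) i) (\<alpha> (N k) j)))"
      unfolding A_def[abs_def] B_def[abs_def] wform_sum_left[OF I(1)] .
    then show ?case
      unfolding right_diff_distrib sum_subtractf diag by (simp add: algebra_simps)
  qed
  from Lim_transform_eventually[OF tendsto_minus[OF lim1] this]
  show "(\<lambda>k. x k j - of_real (phi \<mu> z0 * \<theta> j) * y k j) \<longlonglongrightarrow> 0" by simp
  have lim2: "(\<lambda>k. (\<Sum>i\<in>I. (of_real (\<theta> i) * x k i) * (wform (N k) (?e k) (\<beta> (N k) i) (\<beta> (N k) j) - (if i = j then of_real (- phi \<mu> z0) else 0)))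
     + (\<Sum>i\<in>I. (of_real (\<theta> i) * y k i) * wform (N k) (?o k) (\<alpha> (N k) i) (\<beta> (N k) j))) \<longlonglongrightarrow> 0 + 0"
    using I jJ by (intro tendsto_add null[OF _ scaled_overlap_bounded(2)] null[OF _ scaled_overlap_bounded(1)]
       LIM_zero kernel_even_limit(2) kernel_odd_limit(1)) auto
  have "\<forall>\<^sub>F k in sequentially. - ((\<Sum>i\<in>I. (of_real (\<theta> i) * x k i) * (wform (N k) (?e k) (\<beta> (N k) i) (\<beta> (N k) j) - (if i = j then of_real (- phi \<mu> z0) else 0)))
     + (\<Sum>i\<in>I. (of_real (\<theta> i) * y k i) * wform (N k) (?o k) (\<alpha> (N k) i) (\<beta> (N k) j))) = y k j - of_real (phi \<mu> z0 * \<theta> j) * x k j"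
    using ev_gap
  proof eventually_elim
    case (elim k)
    have ys: "y k j = (\<Sum>c<N k. V k c * conjugate (\<beta> (N k) j c))" by (simp only: y_def ip_def)
    have "y k j = - (wform (N k) (?e k) (B k) (\<beta> (N k) j) + wform (N k) (?o k) (A k) (\<beta> (N k) j))"
      unfolding ys wform_def sum.distrib[symmetric] sum_negf[symmetric]
    proof (intro sum.cong refl)
      fix c assume "c \<in> {..<N k}"
      then have Vc: "V k c = - (of_real (?o k c) * A k c + of_real (?e k c) * B k c)" using elim by (intro solved(2)) auto
      show "V k c * conjugate (\<beta> (N k) j c) = - (of_real (?e k c) * (B k c * conjugate (\<beta> (N k) j c)) + of_real (?o k c) * (A k c * conjugate (\<beta> (N k) j c)))"
        unfolding Vc by (simp add: algebra_simps)
    qed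
    then have "y k j = - ((\<Sum>i\<in>I. (of_real (\<theta> i) * x k i) * wform (N k) (?e k) (\<beta> (N k) i) (\<beta> (N k) j))
       + (\<Sum>i\<in>I. (of_real (\<theta> i) * y k i) * wform (N k) (?o k) (\<alpha> (N k) i) (\<beta> (N k) j)))"
      unfolding A_def[abs_def] B_def[abs_def] wform_sum_left[OF I(1)] .
    then show ?case
      unfolding right_diff_distrib sum_subtractf diag by (simp add: algebra_simps)
  qed
  from Lim_transform_eventually[OF tendsto_minus[OF lim2] this]
  show "(\<lambda>k. y k j - of_real (phi \<mu> z0 * \<theta> j) * x k j) \<longlonglongrightarrow> 0" by simp
qed

text \<open>Adding the two unit norms symmetrises the weights: \<open>A\<close> and \<open>B\<close>
  both receive the sum of the squared kernels, whose limit is \<open>psi2\<close>, while the cross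
  terms carry an odd weight and vanish.\<close>

lemma overlap_normalization:
  "(\<lambda>k. psi2 \<mu> z0 * (\<Sum>i\<in>I. (\<theta> i)\<^sup>2 * ((norm (x k i))\<^sup>2 + (norm (y k i))\<^sup>2))) \<longlonglongrightarrow> 2"
proof -
  let ?e = "\<lambda>k c. ((s (N k) c)\<^sup>2 + (z k)\<^sup>2) / ((s (N k) c)\<^sup>2 - (z k)\<^sup>2)\<^sup>2" and ?o = "\<lambda>k c. z k * s (N k) c / ((s (N k) c)\<^sup>2 - (z k)\<^sup>2)\<^sup>2"
  let ?y = "\<lambda>k i. of_real (\<theta> i) * y k i" and ?x = "\<lambda>k i. of_real (\<theta> i) * x k i"
  let ?d = "\<lambda>i j. if i = j then of_real (psi2 \<mu> z0) else (0 :: 'a)"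
  define R where "R k =
      (\<Sum>i\<in>I. \<Sum>j\<in>I. ?y k i * (conjugate (?y k j) * (wform (N k) (?e k) (\<alpha> (N k) i) (\<alpha> (N k) j) - ?d i j)))
    + (\<Sum>i\<in>I. \<Sum>j\<in>I. ?x k i * (conjugate (?x k j) * (wform (N k) (?e k) (\<beta> (N k) i) (\<beta> (N k) j) - ?d i j)))
    + 2 * (\<Sum>i\<in>I. \<Sum>j\<in>I. ?y k i * (conjugate (?x k j) * wform (N k) (?o k) (\<alpha> (N k) i) (\<beta> (N k) j)))
    + 2 * (\<Sum>i\<in>I. \<Sum>j\<in>I. ?x k i * (conjugate (?y k j) * wform (N k) (?o k) (\<beta> (N k) i) (\<alpha> (N k) j)))" for k
  have cb: "\<forall>\<^sub>F k in sequentially. norm (conjugate (?x k i)) \<le> 2 * (\<Sum>i\<in>I. \<bar>\<theta> i\<bar>)" "\<forall>\<^sub>F k in sequentially. norm (conjugate (?y k i)) \<le> 2 * (\<Sum>i\<in>I. \<bar>\<theta> i\<bar>)"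
    if "i \<in> I" for i using scaled_overlap_bounded[OF that] by simp_all
  have "R \<longlonglongrightarrow> 0 + 0 + 2 * 0 + 2 * 0"
    unfolding R_def[abs_def] using I
    by (intro tendsto_add tendsto_mult tendsto_const bounded_double_sum_null[OF _ scaled_overlap_bounded(1) cb(1)]
        bounded_double_sum_null[OF _ scaled_overlap_bounded(1) cb(2)] bounded_double_sum_null[OF _ scaled_overlap_bounded(2) cb(1)]
        bounded_double_sum_null[OF _ scaled_overlap_bounded(2) cb(2)]
       LIM_zero kernel2_even_limit kernel2_odd_limit) auto
  then have R: "R \<longlonglongrightarrow> 0" by simp
  have diag: "(\<Sum>i\<in>I. \<Sum>j\<in>I. p i * (conjugate (p j) * ?d i j)) = of_real (psi2 \<mu> z0 * (\<Sum>i\<in>I. (norm (p i))\<^sup>2))" for p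
  proof -
    have "(\<Sum>j\<in>I. p i * (conjugate (p j) * ?d i j)) = of_real (psi2 \<mu> z0 * (norm (p i))\<^sup>2)" if "i \<in> I" for i
    proof -
      have "(\<Sum>j\<in>I. p i * (conjugate (p j) * ?d i j)) = (\<Sum>j\<in>I. if i = j then p i * (conjugate (p i) * of_real (psi2 \<mu> z0)) else 0)"
        by (intro sum.cong refl) auto
      also have "\<dots> = p i * conjugate (p i) * of_real (psi2 \<mu> z0)" using I(1) that by (simp add: mult.assoc)
      finally show ?thesis unfolding mult_conjugate by (simp add: mult.commute)
    qed
    then show ?thesis unfolding sum_distrib_left of_real_sum by (intro sum.cong refl) simp
  qed
  have "\<forall>\<^sub>F k in sequentially. of_real (2 - psi2 \<mu> z0 * (\<Sum>i\<in>I. (\<theta> i)\<^sup>2 * ((norm (x k i))\<^sup>2 + (norm (y k i))\<^sup>2))) = R k"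
    using ev_gap
  proof eventually_elim
    case (elim k)
    have "(of_real 2 :: 'a) = ip {..<N k} (U k) (U k) + ip {..<N k} (V k) (V k)"
      by (simp add: ip_self unit)
    also have "\<dots> = wform (N k) (?e k) (A k) (A k) + wform (N k) (?e k) (B k) (B k) + 2 * wform (N k) (?o k) (A k) (B k) + 2 * wform (N k) (?o k) (B k) (A k)"
      unfolding ip_def wform_def sum.distrib[symmetric] sum_distrib_left
    proof (intro sum.cong refl)
      fix c assume c: "c \<in> {..<N k}"
      define E F where "E = (of_real (z k / ((s (N k) c)\<^sup>2 - (z k)\<^sup>2)) :: 'a)" and "F = (of_real (s (N k) c / ((s (N k) c)\<^sup>2 - (z k)\<^sup>2)) :: 'a)"
      have cE: "conjugate E = E" "conjugate F = F" by (simp_all only: E_def F_def conjugate_of_real)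
      have Uc: "U k c = - (E * A k c + F * B k c)" and Vc: "V k c = - (F * A k c + E * B k c)"
        using solved[of c k] c elim by (auto simp: E_def F_def)
      have e: "of_real (?e k c) = E * E + F * F" and o: "of_real (?o k c) = E * F"
        unfolding E_def F_def of_real_mult[symmetric] of_real_add[symmetric]
        by (simp_all add: power2_eq_square add_divide_distrib mult.commute)
      show "U k c * conjugate (U k c) + V k c * conjugate (V k c) = of_real (?e k c) * (A k c * conjugate (A k c)) + of_real (?e k c) * (B k c * conjugate (B k c))
         + 2 * (of_real (?o k c) * (A k c * conjugate (B k c))) + 2 * (of_real (?o k c) * (B k c * conjugate (A k c)))"
        unfolding e o Uc Vc conjugate_neg conjugate_dist_add conjugate_dist_mul cE by (simp add: algebra_simps)
    qed
    also have "\<dots> = R k + (of_real (psi2 \<mu> z0 * (\<Sum>i\<in>I. (norm (?y k i))\<^sup>2)) + of_real (psi2 \<mu> z0 * (\<Sum>i\<in>I. (norm (?x k i))\<^sup>2)))"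
      unfolding A_def[abs_def] B_def[abs_def] wform_sum_left[OF I(1)] wform_sum_right[OF I(1)] R_def diag[symmetric]
      unfolding right_diff_distrib sum_subtractf sum_distrib_left by simp
    also have "of_real (psi2 \<mu> z0 * (\<Sum>i\<in>I. (norm (?y k i))\<^sup>2)) + of_real (psi2 \<mu> z0 * (\<Sum>i\<in>I. (norm (?x k i))\<^sup>2))
       = (of_real (psi2 \<mu> z0 * (\<Sum>i\<in>I. (\<theta> i)\<^sup>2 * ((norm (x k i))\<^sup>2 + (norm (y k i))\<^sup>2))) :: 'a)"
      unfolding of_real_add[symmetric] of_real_eq_iff
      by (simp add: norm_mult power_mult_distrib sum.distrib distrib_left)
    finally have *: "of_real 2 = R k + of_real (psi2 \<mu> z0 * (\<Sum>i\<in>I. (\<theta> i)\<^sup>2 * ((norm (x k i))\<^sup>2 + (norm (y k i))\<^sup>2)))" .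
    show ?case unfolding of_real_diff * by (simp only: add_diff_cancel_right')
  qed
  then have ev: "\<forall>\<^sub>F k in sequentially. R k = of_real (2 - psi2 \<mu> z0 * (\<Sum>i\<in>I. (\<theta> i)\<^sup>2 * ((norm (x k i))\<^sup>2 + (norm (y k i))\<^sup>2)))"
    by eventually_elim (rule sym)
  have "(\<lambda>k. of_real (2 - psi2 \<mu> z0 * (\<Sum>i\<in>I. (\<theta> i)\<^sup>2 * ((norm (x k i))\<^sup>2 + (norm (y k i))\<^sup>2))) :: 'a) \<longlonglongrightarrow> of_real 0"
    unfolding of_real_0 by (rule Lim_transform_eventually[OF R ev])
  then have "(\<lambda>k. 2 - psi2 \<mu> z0 * (\<Sum>i\<in>I. (\<theta> i)\<^sup>2 * ((norm (x k i))\<^sup>2 + (norm (y k i))\<^sup>2))) \<longlonglongrightarrow> 0"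
    unfolding tendsto_of_real_iff .
  from tendsto_diff[OF tendsto_const[of 2] this] show ?thesis by simp
qed

end

end

end

text \<open>The two relations form a linear system with determinant 1 - f^2, which is
  inverted.\<close>

lemma coupled_null_sequences:
  fixes p q :: "nat \<Rightarrow> 'a :: real_normed_field"
  assumes "(\<lambda>k. p k - of_real f * q k) \<longlonglongrightarrow> 0" "(\<lambda>k. q k - of_real f * p k) \<longlonglongrightarrow> 0" and f: "f * f \<noteq> 1"
  shows "p \<longlonglongrightarrow> 0"
proof -
  have "1 - f * f \<noteq> 0" using f by simp
  then have nz: "of_real (1 - f * f) \<noteq> (0 :: 'a)" unfolding of_real_eq_0_iff .
  have "(\<lambda>k. ((p k - of_real f * q k) + of_real f * (q k - of_real f * p k)) / of_real (1 - f * f)) \<longlonglongrightarrow> (0 + of_real f * 0) / of_real (1 - f * f)"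
    by (intro tendsto_intros assms nz)
  moreover have "((p k - of_real f * q k) + of_real f * (q k - of_real f * p k)) / of_real (1 - f * f) = p k" for k
    using nz by (simp add: field_simps)
  ultimately show ?thesis by simp
qed

section \<open>Kernels with two poles, and exclusion of small singular values\<close>

context limit_forms
begin

context
  fixes z w :: real
  assumes zw: "0 \<le> z" "z < a" "0 \<le> w" "w < a"
begin

private definition "zmax = max z w"
private definition "gap_point = (max z w + a) / 2"

private lemma gap_order: "0 \<le> zmax" "zmax < gap_point" "gap_point < a" "z \<le> zmax" "w \<le> zmax" "z < gap_point" "w < gap_point"
  using zw by (auto simp: zmax_def gap_point_def)

private definition inv_gap :: "real \<Rightarrow> real \<Rightarrow> real" where "inv_gap v y = 1 / (1 - (1 + v\<^sup>2) * min y (1 / (1 + gap_point\<^sup>2)))"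

private lemma inv_gap_cont:
  assumes "0 \<le> v" "v \<le> zmax"
  shows "continuous_on ({0..zmax} \<times> {0..1}) (\<lambda>p. inv_gap v (snd p))"
proof -
  have "continuous_on ({0..zmax} \<times> {0..1}) (\<lambda>p. (\<lambda>p. inv_gap (fst p) (snd p)) (v, snd p :: real))"
    unfolding inv_gap_def
    by (rule continuous_on_compose2[OF inverse_gap_continuous[OF gap_order(1,2)]]) (use assms in \<open>auto intro!: continuous_intros\<close>)
  then show ?thesis by simp
qed

private lemma inv_gap_eq:
  assumes "gap_point \<le> t"
  shows "inv_gap z (1 / (1 + t\<^sup>2)) = (1 + t\<^sup>2) / (t\<^sup>2 - z\<^sup>2)" "inv_gap w (1 / (1 + t\<^sup>2)) = (1 + t\<^sup>2) / (t\<^sup>2 - w\<^sup>2)"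
    "t\<^sup>2 - z\<^sup>2 \<noteq> 0" "t\<^sup>2 - w\<^sup>2 \<noteq> 0" "1 + t\<^sup>2 \<noteq> 0"
proof -
  show "inv_gap z (1 / (1 + t\<^sup>2)) = (1 + t\<^sup>2) / (t\<^sup>2 - z\<^sup>2)" "t\<^sup>2 - z\<^sup>2 \<noteq> 0"
    using inverse_gap_eq[OF zw(1) gap_order(6) assms] by (simp_all add: inv_gap_def)
  show "inv_gap w (1 / (1 + t\<^sup>2)) = (1 + t\<^sup>2) / (t\<^sup>2 - w\<^sup>2)" "t\<^sup>2 - w\<^sup>2 \<noteq> 0"
    using inverse_gap_eq[OF zw(3) gap_order(7) assms] by (simp_all add: inv_gap_def)
  have "0 < 1 + t\<^sup>2" by (simp add: add_pos_nonneg)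
  then show "1 + t\<^sup>2 \<noteq> 0" by simp
qed

private lemma const_zz: "(\<lambda>k :: nat. z) \<longlonglongrightarrow> z" "\<forall>\<^sub>F k in sequentially. 0 \<le> z \<and> z \<le> zmax" "0 \<le> z" "z \<le> zmax"
  using zw gap_order by auto

text \<open>Two poles occur because test vectors belonging to different roots are paired. Both are
  fixed here, so \<open>even_limit\<close> is applied with a constant sequence and its moving
  argument is a dummy.\<close>

lemma pair_even_limit:
  assumes ij: "i \<in> J" "j \<in> J"
  shows "(\<lambda>n. wform n (\<lambda>c. (s n c)\<^sup>2 / (((s n c)\<^sup>2 - z\<^sup>2) * ((s n c)\<^sup>2 - w\<^sup>2))) (\<alpha> n i) (\<alpha> n j)) \<longlonglongrightarrow> (if i = j then of_real (\<integral>t. t\<^sup>2 / ((t\<^sup>2 - z\<^sup>2) * (t\<^sup>2 - w\<^sup>2)) \<partial>\<mu>) else 0)"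
    and "(\<lambda>n. wform n (\<lambda>c. (s n c)\<^sup>2 / (((s n c)\<^sup>2 - z\<^sup>2) * ((s n c)\<^sup>2 - w\<^sup>2))) (\<beta> n i) (\<beta> n j)) \<longlonglongrightarrow> (if i = j then of_real (\<integral>t. t\<^sup>2 / ((t\<^sup>2 - z\<^sup>2) * (t\<^sup>2 - w\<^sup>2)) \<partial>\<mu>) else 0)"
proof -
  have c: "continuous_on ({0..zmax} \<times> {0..1}) (\<lambda>(v :: real, y). (1 - y) * y * inv_gap z y * inv_gap w y)"
    unfolding case_prod_beta by (intro continuous_intros inv_gap_cont) (use zw gap_order in auto)
  have f: "t\<^sup>2 / ((t\<^sup>2 - z\<^sup>2) * (t\<^sup>2 - w\<^sup>2)) = (1 - 1 / (1 + t\<^sup>2)) * (1 / (1 + t\<^sup>2)) * inv_gap z (1 / (1 + t\<^sup>2)) * inv_gap w (1 / (1 + t\<^sup>2))"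
    if "0 \<le> v" "v \<le> zmax" "gap_point \<le> t" for v t :: real
  proof -
    define W where "W = 1 + t\<^sup>2"
    have W: "W \<noteq> 0" "1 - 1 / W = t\<^sup>2 / W" using inv_gap_eq(5)[OF that(3)] by (auto simp: W_def field_simps)
    show ?thesis unfolding inv_gap_eq(1,2)[OF that(3)] unfolding W_def[symmetric] W(2) using W(1) by simp
  qed
  have m: "(\<lambda>t. t\<^sup>2 / ((t\<^sup>2 - z\<^sup>2) * (t\<^sup>2 - w\<^sup>2))) \<in> borel_measurable borel" by measurable
  note L = even_limit[where N = "\<lambda>n. n" and f = "\<lambda>_ t. t\<^sup>2 / ((t\<^sup>2 - z\<^sup>2) * (t\<^sup>2 - w\<^sup>2))", OF gap_order(3) c filterlim_ident const_zz f m ij]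
  show "(\<lambda>n. wform n (\<lambda>c. (s n c)\<^sup>2 / (((s n c)\<^sup>2 - z\<^sup>2) * ((s n c)\<^sup>2 - w\<^sup>2))) (\<alpha> n i) (\<alpha> n j)) \<longlonglongrightarrow> (if i = j then of_real (\<integral>t. t\<^sup>2 / ((t\<^sup>2 - z\<^sup>2) * (t\<^sup>2 - w\<^sup>2)) \<partial>\<mu>) else 0)"
    by (rule L(1))
  show "(\<lambda>n. wform n (\<lambda>c. (s n c)\<^sup>2 / (((s n c)\<^sup>2 - z\<^sup>2) * ((s n c)\<^sup>2 - w\<^sup>2))) (\<beta> n i) (\<beta> n j)) \<longlonglongrightarrow> (if i = j then of_real (\<integral>t. t\<^sup>2 / ((t\<^sup>2 - z\<^sup>2) * (t\<^sup>2 - w\<^sup>2)) \<partial>\<mu>) else 0)"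
    by (rule L(2))
qed

lemma pair_inverse_limit:
  assumes ij: "i \<in> J" "j \<in> J"
  shows "(\<lambda>n. wform n (\<lambda>c. 1 / (((s n c)\<^sup>2 - z\<^sup>2) * ((s n c)\<^sup>2 - w\<^sup>2))) (\<alpha> n i) (\<alpha> n j)) \<longlonglongrightarrow> (if i = j then of_real (\<integral>t. 1 / ((t\<^sup>2 - z\<^sup>2) * (t\<^sup>2 - w\<^sup>2)) \<partial>\<mu>) else 0)"
    and "(\<lambda>n. wform n (\<lambda>c. 1 / (((s n c)\<^sup>2 - z\<^sup>2) * ((s n c)\<^sup>2 - w\<^sup>2))) (\<beta> n i) (\<beta> n j)) \<longlonglongrightarrow> (if i = j then of_real (\<integral>t. 1 / ((t\<^sup>2 - z\<^sup>2) * (t\<^sup>2 - w\<^sup>2)) \<partial>\<mu>) else 0)"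
proof -
  have c: "continuous_on ({0..zmax} \<times> {0..1}) (\<lambda>(v :: real, y). y * y * inv_gap z y * inv_gap w y)"
    unfolding case_prod_beta by (intro continuous_intros inv_gap_cont) (use zw gap_order in auto)
  have f: "1 / ((t\<^sup>2 - z\<^sup>2) * (t\<^sup>2 - w\<^sup>2)) = (1 / (1 + t\<^sup>2)) * (1 / (1 + t\<^sup>2)) * inv_gap z (1 / (1 + t\<^sup>2)) * inv_gap w (1 / (1 + t\<^sup>2))"
    if "0 \<le> v" "v \<le> zmax" "gap_point \<le> t" for v t :: real
    unfolding inv_gap_eq(1,2)[OF that(3)] using inv_gap_eq(5)[OF that(3)] by simp
  have m: "(\<lambda>t. 1 / ((t\<^sup>2 - z\<^sup>2) * (t\<^sup>2 - w\<^sup>2))) \<in> borel_measurable borel" by measurable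
  note L = even_limit[where N = "\<lambda>n. n" and f = "\<lambda>_ t. 1 / ((t\<^sup>2 - z\<^sup>2) * (t\<^sup>2 - w\<^sup>2))", OF gap_order(3) c filterlim_ident const_zz f m ij]
  show "(\<lambda>n. wform n (\<lambda>c. 1 / (((s n c)\<^sup>2 - z\<^sup>2) * ((s n c)\<^sup>2 - w\<^sup>2))) (\<alpha> n i) (\<alpha> n j)) \<longlonglongrightarrow> (if i = j then of_real (\<integral>t. 1 / ((t\<^sup>2 - z\<^sup>2) * (t\<^sup>2 - w\<^sup>2)) \<partial>\<mu>) else 0)"
    by (rule L(1))
  show "(\<lambda>n. wform n (\<lambda>c. 1 / (((s n c)\<^sup>2 - z\<^sup>2) * ((s n c)\<^sup>2 - w\<^sup>2))) (\<beta> n i) (\<beta> n j)) \<longlonglongrightarrow> (if i = j then of_real (\<integral>t. 1 / ((t\<^sup>2 - z\<^sup>2) * (t\<^sup>2 - w\<^sup>2)) \<partial>\<mu>) else 0)"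
    by (rule L(2))
qed

lemma pair_odd_limit:
  assumes ij: "i \<in> J" "j \<in> J"
  shows "(\<lambda>n. wform n (\<lambda>c. s n c / (((s n c)\<^sup>2 - z\<^sup>2) * ((s n c)\<^sup>2 - w\<^sup>2))) (\<alpha> n i) (\<beta> n j)) \<longlonglongrightarrow> 0"
    and "(\<lambda>n. wform n (\<lambda>c. s n c / (((s n c)\<^sup>2 - z\<^sup>2) * ((s n c)\<^sup>2 - w\<^sup>2))) (\<beta> n i) (\<alpha> n j)) \<longlonglongrightarrow> 0"
proof -
  have c: "continuous_on ({0..zmax} \<times> {0..1}) (\<lambda>(v :: real, y). y * inv_gap z y * inv_gap w y)"
    unfolding case_prod_beta by (intro continuous_intros inv_gap_cont) (use zw gap_order in auto)
  have f: "t / ((t\<^sup>2 - z\<^sup>2) * (t\<^sup>2 - w\<^sup>2)) = 1 / (1 + t\<^sup>2) * t * (1 / (1 + t\<^sup>2) * inv_gap z (1 / (1 + t\<^sup>2)) * inv_gap w (1 / (1 + t\<^sup>2)))"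
    if "0 \<le> v" "v \<le> zmax" "gap_point \<le> t" for v t :: real
    unfolding inv_gap_eq(1,2)[OF that(3)] using inv_gap_eq(5)[OF that(3)] by simp
  note L = odd_limit[where N = "\<lambda>n. n" and f = "\<lambda>_ t. t / ((t\<^sup>2 - z\<^sup>2) * (t\<^sup>2 - w\<^sup>2))", OF gap_order(3) c filterlim_ident const_zz f ij]
  show "(\<lambda>n. wform n (\<lambda>c. s n c / (((s n c)\<^sup>2 - z\<^sup>2) * ((s n c)\<^sup>2 - w\<^sup>2))) (\<alpha> n i) (\<beta> n j)) \<longlonglongrightarrow> 0" by (rule L(1))
  show "(\<lambda>n. wform n (\<lambda>c. s n c / (((s n c)\<^sup>2 - z\<^sup>2) * ((s n c)\<^sup>2 - w\<^sup>2))) (\<beta> n i) (\<alpha> n j)) \<longlonglongrightarrow> 0" by (rule L(2))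
qed

end

text \<open>Otherwise a subsequence of \<tau> converges to some l \<le> z1. There \<theta> j |phi l|
  < 1, so the coupled relations force all overlaps to 0, against the normalisation, whose limit is
  2.\<close>

lemma no_small_singular_value:
  fixes \<theta> :: "nat \<Rightarrow> real" and U V :: "nat \<Rightarrow> nat \<Rightarrow> 'a"
  assumes I: "finite I" "I \<subseteq> J" and \<theta>: "\<And>i. i \<in> I \<Longrightarrow> 0 < \<theta> i" and z1: "0 \<le> z1" "z1 < a"
    and sub: "\<And>i. i \<in> I \<Longrightarrow> \<theta> i * - phi \<mu> z1 < 1"
    and \<tau>: "\<And>n. 0 \<le> \<tau> n"
    and eq1: "\<And>n c. c < n \<Longrightarrow> of_real (s n c) * V n c + (\<Sum>i\<in>I. of_real (\<theta> i) * ip {..<n} (V n) (\<beta> n i) * \<alpha> n i c) = of_real (\<tau> n) * U n c"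
    and eq2: "\<And>n c. c < n \<Longrightarrow> of_real (s n c) * U n c + (\<Sum>i\<in>I. of_real (\<theta> i) * ip {..<n} (U n) (\<alpha> n i) * \<beta> n i c) = of_real (\<tau> n) * V n c"
    and unit: "\<And>n. 0 < n \<Longrightarrow> nsq {..<n} (U n) = 1" "\<And>n. 0 < n \<Longrightarrow> nsq {..<n} (V n) = 1"
  shows "\<forall>\<^sub>F n in sequentially. z1 < \<tau> n"
proof (rule ccontr)
  assume neg: "\<not> ?thesis"
  have "infinite {n. 0 < n \<and> \<tau> n \<le> z1}"
    unfolding infinite_nat_iff_unbounded_le
  proof
    fix m
    from neg obtain n where "n \<ge> Suc m" "\<not> z1 < \<tau> n" unfolding eventually_sequentially by blast
    then show "\<exists>n\<ge>m. n \<in> {n. 0 < n \<and> \<tau> n \<le> z1}" by (intro exI[of _ n]) auto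
  qed
  from infinite_enumerate[OF this] obtain r :: "nat \<Rightarrow> nat" where r: "strict_mono r" "\<And>k. r k \<in> {n. 0 < n \<and> \<tau> n \<le> z1}"
    by blast
  have "seq_compact {0..z1}" by (rule compact_imp_seq_compact[OF compact_Icc])
  then have "\<exists>l\<in>{0..z1}. \<exists>r' :: nat \<Rightarrow> nat. strict_mono r' \<and> ((\<tau> \<circ> r) \<circ> r') \<longlonglongrightarrow> l"
    unfolding seq_compact_def by (elim allE[of _ "\<tau> \<circ> r"]) (use r(2) \<tau> in auto)
  then obtain l and r' :: "nat \<Rightarrow> nat" where l: "l \<in> {0..z1}" "strict_mono r'" "((\<tau> \<circ> r) \<circ> r') \<longlonglongrightarrow> l" by blast
  define N where "N = r \<circ> r'"
  have N: "filterlim N at_top sequentially"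
    unfolding N_def by (intro filterlim_subseq strict_mono_o r l)
  have Npos: "0 < N k" for k using r(2) by (simp add: N_def)
  have lim: "(\<lambda>k. \<tau> (N k)) \<longlonglongrightarrow> l" using l(3) by (simp add: N_def comp_def)
  have la: "l < a" using l(1) z1 by simp
  let ?x = "\<lambda>k i. ip {..<N k} (U (N k)) (\<alpha> (N k) i)" and ?y = "\<lambda>k i. ip {..<N k} (V (N k)) (\<beta> (N k) i)"
  have R: "(\<lambda>k. ?x k j - of_real (phi \<mu> l * \<theta> j) * ?y k j) \<longlonglongrightarrow> 0"
      "(\<lambda>k. ?y k j - of_real (phi \<mu> l * \<theta> j) * ?x k j) \<longlonglongrightarrow> 0" if "j \<in> I" for j
    by (rule overlap_relation[where U = "\<lambda>k. U (N k)" and V = "\<lambda>k. V (N k)" and x = ?x and y = ?y and \<theta> = \<theta>,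
          OF N lim \<tau> la I refl refl _ _ unit(1)[OF Npos] unit(2)[OF Npos] that]; erule eq1 eq2)+
  have S: "(\<lambda>k. psi2 \<mu> l * (\<Sum>i\<in>I. (\<theta> i)\<^sup>2 * ((norm (?x k i))\<^sup>2 + (norm (?y k i))\<^sup>2))) \<longlonglongrightarrow> 2"
    by (rule overlap_normalization[where U = "\<lambda>k. U (N k)" and V = "\<lambda>k. V (N k)" and x = ?x and y = ?y and \<theta> = \<theta>,
          OF N lim \<tau> la I refl refl _ _ unit(1)[OF Npos] unit(2)[OF Npos]]; erule eq1 eq2)
  have zero: "(\<lambda>k. ?x k j) \<longlonglongrightarrow> 0 \<and> (\<lambda>k. ?y k j) \<longlonglongrightarrow> 0" if j: "j \<in> I" for j
  proof -
    define f where "f = phi \<mu> l * \<theta> j"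
    have "phi \<mu> z1 \<le> phi \<mu> l"
      using l(1) z1 a_pos phi_strict_decreasing[of l z1] by (cases "l = z1") auto
    then have "\<theta> j * - phi \<mu> l \<le> \<theta> j * - phi \<mu> z1" using \<theta>[OF j] by (intro mult_left_mono) auto
    then have f1: "- f < 1" using sub[OF j] by (simp add: f_def mult.commute)
    have f0: "f \<le> 0" using phi_nonpos[of l] l(1) la \<theta>[OF j] by (simp add: f_def mult_nonpos_nonneg)
    have "f * f < 1" using f1 f0 by (smt (verit, best) mult_le_cancel_left1 mult_minus_left mult_minus_right)
    then show ?thesis
      using coupled_null_sequences[OF R(1)[OF j, folded f_def] R(2)[OF j, folded f_def]]
        coupled_null_sequences[OF R(2)[OF j, folded f_def] R(1)[OF j, folded f_def]] by simp
  qed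
  have "(\<lambda>k. psi2 \<mu> l * (\<Sum>i\<in>I. (\<theta> i)\<^sup>2 * ((norm (?x k i))\<^sup>2 + (norm (?y k i))\<^sup>2))) \<longlonglongrightarrow> psi2 \<mu> l * (\<Sum>i\<in>I. (\<theta> i)\<^sup>2 * ((norm (0 :: 'a))\<^sup>2 + (norm (0 :: 'a))\<^sup>2))"
    by (intro tendsto_intros conjunct1[OF zero] conjunct2[OF zero])
  from LIMSEQ_unique[OF S this] show False by simp
qed

end

section \<open>Test vectors\<close>

context limit_forms
begin

text \<open>The vectors \<open>left_test\<close>, \<open>right_test\<close> are approximate singular vectors of the perturbed matrix for the singular value \<open>\<rho> i\<close>.\<close>

definition left_test :: "(nat \<Rightarrow> real) \<Rightarrow> nat \<Rightarrow> nat \<Rightarrow> nat \<Rightarrow> 'a" where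
  "left_test \<rho> n i c = of_real (\<rho> i / ((s n c)\<^sup>2 - (\<rho> i)\<^sup>2)) * \<alpha> n i c - of_real (s n c / ((s n c)\<^sup>2 - (\<rho> i)\<^sup>2)) * \<beta> n i c"

definition right_test :: "(nat \<Rightarrow> real) \<Rightarrow> nat \<Rightarrow> nat \<Rightarrow> nat \<Rightarrow> 'a" where
  "right_test \<rho> n i c = of_real (s n c / ((s n c)\<^sup>2 - (\<rho> i)\<^sup>2)) * \<alpha> n i c - of_real (\<rho> i / ((s n c)\<^sup>2 - (\<rho> i)\<^sup>2)) * \<beta> n i c"

context
  fixes I :: "nat set" and \<rho> \<theta> :: "nat \<Rightarrow> real" and \<rho>0 :: real
  assumes J: "finite J" and I: "I \<subseteq> J" "I \<noteq> {}"
    and \<rho>: "\<And>i. i \<in> I \<Longrightarrow> 0 \<le> \<rho> i" "\<And>i. i \<in> I \<Longrightarrow> \<rho> i < a" "\<And>i. i \<in> I \<Longrightarrow> \<rho> i \<le> \<rho>0"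
    and root: "\<And>i. i \<in> I \<Longrightarrow> \<theta> i * phi \<mu> (\<rho> i) = -1"
begin

private lemma fin: "finite I" using J I finite_subset by blast

private lemma psi2_split: "psi2 \<mu> (\<rho> i) = (\<integral>t. t\<^sup>2 / ((t\<^sup>2 - (\<rho> i)\<^sup>2) * (t\<^sup>2 - (\<rho> i)\<^sup>2)) \<partial>\<mu>) + \<rho> i * \<rho> i * (\<integral>t. 1 / ((t\<^sup>2 - (\<rho> i)\<^sup>2) * (t\<^sup>2 - (\<rho> i)\<^sup>2)) \<partial>\<mu>)"
  if "i \<in> I" for i
proof -
  have z: "\<bar>\<rho> i\<bar> < a" using \<rho>(1,2)[OF that] by simp
  have b: "\<bar>0 :: real\<bar> < a" using a_pos by simp
  define \<delta> where "\<delta> = (1 - (\<rho> i / a)\<^sup>2) * a\<^sup>2"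
  have \<delta>: "0 < \<delta>" using gap_const[of "\<rho> i" "\<rho> i"] z \<rho>(1)[OF that] a_pos by (simp add: \<delta>_def)
  have inv: "integrable \<mu> (\<lambda>t. 1 / ((t\<^sup>2 - (\<rho> i)\<^sup>2) * (t\<^sup>2 - (\<rho> i)\<^sup>2)))"
  proof (rule integrable_const_bound[where B = "1 / (\<delta> * \<delta>)"])
    show "AE t in \<mu>. norm (1 / ((t\<^sup>2 - (\<rho> i)\<^sup>2) * (t\<^sup>2 - (\<rho> i)\<^sup>2))) \<le> 1 / (\<delta> * \<delta>)"
      using supp
    proof eventually_elim
      case (elim t)
      have "\<delta> \<le> (1 - (\<rho> i / a)\<^sup>2) * t\<^sup>2"
        unfolding \<delta>_def using gap_const[of "\<rho> i" "\<rho> i"] z \<rho>(1)[OF that] elim a_pos by (intro mult_left_mono power_mono) auto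
      also have "\<dots> \<le> t\<^sup>2 - (\<rho> i)\<^sup>2" using z \<rho>(1)[OF that] elim by (intro gap) auto
      finally have "\<delta> * \<delta> \<le> (t\<^sup>2 - (\<rho> i)\<^sup>2) * (t\<^sup>2 - (\<rho> i)\<^sup>2)" using \<delta> by (intro mult_mono) auto
      then show ?case using \<delta> by (simp add: frac_le)
    qed
  qed simp
  have all: "integrable \<mu> (\<lambda>t. (t\<^sup>2 + \<rho> i * \<rho> i) / ((t\<^sup>2 - (\<rho> i)\<^sup>2) * (t\<^sup>2 - (\<rho> i)\<^sup>2)))" by (rule ratio_integrable[OF z z])
  have "(\<lambda>t. t\<^sup>2 / ((t\<^sup>2 - (\<rho> i)\<^sup>2) * (t\<^sup>2 - (\<rho> i)\<^sup>2))) =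
     (\<lambda>t. (t\<^sup>2 + \<rho> i * \<rho> i) / ((t\<^sup>2 - (\<rho> i)\<^sup>2) * (t\<^sup>2 - (\<rho> i)\<^sup>2)) - \<rho> i * \<rho> i * (1 / ((t\<^sup>2 - (\<rho> i)\<^sup>2) * (t\<^sup>2 - (\<rho> i)\<^sup>2))))"
    by (simp add: fun_eq_iff add_divide_distrib)
  then have "(\<integral>t. t\<^sup>2 / ((t\<^sup>2 - (\<rho> i)\<^sup>2) * (t\<^sup>2 - (\<rho> i)\<^sup>2)) \<partial>\<mu>) =
     (\<integral>t. (t\<^sup>2 + \<rho> i * \<rho> i) / ((t\<^sup>2 - (\<rho> i)\<^sup>2) * (t\<^sup>2 - (\<rho> i)\<^sup>2)) \<partial>\<mu>) - \<rho> i * \<rho> i * (\<integral>t. 1 / ((t\<^sup>2 - (\<rho> i)\<^sup>2) * (t\<^sup>2 - (\<rho> i)\<^sup>2)) \<partial>\<mu>)"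
    using inv all by (simp only: Bochner_Integration.integral_diff integrable_mult_right integral_mult_right_zero)
  then show ?thesis by (simp add: psi2_def power2_eq_square)
qed

text \<open>Asymptotic orthogonality is inherited from the weighted forms; on the diagonal the two
  even kernels add up to \<open>psi2\<close> by \<open>psi2_split\<close>.\<close>

private lemma gram_tests:
  assumes ij: "i \<in> I" "j \<in> I"
  shows "(\<lambda>n. ip {..<n} (left_test \<rho> n i) (left_test \<rho> n j)) \<longlonglongrightarrow> (if i = j then of_real (psi2 \<mu> (\<rho> i)) else 0)"
    and "(\<lambda>n. ip {..<n} (right_test \<rho> n i) (right_test \<rho> n j)) \<longlonglongrightarrow> (if i = j then of_real (psi2 \<mu> (\<rho> i)) else 0)"
proof -
  have J: "i \<in> J" "j \<in> J" using ij I by auto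
  let ?d = "\<lambda>n c. ((s n c)\<^sup>2 - (\<rho> i)\<^sup>2) * ((s n c)\<^sup>2 - (\<rho> j)\<^sup>2)"
  note z = \<rho>(1,2)[OF ij(1)] \<rho>(1,2)[OF ij(2)]
  note E = pair_even_limit[OF z J] and V = pair_inverse_limit[OF z J] and O = pair_odd_limit[OF z J]
  have L: "ip {..<n} (left_test \<rho> n i) (left_test \<rho> n j) = of_real (\<rho> i * \<rho> j) * wform n (\<lambda>c. 1 / ?d n c) (\<alpha> n i) (\<alpha> n j)
      + wform n (\<lambda>c. (s n c)\<^sup>2 / ?d n c) (\<beta> n i) (\<beta> n j) - of_real (\<rho> i) * wform n (\<lambda>c. s n c / ?d n c) (\<alpha> n i) (\<beta> n j)
      - of_real (\<rho> j) * wform n (\<lambda>c. s n c / ?d n c) (\<beta> n i) (\<alpha> n j)" for n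
    unfolding ip_def wform_def left_test_def sum_distrib_left sum.distrib[symmetric] sum_subtractf[symmetric]
    by (intro sum.cong refl) (simp add: conjugate_diff conjugate_dist_mul power2_eq_square algebra_simps del: of_real_divide of_real_power flip: of_real_mult, simp add: algebra_simps power2_eq_square)
  have R: "ip {..<n} (right_test \<rho> n i) (right_test \<rho> n j) = of_real (\<rho> i * \<rho> j) * wform n (\<lambda>c. 1 / ?d n c) (\<beta> n i) (\<beta> n j)
      + wform n (\<lambda>c. (s n c)\<^sup>2 / ?d n c) (\<alpha> n i) (\<alpha> n j) - of_real (\<rho> j) * wform n (\<lambda>c. s n c / ?d n c) (\<alpha> n i) (\<beta> n j)
      - of_real (\<rho> i) * wform n (\<lambda>c. s n c / ?d n c) (\<beta> n i) (\<alpha> n j)" for n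
    unfolding ip_def wform_def right_test_def sum_distrib_left sum.distrib[symmetric] sum_subtractf[symmetric]
    by (intro sum.cong refl) (simp add: conjugate_diff conjugate_dist_mul power2_eq_square algebra_simps del: of_real_divide of_real_power flip: of_real_mult, simp add: algebra_simps power2_eq_square)
  let ?e = "if i = j then of_real (\<integral>t. t\<^sup>2 / ((t\<^sup>2 - (\<rho> i)\<^sup>2) * (t\<^sup>2 - (\<rho> j)\<^sup>2)) \<partial>\<mu>) else (0 :: 'a)"
  let ?v = "if i = j then of_real (\<integral>t. 1 / ((t\<^sup>2 - (\<rho> i)\<^sup>2) * (t\<^sup>2 - (\<rho> j)\<^sup>2)) \<partial>\<mu>) else (0 :: 'a)"
  have lim: "of_real (\<rho> i * \<rho> j) * ?v + ?e - of_real r * 0 - of_real r' * 0 = (if i = j then of_real (psi2 \<mu> (\<rho> i)) else 0)" for r r' :: real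
    using psi2_split[OF ij(1)] by (cases "i = j") (simp_all add: add.commute)
  show "(\<lambda>n. ip {..<n} (left_test \<rho> n i) (left_test \<rho> n j)) \<longlonglongrightarrow> (if i = j then of_real (psi2 \<mu> (\<rho> i)) else 0)"
    unfolding L lim[of "\<rho> i" "\<rho> j", symmetric] by (intro tendsto_diff tendsto_add tendsto_mult tendsto_const E V O)
  show "(\<lambda>n. ip {..<n} (right_test \<rho> n i) (right_test \<rho> n j)) \<longlonglongrightarrow> (if i = j then of_real (psi2 \<mu> (\<rho> i)) else 0)"
    unfolding R lim[of "\<rho> j" "\<rho> i", symmetric] by (intro tendsto_diff tendsto_add tendsto_mult tendsto_const E V O)
qed

text \<open>The root equation enters here. Multiplying \<open>right_test\<close> by s leaves an
  extra \<alpha> of the same index, and this limit says that the low-rank term cancels it.\<close>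

private lemma cross_test:
  assumes ij: "i \<in> I" "j \<in> J"
  shows "(\<lambda>n. of_real (\<theta> i) * ip {..<n} (right_test \<rho> n i) (\<beta> n j) + (if i = j then 1 else 0)) \<longlonglongrightarrow> 0"
proof -
  have iJ: "i \<in> J" using ij I by auto
  have c: "(\<lambda>k :: nat. \<rho> i) \<longlonglongrightarrow> \<rho> i" by simp
  have R: "ip {..<n} (right_test \<rho> n i) (\<beta> n j) = wform n (\<lambda>c. s n c / ((s n c)\<^sup>2 - (\<rho> i)\<^sup>2)) (\<alpha> n i) (\<beta> n j)
     - wform n (\<lambda>c. \<rho> i / ((s n c)\<^sup>2 - (\<rho> i)\<^sup>2)) (\<beta> n i) (\<beta> n j)" for n
    unfolding ip_def wform_def right_test_def sum_subtractf[symmetric] by (intro sum.cong refl) (simp add: algebra_simps)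
  have "(\<lambda>n. of_real (\<theta> i) * ip {..<n} (right_test \<rho> n i) (\<beta> n j) + (if i = j then 1 else 0))
    \<longlonglongrightarrow> of_real (\<theta> i) * (0 - (if i = j then of_real (- phi \<mu> (\<rho> i)) else 0)) + (if i = j then 1 else 0)"
    unfolding R using kernel_odd_limit(1)[OF filterlim_ident c \<rho>(1,2)[OF ij(1)] iJ ij(2)] kernel_even_limit(2)[OF filterlim_ident c \<rho>(1,2)[OF ij(1)] iJ ij(2)]
    by (intro tendsto_add tendsto_mult tendsto_diff tendsto_const)
  moreover have "of_real (\<theta> i) * (0 - (if i = j then of_real (- phi \<mu> (\<rho> i)) else 0)) + (if i = j then 1 else 0) = (0 :: 'a)"
  proof (cases "i = j")
    case True
    have "of_real (\<theta> i) * (0 - of_real (- phi \<mu> (\<rho> i))) = (of_real (\<theta> i * phi \<mu> (\<rho> i)) :: 'a)" by simp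
    also have "\<dots> = of_real (- 1)" using root[OF ij(1)] by (simp only:)
    finally show ?thesis using True by simp
  qed simp
  ultimately show ?thesis by simp
qed

text \<open>Up to o(1), the perturbed matrix maps a combination of right test vectors to the same
  combination of left ones, each multiplied by its \<open>\<rho> i\<close>. The coefficients
  \<open>d\<close> depend on \<open>n\<close> without control, so all errors must be uniform over
  unit coefficient vectors.\<close>

lemma test_vector_bound:
  fixes d :: "nat \<Rightarrow> nat \<Rightarrow> 'a"
  assumes d: "\<And>n. (\<Sum>i\<in>I. (norm (d n i))\<^sup>2) = 1" and \<epsilon>: "0 < \<epsilon>" and \<theta>0: "\<And>i. i \<in> I \<Longrightarrow> \<theta> i \<noteq> 0"
    and W: "\<And>n c. W n c = (\<Sum>i\<in>I. d n i * right_test \<rho> n i c)"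
  shows "\<forall>\<^sub>F n in sequentially. sqrt (nsq {..<n} (\<lambda>c. of_real (s n c) * W n c + (\<Sum>j\<in>J. of_real (\<theta> j) * ip {..<n} (W n) (\<beta> n j) * \<alpha> n j c)))
     < (\<rho>0 + \<epsilon>) * sqrt (nsq {..<n} (W n))"
proof -
  define g where "g i = psi2 \<mu> (\<rho> i)" for i
  have g: "0 < g i" if "i \<in> I" for i unfolding g_def using \<rho>(1,2)[OF that] by (intro psi2_pos) auto
  define \<rho>m where "\<rho>m = \<rho>0"
  have \<rho>0: "0 \<le> \<rho>0" using I \<rho>(1,3) by (metis equals0I order_trans)
  \<comment> \<open>Asymptotic lower bound for the squared norm of \<open>W\<close>; the o(1) errors
    are compared with \<epsilon> times its root.\<close>
  define g0 where "g0 = Min (g ` I)"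
  have g0: "0 < g0" "\<And>i. i \<in> I \<Longrightarrow> g0 \<le> g i" using fin I(2) g by (auto simp: g0_def Min_gr_iff)
  define S where "S n = (\<Sum>i\<in>I. (norm (d n i))\<^sup>2 * g i)" for n
  have S0: "g0 \<le> S n" for n
  proof -
    have "g0 = (\<Sum>i\<in>I. (norm (d n i))\<^sup>2 * g0)" unfolding sum_distrib_right[symmetric] d by simp
    also have "\<dots> \<le> S n" unfolding S_def by (intro sum_mono mult_left_mono g0(2)) auto
    finally show ?thesis .
  qed
  have dle: "norm (d n i) \<le> 1" if "i \<in> I" for n i
  proof -
    have "(norm (d n i))\<^sup>2 \<le> 1" unfolding d[of n, symmetric] by (rule member_le_sum) (use that fin in auto)
    then show ?thesis by (simp add: power_le_one_iff abs_square_le_1)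
  qed
  define P where "P n c = (\<Sum>i\<in>I. (d n i * of_real (\<rho> i)) * left_test \<rho> n i c)" for n c
  define D where "D n i j = of_real (\<theta> i) * ip {..<n} (right_test \<rho> n i) (\<beta> n j) + (if i = j then 1 else 0)" for n i j
  have diag: "(\<Sum>i\<in>I. \<Sum>j\<in>I. p i * (conjugate (p j) * (if i = j then of_real (g i) else 0))) = of_real (\<Sum>i\<in>I. (norm (p i))\<^sup>2 * g i)" for p :: "nat \<Rightarrow> 'a"
  proof -
    have "(\<Sum>j\<in>I. p i * (conjugate (p j) * (if i = j then of_real (g i) else 0))) = of_real ((norm (p i))\<^sup>2 * g i)" if "i \<in> I" for i
    proof -
      have "(\<Sum>j\<in>I. p i * (conjugate (p j) * (if i = j then of_real (g i) else 0))) = (\<Sum>j\<in>I. if i = j then p i * (conjugate (p i) * of_real (g i)) else 0)"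
        by (intro sum.cong refl) auto
      also have "\<dots> = p i * conjugate (p i) * of_real (g i)" using fin that by (simp add: mult.assoc)
      finally show ?thesis unfolding mult_conjugate by simp
    qed
    then show ?thesis unfolding of_real_sum by (intro sum.cong refl) simp
  qed
  have quad: "(\<lambda>n. nsq {..<n} (\<lambda>c. \<Sum>i\<in>I. p n i * e n i c) - (\<Sum>i\<in>I. (norm (p n i))\<^sup>2 * g i)) \<longlonglongrightarrow> 0"
    if e: "\<And>i j. i \<in> I \<Longrightarrow> j \<in> I \<Longrightarrow> (\<lambda>n. ip {..<n} (e n i) (e n j)) \<longlonglongrightarrow> (if i = j then of_real (g i) else 0)"
      and p: "\<And>n i. i \<in> I \<Longrightarrow> norm (p n i) \<le> C" for p :: "nat \<Rightarrow> nat \<Rightarrow> 'a" and e C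
  proof -
    have "(\<lambda>n. \<Sum>i\<in>I. \<Sum>j\<in>I. p n i * (conjugate (p n j) * (ip {..<n} (e n i) (e n j) - (if i = j then of_real (g i) else 0)))) \<longlonglongrightarrow> 0"
      by (rule bounded_double_sum_null[where B = C]; (rule LIM_zero[OF e], assumption, assumption | simp add: p))
    moreover have "(\<Sum>i\<in>I. \<Sum>j\<in>I. p n i * (conjugate (p n j) * (ip {..<n} (e n i) (e n j) - (if i = j then of_real (g i) else 0))))
       = of_real (nsq {..<n} (\<lambda>c. \<Sum>i\<in>I. p n i * e n i c) - (\<Sum>i\<in>I. (norm (p n i))\<^sup>2 * g i))" for n
    proof -
      have "of_real (nsq {..<n} (\<lambda>c. \<Sum>i\<in>I. p n i * e n i c)) = (\<Sum>i\<in>I. \<Sum>j\<in>I. p n i * (conjugate (p n j) * ip {..<n} (e n i) (e n j)))"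
        unfolding ip_self[symmetric] ip_sum_left ip_sum_right ip_mult_left ip_mult_right
        by (simp add: mult_ac)
      then show ?thesis unfolding of_real_diff diag[symmetric] right_diff_distrib sum_subtractf by simp
    qed
    ultimately have "(\<lambda>n. of_real (nsq {..<n} (\<lambda>c. \<Sum>i\<in>I. p n i * e n i c) - (\<Sum>i\<in>I. (norm (p n i))\<^sup>2 * g i)) :: 'a) \<longlonglongrightarrow> of_real 0" by simp
    then show ?thesis unfolding tendsto_of_real_iff .
  qed
  have limW: "(\<lambda>n. nsq {..<n} (W n) - S n) \<longlonglongrightarrow> 0"
  proof -
    have "nsq {..<n} (W n) = nsq {..<n} (\<lambda>c. \<Sum>i\<in>I. d n i * right_test \<rho> n i c)" for n by (simp add: W nsq_def)
    then show ?thesis unfolding S_def using quad[OF gram_tests(2)[folded g_def] dle] by simp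
  qed
  have limP: "(\<lambda>n. nsq {..<n} (P n) - (\<Sum>i\<in>I. (norm (d n i * of_real (\<rho> i)))\<^sup>2 * g i)) \<longlonglongrightarrow> 0"
  proof -
    have "norm (d n i * of_real (\<rho> i)) \<le> \<rho>0" if "i \<in> I" for n i
      using mult_mono[OF dle[OF that] \<rho>(3)[OF that]] \<rho>(1)[OF that] by (simp add: norm_mult)
    from quad[OF gram_tests(1)[folded g_def] this] show ?thesis by (simp add: P_def[abs_def])
  qed
  \<comment> \<open>The remainder after the cancellation of \<open>cross_test\<close>. The ratio
    \<theta> j / \<theta> i converts the factor \<theta> i contained in \<open>D\<close> into the
    coefficient \<theta> j of the perturbation.\<close>
  define Q where "Q n c = (\<Sum>j\<in>J. (\<Sum>i\<in>I. d n i * (of_real (\<theta> j / \<theta> i) * D n i j)) * \<alpha> n j c)" for n c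
  have limQ: "(\<lambda>n. sqrt (nsq {..<n} (Q n))) \<longlonglongrightarrow> 0"
  proof -
    have qle: "sqrt (nsq {..<n} (\<lambda>c. \<Sum>j\<in>L. f j * \<alpha> n j c)) \<le> (\<Sum>j\<in>L. norm (f j) * sqrt (nsq {..<n} (\<alpha> n j)))"
      if "finite L" for n L and f :: "nat \<Rightarrow> 'a"
      using that
    proof (induction L rule: finite_induct)
      case empty
      then show ?case by (simp add: nsq_def)
    next
      case (insert j L)
      have "sqrt (nsq {..<n} (\<lambda>c. \<Sum>j\<in>insert j L. f j * \<alpha> n j c)) = sqrt (nsq {..<n} (\<lambda>c. f j * \<alpha> n j c + (\<Sum>j\<in>L. f j * \<alpha> n j c)))"
        using insert by simp
      also have "\<dots> \<le> sqrt (nsq {..<n} (\<lambda>c. f j * \<alpha> n j c)) + sqrt (nsq {..<n} (\<lambda>c. \<Sum>j\<in>L. f j * \<alpha> n j c))"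
        by (rule sqrt_nsq_add_le)
      also have "sqrt (nsq {..<n} (\<lambda>c. f j * \<alpha> n j c)) = norm (f j) * sqrt (nsq {..<n} (\<alpha> n j))"
        by (simp add: nsq_mult real_sqrt_mult)
      finally show ?case using insert by simp
    qed
    have bound: "(\<lambda>n. \<Sum>j\<in>J. norm (\<Sum>i\<in>I. d n i * (of_real (\<theta> j / \<theta> i) * D n i j)) * sqrt (nsq {..<n} (\<alpha> n j))) \<longlonglongrightarrow> (\<Sum>j\<in>J. norm (\<Sum>i\<in>I. (0 :: 'a)) * sqrt 1)"
    proof (intro tendsto_sum tendsto_mult tendsto_norm tendsto_real_sqrt nsq_lim(1))
      fix i j assume ij: "j \<in> J" "i \<in> I"
      have "(\<lambda>n. of_real (\<theta> j / \<theta> i) * D n i j) \<longlonglongrightarrow> of_real (\<theta> j / \<theta> i) * 0"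
        unfolding D_def by (intro tendsto_mult tendsto_const cross_test ij)
      then have "(\<lambda>n. of_real (\<theta> j / \<theta> i) * D n i j) \<longlonglongrightarrow> 0" by simp
      then show "(\<lambda>n. d n i * (of_real (\<theta> j / \<theta> i) * D n i j)) \<longlonglongrightarrow> 0"
        by (rule lim_null_mult_left_bounded[where B = 1, rotated]) (intro always_eventually allI dle ij(2))
    qed
    show ?thesis
    proof (rule tendsto_sandwich[OF _ _ tendsto_const])
      show "(\<lambda>n. \<Sum>j\<in>J. norm (\<Sum>i\<in>I. d n i * (of_real (\<theta> j / \<theta> i) * D n i j)) * sqrt (nsq {..<n} (\<alpha> n j))) \<longlonglongrightarrow> 0"
        using bound by simp
      show "\<forall>\<^sub>F n in sequentially. sqrt (nsq {..<n} (Q n)) \<le> (\<Sum>j\<in>J. norm (\<Sum>i\<in>I. d n i * (of_real (\<theta> j / \<theta> i) * D n i j)) * sqrt (nsq {..<n} (\<alpha> n j)))"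
        unfolding Q_def[abs_def] by (intro always_eventually allI qle J)
    qed simp
  qed
  have ev_gap: "\<forall>\<^sub>F n in sequentially. \<forall>i\<in>I. \<forall>c<n. (s n c)\<^sup>2 - (\<rho> i)\<^sup>2 \<noteq> 0"
    unfolding eventually_ball_finite_distrib[OF fin]
  proof
    fix i assume i: "i \<in> I"
    show "\<forall>\<^sub>F n in sequentially. \<forall>c<n. (s n c)\<^sup>2 - (\<rho> i)\<^sup>2 \<noteq> 0"
      using s_low[OF \<rho>(2)[OF i]]
    proof eventually_elim
      case (elim n)
      have "(\<rho> i)\<^sup>2 < (s n c)\<^sup>2" if "c < n" for c using elim that \<rho>(1)[OF i] by (intro power_strict_mono) auto
      then show ?case by force
    qed
  qed
  have split: "of_real (s n c) * W n c + (\<Sum>j\<in>J. of_real (\<theta> j) * ip {..<n} (W n) (\<beta> n j) * \<alpha> n j c) = P n c + Q n c"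
    if c: "c < n" and gap: "\<forall>i\<in>I. \<forall>c<n. (s n c)\<^sup>2 - (\<rho> i)\<^sup>2 \<noteq> 0" for n c
  proof -
    \<comment> \<open>Writing s^2 as \<rho>^2 + (s^2 - \<rho>^2) splits off the unweighted
      \<alpha>.\<close>
    have 1: "of_real (s n c) * right_test \<rho> n i c = of_real (\<rho> i) * left_test \<rho> n i c + \<alpha> n i c" if i: "i \<in> I" for i
    proof -
      define D where "D = (s n c)\<^sup>2 - (\<rho> i)\<^sup>2"
      have D: "D \<noteq> 0" "s n c * s n c = \<rho> i * \<rho> i + D" using gap i c by (auto simp: D_def power2_eq_square)
      have "of_real (s n c) * right_test \<rho> n i c = of_real (s n c * s n c / D) * \<alpha> n i c - of_real (s n c * \<rho> i / D) * \<beta> n i c"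
        unfolding right_test_def D_def[symmetric] by (simp add: algebra_simps)
      also have "s n c * s n c / D = \<rho> i * \<rho> i / D + 1" unfolding D(2) using D(1) by (simp add: add_divide_distrib)
      finally show ?thesis unfolding left_test_def D_def[symmetric] by (simp add: algebra_simps)
    qed
    have "of_real (s n c) * W n c = (\<Sum>i\<in>I. d n i * (of_real (s n c) * right_test \<rho> n i c))"
      unfolding W sum_distrib_left by (simp add: mult_ac)
    also have "\<dots> = (\<Sum>i\<in>I. d n i * (of_real (\<rho> i) * left_test \<rho> n i c + \<alpha> n i c))" by (intro sum.cong refl) (simp add: 1)
    also have "\<dots> = P n c + (\<Sum>i\<in>I. d n i * \<alpha> n i c)" by (simp add: P_def distrib_left sum.distrib mult.assoc)
    finally have a: "of_real (s n c) * W n c = P n c + (\<Sum>i\<in>I. d n i * \<alpha> n i c)" .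
    have ipW: "ip {..<n} (W n) (\<beta> n j) = (\<Sum>i\<in>I. d n i * ip {..<n} (right_test \<rho> n i) (\<beta> n j))" for j
    proof -
      have "ip {..<n} (W n) (\<beta> n j) = ip {..<n} (\<lambda>c. \<Sum>i\<in>I. d n i * right_test \<rho> n i c) (\<beta> n j)" by (rule ip_cong) (simp_all add: W)
      then show ?thesis by (simp add: ip_sum_left ip_mult_left)
    qed
    have "of_real (\<theta> j) * ip {..<n} (W n) (\<beta> n j) = (\<Sum>i\<in>I. d n i * (of_real (\<theta> j / \<theta> i) * D n i j)) - (if j \<in> I then d n j else 0)" for j
    proof -
      have "(\<Sum>i\<in>I. d n i * (of_real (\<theta> j / \<theta> i) * D n i j)) = (\<Sum>i\<in>I. of_real (\<theta> j) * (d n i * ip {..<n} (right_test \<rho> n i) (\<beta> n j)) + (if i = j then d n j else 0))"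
        by (intro sum.cong refl) (use \<theta>0 in \<open>auto simp: D_def distrib_left\<close>)
      also have "\<dots> = of_real (\<theta> j) * ip {..<n} (W n) (\<beta> n j) + (if j \<in> I then d n j else 0)"
        unfolding sum.distrib ipW sum_distrib_left using fin by simp
      finally show ?thesis by simp
    qed
    then have "(\<Sum>j\<in>J. of_real (\<theta> j) * ip {..<n} (W n) (\<beta> n j) * \<alpha> n j c) = Q n c - (\<Sum>j\<in>J. (if j \<in> I then d n j else 0) * \<alpha> n j c)"
      by (simp add: Q_def left_diff_distrib sum_subtractf)
    also have "(\<Sum>j\<in>J. (if j \<in> I then d n j else 0) * \<alpha> n j c) = (\<Sum>j\<in>I. d n j * \<alpha> n j c)"
      using J I(1) by (intro sum.mono_neutral_cong_right) auto
    finally show ?thesis unfolding a by simp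
  qed
  have e1: "(\<lambda>n. sqrt \<bar>nsq {..<n} (P n) - (\<Sum>i\<in>I. (norm (d n i * of_real (\<rho> i)))\<^sup>2 * g i)\<bar>) \<longlonglongrightarrow> sqrt \<bar>0\<bar>"
    by (intro tendsto_real_sqrt tendsto_rabs limP)
  have e2: "(\<lambda>n. sqrt \<bar>nsq {..<n} (W n) - S n\<bar>) \<longlonglongrightarrow> sqrt \<bar>0\<bar>"
    by (intro tendsto_real_sqrt tendsto_rabs limW)
  have "(\<lambda>n. sqrt \<bar>nsq {..<n} (P n) - (\<Sum>i\<in>I. (norm (d n i * of_real (\<rho> i)))\<^sup>2 * g i)\<bar> + sqrt (nsq {..<n} (Q n)) + (\<rho>0 + \<epsilon>) * sqrt \<bar>nsq {..<n} (W n) - S n\<bar>)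
     \<longlonglongrightarrow> sqrt \<bar>0\<bar> + 0 + (\<rho>0 + \<epsilon>) * sqrt \<bar>0\<bar>"
    by (intro tendsto_add tendsto_mult tendsto_const e1 e2 limQ)
  then have "(\<lambda>n. sqrt \<bar>nsq {..<n} (P n) - (\<Sum>i\<in>I. (norm (d n i * of_real (\<rho> i)))\<^sup>2 * g i)\<bar> + sqrt (nsq {..<n} (Q n)) + (\<rho>0 + \<epsilon>) * sqrt \<bar>nsq {..<n} (W n) - S n\<bar>) \<longlonglongrightarrow> 0"
    by simp
  from order_tendstoD(2)[OF this, of "\<epsilon> * sqrt g0"] \<epsilon> g0(1)
  have small: "\<forall>\<^sub>F n in sequentially. sqrt \<bar>nsq {..<n} (P n) - (\<Sum>i\<in>I. (norm (d n i * of_real (\<rho> i)))\<^sup>2 * g i)\<bar> + sqrt (nsq {..<n} (Q n)) + (\<rho>0 + \<epsilon>) * sqrt \<bar>nsq {..<n} (W n) - S n\<bar> < \<epsilon> * sqrt g0"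
    by simp
  from small ev_gap show ?thesis
  proof eventually_elim
    case (elim n)
    define T where "T = (\<Sum>i\<in>I. (norm (d n i * of_real (\<rho> i)))\<^sup>2 * g i)"
    have TS: "T \<le> \<rho>0\<^sup>2 * S n"
      unfolding T_def S_def sum_distrib_left
    proof (rule sum_mono)
      fix i assume i: "i \<in> I"
      have "(norm (d n i * of_real (\<rho> i)))\<^sup>2 * g i = (\<rho> i)\<^sup>2 * ((norm (d n i))\<^sup>2 * g i)" by (simp add: norm_mult power_mult_distrib)
      also have "\<dots> \<le> \<rho>0\<^sup>2 * ((norm (d n i))\<^sup>2 * g i)" using \<rho>[OF i] g[OF i] by (intro mult_right_mono power_mono) auto
      finally show "(norm (d n i * of_real (\<rho> i)))\<^sup>2 * g i \<le> \<rho>0\<^sup>2 * ((norm (d n i))\<^sup>2 * g i)" .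
    qed
    have T0: "0 \<le> T" unfolding T_def by (intro sum_nonneg mult_nonneg_nonneg) (auto intro: less_imp_le g)
    have sS: "0 \<le> S n" using S0[of n] g0 by simp
    have "sqrt (nsq {..<n} (\<lambda>c. of_real (s n c) * W n c + (\<Sum>j\<in>J. of_real (\<theta> j) * ip {..<n} (W n) (\<beta> n j) * \<alpha> n j c)))
      = sqrt (nsq {..<n} (\<lambda>c. P n c + Q n c))"
      by (intro arg_cong[where f = sqrt] nsq_cong split) (use elim(2) in auto)
    also have "\<dots> \<le> sqrt (nsq {..<n} (P n)) + sqrt (nsq {..<n} (Q n))" by (rule sqrt_nsq_add_le)
    finally have 1: "sqrt (nsq {..<n} (\<lambda>c. of_real (s n c) * W n c + (\<Sum>j\<in>J. of_real (\<theta> j) * ip {..<n} (W n) (\<beta> n j) * \<alpha> n j c)))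
      \<le> sqrt (nsq {..<n} (P n)) + sqrt (nsq {..<n} (Q n))" .
    have "sqrt (nsq {..<n} (P n)) \<le> sqrt (T + \<bar>nsq {..<n} (P n) - T\<bar>)" by (intro real_sqrt_le_mono) simp
    also have "\<dots> \<le> sqrt T + sqrt \<bar>nsq {..<n} (P n) - T\<bar>" by (rule sqrt_add_le_add_sqrt[OF T0]) simp
    also have "sqrt T \<le> sqrt (\<rho>0\<^sup>2 * S n)" using TS by (rule real_sqrt_le_mono)
    also have "sqrt (\<rho>0\<^sup>2 * S n) = \<rho>0 * sqrt (S n)" using \<rho>0 by (simp add: real_sqrt_mult)
    finally have 2: "sqrt (nsq {..<n} (P n)) \<le> \<rho>0 * sqrt (S n) + sqrt \<bar>nsq {..<n} (P n) - T\<bar>" by simp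
    have "sqrt (S n) \<le> sqrt (nsq {..<n} (W n) + \<bar>nsq {..<n} (W n) - S n\<bar>)" by (intro real_sqrt_le_mono) simp
    also have "\<dots> \<le> sqrt (nsq {..<n} (W n)) + sqrt \<bar>nsq {..<n} (W n) - S n\<bar>" by (rule sqrt_add_le_add_sqrt) simp_all
    finally have "(\<rho>0 + \<epsilon>) * sqrt (S n) \<le> (\<rho>0 + \<epsilon>) * (sqrt (nsq {..<n} (W n)) + sqrt \<bar>nsq {..<n} (W n) - S n\<bar>)"
      using \<rho>0 \<epsilon> by (intro mult_left_mono) auto
    then have 3: "\<rho>0 * sqrt (S n) + \<epsilon> * sqrt (S n) \<le> (\<rho>0 + \<epsilon>) * sqrt (nsq {..<n} (W n)) + (\<rho>0 + \<epsilon>) * sqrt \<bar>nsq {..<n} (W n) - S n\<bar>"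
      by (simp only: distrib_left distrib_right)
    have 4: "\<epsilon> * sqrt g0 \<le> \<epsilon> * sqrt (S n)" using \<epsilon> S0 by (intro mult_left_mono real_sqrt_le_mono) auto
    show ?case using 1 2 3 4 elim(1) unfolding T_def[symmetric] by linarith
  qed
qed

end

end

section \<open>Low-rank perturbations and interlacing\<close>

lemma is_svdD:
  assumes "is_svd n X s p q"
  shows "orthonormal_basis {..<n} {..<n} p" "orthonormal_basis {..<n} {..<n} q" "i < n \<Longrightarrow> 0 \<le> s i"
    "i < n \<Longrightarrow> k < n \<Longrightarrow> mv {..<n} X (q i) k = of_real (s i) * p i k"
    "i < n \<Longrightarrow> k < n \<Longrightarrow> mv {..<n} (adj X) (p i) k = of_real (s i) * q i k"
  using assms unfolding is_svd_def by auto

lemma svd_coordinate: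
  assumes svd: "is_svd n X s p q" and c: "c < n"
  shows "ip {..<n} (mv {..<n} X w) (p c) = of_real (s c) * ip {..<n} w (q c)"
proof -
  have "ip {..<n} (mv {..<n} X w) (p c) = ip {..<n} w (mv {..<n} (adj X) (p c))" by (rule ip_mv) simp
  also have "\<dots> = ip {..<n} w (\<lambda>k. of_real (s c) * q c k)"
    by (rule ip_cong) (simp_all add: is_svdD(5)[OF svd c])
  finally show ?thesis by (simp add: ip_mult_right)
qed

lemma svd_nsq:
  assumes svd: "is_svd n X s p q"
  shows "nsq {..<n} (mv {..<n} X w) = (\<Sum>c<n. (s c)\<^sup>2 * (norm (ip {..<n} w (q c)))\<^sup>2)"
proof -
  have "nsq {..<n} (mv {..<n} X w) = nsq {..<n} (\<lambda>c. ip {..<n} (mv {..<n} X w) (p c))"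
    by (rule orthonormal_basis.parseval_nsq[OF is_svdD(1)[OF svd], symmetric])
  also have "\<dots> = (\<Sum>c<n. (s c)\<^sup>2 * (norm (ip {..<n} w (q c)))\<^sup>2)"
    unfolding nsq_def
    by (intro sum.cong refl) (simp add: svd_coordinate[OF svd] norm_mult power_mult_distrib)
  finally show ?thesis .
qed

lemma svd_domain_nsq:
  assumes svd: "is_svd n X s p q"
  shows "nsq {..<n} w = (\<Sum>c<n. (norm (ip {..<n} w (q c)))\<^sup>2)"
  using orthonormal_basis.parseval_nsq[OF is_svdD(2)[OF svd], of w] by (simp add: nsq_def)

definition low_rank :: "(nat \<Rightarrow> real) \<Rightarrow> nat set \<Rightarrow> (nat \<Rightarrow> nat \<Rightarrow> 'a :: real_or_complex) \<Rightarrow> (nat \<Rightarrow> nat \<Rightarrow> 'a) \<Rightarrow> (nat \<Rightarrow> nat \<Rightarrow> 'a) \<Rightarrow> nat \<Rightarrow> nat \<Rightarrow> 'a" where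
  "low_rank \<theta> I u v X j k = X j k + (\<Sum>i\<in>I. of_real (\<theta> i) * u i j * conjugate (v i k))"

lemma adj_low_rank: "adj (low_rank \<theta> I u v X) = low_rank \<theta> I v u (adj X)"
  by (intro ext) (simp add: adj_def low_rank_def conjugate_dist_add sum_conjugate conjugate_dist_mul mult_ac,
    cases "finite I", simp_all add: sum_conjugate conjugate_dist_mul mult_ac)

lemma mv_low_rank:
  "mv K (low_rank \<theta> I u v X) w j = mv K X w j + (\<Sum>i\<in>I. of_real (\<theta> i) * ip K w (v i) * u i j)"
proof -
  have "(\<Sum>k\<in>K. (\<Sum>i\<in>I. of_real (\<theta> i) * u i j * conjugate (v i k)) * w k) = (\<Sum>i\<in>I. of_real (\<theta> i) * ip K w (v i) * u i j)"
    unfolding sum_distrib_right by (subst sum.swap) (simp add: ip_def sum_distrib_left sum_distrib_right mult_ac)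
  then show ?thesis by (simp add: mv_def low_rank_def distrib_right sum.distrib)
qed

lemma low_rank_coordinate:
  assumes svd: "is_svd n X s p q" and c: "c < n"
  shows "ip {..<n} (mv {..<n} (low_rank \<theta> I u v X) w) (p c) = of_real (s c) * ip {..<n} w (q c)
    + (\<Sum>i\<in>I. of_real (\<theta> i) * ip {..<n} (\<lambda>c. ip {..<n} w (q c)) (\<lambda>c. ip {..<n} (v i) (q c)) * ip {..<n} (u i) (p c))"
proof -
  have "ip {..<n} (mv {..<n} (low_rank \<theta> I u v X) w) (p c)
     = ip {..<n} (\<lambda>j. mv {..<n} X w j + (\<Sum>i\<in>I. of_real (\<theta> i) * ip {..<n} w (v i) * u i j)) (p c)"
    by (rule ip_cong) (simp_all add: mv_low_rank)
  then show ?thesis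
    by (simp only: ip_add_left ip_sum_left ip_mult_left svd_coordinate[OF svd c] orthonormal_basis.parseval[OF is_svdD(2)[OF svd]])
qed

lemma svd_of_low_rank_coordinates:
  assumes svd: "is_svd n X s p q" and pair: "\<And>k. k < n \<Longrightarrow> mv {..<n} (low_rank \<theta> I u v X) y k = of_real \<tau> * x k"
    and c: "c < n"
  shows "of_real (s c) * ip {..<n} y (q c)
    + (\<Sum>i\<in>I. of_real (\<theta> i) * ip {..<n} (\<lambda>c. ip {..<n} y (q c)) (\<lambda>c. ip {..<n} (v i) (q c)) * ip {..<n} (u i) (p c))
    = of_real \<tau> * ip {..<n} x (p c)"
proof -
  have "ip {..<n} (mv {..<n} (low_rank \<theta> I u v X) y) (p c) = ip {..<n} (\<lambda>k. of_real \<tau> * x k) (p c)"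
    by (rule ip_cong) (simp_all add: pair)
  then show ?thesis unfolding low_rank_coordinate[OF svd c] ip_mult_left .
qed

text \<open>A dimension count gives a nonzero \<open>x\<close> in the span of the right singular
  vectors of \<open>Y\<close> with t k \<le> \<sigma> that is orthogonal to every
  \<open>v i\<close>. There \<open>Y\<close> and \<open>Z\<close> agree, so |Z x| \<le> \<sigma>
  |x|, which is impossible if every \<tau> k exceeds \<sigma>.\<close>

lemma interlacing_lower:
  assumes Y: "is_svd n Y t a b" and Z: "is_svd n Z \<tau> p q" and \<sigma>: "0 \<le> \<sigma>"
    and K: "finite K" "card K < card {k. k < n \<and> t k \<le> \<sigma>}"
    and agree: "\<And>x k. (\<And>i. i \<in> K \<Longrightarrow> ip {..<n} x (v i) = 0) \<Longrightarrow> k < n \<Longrightarrow> mv {..<n} Y x k = mv {..<n} Z x k"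
  shows "\<exists>k<n. \<tau> k \<le> \<sigma>"
proof (rule ccontr)
  assume "\<not> ?thesis"
  then have big: "\<sigma> < \<tau> k" if "k < n" for k using that by auto
  define S where "S = {k. k < n \<and> t k \<le> \<sigma>}"
  have S: "finite S" "S \<subseteq> {..<n}" by (auto simp: S_def)
  obtain c where c: "\<exists>k\<in>S. c k \<noteq> 0" "\<forall>i\<in>K. (\<Sum>k\<in>S. ip {..<n} (b k) (v i) * c k) = 0"
    using homogeneous_system[OF K(1) S(1) K(2)[folded S_def], of "\<lambda>i k. ip {..<n} (b k) (v i)"] by blast
  define x where "x = (\<lambda>j. \<Sum>k\<in>S. c k * b k j)"
  have coord: "ip {..<n} x (b l) = (if l \<in> S then c l else 0)" if "l < n" for l
  proof -
    have "ip {..<n} x (b l) = (\<Sum>k\<in>S. c k * (if k = l then 1 else 0))"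
      unfolding x_def ip_sum_left ip_mult_left
      by (intro sum.cong refl) (use S that orthonormal_basis.orthonormal[OF is_svdD(2)[OF Y]] in auto)
    also have "\<dots> = (if l \<in> S then c l else 0)" using S(1) by (simp add: if_distrib[of "\<lambda>x. _ * x"] cong: if_cong)
    finally show ?thesis .
  qed
  have "ip {..<n} x (v i) = 0" if "i \<in> K" for i
    using c(2) that by (simp add: x_def ip_sum_left ip_mult_left mult.commute)
  then have "nsq {..<n} (mv {..<n} Y x) = nsq {..<n} (mv {..<n} Z x)" by (intro nsq_cong agree) auto
  moreover have "nsq {..<n} (mv {..<n} Y x) \<le> \<sigma>\<^sup>2 * nsq {..<n} x"
    unfolding svd_nsq[OF Y] svd_domain_nsq[OF Y, of x] sum_distrib_left
  proof (rule sum_mono)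
    fix l assume "l \<in> {..<n}"
    then show "(t l)\<^sup>2 * (norm (ip {..<n} x (b l)))\<^sup>2 \<le> \<sigma>\<^sup>2 * (norm (ip {..<n} x (b l)))\<^sup>2"
      using coord[of l] is_svdD(3)[OF Y, of l] by (auto simp: S_def intro!: mult_right_mono power_mono)
  qed
  moreover have "\<sigma>\<^sup>2 * nsq {..<n} x < nsq {..<n} (mv {..<n} Z x)"
  proof -
    have "nsq {..<n} x \<noteq> 0"
    proof
      assume "nsq {..<n} x = 0"
      then have "\<forall>l<n. ip {..<n} x (b l) = 0"
        unfolding svd_domain_nsq[OF Y] by (subst (asm) sum_nonneg_eq_0_iff) auto
      then show False using c(1) S coord by auto
    qed
    then have "\<not> (\<forall>l\<in>{..<n}. ip {..<n} x (q l) = 0)"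
      unfolding svd_domain_nsq[OF Z, of x] by (metis (mono_tags, lifting) norm_zero power_zero_numeral sum.neutral)
    then obtain l where l: "l < n" "ip {..<n} x (q l) \<noteq> 0" by auto
    have le: "\<sigma>\<^sup>2 < (\<tau> k)\<^sup>2" if "k < n" for k using big[OF that] \<sigma> by (intro power_strict_mono) auto
    show ?thesis
      unfolding svd_nsq[OF Z] svd_domain_nsq[OF Z, of x] sum_distrib_left
    proof (rule sum_strict_mono_ex1)
      show "\<forall>k\<in>{..<n}. \<sigma>\<^sup>2 * (norm (ip {..<n} x (q k)))\<^sup>2 \<le> (\<tau> k)\<^sup>2 * (norm (ip {..<n} x (q k)))\<^sup>2"
        using le by (intro ballI mult_right_mono) (auto intro: less_imp_le)
      show "\<exists>k\<in>{..<n}. \<sigma>\<^sup>2 * (norm (ip {..<n} x (q k)))\<^sup>2 < (\<tau> k)\<^sup>2 * (norm (ip {..<n} x (q k)))\<^sup>2"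
        using l le by (intro bexI[of _ l]) auto
    qed simp
  qed
  ultimately show False by linarith
qed

text \<open>With more test vectors than singular values below \<sigma>, some combination is
  orthogonal to the corresponding right singular vectors. The coefficients are normalised and not
  the combination, since the \<open>w i\<close> might be dependent.\<close>

lemma interlacing_upper:
  fixes w :: "nat \<Rightarrow> nat \<Rightarrow> 'a :: real_or_complex"
  assumes Y: "is_svd n Y t a b" and \<sigma>: "0 \<le> \<sigma>" and I: "finite I" "card {k. k < n \<and> t k < \<sigma>} < card I"
  shows "\<exists>d. (\<Sum>i\<in>I. (norm (d i))\<^sup>2) = 1 \<and>
    \<sigma>\<^sup>2 * nsq {..<n} (\<lambda>k. \<Sum>i\<in>I. d i * w i k) \<le> nsq {..<n} (mv {..<n} Y (\<lambda>k. \<Sum>i\<in>I. d i * w i k))"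
proof -
  define S where "S = {k. k < n \<and> t k < \<sigma>}"
  have S: "finite S" by (simp add: S_def)
  obtain c where c: "\<exists>i\<in>I. c i \<noteq> 0" "\<forall>k\<in>S. (\<Sum>i\<in>I. ip {..<n} (w i) (b k) * c i) = 0"
    using homogeneous_system[OF S I(1) I(2)[folded S_def], of "\<lambda>k i. ip {..<n} (w i) (b k)"] by blast
  define C where "C = sqrt (\<Sum>i\<in>I. (norm (c i))\<^sup>2)"
  have "0 < (\<Sum>i\<in>I. (norm (c i))\<^sup>2)" using c(1) I(1) by (auto intro!: sum_pos2)
  then have C: "0 < C" "C\<^sup>2 = (\<Sum>i\<in>I. (norm (c i))\<^sup>2)" by (simp_all add: C_def)
  define d where "d i = c i * of_real (1 / C)" for i
  have d1: "(\<Sum>i\<in>I. (norm (d i))\<^sup>2) = 1"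
  proof -
    have "(\<Sum>i\<in>I. (norm (d i))\<^sup>2) = (\<Sum>i\<in>I. (norm (c i))\<^sup>2) / C\<^sup>2"
      unfolding sum_divide_distrib by (simp add: d_def norm_mult norm_divide power_divide)
    then show ?thesis unfolding C(2)[symmetric] using C(1) by simp
  qed
  let ?W = "\<lambda>k. \<Sum>i\<in>I. d i * w i k"
  have zero: "ip {..<n} ?W (b k) = 0" if "k \<in> S" for k
  proof -
    have "ip {..<n} ?W (b k) = (\<Sum>i\<in>I. ip {..<n} (w i) (b k) * c i) * of_real (1 / C)"
      unfolding ip_sum_left ip_mult_left sum_distrib_right by (simp add: d_def mult_ac)
    then show ?thesis using c(2) that by simp
  qed
  have "\<sigma>\<^sup>2 * nsq {..<n} ?W \<le> nsq {..<n} (mv {..<n} Y ?W)"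
    unfolding svd_nsq[OF Y] svd_domain_nsq[OF Y, of ?W] sum_distrib_left
  proof (rule sum_mono)
    fix l assume l: "l \<in> {..<n}"
    show "\<sigma>\<^sup>2 * (norm (ip {..<n} ?W (b l)))\<^sup>2 \<le> (t l)\<^sup>2 * (norm (ip {..<n} ?W (b l)))\<^sup>2"
    proof (cases "l \<in> S")
      case False
      then have "\<sigma> \<le> t l" using l by (simp add: S_def)
      then show ?thesis using \<sigma> by (intro mult_right_mono power_mono) auto
    qed (simp add: zero)
  qed
  with d1 show ?thesis by blast
qed

section \<open>Location of the singular value\<close>

lemma nsq_svd_left: "is_svd n X s p q \<Longrightarrow> k < n \<Longrightarrow> nsq {..<n} (p k) = 1"
  using orthonormal_basis.orthonormal[OF is_svdD(1), of n X s p q k k]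
  by (simp add: ip_self del: of_real_eq_1_iff) (metis of_real_eq_1_iff)

text \<open>\<open>\<sigma>\<close> is pinned down by counts valid for every decomposition, and only
  for n \<ge> i0, because smaller matrices have no i0-th smallest singular value.\<close>

locale perturbed_singular_values = limit_forms \<mu> a s \<alpha> \<beta> "{1..r}"
  for \<mu> a s and \<alpha> \<beta> :: "nat \<Rightarrow> nat \<Rightarrow> nat \<Rightarrow> 'a :: real_or_complex" and r +
  fixes X p q u v :: "nat \<Rightarrow> nat \<Rightarrow> nat \<Rightarrow> 'a" and \<theta> \<sigma> :: "nat \<Rightarrow> real" and \<rho> :: real and i0 :: nat
  assumes i0: "i0 \<in> {1..r}"
    and \<theta>_decr: "\<And>i j. 1 \<le> i \<Longrightarrow> i \<le> j \<Longrightarrow> j \<le> r \<Longrightarrow> \<theta> j \<le> \<theta> i"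
    and \<theta>_pos: "\<And>i. i \<in> {1..r} \<Longrightarrow> 0 < \<theta> i"
    and svd: "\<And>n. is_svd n (X n) (s n) (p n) (q n)"
    and \<alpha>_eq: "\<And>n i. \<alpha> n i = (\<lambda>c. ip {..<n} (u n i) (p n c))"
    and \<beta>_eq: "\<And>n i. \<beta> n i = (\<lambda>c. ip {..<n} (v n i) (q n c))"
    and count: "\<And>n t a b. i0 \<le> n \<Longrightarrow> is_svd n (low_rank \<theta> {1..r} (u n) (v n) (X n)) t a b \<Longrightarrow>
      card {k. k < n \<and> t k < \<sigma> n} < i0 \<and> i0 \<le> card {k. k < n \<and> t k \<le> \<sigma> n}"
    and \<rho>: "0 < \<rho>" "\<rho> < a" "phi \<mu> \<rho> = - 1 / \<theta> i0"
begin

lemma svd_adj: "is_svd n (adj (X n)) (s n) (q n) (p n)"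
  by (rule is_svd_adj[OF svd])

lemma \<sigma>_nonneg:
  assumes "i0 \<le> n" shows "0 \<le> \<sigma> n"
proof -
  obtain t a b where t: "is_svd n (low_rank \<theta> {1..r} (u n) (v n) (X n)) t a b"
    using svd_exists by blast
  have "0 < card {k. k < n \<and> t k \<le> \<sigma> n}" using count[OF assms t] i0 by auto
  then obtain k where "k < n" "t k \<le> \<sigma> n" by (metis (mono_tags, lifting) card_gt_0_iff empty_Collect_eq)
  then show ?thesis using is_svdD(3)[OF t, of k] by simp
qed

text \<open>Dropping the first i0 - 1 terms leaves a perturbation with \<theta> i \<le> \<theta> i0,
  which is subcritical below \<rho>. Interlacing places one of its singular values at or below
  \<open>\<sigma> n\<close>, and that value eventually exceeds any z < \<rho>.\<close>

lemma singular_value_lower: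
  assumes z: "z < \<rho>"
  shows "\<forall>\<^sub>F n in sequentially. z < \<sigma> n"
proof -
  define Z where "Z n = low_rank \<theta> {i0..r} (u n) (v n) (X n)" for n
  obtain \<tau> A B where Z: "\<And>n. is_svd n (Z n) (\<tau> n) (A n) (B n)"
  proof -
    have "\<forall>n. \<exists>\<tau> A B. is_svd n (Z n) \<tau> A B" by (intro allI svd_exists)
    then show thesis unfolding choice_iff by (elim exE) (rule that, blast)
  qed
  have small: "\<exists>k<n. \<tau> n k \<le> \<sigma> n" if n: "i0 \<le> n" for n
  proof -
    obtain t a b where t: "is_svd n (low_rank \<theta> {1..r} (u n) (v n) (X n)) t a b"
      using svd_exists by blast
    have c: "card {1..<i0} < card {k. k < n \<and> t k \<le> \<sigma> n}" using count[OF n t] i0 by auto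
    show ?thesis
    proof (rule interlacing_lower[OF t Z \<sigma>_nonneg[OF n] finite_atLeastLessThan c])
      fix x k assume orth: "\<And>i. i \<in> {1..<i0} \<Longrightarrow> ip {..<n} x (v n i) = 0" and k: "k < n"
      have "(\<Sum>i\<in>{1..r}. of_real (\<theta> i) * ip {..<n} x (v n i) * u n i k) = (\<Sum>i\<in>{i0..r}. of_real (\<theta> i) * ip {..<n} x (v n i) * u n i k)"
        by (rule sum.mono_neutral_right) (use i0 orth in auto)
      then show "mv {..<n} (low_rank \<theta> {1..r} (u n) (v n) (X n)) x k = mv {..<n} (Z n) x k"
        by (simp add: mv_low_rank Z_def)
    qed
  qed
  \<comment> \<open>For n < i0 the index 0 is a placeholder, admissible as soon as n > 0; at n = 0
    the singular value itself is replaced by 0 below.\<close>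
  define k where "k n = (if i0 \<le> n then SOME k. k < n \<and> \<tau> n k \<le> \<sigma> n else 0)" for n
  have k1: "k n < n \<and> \<tau> n (k n) \<le> \<sigma> n" if "i0 \<le> n" for n
    using someI_ex[OF small[OF that]] that by (simp add: k_def)
  then have k: "k n < n" if "0 < n" for n using that by (cases "i0 \<le> n") (auto simp: k_def)
  \<comment> \<open>\<open>no_small_singular_value\<close> is stated for nonnegative bounds.\<close>
  define z1 where "z1 = max z 0"
  have z1: "0 \<le> z1" "z1 < \<rho>" "z1 < a" using z \<rho> by (auto simp: z1_def)
  have "\<forall>\<^sub>F n in sequentially. z1 < (if n = 0 then 0 else \<tau> n (k n))"
  proof (rule no_small_singular_value[where I = "{i0..r}" and \<theta> = \<theta>
        and U = "\<lambda>n c. ip {..<n} (A n (k n)) (p n c)" and V = "\<lambda>n c. ip {..<n} (B n (k n)) (q n c)"])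
    show "{i0..r} \<subseteq> {1..r}" using i0 by auto
    show "0 < \<theta> i" if "i \<in> {i0..r}" for i using that i0 by (intro \<theta>_pos) auto
    show "\<theta> i * - phi \<mu> z1 < 1" if i: "i \<in> {i0..r}" for i
    proof -
      have "phi \<mu> \<rho> < phi \<mu> z1" using z1 \<rho> a_pos by (intro phi_strict_decreasing) auto
      then have "- phi \<mu> z1 < 1 / \<theta> i0" unfolding \<rho>(3) by simp
      then have "\<theta> i0 * - phi \<mu> z1 < \<theta> i0 * (1 / \<theta> i0)" using \<theta>_pos[OF i0] by (intro mult_strict_left_mono) auto
      moreover have "\<theta> i * - phi \<mu> z1 \<le> \<theta> i0 * - phi \<mu> z1"
        using \<theta>_decr[of i0 i] i i0 phi_nonpos[of z1] z1 by (intro mult_right_mono) auto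
      ultimately show ?thesis using \<theta>_pos[OF i0] by simp
    qed
    show "0 \<le> (if n = 0 then 0 else \<tau> n (k n))" for n
      using is_svdD(3)[OF Z k] by auto
    show "of_real (s n c) * ip {..<n} (B n (k n)) (q n c) + (\<Sum>i\<in>{i0..r}. of_real (\<theta> i) * ip {..<n} (\<lambda>c. ip {..<n} (B n (k n)) (q n c)) (\<beta> n i) * \<alpha> n i c)
      = of_real (if n = 0 then 0 else \<tau> n (k n)) * ip {..<n} (A n (k n)) (p n c)" if c: "c < n" for n c
      unfolding \<alpha>_eq \<beta>_eq
      by (rule svd_of_low_rank_coordinates[OF svd _ c]) (use c is_svdD(4)[OF Z k] in \<open>simp add: Z_def\<close>)
    show "of_real (s n c) * ip {..<n} (A n (k n)) (p n c) + (\<Sum>i\<in>{i0..r}. of_real (\<theta> i) * ip {..<n} (\<lambda>c. ip {..<n} (A n (k n)) (p n c)) (\<alpha> n i) * \<beta> n i c)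
      = of_real (if n = 0 then 0 else \<tau> n (k n)) * ip {..<n} (B n (k n)) (q n c)" if c: "c < n" for n c
      unfolding \<alpha>_eq \<beta>_eq
      by (rule svd_of_low_rank_coordinates[OF svd_adj _ c]) (use c is_svdD(5)[OF Z k] in \<open>simp add: Z_def adj_low_rank\<close>)
    show "nsq {..<n} (\<lambda>c. ip {..<n} (A n (k n)) (p n c)) = 1" "nsq {..<n} (\<lambda>c. ip {..<n} (B n (k n)) (q n c)) = 1" if n: "0 < n" for n
      by (simp_all only: orthonormal_basis.parseval_nsq[OF is_svdD(1)[OF svd]] orthonormal_basis.parseval_nsq[OF is_svdD(2)[OF svd]]
          nsq_svd_left[OF Z k[OF n]] nsq_svd_left[OF is_svd_adj[OF Z] k[OF n]])
  qed (use z1 in auto)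
  then show ?thesis using eventually_ge_at_top[of i0]
  proof eventually_elim
    case (elim n)
    have "0 < n" using elim(2) i0 by simp
    then show ?case using elim k1[of n] by (simp add: z1_def)
  qed
qed

text \<open>For i \<le> i0 the equation phi = -1/\<theta> i has a root at most \<rho>, because
  \<theta> i \<ge> \<theta> i0. The i0 resulting test vectors outnumber the singular values below
  \<open>\<sigma> n\<close>, so one combination obeys both the lower bound with
  \<open>\<sigma> n\<close> and the upper bound with \<rho> + \<epsilon>.\<close>

lemma singular_value_upper:
  assumes \<epsilon>: "0 < \<epsilon>"
  shows "\<forall>\<^sub>F n in sequentially. \<sigma> n < \<rho> + \<epsilon>"
proof -
  have "\<exists>x. 0 < x \<and> x \<le> \<rho> \<and> phi \<mu> x = - 1 / \<theta> i" if i: "i \<in> {1..i0}" for i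
  proof (rule phi_root[OF \<rho>(1,2)])
    have "0 < \<theta> i" "0 < \<theta> i0" "\<theta> i0 \<le> \<theta> i" using i i0 \<theta>_pos[of i] \<theta>_pos[of i0] \<theta>_decr[of i i0] by auto
    then show "phi \<mu> \<rho> \<le> - 1 / \<theta> i" "- 1 / \<theta> i < 0" unfolding \<rho>(3) by (auto simp: frac_le)
  qed
  then obtain \<rho>' where \<rho>': "\<And>i. i \<in> {1..i0} \<Longrightarrow> 0 < \<rho>' i \<and> \<rho>' i \<le> \<rho> \<and> phi \<mu> (\<rho>' i) = - 1 / \<theta> i" by metis
  define Y where "Y n = low_rank \<theta> {1..r} (u n) (v n) (X n)" for n
  \<comment> \<open>\<open>right_test\<close> lists coordinates in the right singular basis;
    \<open>w\<close> is the vector with these coordinates.\<close>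
  define w where "w n i k = (\<Sum>c<n. right_test \<rho>' n i c * q n c k)" for n i k
  have ex: "\<forall>n. \<exists>d. (\<Sum>i\<in>{1..i0}. (norm (d i))\<^sup>2) = 1 \<and> (i0 \<le> n \<longrightarrow>
    (\<sigma> n)\<^sup>2 * nsq {..<n} (\<lambda>k. \<Sum>i\<in>{1..i0}. d i * w n i k) \<le> nsq {..<n} (mv {..<n} (Y n) (\<lambda>k. \<Sum>i\<in>{1..i0}. d i * w n i k)))" (is "\<forall>n. ?E n")
  proof
    fix n
    show "?E n"
    proof (cases "i0 \<le> n")
    case True
    obtain t a b where t: "is_svd n (Y n) t a b" using svd_exists by blast
    have "card {k. k < n \<and> t k < \<sigma> n} < card {1..i0}" using count[OF True t[unfolded Y_def]] by simp
    from interlacing_upper[OF t \<sigma>_nonneg[OF True] finite_atLeastAtMost this, of "w n"] show ?thesis by (elim exE) blast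
  next
    case False
    \<comment> \<open>Below i0 only the normalisation of the coefficients is demanded.\<close>
    have "(\<Sum>i\<in>{1..i0}. (norm (if i = i0 then 1 else 0 :: 'a))\<^sup>2) = (\<Sum>i\<in>{1..i0}. if i = i0 then 1 else 0)"
      by (intro sum.cong refl) auto
    also have "\<dots> = 1" using i0 by simp
    finally show ?thesis using False by (intro exI[of _ "\<lambda>i. if i = i0 then 1 else 0"]) simp
  qed
  qed
  obtain d where dd: "\<forall>n. (\<Sum>i\<in>{1..i0}. (norm (d n i))\<^sup>2) = 1 \<and> (i0 \<le> n \<longrightarrow>
    (\<sigma> n)\<^sup>2 * nsq {..<n} (\<lambda>k. \<Sum>i\<in>{1..i0}. d n i * w n i k) \<le> nsq {..<n} (mv {..<n} (Y n) (\<lambda>k. \<Sum>i\<in>{1..i0}. d n i * w n i k)))"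
    using choice[OF ex] by (elim exE) (rule that)
  have d: "(\<Sum>i\<in>{1..i0}. (norm (d n i))\<^sup>2) = 1" for n using dd by blast
  note le = dd[rule_format, THEN conjunct2, rule_format]
  define W where "W n c = (\<Sum>i\<in>{1..i0}. d n i * right_test \<rho>' n i c)" for n c
  have coord: "ip {..<n} (\<lambda>k. \<Sum>i\<in>{1..i0}. d n i * w n i k) (q n c) = W n c" if c: "c < n" for n c
  proof -
    have "ip {..<n} (w n i) (q n c) = right_test \<rho>' n i c" for i
    proof -
      have "ip {..<n} (w n i) (q n c) = (\<Sum>e<n. right_test \<rho>' n i e * (if e = c then 1 else 0))"
        unfolding w_def[abs_def] ip_sum_left ip_mult_left
        by (intro sum.cong refl) (use c orthonormal_basis.orthonormal[OF is_svdD(2)[OF svd]] in auto)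
      also have "\<dots> = right_test \<rho>' n i c" using c by (simp add: if_distrib[of "\<lambda>x. _ * x"] cong: if_cong)
      finally show ?thesis .
    qed
    then show ?thesis unfolding ip_sum_left ip_mult_left W_def by simp
  qed
  have "\<forall>\<^sub>F n in sequentially. sqrt (nsq {..<n} (\<lambda>c. of_real (s n c) * W n c + (\<Sum>j\<in>{1..r}. of_real (\<theta> j) * ip {..<n} (W n) (\<beta> n j) * \<alpha> n j c)))
     < (\<rho> + \<epsilon>) * sqrt (nsq {..<n} (W n))"
  proof (rule test_vector_bound[where I = "{1..i0}" and d = d and \<rho> = \<rho>'])
    show "{1..i0} \<subseteq> {1..r}" "{1..i0} \<noteq> {}" using i0 by auto
    fix i assume i: "i \<in> {1..i0}"
    show "0 \<le> \<rho>' i" "\<rho>' i < a" "\<rho>' i \<le> \<rho>" using \<rho>'[OF i] \<rho> by auto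
    show "\<theta> i \<noteq> 0" using \<theta>_pos[of i] i i0 by auto
    then show "\<theta> i * phi \<mu> (\<rho>' i) = - 1" using \<rho>'[OF i] by simp
  qed (use d \<epsilon> in \<open>auto simp: W_def\<close>)
  then show ?thesis using eventually_ge_at_top[of i0]
  proof eventually_elim
    case (elim n)
    let ?W = "\<lambda>k. \<Sum>i\<in>{1..i0}. d n i * w n i k"
    have nW: "nsq {..<n} ?W = nsq {..<n} (W n)"
      unfolding orthonormal_basis.parseval_nsq[OF is_svdD(2)[OF svd], of n ?W, symmetric] by (rule nsq_cong) (simp add: coord del: One_nat_def)
    have "nsq {..<n} (mv {..<n} (Y n) ?W) = nsq {..<n} (\<lambda>c. ip {..<n} (mv {..<n} (Y n) ?W) (p n c))"
      by (rule orthonormal_basis.parseval_nsq[OF is_svdD(1)[OF svd], symmetric])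
    also have "\<dots> = nsq {..<n} (\<lambda>c. of_real (s n c) * W n c + (\<Sum>j\<in>{1..r}. of_real (\<theta> j) * ip {..<n} (W n) (\<beta> n j) * \<alpha> n j c))"
    proof (rule nsq_cong)
      fix c assume c: "c \<in> {..<n}"
      have "ip {..<n} (\<lambda>c. ip {..<n} ?W (q n c)) (\<beta> n j) = ip {..<n} (W n) (\<beta> n j)" for j
        by (rule ip_cong) (simp_all add: coord del: One_nat_def)
      then show "ip {..<n} (mv {..<n} (Y n) ?W) (p n c) = of_real (s n c) * W n c + (\<Sum>j\<in>{1..r}. of_real (\<theta> j) * ip {..<n} (W n) (\<beta> n j) * \<alpha> n j c)"
        using c unfolding Y_def by (subst low_rank_coordinate[OF svd]) (simp_all add: coord \<alpha>_eq \<beta>_eq del: One_nat_def)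
    qed
    finally have "(\<sigma> n)\<^sup>2 * nsq {..<n} (W n) \<le> nsq {..<n} (\<lambda>c. of_real (s n c) * W n c + (\<Sum>j\<in>{1..r}. of_real (\<theta> j) * ip {..<n} (W n) (\<beta> n j) * \<alpha> n j c))"
      using le[OF elim(2)] nW by simp
    then have "sqrt ((\<sigma> n)\<^sup>2 * nsq {..<n} (W n)) < (\<rho> + \<epsilon>) * sqrt (nsq {..<n} (W n))"
      using elim(1) by (meson order_le_less_trans real_sqrt_le_mono)
    then have "\<sigma> n * sqrt (nsq {..<n} (W n)) < (\<rho> + \<epsilon>) * sqrt (nsq {..<n} (W n))"
      using \<sigma>_nonneg[OF elim(2)] by (simp add: real_sqrt_mult)
    then show ?case by (rule mult_right_less_imp_less) simp
  qed
qed

lemma singular_value_limit: "\<sigma> \<longlonglongrightarrow> \<rho>"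
proof (rule order_tendstoI)
  fix b assume "\<rho> < b"
  then show "\<forall>\<^sub>F n in sequentially. \<sigma> n < b" using singular_value_upper[of "b - \<rho>"] by simp
qed (rule singular_value_lower)

section \<open>Overlaps at the limiting singular value\<close>

lemma gram_limit:
  assumes "i \<in> {1..r}" "j \<in> {1..r}"
  shows "(\<lambda>n. ip {..<n} (u n i) (u n j)) \<longlonglongrightarrow> (if i = j then 1 else 0)"
    and "(\<lambda>n. ip {..<n} (v n i) (v n j)) \<longlonglongrightarrow> (if i = j then 1 else 0)"
  using gram[OF assms] unfolding \<alpha>_eq \<beta>_eq
  by (simp_all only: orthonormal_basis.parseval[OF is_svdD(1)[OF svd]] orthonormal_basis.parseval[OF is_svdD(2)[OF svd]])

context
  fixes u' v' :: "nat \<Rightarrow> nat \<Rightarrow> 'a"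
  assumes right: "\<And>n k. i0 \<le> n \<Longrightarrow> k < n \<Longrightarrow> mv {..<n} (low_rank \<theta> {1..r} (u n) (v n) (X n)) (v' n) k = of_real (\<sigma> n) * u' n k"
    and left: "\<And>n k. i0 \<le> n \<Longrightarrow> k < n \<Longrightarrow> mv {..<n} (adj (low_rank \<theta> {1..r} (u n) (v n) (X n))) (u' n) k = of_real (\<sigma> n) * v' n k"
    and unit: "\<And>n. i0 \<le> n \<Longrightarrow> nsq {..<n} (u' n) = 1" "\<And>n. i0 \<le> n \<Longrightarrow> nsq {..<n} (v' n) = 1"
begin

private abbreviation "x n i \<equiv> ip {..<n} (u' n) (u n i)"
private abbreviation "y n i \<equiv> ip {..<n} (v' n) (v n i)"

lemma overlap_limits:
  shows "j \<in> {1..r} \<Longrightarrow> (\<lambda>n. x n j - of_real (phi \<mu> \<rho> * \<theta> j) * y n j) \<longlonglongrightarrow> 0"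
    and "j \<in> {1..r} \<Longrightarrow> (\<lambda>n. y n j - of_real (phi \<mu> \<rho> * \<theta> j) * x n j) \<longlonglongrightarrow> 0"
    and "(\<lambda>n. psi2 \<mu> \<rho> * (\<Sum>i\<in>{1..r}. (\<theta> i)\<^sup>2 * ((norm (x n i))\<^sup>2 + (norm (y n i))\<^sup>2))) \<longlonglongrightarrow> 2"
proof -
  \<comment> \<open>The singular vector equations are given from i0 on only; the sequences are
    shifted by i0 and the limits shifted back at the end.\<close>
  define N where "N k = k + i0" for k
  define U where "U k c = ip {..<N k} (u' (N k)) (p (N k) c)" for k c
  define V where "V k c = ip {..<N k} (v' (N k)) (q (N k) c)" for k c
  have Ni: "i0 \<le> N k" for k by (simp add: N_def)
  have N: "filterlim N at_top sequentially" unfolding N_def by (rule filterlim_add_const_nat_at_top)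
  have lim: "(\<lambda>k. \<sigma> (N k)) \<longlonglongrightarrow> \<rho>" unfolding N_def using singular_value_limit by (rule LIMSEQ_ignore_initial_segment)
  have x: "x (N k) i = ip {..<N k} (U k) (\<alpha> (N k) i)" for k i
    unfolding \<alpha>_eq U_def[abs_def] by (rule orthonormal_basis.parseval[OF is_svdD(1)[OF svd], symmetric])
  have y: "y (N k) i = ip {..<N k} (V k) (\<beta> (N k) i)" for k i
    unfolding \<beta>_eq V_def[abs_def] by (rule orthonormal_basis.parseval[OF is_svdD(2)[OF svd], symmetric])
  have eq1: "of_real (s (N k) c) * V k c + (\<Sum>i\<in>{1..r}. of_real (\<theta> i) * y (N k) i * \<alpha> (N k) i c) = of_real (\<sigma> (N k)) * U k c"
    if c: "c < N k" for k c
    unfolding y unfolding \<alpha>_eq \<beta>_eq U_def[abs_def] V_def[abs_def]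
    by (rule svd_of_low_rank_coordinates[OF svd right[OF Ni] c])
  have eq2: "of_real (s (N k) c) * U k c + (\<Sum>i\<in>{1..r}. of_real (\<theta> i) * x (N k) i * \<beta> (N k) i c) = of_real (\<sigma> (N k)) * V k c"
    if c: "c < N k" for k c
    unfolding x unfolding \<alpha>_eq \<beta>_eq U_def[abs_def] V_def[abs_def]
    by (rule svd_of_low_rank_coordinates[OF svd_adj left[OF Ni, unfolded adj_low_rank] c])
  have unit': "nsq {..<N k} (U k) = 1" "nsq {..<N k} (V k) = 1" for k
    unfolding U_def[abs_def] V_def[abs_def] orthonormal_basis.parseval_nsq[OF is_svdD(1)[OF svd]] orthonormal_basis.parseval_nsq[OF is_svdD(2)[OF svd]]
    by (rule unit[OF Ni])+
  have I: "finite {1..r}" "{1..r} \<subseteq> {1..r}" by auto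
  note off = LIMSEQ_offset[where k = i0]
  show "(\<lambda>n. psi2 \<mu> \<rho> * (\<Sum>i\<in>{1..r}. (\<theta> i)\<^sup>2 * ((norm (x n i))\<^sup>2 + (norm (y n i))\<^sup>2))) \<longlonglongrightarrow> 2"
    by (rule off, rule overlap_normalization[where U = U and V = V and x = "\<lambda>k i. x (N k) i" and y = "\<lambda>k i. y (N k) i" and \<theta> = \<theta>,
          OF N lim \<sigma>_nonneg[OF Ni] \<rho>(2) I x y _ _ unit', unfolded N_def]; erule eq1[unfolded N_def] eq2[unfolded N_def])
  assume j: "j \<in> {1..r}"
  show "(\<lambda>n. x n j - of_real (phi \<mu> \<rho> * \<theta> j) * y n j) \<longlonglongrightarrow> 0"
    by (rule off, rule overlap_relation(1)[where U = U and V = V and x = "\<lambda>k i. x (N k) i" and y = "\<lambda>k i. y (N k) i" and \<theta> = \<theta>,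
          OF N lim \<sigma>_nonneg[OF Ni] \<rho>(2) I x y _ _ unit' j, unfolded N_def]; erule eq1[unfolded N_def] eq2[unfolded N_def])
  show "(\<lambda>n. y n j - of_real (phi \<mu> \<rho> * \<theta> j) * x n j) \<longlonglongrightarrow> 0"
    by (rule off, rule overlap_relation(2)[where U = U and V = V and x = "\<lambda>k i. x (N k) i" and y = "\<lambda>k i. y (N k) i" and \<theta> = \<theta>,
          OF N lim \<sigma>_nonneg[OF Ni] \<rho>(2) I x y _ _ unit' j, unfolded N_def]; erule eq1[unfolded N_def] eq2[unfolded N_def])
qed

text \<open>The squared coupling factor is (\<theta> j / \<theta> i0)^2, which differs from 1, so
  the coupled relations are nondegenerate.\<close>

lemma overlap_other:
  assumes j: "j \<in> {1..r}" "\<theta> j \<noteq> \<theta> i0"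
  shows "(\<lambda>n. x n j) \<longlonglongrightarrow> 0" and "(\<lambda>n. y n j) \<longlonglongrightarrow> 0"
proof -
  have pos: "0 < \<theta> j" "0 < \<theta> i0" using \<theta>_pos j i0 by auto
  have "phi \<mu> \<rho> * \<theta> j * (phi \<mu> \<rho> * \<theta> j) = (\<theta> j / \<theta> i0)\<^sup>2" unfolding \<rho>(3) by (simp add: power2_eq_square)
  also have "\<dots> \<noteq> 1"
  proof
    assume "(\<theta> j / \<theta> i0)\<^sup>2 = 1"
    then have "\<theta> j / \<theta> i0 = 1" using divide_pos_pos[OF pos] unfolding power2_eq_1_iff by linarith
    then show False using pos j(2) by simp
  qed
  finally have f: "phi \<mu> \<rho> * \<theta> j * (phi \<mu> \<rho> * \<theta> j) \<noteq> 1" .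
  show "(\<lambda>n. x n j) \<longlonglongrightarrow> 0" "(\<lambda>n. y n j) \<longlonglongrightarrow> 0"
    by (rule coupled_null_sequences[OF overlap_limits(1,2)[OF j(1)] f],
        rule coupled_null_sequences[OF overlap_limits(2,1)[OF j(1)] f])
qed

text \<open>The coupling factor is -1, the degenerate case: the relations only tie each overlap to
  minus its partner.\<close>

lemma overlap_same:
  assumes j: "j \<in> {1..r}" "\<theta> j = \<theta> i0"
  shows "(\<lambda>n. x n j + y n j) \<longlonglongrightarrow> 0"
proof -
  have "phi \<mu> \<rho> * \<theta> j = - 1" unfolding \<rho>(3) j(2) using \<theta>_pos[OF i0] by simp
  then show ?thesis using overlap_limits(1)[OF j(1)] by simp
qed

lemma overlap_bound:
  assumes j: "j \<in> {1..r}"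
  shows "\<forall>\<^sub>F n in sequentially. norm (x n j) \<le> 2" and "\<forall>\<^sub>F n in sequentially. norm (y n j) \<le> 2"
proof -
  show "\<forall>\<^sub>F n in sequentially. norm (x n j) \<le> 2"
    using nsq_bounded(1)[OF j] eventually_ge_at_top[of i0]
  proof eventually_elim
    case (elim n)
    have "norm (x n j) \<le> sqrt (nsq {..<n} (u' n)) * sqrt (nsq {..<n} (u n j))" by (rule norm_ip_le)
    then show ?case using elim unfolding unit(1)[OF elim(2)] \<alpha>_eq orthonormal_basis.parseval_nsq[OF is_svdD(1)[OF svd]] by simp
  qed
  show "\<forall>\<^sub>F n in sequentially. norm (y n j) \<le> 2"
    using nsq_bounded(2)[OF j] eventually_ge_at_top[of i0]
  proof eventually_elim
    case (elim n)
    have "norm (y n j) \<le> sqrt (nsq {..<n} (v' n)) * sqrt (nsq {..<n} (v n j))" by (rule norm_ip_le)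
    then show ?case using elim unfolding unit(2)[OF elim(2)] \<beta>_eq orthonormal_basis.parseval_nsq[OF is_svdD(2)[OF svd]] by simp
  qed
qed

text \<open>The normalisation fixes the sum of the two quantities, and \<open>overlap_same\<close>
  makes them asymptotically equal, so each tends to half of 2 / ((\<theta> i0)^2 psi2).\<close>

lemma overlap_sum:
  shows "(\<lambda>n. \<Sum>i | i \<in> {1..r} \<and> \<theta> i = \<theta> i0. (norm (x n i))\<^sup>2) \<longlonglongrightarrow> 1 / ((\<theta> i0)\<^sup>2 * psi2 \<mu> \<rho>)"
    and "(\<lambda>n. \<Sum>i | i \<in> {1..r} \<and> \<theta> i = \<theta> i0. (norm (y n i))\<^sup>2) \<longlonglongrightarrow> 1 / ((\<theta> i0)\<^sup>2 * psi2 \<mu> \<rho>)"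
proof -
  define S where "S = {i. i \<in> {1..r} \<and> \<theta> i = \<theta> i0}"
  have S: "finite S" "S \<subseteq> {1..r}" by (auto simp: S_def)
  define T where "T = (\<theta> i0)\<^sup>2 * psi2 \<mu> \<rho>"
  have T: "0 < T" using psi2_pos[of \<rho>] \<rho> \<theta>_pos[OF i0] by (simp add: T_def)
  have "(\<lambda>n. psi2 \<mu> \<rho> * (\<Sum>i\<in>{1..r}. (\<theta> i)\<^sup>2 * ((norm (x n i))\<^sup>2 + (norm (y n i))\<^sup>2))
      - psi2 \<mu> \<rho> * (\<Sum>i\<in>{1..r} - S. (\<theta> i)\<^sup>2 * ((norm (x n i))\<^sup>2 + (norm (y n i))\<^sup>2)))
    \<longlonglongrightarrow> 2 - psi2 \<mu> \<rho> * (\<Sum>i\<in>{1..r} - S. (\<theta> i)\<^sup>2 * ((norm (0 :: 'a))\<^sup>2 + (norm (0 :: 'a))\<^sup>2))"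
    by (intro tendsto_diff overlap_limits(3) tendsto_mult tendsto_const tendsto_sum tendsto_add tendsto_power tendsto_norm overlap_other)
       (auto simp: S_def)
  moreover have "psi2 \<mu> \<rho> * (\<Sum>i\<in>{1..r}. (\<theta> i)\<^sup>2 * ((norm (x n i))\<^sup>2 + (norm (y n i))\<^sup>2))
      - psi2 \<mu> \<rho> * (\<Sum>i\<in>{1..r} - S. (\<theta> i)\<^sup>2 * ((norm (x n i))\<^sup>2 + (norm (y n i))\<^sup>2))
      = T * ((\<Sum>i\<in>S. (norm (x n i))\<^sup>2) + (\<Sum>i\<in>S. (norm (y n i))\<^sup>2))" for n
  proof -
    have "(\<Sum>i\<in>{1..r}. (\<theta> i)\<^sup>2 * ((norm (x n i))\<^sup>2 + (norm (y n i))\<^sup>2))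
      = (\<Sum>i\<in>{1..r} - S. (\<theta> i)\<^sup>2 * ((norm (x n i))\<^sup>2 + (norm (y n i))\<^sup>2)) + (\<Sum>i\<in>S. (\<theta> i)\<^sup>2 * ((norm (x n i))\<^sup>2 + (norm (y n i))\<^sup>2))"
      by (rule sum.subset_diff) (use S in auto)
    also have "(\<Sum>i\<in>S. (\<theta> i)\<^sup>2 * ((norm (x n i))\<^sup>2 + (norm (y n i))\<^sup>2)) = (\<theta> i0)\<^sup>2 * ((\<Sum>i\<in>S. (norm (x n i))\<^sup>2) + (\<Sum>i\<in>S. (norm (y n i))\<^sup>2))"
      unfolding sum.distrib[symmetric] sum_distrib_left by (intro sum.cong refl) (simp add: S_def)
    finally show ?thesis by (simp add: T_def algebra_simps)
  qed
  ultimately have total: "(\<lambda>n. T * ((\<Sum>i\<in>S. (norm (x n i))\<^sup>2) + (\<Sum>i\<in>S. (norm (y n i))\<^sup>2))) \<longlonglongrightarrow> 2" by simp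
  have "(\<lambda>n. (norm (x n i))\<^sup>2 - (norm (y n i))\<^sup>2) \<longlonglongrightarrow> 0" if i: "i \<in> S" for i
  proof (rule Lim_null_comparison)
    have i': "i \<in> {1..r}" "\<theta> i = \<theta> i0" using i by (auto simp: S_def)
    show "(\<lambda>n. norm (x n i + y n i) * 4) \<longlonglongrightarrow> 0"
      using tendsto_mult[OF tendsto_norm[OF overlap_same[OF i']] tendsto_const[of 4]] by simp
    show "\<forall>\<^sub>F n in sequentially. norm ((norm (x n i))\<^sup>2 - (norm (y n i))\<^sup>2) \<le> norm (x n i + y n i) * 4"
      using overlap_bound[OF i'(1)]
    proof eventually_elim
      case (elim n)
      have "(norm (x n i))\<^sup>2 - (norm (y n i))\<^sup>2 = (norm (x n i) - norm (- y n i)) * (norm (x n i) + norm (y n i))"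
        by (simp add: power2_eq_square algebra_simps)
      moreover have "\<bar>norm (x n i) - norm (- y n i)\<bar> \<le> norm (x n i + y n i)"
        using norm_triangle_ineq3[of "x n i" "- y n i"] by simp
      moreover have "\<bar>norm (x n i) + norm (y n i)\<bar> \<le> 4" using elim by simp
      ultimately show ?case by (simp add: abs_mult mult_mono del: norm_minus_cancel)
    qed
  qed
  then have "(\<lambda>n. \<Sum>i\<in>S. (norm (x n i))\<^sup>2 - (norm (y n i))\<^sup>2) \<longlonglongrightarrow> (\<Sum>i\<in>S. 0)" by (rule tendsto_sum)
  then have diff: "(\<lambda>n. (\<Sum>i\<in>S. (norm (x n i))\<^sup>2) - (\<Sum>i\<in>S. (norm (y n i))\<^sup>2)) \<longlonglongrightarrow> 0" by (simp add: sum_subtractf)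
  have "(\<lambda>n. (T * ((\<Sum>i\<in>S. (norm (x n i))\<^sup>2) + (\<Sum>i\<in>S. (norm (y n i))\<^sup>2)) / T + ((\<Sum>i\<in>S. (norm (x n i))\<^sup>2) - (\<Sum>i\<in>S. (norm (y n i))\<^sup>2))) / 2) \<longlonglongrightarrow> (2 / T + 0) / 2"
    "(\<lambda>n. (T * ((\<Sum>i\<in>S. (norm (x n i))\<^sup>2) + (\<Sum>i\<in>S. (norm (y n i))\<^sup>2)) / T - ((\<Sum>i\<in>S. (norm (x n i))\<^sup>2) - (\<Sum>i\<in>S. (norm (y n i))\<^sup>2))) / 2) \<longlonglongrightarrow> (2 / T - 0) / 2"
    using T by (intro tendsto_intros total diff; simp)+
  then show "(\<lambda>n. \<Sum>i | i \<in> {1..r} \<and> \<theta> i = \<theta> i0. (norm (x n i))\<^sup>2) \<longlonglongrightarrow> 1 / ((\<theta> i0)\<^sup>2 * psi2 \<mu> \<rho>)"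
    "(\<lambda>n. \<Sum>i | i \<in> {1..r} \<and> \<theta> i = \<theta> i0. (norm (y n i))\<^sup>2) \<longlonglongrightarrow> 1 / ((\<theta> i0)\<^sup>2 * psi2 \<mu> \<rho>)"
    using T unfolding S_def[symmetric] T_def[symmetric] by simp_all
qed

end

end

section \<open>Orthogonal projections\<close>

text \<open>Independence is not assumed: when the residual \<open>e\<close> of \<open>w j\<close>
  vanishes, \<open>w j\<close> adds nothing to the span and any coefficient \<open>t\<close> is
  right.\<close>

lemma projection_exists:
  fixes w :: "'i \<Rightarrow> 'k \<Rightarrow> 'a :: real_or_complex"
  assumes K: "finite K" and I: "finite I"
  shows "\<exists>c. \<forall>j\<in>I. ip K (\<lambda>k. x k - (\<Sum>i\<in>I. c i * w i k)) (w j) = 0"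
  using I
proof (induction I arbitrary: x rule: finite_induct)
  case (insert j I)
  obtain a where a: "\<forall>i\<in>I. ip K (\<lambda>k. x k - (\<Sum>i\<in>I. a i * w i k)) (w i) = 0" using insert.IH[of x] by blast
  obtain b where b: "\<forall>i\<in>I. ip K (\<lambda>k. w j k - (\<Sum>i\<in>I. b i * w i k)) (w i) = 0" using insert.IH[of "w j"] by blast
  define y where "y k = x k - (\<Sum>i\<in>I. a i * w i k)" for k
  define e where "e k = w j k - (\<Sum>i\<in>I. b i * w i k)" for k
  define t where "t = ip K y e / of_real (nsq K e)"
  have wj: "w j k = e k + (\<Sum>i\<in>I. b i * w i k)" for k by (simp add: e_def)
  have orth: "ip K z (w j) = ip K z e" if "\<And>i. i \<in> I \<Longrightarrow> ip K z (w i) = 0" for z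
  proof -
    have "ip K z (w j) = ip K z (\<lambda>k. e k + (\<Sum>i\<in>I. b i * w i k))" by (rule ip_cong) (simp_all add: wj)
    then show ?thesis by (simp add: ip_add_right ip_sum_right ip_mult_right that)
  qed
  define c where "c i = (if i = j then t else a i - t * b i)" for i
  have res: "x k - (\<Sum>i\<in>insert j I. c i * w i k) = y k - t * e k" for k
  proof -
    have "(\<Sum>i\<in>insert j I. c i * w i k) = t * w j k + (\<Sum>i\<in>I. (a i - t * b i) * w i k)"
      using insert.hyps by (simp add: c_def) (intro sum.cong refl, auto)
    then show ?thesis
      by (simp add: y_def e_def left_diff_distrib sum_subtractf algebra_simps sum_distrib_left)
  qed
  have z: "ip K (\<lambda>k. y k - t * e k) (w i) = 0" if "i \<in> I" for i
    using a b that by (simp add: ip_diff_left ip_mult_left y_def[abs_def] e_def[abs_def])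
  have "ip K (\<lambda>k. y k - t * e k) e = 0"
  proof (cases "nsq K e = 0")
    case True
    then have "ip K (\<lambda>k. y k - t * e k) e = ip K (\<lambda>k. y k - t * e k) (\<lambda>k. 0)"
      by (intro ip_cong) (simp_all add: nsq_eq_0_iff[OF K])
    then show ?thesis by simp
  next
    case False
    have "ip K (\<lambda>k. y k - t * e k) e = ip K y e - t * of_real (nsq K e)" by (simp only: ip_diff_left ip_mult_left ip_self)
    then show ?thesis using False by (simp add: t_def)
  qed
  then have "ip K (\<lambda>k. y k - t * e k) (w j) = 0" using orth[OF z] by simp
  then show ?case using z by (intro exI[of _ c]) (simp only: res, blast)
qed simp

text \<open>The span is that of a set, whereas the family \<open>w\<close> may repeat vectors. One
  direction selects one index per vector, the other adds up the coefficients of equal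
  vectors.\<close>

lemma vspan_eq:
  fixes w :: "'i \<Rightarrow> 'a :: real_or_complex vec"
  assumes I: "finite I" and w: "\<And>i. i \<in> I \<Longrightarrow> w i \<in> carrier_vec n"
  shows "vspan n {w i | i. i \<in> I} = range (\<lambda>c. Matrix.vec n (\<lambda>k. \<Sum>i\<in>I. c i * w i $ k))"
proof -
  interpret vec_space "TYPE('a)" n .
  let ?S = "{w i | i. i \<in> I}"
  have S: "?S = w ` I" "w ` I \<subseteq> carrier_vec n" "finite (w ` I)" using I w by auto
  have index: "lincomb a (w ` I) $ k = (\<Sum>x\<in>w ` I. a x * x $ k)" if "k < n" for a k
    by (rule lincomb_index[OF that S(2)])
  have "f \<in> range (\<lambda>c. Matrix.vec n (\<lambda>k. \<Sum>i\<in>I. c i * w i $ k))" if "f \<in> vspan n ?S" for f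
  proof -
    have fS: "f \<in> span (w ` I)" using that unfolding vspan_def S(1) .
    obtain a where a: "lincomb a (w ` I) = f" using finite_in_span[OF S(3,2) fS] by blast
    obtain J where J: "J \<subseteq> I" "inj_on w J" "w ` I = w ` J" using subset_image_inj[of "w ` I" w I] by auto
    have f: "f \<in> carrier_vec n" using lincomb_closed[OF S(2), of a] by (simp add: a)
    have "f $ k = (\<Sum>i\<in>I. (if i \<in> J then a (w i) else 0) * w i $ k)" if k: "k < n" for k
    proof -
      have "f $ k = (\<Sum>x\<in>w ` J. a x * x $ k)" using index[OF k, of a] unfolding a unfolding J(3) .
      also have "\<dots> = (\<Sum>i\<in>J. a (w i) * w i $ k)" by (simp add: sum.reindex[OF J(2)])
      also have "\<dots> = (\<Sum>i\<in>I. (if i \<in> J then a (w i) else 0) * w i $ k)"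
        using J(1) I by (intro sum.mono_neutral_cong_left) auto
      finally show ?thesis .
    qed
    then have "f = Matrix.vec n (\<lambda>k. \<Sum>i\<in>I. (if i \<in> J then a (w i) else 0) * w i $ k)" using f by (intro eq_vecI) auto
    then show ?thesis by (rule range_eqI[where x = "\<lambda>i. if i \<in> J then a (w i) else 0"])
  qed
  moreover have "Matrix.vec n (\<lambda>k. \<Sum>i\<in>I. c i * w i $ k) \<in> vspan n ?S" for c
  proof -
    define a where "a x = (\<Sum>i | i \<in> I \<and> w i = x. c i)" for x
    have car: "lincomb a (w ` I) \<in> carrier_vec n" using lincomb_closed[OF S(2), of a] by simp
    have "Matrix.vec n (\<lambda>k. \<Sum>i\<in>I. c i * w i $ k) = lincomb a (w ` I)"
    proof (rule eq_vecI)
      fix k assume "k < dim_vec (lincomb a (w ` I))"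
      then have k: "k < n" using car by auto
      have "(\<Sum>i\<in>I. c i * w i $ k) = (\<Sum>x\<in>w ` I. \<Sum>i | i \<in> I \<and> w i = x. c i * w i $ k)"
        by (rule sum.image_gen[OF I])
      also have "\<dots> = (\<Sum>x\<in>w ` I. a x * x $ k)"
        by (intro sum.cong refl) (simp add: a_def sum_distrib_right)
      also have "\<dots> = lincomb a (w ` I) $ k" by (rule index[OF k, symmetric])
      finally show "Matrix.vec n (\<lambda>k. \<Sum>i\<in>I. c i * w i $ k) $ k = lincomb a (w ` I) $ k" using k by simp
    qed (use car in auto)
    then show ?thesis unfolding vspan_def S(1) by (rule in_spanI) (use S in auto)
  qed
  ultimately show ?thesis by blast
qed

lemma cscalar_prod_ip: "w \<in> carrier_vec n \<Longrightarrow> v \<bullet>c w = ip {..<n} (($) v) (($) w)"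
  by (auto simp: scalar_prod_def ip_def atLeast0LessThan intro!: sum.cong)

text \<open>The normal equations determine the projection even where the coefficients
  \<open>c\<close> are not unique. The description in \<open>orth_proj\<close> is well defined
  because two candidates differ by a vector of the span that is orthogonal to the span.\<close>

lemma proj_norm_vspan:
  fixes w :: "'i \<Rightarrow> 'a :: real_or_complex vec"
  assumes I: "finite I" and w: "\<And>i. i \<in> I \<Longrightarrow> w i \<in> carrier_vec n" and x: "x \<in> carrier_vec n"
  shows "\<exists>c. (\<forall>j\<in>I. ip {..<n} (\<lambda>k. \<Sum>i\<in>I. c i * w i $ k) (($) (w j)) = ip {..<n} (($) x) (($) (w j))) \<and>
    (proj_norm x (vspan n {w i | i. i \<in> I}))\<^sup>2 = nsq {..<n} (\<lambda>k. \<Sum>i\<in>I. c i * w i $ k)"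
proof -
  let ?F = "vspan n {w i | i. i \<in> I}"
  obtain c where "\<forall>j\<in>I. ip {..<n} (\<lambda>k. x $ k - (\<Sum>i\<in>I. c i * w i $ k)) (($) (w j)) = 0"
    using projection_exists[OF finite_lessThan I, of n "($) x" "\<lambda>i. ($) (w i)"] by blast
  then have c: "ip {..<n} (\<lambda>k. \<Sum>i\<in>I. c i * w i $ k) (($) (w j)) = ip {..<n} (($) x) (($) (w j))" if "j \<in> I" for j
    using that by (simp add: ip_diff_left)
  define p where "p = Matrix.vec n (\<lambda>k. \<Sum>i\<in>I. c i * w i $ k)"
  have F_eq: "?F = range (\<lambda>c. Matrix.vec n (\<lambda>k. \<Sum>i\<in>I. c i * w i $ k))" by (rule vspan_eq[OF I w])
  have p: "p \<in> carrier_vec n" "p \<in> ?F" by (simp_all add: p_def F_eq)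
  have F: "f \<in> carrier_vec n" if "f \<in> ?F" for f using that by (auto simp: F_eq)
  have orth: "ip {..<n} (\<lambda>k. x $ k - p $ k) (($) f) = 0" if f: "f \<in> ?F" for f
  proof -
    obtain d where d: "f = Matrix.vec n (\<lambda>k. \<Sum>i\<in>I. d i * w i $ k)" using f[unfolded F_eq] by (elim rangeE) (rule that)
    have "ip {..<n} (\<lambda>k. x $ k - p $ k) (($) f) = ip {..<n} (\<lambda>k. x $ k - (\<Sum>i\<in>I. c i * w i $ k)) (\<lambda>k. \<Sum>i\<in>I. d i * w i $ k)"
      by (rule ip_cong) (simp_all add: p_def d)
    also have "\<dots> = (\<Sum>i\<in>I. conjugate (d i) * (ip {..<n} (($) x) (($) (w i)) - ip {..<n} (\<lambda>k. \<Sum>i\<in>I. c i * w i $ k) (($) (w i))))"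
      unfolding ip_sum_right ip_mult_right ip_diff_left ..
    also have "\<dots> = 0" by (intro sum.neutral ballI) (simp only: c diff_self mult_zero_right)
    finally show ?thesis .
  qed
  have conv: "(x - p') \<bullet>c f = ip {..<n} (\<lambda>k. x $ k - p' $ k) (($) f)" if "p' \<in> carrier_vec n" "f \<in> carrier_vec n" for p' f
    unfolding cscalar_prod_ip[OF that(2)] by (rule ip_cong) (use x that in auto)
  have "orth_proj ?F x = p"
    unfolding orth_proj_def
  proof (rule the_equality)
    show "p \<in> ?F \<and> (\<forall>f\<in>?F. (x - p) \<bullet>c f = 0)" using p orth F by (simp add: conv)
  next
    fix p' assume p': "p' \<in> ?F \<and> (\<forall>f\<in>?F. (x - p') \<bullet>c f = 0)"
    then have p'o: "ip {..<n} (\<lambda>k. x $ k - p' $ k) (($) f) = 0" if "f \<in> ?F" for f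
      using conv[OF F F[OF that], of p'] p' that by simp
    have "ip {..<n} (\<lambda>k. p' $ k - p $ k) (($) f) = 0" if "f \<in> ?F" for f
      using p'o[OF that] orth[OF that] by (simp add: ip_diff_left)
    then have "ip {..<n} (\<lambda>k. p' $ k - p $ k) (\<lambda>k. p' $ k - p $ k) = 0"
      using p' p by (simp add: ip_diff_right)
    then have "nsq {..<n} (\<lambda>k. p' $ k - p $ k) = 0" by (simp add: ip_self)
    then show "p' = p" using F[of p'] p' p(1) by (intro eq_vecI) (auto simp: nsq_eq_0_iff)
  qed
  then have "(proj_norm x ?F)\<^sup>2 = nsq {..<n} (\<lambda>k. \<Sum>i\<in>I. c i * w i $ k)"
    by (simp add: proj_norm_def l2norm_def p_def nsq_def sum_nonneg)
  with c show ?thesis by blast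
qed

text \<open>The overlaps \<open>x\<close> arise from the coefficients \<open>c\<close> through a
  Gram matrix near the identity, so \<open>c\<close> is close to \<open>x\<close>, and the squared
  norm is the pairing of \<open>c\<close> with \<open>x\<close>. The smallness of \<epsilon> lets
  the sum of the |c i| be absorbed into its own bound, giving A \<le> 2B.\<close>

lemma projection_nearly_orthonormal:
  fixes x c :: "'i \<Rightarrow> 'a :: real_or_complex"
  assumes I: "finite I" and close: "\<And>i j. i \<in> I \<Longrightarrow> j \<in> I \<Longrightarrow> norm (ip K (w i) (w j) - (if i = j then 1 else 0)) \<le> \<epsilon>"
    and \<epsilon>: "0 \<le> \<epsilon>" "real (card I) * \<epsilon> \<le> 1 / 2"
    and x: "\<And>j. j \<in> I \<Longrightarrow> ip K (\<lambda>k. \<Sum>i\<in>I. c i * w i k) (w j) = x j"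
  shows "\<bar>nsq K (\<lambda>k. \<Sum>i\<in>I. c i * w i k) - (\<Sum>i\<in>I. (norm (x i))\<^sup>2)\<bar> \<le> 2 * \<epsilon> * (\<Sum>i\<in>I. norm (x i))\<^sup>2"
proof -
  define A where "A = (\<Sum>i\<in>I. norm (c i))"
  define B where "B = (\<Sum>i\<in>I. norm (x i))"
  have diff: "norm (x j - c j) \<le> \<epsilon> * A" if j: "j \<in> I" for j
  proof -
    have "x j = (\<Sum>i\<in>I. c i * (ip K (w i) (w j) - (if i = j then 1 else 0)) + (if i = j then c i else 0))"
      unfolding x[OF j, symmetric] ip_sum_left ip_mult_left by (intro sum.cong refl) (simp add: algebra_simps)
    then have "x j - c j = (\<Sum>i\<in>I. c i * (ip K (w i) (w j) - (if i = j then 1 else 0)))"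
      using I j by (simp add: sum.distrib)
    also have "norm \<dots> \<le> (\<Sum>i\<in>I. norm (c i) * \<epsilon>)"
      by (rule sum_norm_le) (simp add: norm_mult mult_left_mono close j)
    finally show ?thesis by (simp add: A_def sum_distrib_left mult.commute)
  qed
  have "norm (c j) \<le> norm (x j) + \<epsilon> * A" if "j \<in> I" for j
    using diff[OF that] norm_triangle_ineq2[of "c j" "x j"] by (simp add: norm_minus_commute)
  then have "A \<le> (\<Sum>j\<in>I. norm (x j) + \<epsilon> * A)" unfolding A_def by (rule sum_mono)
  then have "A \<le> B + real (card I) * \<epsilon> * A" by (simp add: B_def sum.distrib)
  moreover have "real (card I) * \<epsilon> * A \<le> 1 / 2 * A" using \<epsilon> by (intro mult_right_mono) (auto simp: A_def sum_nonneg)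
  ultimately have A: "A \<le> 2 * B" by simp
  have "of_real (nsq K (\<lambda>k. \<Sum>i\<in>I. c i * w i k)) = (\<Sum>i\<in>I. conjugate (c i) * x i)"
    unfolding ip_self[symmetric] ip_sum_right ip_mult_right by (intro sum.cong refl) (simp add: x)
  moreover have "(\<Sum>i\<in>I. conjugate (c i - x i) * x i) = (\<Sum>i\<in>I. conjugate (c i) * x i) - of_real (\<Sum>i\<in>I. (norm (x i))\<^sup>2)"
    unfolding of_real_sum sum_subtractf[symmetric]
    by (intro sum.cong refl) (simp only: conjugate_diff left_diff_distrib conjugate_mult_self)
  ultimately have "of_real (nsq K (\<lambda>k. \<Sum>i\<in>I. c i * w i k) - (\<Sum>i\<in>I. (norm (x i))\<^sup>2)) = (\<Sum>i\<in>I. conjugate (c i - x i) * x i)"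
    by (simp only: of_real_diff)
  from arg_cong[OF this, of norm] have "\<bar>nsq K (\<lambda>k. \<Sum>i\<in>I. c i * w i k) - (\<Sum>i\<in>I. (norm (x i))\<^sup>2)\<bar> = norm (\<Sum>i\<in>I. conjugate (c i - x i) * x i)"
    by (simp only: norm_of_real)
  also have "\<dots> \<le> (\<Sum>i\<in>I. (2 * \<epsilon> * B) * norm (x i))"
  proof (rule sum_norm_le)
    fix i assume i: "i \<in> I"
    have "norm (c i - x i) \<le> \<epsilon> * A" using diff[OF i] by (simp add: norm_minus_commute)
    also have "\<dots> \<le> 2 * \<epsilon> * B" using mult_left_mono[OF A \<epsilon>(1)] by simp
    finally show "norm (conjugate (c i - x i) * x i) \<le> (2 * \<epsilon> * B) * norm (x i)"
      by (simp add: norm_mult mult_right_mono)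
  qed
  also have "\<dots> = 2 * \<epsilon> * B\<^sup>2" by (simp add: B_def sum_distrib_left power2_eq_square mult_ac)
  finally show ?thesis unfolding B_def .
qed

lemma proj_norm_limit:
  fixes w :: "nat \<Rightarrow> 'i \<Rightarrow> 'a :: real_or_complex vec" and x :: "nat \<Rightarrow> 'a vec"
  assumes I: "finite I" and w: "\<And>n i. i \<in> I \<Longrightarrow> w n i \<in> carrier_vec n"
    and x: "\<forall>\<^sub>F n in sequentially. x n \<in> carrier_vec n"
    and gram: "\<And>i j. i \<in> I \<Longrightarrow> j \<in> I \<Longrightarrow> (\<lambda>n. ip {..<n} (($) (w n i)) (($) (w n j))) \<longlonglongrightarrow> (if i = j then 1 else 0)"
    and bound: "\<And>i. i \<in> I \<Longrightarrow> \<forall>\<^sub>F n in sequentially. norm (ip {..<n} (($) (x n)) (($) (w n i))) \<le> B"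
  shows "(\<lambda>n. (proj_norm (x n) (vspan n {w n i | i. i \<in> I}))\<^sup>2 - (\<Sum>i\<in>I. (norm (ip {..<n} (($) (x n)) (($) (w n i))))\<^sup>2)) \<longlonglongrightarrow> 0"
proof -
  define E where "E n = (\<Sum>i\<in>I. \<Sum>j\<in>I. norm (ip {..<n} (($) (w n i)) (($) (w n j)) - (if i = j then 1 else 0)))" for n
  have E0: "0 \<le> E n" for n unfolding E_def by (intro sum_nonneg norm_ge_zero)
  have "E \<longlonglongrightarrow> (\<Sum>i\<in>I. \<Sum>j\<in>I. norm (0 :: 'a))"
    unfolding E_def[abs_def] by (intro tendsto_sum tendsto_norm LIM_zero gram)
  then have E: "E \<longlonglongrightarrow> 0" by simp
  have Ele: "norm (ip {..<n} (($) (w n i)) (($) (w n j)) - (if i = j then 1 else 0)) \<le> E n" if "i \<in> I" "j \<in> I" for i j n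
  proof -
    have "norm (ip {..<n} (($) (w n i)) (($) (w n j)) - (if i = j then 1 else 0)) \<le> (\<Sum>j\<in>I. norm (ip {..<n} (($) (w n i)) (($) (w n j)) - (if i = j then 1 else 0)))"
      by (rule member_le_sum[OF that(2)]) (use I in auto)
    also have "\<dots> \<le> E n" unfolding E_def by (rule member_le_sum[OF that(1)]) (use I in \<open>auto intro: sum_nonneg\<close>)
    finally show ?thesis .
  qed
  have "(\<lambda>n. real (card I) * E n) \<longlonglongrightarrow> real (card I) * 0" by (intro tendsto_intros E)
  from order_tendstoD(2)[OF this, of "1 / 2"] have "\<forall>\<^sub>F n in sequentially. real (card I) * E n < 1 / 2" by simp
  moreover have "\<forall>\<^sub>F n in sequentially. \<forall>i\<in>I. norm (ip {..<n} (($) (x n)) (($) (w n i))) \<le> B"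
    using bound by (intro eventually_ball_finite[OF I]) auto
  ultimately have "\<forall>\<^sub>F n in sequentially. norm ((proj_norm (x n) (vspan n {w n i | i. i \<in> I}))\<^sup>2 - (\<Sum>i\<in>I. (norm (ip {..<n} (($) (x n)) (($) (w n i))))\<^sup>2))
     \<le> 2 * E n * (real (card I) * B)\<^sup>2"
    using x
  proof eventually_elim
    case (elim n)
    obtain c where c: "\<forall>j\<in>I. ip {..<n} (\<lambda>k. \<Sum>i\<in>I. c i * w n i $ k) (($) (w n j)) = ip {..<n} (($) (x n)) (($) (w n j))"
      "(proj_norm (x n) (vspan n {w n i | i. i \<in> I}))\<^sup>2 = nsq {..<n} (\<lambda>k. \<Sum>i\<in>I. c i * w n i $ k)"
      using proj_norm_vspan[where w = "w n", OF I w elim(3)] by blast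
    have "(\<Sum>i\<in>I. norm (ip {..<n} (($) (x n)) (($) (w n i)))) \<le> real (card I) * B"
      using elim(2) by (intro sum_bounded_above) auto
    then have sq: "(\<Sum>i\<in>I. norm (ip {..<n} (($) (x n)) (($) (w n i))))\<^sup>2 \<le> (real (card I) * B)\<^sup>2"
      by (intro power_mono sum_nonneg norm_ge_zero)
    have "\<bar>nsq {..<n} (\<lambda>k. \<Sum>i\<in>I. c i * w n i $ k) - (\<Sum>i\<in>I. (norm (ip {..<n} (($) (x n)) (($) (w n i))))\<^sup>2)\<bar>
      \<le> 2 * E n * (\<Sum>i\<in>I. norm (ip {..<n} (($) (x n)) (($) (w n i))))\<^sup>2"
      by (rule projection_nearly_orthonormal[where w = "\<lambda>i. ($) (w n i)" and K = "{..<n}", OF I Ele[of _ _ n] E0[of n] _ c(1)[rule_format]])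
        (use elim(1) in simp_all)
    also have "\<dots> \<le> 2 * E n * (real (card I) * B)\<^sup>2" using sq E0[of n] by (intro mult_left_mono) auto
    finally show ?case unfolding c(2) by simp
  qed
  moreover have "(\<lambda>n. 2 * E n * (real (card I) * B)\<^sup>2) \<longlonglongrightarrow> 2 * 0 * (real (card I) * B)\<^sup>2" by (intro tendsto_intros E)
  then have "(\<lambda>n. 2 * E n * (real (card I) * B)\<^sup>2) \<longlonglongrightarrow> 0" by simp
  ultimately show ?thesis by (rule Lim_null_comparison)
qed

section \<open>Gram-Schmidt orthonormalisation of nearly orthonormal vectors\<close>

lemma wform_one: "wform n (\<lambda>c. 1) x y = ip {..<n} x y"
  by (simp add: wform_def ip_def)

lemma sqrt_nsq_diff_commute: "sqrt (nsq K (\<lambda>k. x k - y k)) = sqrt (nsq K (\<lambda>k. y k - x k))"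
  by (simp add: nsq_def norm_minus_commute)

lemma wform_perturb:
  fixes a b a' b' :: "nat \<Rightarrow> nat \<Rightarrow> 'a :: real_or_complex"
  assumes w: "\<And>n c. \<bar>w n c\<bar> \<le> (C :: real)"
    and lim: "(\<lambda>n. wform n (w n) (a n) (b n)) \<longlonglongrightarrow> L"
    and a: "\<forall>\<^sub>F n in sequentially. sqrt (nsq {..<n} (a n)) \<le> 2" "(\<lambda>n. sqrt (nsq {..<n} (\<lambda>k. a' n k - a n k))) \<longlonglongrightarrow> 0"
    and b: "\<forall>\<^sub>F n in sequentially. sqrt (nsq {..<n} (b n)) \<le> 2" "(\<lambda>n. sqrt (nsq {..<n} (\<lambda>k. b' n k - b n k))) \<longlonglongrightarrow> 0"
  shows "(\<lambda>n. wform n (w n) (a' n) (b' n)) \<longlonglongrightarrow> L"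
proof -
  let ?a = "\<lambda>n. sqrt (nsq {..<n} (\<lambda>k. a' n k - a n k))" and ?b = "\<lambda>n. sqrt (nsq {..<n} (\<lambda>k. b' n k - b n k))"
  have C: "0 \<le> C" using w[of 0 0] by simp
  have "(\<lambda>n. wform n (w n) (a' n) (b' n) - wform n (w n) (a n) (b n)) \<longlonglongrightarrow> 0"
  proof (rule Lim_null_comparison)
    have "(\<lambda>n. C * (?a n * (2 + ?b n)) + C * (2 * ?b n)) \<longlonglongrightarrow> C * (0 * (2 + 0)) + C * (2 * 0)"
      by (intro tendsto_add tendsto_mult tendsto_const a(2) b(2))
    then show "(\<lambda>n. C * (?a n * (2 + ?b n)) + C * (2 * ?b n)) \<longlonglongrightarrow> 0" by simp
    show "\<forall>\<^sub>F n in sequentially. norm (wform n (w n) (a' n) (b' n) - wform n (w n) (a n) (b n)) \<le> C * (?a n * (2 + ?b n)) + C * (2 * ?b n)"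
      using a(1) b(1)
    proof eventually_elim
      case (elim n)
      have eq: "wform n (w n) (a' n) (b' n) - wform n (w n) (a n) (b n)
        = wform n (w n) (\<lambda>k. a' n k - a n k) (b' n) + wform n (w n) (a n) (\<lambda>k. b' n k - b n k)"
        unfolding wform_def sum.distrib[symmetric] sum_subtractf[symmetric]
        by (intro sum.cong refl) (simp add: conjugate_diff algebra_simps)
      have b2: "sqrt (nsq {..<n} (b' n)) \<le> 2 + ?b n"
        using sqrt_nsq_add_le[of "{..<n}" "b n" "\<lambda>k. b' n k - b n k"] elim(2) by simp
      have "norm (wform n (w n) (\<lambda>k. a' n k - a n k) (b' n)) \<le> C * (?a n * sqrt (nsq {..<n} (b' n)))"
        by (rule norm_wform_le[OF w C])
      also have "\<dots> \<le> C * (?a n * (2 + ?b n))" using b2 C by (intro mult_left_mono) auto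
      finally have 1: "norm (wform n (w n) (\<lambda>k. a' n k - a n k) (b' n)) \<le> C * (?a n * (2 + ?b n))" .
      have "norm (wform n (w n) (a n) (\<lambda>k. b' n k - b n k)) \<le> C * (sqrt (nsq {..<n} (a n)) * ?b n)"
        by (rule norm_wform_le[OF w C])
      also have "\<dots> \<le> C * (2 * ?b n)" using elim(1) C by (intro mult_left_mono mult_right_mono) auto
      finally have 2: "norm (wform n (w n) (a n) (\<lambda>k. b' n k - b n k)) \<le> C * (2 * ?b n)" .
      show ?case unfolding eq by (rule norm_triangle_le[OF add_mono[OF 1 2]])
    qed
  qed
  from tendsto_add[OF this lim] show ?thesis by simp
qed

text \<open>The weights are bounded, so the forms are continuous in the vectors. In this way the
  orthonormalized model is reduced to the i.i.d. one.\<close>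

lemma (in limit_forms) limit_forms_perturb:
  assumes \<alpha>': "\<And>i. i \<in> J \<Longrightarrow> (\<lambda>n. sqrt (nsq {..<n} (\<lambda>k. \<alpha>' n i k - \<alpha> n i k))) \<longlonglongrightarrow> 0"
    and \<beta>': "\<And>i. i \<in> J \<Longrightarrow> (\<lambda>n. sqrt (nsq {..<n} (\<lambda>k. \<beta>' n i k - \<beta> n i k))) \<longlonglongrightarrow> 0"
  shows "limit_forms \<mu> a s \<alpha>' \<beta>' J"
proof unfold_locales
  fix F :: "real \<Rightarrow> real" and i j assume F: "continuous_on {0..1} F" and ij: "i \<in> J" "j \<in> J"
  have "bounded (F ` {0..1})" by (intro compact_imp_bounded compact_continuous_image[OF F] compact_Icc)
  then obtain C where "\<forall>y\<in>F ` {0..1}. norm y \<le> C" unfolding bounded_iff by blast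
  then have C: "\<bar>F x\<bar> \<le> C" if "0 \<le> x" "x \<le> 1" for x using that by auto
  have pos: "0 < 1 + t\<^sup>2" for t :: real by (simp add: add_pos_nonneg)
  have bound: "\<bar>F (1 / (1 + t\<^sup>2))\<bar> \<le> C" for t by (rule C) (use pos[of t] in auto)
  have C0: "0 \<le> C" using bound[of 0] by simp
  have half: "\<bar>1 / (1 + t\<^sup>2) * t\<bar> \<le> 1" for t :: real
  proof -
    have "\<bar>t\<bar> \<le> 1 + t\<^sup>2"
      using sum_squares_bound[of "\<bar>t\<bar>" 1] by (simp add: power2_eq_square)
    then show ?thesis using pos[of t] by (simp add: abs_mult)
  qed
  have odd: "\<bar>1 / (1 + t\<^sup>2) * t * F (1 / (1 + t\<^sup>2))\<bar> \<le> C" for t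
  proof -
    have "\<bar>1 / (1 + t\<^sup>2) * t * F (1 / (1 + t\<^sup>2))\<bar> \<le> 1 * C" unfolding abs_mult[of "1 / (1 + t\<^sup>2) * t"] by (intro mult_mono half bound) auto
    then show ?thesis by simp
  qed
  show "(\<lambda>n. wform n (\<lambda>c. 1 * F (1 / (1 + (s n c)\<^sup>2))) (\<alpha>' n i) (\<alpha>' n j)) \<longlonglongrightarrow> of_real ((if i = j then 1 else 0) * (\<integral>t. F (1 / (1 + t\<^sup>2)) \<partial>\<mu>))"
    by (rule wform_perturb[OF _ EA[OF F ij] nsq_bounded(1)[OF ij(1)] \<alpha>'[OF ij(1)] nsq_bounded(1)[OF ij(2)] \<alpha>'[OF ij(2)], of C]) (simp add: bound)
  show "(\<lambda>n. wform n (\<lambda>c. 1 * F (1 / (1 + (s n c)\<^sup>2))) (\<beta>' n i) (\<beta>' n j)) \<longlonglongrightarrow> of_real ((if i = j then 1 else 0) * (\<integral>t. F (1 / (1 + t\<^sup>2)) \<partial>\<mu>))"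
    by (rule wform_perturb[OF _ EB[OF F ij] nsq_bounded(2)[OF ij(1)] \<beta>'[OF ij(1)] nsq_bounded(2)[OF ij(2)] \<beta>'[OF ij(2)], of C]) (simp add: bound)
  show "(\<lambda>n. wform n (\<lambda>c. (1 / (1 + (s n c)\<^sup>2) * s n c) * F (1 / (1 + (s n c)\<^sup>2))) (\<alpha>' n i) (\<beta>' n j)) \<longlonglongrightarrow> 0"
    by (rule wform_perturb[OF _ OC[OF F ij] nsq_bounded(1)[OF ij(1)] \<alpha>'[OF ij(1)] nsq_bounded(2)[OF ij(2)] \<beta>'[OF ij(2)], of C]) (rule odd)
qed (rule s_low)

context
  fixes u y :: "nat \<Rightarrow> nat \<Rightarrow> nat \<Rightarrow> 'a :: real_or_complex" and r :: nat
  assumes gram: "\<And>i j. i < r \<Longrightarrow> j < r \<Longrightarrow> (\<lambda>n. ip {..<n} (u n i) (u n j)) \<longlonglongrightarrow> (if i = j then 1 else 0)"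
    and rec: "\<And>n i k. i < r \<Longrightarrow> k < n \<Longrightarrow> y n i k = u n i k - (\<Sum>j<i. ip {..<n} (u n i) (y n j) / ip {..<n} (y n j) (y n j) * y n j k)"
begin

private lemma norm_lim: "i < r \<Longrightarrow> (\<lambda>n. sqrt (nsq {..<n} (u n i))) \<longlonglongrightarrow> 1"
proof -
  assume i: "i < r"
  have "(\<lambda>n. of_real (nsq {..<n} (u n i)) :: 'a) \<longlonglongrightarrow> of_real 1" using gram[OF i i] unfolding ip_self by simp
  then have "(\<lambda>n. sqrt (nsq {..<n} (u n i))) \<longlonglongrightarrow> sqrt 1" unfolding tendsto_of_real_iff by (rule tendsto_real_sqrt)
  then show ?thesis by simp
qed

private lemma norm_bd: "i < r \<Longrightarrow> \<forall>\<^sub>F n in sequentially. sqrt (nsq {..<n} (u n i)) \<le> 2"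
  using order_tendstoD(2)[OF norm_lim, of i 2] by (auto elim: eventually_mono)

text \<open>By induction the earlier \<open>y n j\<close> are close to \<open>u n j\<close>, so the
  coefficients subtracted at stage \<open>i\<close> tend to off-diagonal Gram entries, that is, to
  0.\<close>

lemma gram_schmidt_close:
  assumes "i < r"
  shows "(\<lambda>n. sqrt (nsq {..<n} (\<lambda>k. y n i k - u n i k))) \<longlonglongrightarrow> 0"
  using assms
proof (induction i rule: less_induct)
  case (less i)
  have j: "j < r" if "j < i" for j using that less.prems by simp
  define c where "c n j = ip {..<n} (u n i) (y n j) / ip {..<n} (y n j) (y n j)" for n j
  have triangle: "sqrt (nsq {..<n} (\<lambda>k. \<Sum>j\<in>L. c n j * y n j k)) \<le> (\<Sum>j\<in>L. norm (c n j) * sqrt (nsq {..<n} (y n j)))"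
    if "finite L" for n and L :: "nat set"
    using that
  proof (induction L rule: finite_induct)
    case (insert j L)
    have "sqrt (nsq {..<n} (\<lambda>k. c n j * y n j k + (\<Sum>j\<in>L. c n j * y n j k))) \<le> sqrt (nsq {..<n} (\<lambda>k. c n j * y n j k)) + sqrt (nsq {..<n} (\<lambda>k. \<Sum>j\<in>L. c n j * y n j k))"
      by (rule sqrt_nsq_add_le)
    also have "sqrt (nsq {..<n} (\<lambda>k. c n j * y n j k)) = norm (c n j) * sqrt (nsq {..<n} (y n j))"
      by (simp add: nsq_mult real_sqrt_mult)
    finally show ?case using insert by simp
  qed (simp add: nsq_def)
  have same: "(\<lambda>n. sqrt (nsq {..<n} (\<lambda>k. u n i k - u n i k))) \<longlonglongrightarrow> 0" for i by (simp add: nsq_def)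
  have one: "\<bar>1\<bar> \<le> (1 :: real)" by simp
  have small: "(\<lambda>n. norm (c n j) * sqrt (nsq {..<n} (y n j))) \<longlonglongrightarrow> 0" if ji: "j < i" for j
  proof -
    have 1: "(\<lambda>n. ip {..<n} (u n i) (y n j)) \<longlonglongrightarrow> (if i = j then 1 else 0)"
      unfolding wform_one[symmetric]
      by (rule wform_perturb[OF one gram[OF less.prems j[OF ji], folded wform_one] norm_bd[OF less.prems] same norm_bd[OF j[OF ji]] less.IH[OF ji j[OF ji]]])
    have 2: "(\<lambda>n. ip {..<n} (y n j) (y n j)) \<longlonglongrightarrow> (if j = j then 1 else 0)"
      unfolding wform_one[symmetric]
      by (rule wform_perturb[OF one gram[OF j[OF ji] j[OF ji], folded wform_one] norm_bd[OF j[OF ji]] less.IH[OF ji j[OF ji]] norm_bd[OF j[OF ji]] less.IH[OF ji j[OF ji]]])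
    have "(\<lambda>n. c n j) \<longlonglongrightarrow> 0 / 1" unfolding c_def using 1 2 ji by (intro tendsto_divide) auto
    moreover have "(\<lambda>n. of_real (nsq {..<n} (y n j)) :: 'a) \<longlonglongrightarrow> of_real 1" using 2 unfolding ip_self by simp
    then have "(\<lambda>n. nsq {..<n} (y n j)) \<longlonglongrightarrow> 1" unfolding tendsto_of_real_iff .
    ultimately have "(\<lambda>n. norm (c n j) * sqrt (nsq {..<n} (y n j))) \<longlonglongrightarrow> norm (0 / 1 :: 'a) * sqrt 1" by (intro tendsto_intros)
    then show ?thesis by simp
  qed
  have "(\<lambda>n. \<Sum>j<i. norm (c n j) * sqrt (nsq {..<n} (y n j))) \<longlonglongrightarrow> (\<Sum>j<i. 0)" by (intro tendsto_sum small) auto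
  then have lim: "(\<lambda>n. \<Sum>j<i. norm (c n j) * sqrt (nsq {..<n} (y n j))) \<longlonglongrightarrow> 0" by simp
  show ?case
  proof (rule tendsto_sandwich[OF _ _ tendsto_const lim])
    have "nsq {..<n} (\<lambda>k. y n i k - u n i k) = nsq {..<n} (\<lambda>k. \<Sum>j<i. c n j * y n j k)" for n
    proof -
      have "nsq {..<n} (\<lambda>k. y n i k - u n i k) = nsq {..<n} (\<lambda>k. - (\<Sum>j<i. c n j * y n j k))"
        by (rule nsq_cong) (simp add: rec[OF less.prems] c_def)
      then show ?thesis by (simp add: nsq_uminus)
    qed
    then show "\<forall>\<^sub>F n in sequentially. sqrt (nsq {..<n} (\<lambda>k. y n i k - u n i k)) \<le> (\<Sum>j<i. norm (c n j) * sqrt (nsq {..<n} (y n j)))"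
      using triangle[of "{..<i}"] by simp
  qed simp
qed

lemma orthonormalized_close:
  assumes i: "i < r"
  shows "(\<lambda>n. sqrt (nsq {..<n} (\<lambda>k. of_real (1 / sqrt (nsq {..<n} (y n i))) * y n i k - u n i k))) \<longlonglongrightarrow> 0"
proof -
  let ?d = "\<lambda>n. sqrt (nsq {..<n} (\<lambda>k. y n i k - u n i k))"
  have near: "\<bar>sqrt (nsq {..<n} (y n i)) - sqrt (nsq {..<n} (u n i))\<bar> \<le> ?d n" for n
    using sqrt_nsq_add_le[of "{..<n}" "u n i" "\<lambda>k. y n i k - u n i k"] sqrt_nsq_add_le[of "{..<n}" "y n i" "\<lambda>k. u n i k - y n i k"]
    by (simp add: sqrt_nsq_diff_commute[of _ "u n i"] abs_le_iff)
  have "(\<lambda>n. sqrt (nsq {..<n} (y n i)) - sqrt (nsq {..<n} (u n i))) \<longlonglongrightarrow> 0"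
    by (rule Lim_null_comparison[OF _ gram_schmidt_close[OF i]]) (simp add: near)
  from tendsto_add[OF this norm_lim[OF i]] have lim: "(\<lambda>n. sqrt (nsq {..<n} (y n i))) \<longlonglongrightarrow> 1" by simp
  have "(\<lambda>n. \<bar>1 - sqrt (nsq {..<n} (y n i))\<bar> + ?d n) \<longlonglongrightarrow> \<bar>1 - 1\<bar> + 0"
    by (intro tendsto_intros lim gram_schmidt_close[OF i])
  then have b: "(\<lambda>n. \<bar>1 - sqrt (nsq {..<n} (y n i))\<bar> + ?d n) \<longlonglongrightarrow> 0" by simp
  have "\<forall>\<^sub>F n in sequentially. 0 < sqrt (nsq {..<n} (y n i))" using order_tendstoD(1)[OF lim, of 0] by simp
  then have "\<forall>\<^sub>F n in sequentially. norm (sqrt (nsq {..<n} (\<lambda>k. of_real (1 / sqrt (nsq {..<n} (y n i))) * y n i k - u n i k))) \<le> \<bar>1 - sqrt (nsq {..<n} (y n i))\<bar> + ?d n"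
  proof eventually_elim
    case (elim n)
    define h where "h = sqrt (nsq {..<n} (y n i))"
    have h: "0 < h" using elim by (simp add: h_def)
    have "sqrt (nsq {..<n} (\<lambda>k. of_real (1 / h) * y n i k - u n i k)) = sqrt (nsq {..<n} (\<lambda>k. of_real (1 / h - 1) * y n i k + (y n i k - u n i k)))"
      by (simp add: algebra_simps)
    also have "\<dots> \<le> sqrt (nsq {..<n} (\<lambda>k. of_real (1 / h - 1) * y n i k)) + ?d n" by (rule sqrt_nsq_add_le)
    also have "sqrt (nsq {..<n} (\<lambda>k. of_real (1 / h - 1) * y n i k)) = \<bar>1 / h - 1\<bar> * h"
      unfolding nsq_mult norm_of_real real_sqrt_mult h_def by simp
    also have "\<bar>1 / h - 1\<bar> * h = \<bar>1 - h\<bar>" using h by (simp add: abs_if field_simps)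
    finally show ?case by (simp add: h_def)
  qed
  from Lim_null_comparison[OF this b] show ?thesis .
qed

end

section \<open>Gram-Schmidt on lists of vectors, in coordinates\<close>

lemma adjuster_index:
  fixes us :: "'a :: real_or_complex vec list"
  assumes "set us \<subseteq> carrier_vec n"
  shows "adjuster n w us \<in> carrier_vec n"
    and "k < n \<Longrightarrow> adjuster n w us $ k = - (\<Sum>u\<leftarrow>us. (w \<bullet>c u) / (u \<bullet>c u) * u $ k)"
  using assms by (induction us) auto

lemma length_gram_schmidt_sub2: "length (gram_schmidt_sub2 n us ws) = length ws"
  by (induction ws arbitrary: us) (auto simp: Let_def)

lemma gram_schmidt_sub2_nth:
  "i < length ws \<Longrightarrow> gram_schmidt_sub2 n us ws ! i = adjuster n (ws ! i) (rev (take i (gram_schmidt_sub2 n us ws)) @ us) + ws ! i"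
proof (induction ws arbitrary: us i)
  case (Cons w ws)
  show ?case
  proof (cases i)
    case (Suc j)
    then show ?thesis using Cons.IH[of j "(adjuster n w us + w) # us"] Cons.prems by (simp add: Let_def)
  qed (simp add: Let_def)
qed simp

lemma gram_schmidt_sub2_carrier:
  fixes us :: "'a :: real_or_complex vec list"
  assumes "set us \<subseteq> carrier_vec n" "set ws \<subseteq> carrier_vec n"
  shows "set (gram_schmidt_sub2 n us ws) \<subseteq> carrier_vec n"
  using assms by (induction ws arbitrary: us) (auto simp: Let_def adjuster_index(1))

lemma gram_schmidt_index:
  fixes ws :: "'a :: real_or_complex vec list"
  assumes ws: "set ws \<subseteq> carrier_vec n" and i: "i < length ws" and k: "k < n"
  shows "gram_schmidt n ws ! i \<in> carrier_vec n"
    and "gram_schmidt n ws ! i $ k = ws ! i $ k - (\<Sum>j<i. ip {..<n} (($) (ws ! i)) (($) (gram_schmidt n ws ! j)) /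
      ip {..<n} (($) (gram_schmidt n ws ! j)) (($) (gram_schmidt n ws ! j)) * gram_schmidt n ws ! j $ k)"
proof -
  define L where "L = gram_schmidt n ws"
  have L: "L = gram_schmidt_sub2 n [] ws" by (simp add: L_def gram_schmidt_code)
  have car: "set L \<subseteq> carrier_vec n" unfolding L by (rule gram_schmidt_sub2_carrier) (use ws in auto)
  have len: "length L = length ws" unfolding L by (rule length_gram_schmidt_sub2)
  show "gram_schmidt n ws ! i \<in> carrier_vec n" using car len i nth_mem[of i L] by (auto simp: L_def)
  have Lj: "L ! j \<in> carrier_vec n" if "j < i" for j using car len i that nth_mem[of j L] by auto
  have tk: "set (rev (take i L)) \<subseteq> carrier_vec n" using car set_take_subset[of i L] by auto
  have "L ! i $ k = adjuster n (ws ! i) (rev (take i L)) $ k + ws ! i $ k"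
  proof -
    have "ws ! i \<in> carrier_vec n" using ws i by (meson nth_mem subsetD)
    then show ?thesis
      using gram_schmidt_sub2_nth[OF i, of n "[]"] adjuster_index(1)[OF tk, of "ws ! i"] k unfolding L[symmetric] by simp
  qed
  also have "adjuster n (ws ! i) (rev (take i L)) $ k = - (\<Sum>u\<leftarrow>rev (take i L). (ws ! i \<bullet>c u) / (u \<bullet>c u) * u $ k)"
    by (rule adjuster_index(2)[OF tk k])
  also have "(\<Sum>u\<leftarrow>rev (take i L). (ws ! i \<bullet>c u) / (u \<bullet>c u) * u $ k) = (\<Sum>u\<leftarrow>take i L. (ws ! i \<bullet>c u) / (u \<bullet>c u) * u $ k)"
    by (simp add: rev_map[symmetric] sum_list_rev)
  also have "\<dots> = (\<Sum>j<i. (ws ! i \<bullet>c L ! j) / (L ! j \<bullet>c L ! j) * L ! j $ k)"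
    using len i by (simp add: sum_list_sum_nth atLeast0LessThan min_def)
  also have "\<dots> = (\<Sum>j<i. ip {..<n} (($) (ws ! i)) (($) (L ! j)) / ip {..<n} (($) (L ! j)) (($) (L ! j)) * L ! j $ k)"
    by (intro sum.cong refl) (simp add: cscalar_prod_ip[OF Lj])
  finally show "gram_schmidt n ws ! i $ k = ws ! i $ k - (\<Sum>j<i. ip {..<n} (($) (ws ! i)) (($) (gram_schmidt n ws ! j)) /
      ip {..<n} (($) (gram_schmidt n ws ! j)) (($) (gram_schmidt n ws ! j)) * gram_schmidt n ws ! j $ k)"
    unfolding L_def[symmetric] by simp
qed

section \<open>Conclusion for one realisation\<close>

lemma is_svd_cong:
  assumes "\<And>i j. i < n \<Longrightarrow> j < n \<Longrightarrow> X i j = Y i j"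
  shows "is_svd n X s p q \<longleftrightarrow> is_svd n Y s p q"
proof -
  have "mv {..<n} X x k = mv {..<n} Y x k" "mv {..<n} (adj X) x k = mv {..<n} (adj Y) x k" if "k < n" for x k
    using assms that by (auto simp: mv_def adj_def intro!: sum.cong)
  then show ?thesis unfolding is_svd_def by auto
qed

lemma mult_mat_vec_mv:
  assumes "A \<in> carrier_mat n n" "x \<in> carrier_vec n" "k < n" "\<And>i j. i < n \<Longrightarrow> j < n \<Longrightarrow> A $$ (i, j) = B i j"
  shows "(A *\<^sub>v x) $ k = mv {..<n} B (($) x) k"
  using assms by (auto simp: mv_def scalar_prod_def atLeast0LessThan intro!: sum.cong)

lemma null_proj_norm:
  assumes "(\<lambda>n. (proj_norm (x n) (F n))\<^sup>2) \<longlonglongrightarrow> 0"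
  shows "(\<lambda>n. proj_norm (x n) (F n)) \<longlonglongrightarrow> 0"
proof -
  have "(\<lambda>n. sqrt ((proj_norm (x n) (F n))\<^sup>2)) \<longlonglongrightarrow> sqrt 0" by (rule tendsto_real_sqrt[OF assms])
  then show ?thesis by (simp add: tendsto_rabs_zero_iff)
qed

text \<open>The conclusion for one outcome. Projections reduce to sums of squared overlaps because
  the Gram matrices of the \<open>u n i\<close> and of the \<open>v n i\<close> tend to the
  identity.\<close>

theorem perturbed_projections:
  fixes A :: "nat \<Rightarrow> 'a :: real_or_complex mat" and u v :: "nat \<Rightarrow> nat \<Rightarrow> 'a vec" and u' v' :: "nat \<Rightarrow> 'a vec"
    and \<theta> :: "nat \<Rightarrow> real" and \<rho> :: real
  assumes A: "\<And>n. A n \<in> carrier_mat n n" and svd: "\<And>n. is_svd n (entries (A n)) (s n) (p n) (q n)"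
    and uv: "\<And>n i. i \<in> {1..r} \<Longrightarrow> u n i \<in> carrier_vec n" "\<And>n i. i \<in> {1..r} \<Longrightarrow> v n i \<in> carrier_vec n"
    and lf: "limit_forms \<mu> a s (\<lambda>n i c. ip {..<n} (($) (u n i)) (p n c)) (\<lambda>n i c. ip {..<n} (($) (v n i)) (q n c)) {1..r}"
    and i0: "i0 \<in> {1..r}"
    and \<theta>_decr: "\<And>i j. 1 \<le> i \<Longrightarrow> i \<le> j \<Longrightarrow> j \<le> r \<Longrightarrow> \<theta> j \<le> \<theta> i"
    and \<theta>_pos: "\<And>i. i \<in> {1..r} \<Longrightarrow> 0 < \<theta> i"
    and \<rho>: "0 < \<rho>" "\<rho> < a" "phi \<mu> \<rho> = - 1 / \<theta> i0"
    and pair: "\<And>n. i0 \<le> n \<Longrightarrow> singular_vector_pair (A n + perturbation n r \<theta> (u n) (v n))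
        (singular_value (n + 1 - i0) (A n + perturbation n r \<theta> (u n) (v n))) (u' n) (v' n)"
  shows "(\<lambda>n. (proj_norm (u' n) (vspan n {u n i | i. i \<in> {1..r} \<and> \<theta> i = \<theta> i0}))\<^sup>2) \<longlonglongrightarrow> - 1 / ((\<theta> i0)\<^sup>2 * deriv (phi \<mu>) \<rho>)" (is ?a)
    and "(\<lambda>n. (proj_norm (v' n) (vspan n {v n i | i. i \<in> {1..r} \<and> \<theta> i = \<theta> i0}))\<^sup>2) \<longlonglongrightarrow> - 1 / ((\<theta> i0)\<^sup>2 * deriv (phi \<mu>) \<rho>)" (is ?b)
    and "(\<lambda>n. (proj_norm (u' n) (vspan n {u n i | i. i \<in> {1..r} \<and> \<theta> i \<noteq> \<theta> i0}))\<^sup>2) \<longlonglongrightarrow> 0" (is ?c)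
    and "(\<lambda>n. (proj_norm (v' n) (vspan n {v n i | i. i \<in> {1..r} \<and> \<theta> i \<noteq> \<theta> i0}))\<^sup>2) \<longlonglongrightarrow> 0" (is ?d)
    and "(\<lambda>n. proj_norm (of_real (phi \<mu> \<rho>) \<cdot>\<^sub>v (perturbation n r \<theta> (u n) (v n) *\<^sub>v v' n) - u' n)
          (vspan n {u n i | i. i \<in> {1..r} \<and> \<theta> i = \<theta> i0})) \<longlonglongrightarrow> 0" (is ?e)
proof -
  interpret limit_forms \<mu> a s "\<lambda>n i c. ip {..<n} (($) (u n i)) (p n c)" "\<lambda>n i c. ip {..<n} (($) (v n i)) (q n c)" "{1..r}"
    by (rule lf)
  define B where "B n = A n + perturbation n r \<theta> (u n) (v n)" for n
  define \<sigma> where "\<sigma> n = singular_value (n + 1 - i0) (B n)" for n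
  define L where "L n = low_rank \<theta> {1..r} (\<lambda>i. ($) (u n i)) (\<lambda>i. ($) (v n i)) (entries (A n))" for n
  have P: "perturbation n r \<theta> (u n) (v n) \<in> carrier_mat n n" for n by (simp add: perturbation_def)
  have B: "B n \<in> carrier_mat n n" for n using A P by (simp add: B_def)
  have BL: "B n $$ (i, j) = L n i j" if "i < n" "j < n" for n i j
    using that A[of n] by (simp add: B_def L_def low_rank_def entries_def perturbation_def)
  interpret perturbed_singular_values \<mu> a s "\<lambda>n i c. ip {..<n} (($) (u n i)) (p n c)" "\<lambda>n i c. ip {..<n} (($) (v n i)) (q n c)" r
    "\<lambda>n. entries (A n)" p q "\<lambda>n i. ($) (u n i)" "\<lambda>n i. ($) (v n i)" \<theta> \<sigma> \<rho> i0
  proof unfold_locales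
    fix n t b d assume n: "i0 \<le> n" and t: "is_svd n (low_rank \<theta> {1..r} (\<lambda>i. ($) (u n i)) (\<lambda>i. ($) (v n i)) (entries (A n))) t b d"
    have "is_svd n (entries (B n)) t b d"
      using t unfolding L_def[symmetric] by (subst is_svd_cong[of n _ "L n"]) (simp_all add: BL entries_def)
    from card_svd_less_singular_value[OF B this, of i0] card_svd_le_singular_value[OF B this, of i0]
    show "card {k. k < n \<and> t k < \<sigma> n} < i0 \<and> i0 \<le> card {k. k < n \<and> t k \<le> \<sigma> n}"
      using n i0 by (simp add: \<sigma>_def)
  qed (use i0 \<theta>_decr \<theta>_pos svd \<rho> in auto)
  have pair': "u' n \<in> carrier_vec n" "v' n \<in> carrier_vec n" "nsq {..<n} (($) (u' n)) = 1" "nsq {..<n} (($) (v' n)) = 1"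
      "B n *\<^sub>v v' n = of_real (\<sigma> n) \<cdot>\<^sub>v u' n" "mat_adjoint (B n) *\<^sub>v u' n = of_real (\<sigma> n) \<cdot>\<^sub>v v' n" if "i0 \<le> n" for n
    using pair[OF that] B[of n] unfolding singular_vector_pair_def B_def[symmetric] \<sigma>_def[symmetric]
    by (auto simp: l2norm_def nsq_def)
  have right: "mv {..<n} (L n) (($) (v' n)) k = of_real (\<sigma> n) * u' n $ k" if "i0 \<le> n" "k < n" for n k
    using mult_mat_vec_mv[OF B pair'(2)[OF that(1)] that(2) BL] pair'[OF that(1)] that(2) by simp
  have left: "mv {..<n} (adj (L n)) (($) (u' n)) k = of_real (\<sigma> n) * v' n $ k" if "i0 \<le> n" "k < n" for n k
  proof -
    have "mat_adjoint (B n) $$ (i, j) = adj (L n) i j" if "i < n" "j < n" for i j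
      using mat_adjoint_index[OF B that] BL[OF that(2,1)] by (simp add: adj_def)
    from mult_mat_vec_mv[OF mat_adjoint_carrier[OF B] pair'(1)[OF that(1)] that(2) this]
    show ?thesis using pair'[OF that(1)] that(2) by simp
  qed
  note o = right[unfolded L_def] left[unfolded L_def] pair'(3,4)
  let ?x = "\<lambda>n i. ip {..<n} (($) (u' n)) (($) (u n i))" and ?y = "\<lambda>n i. ip {..<n} (($) (v' n)) (($) (v n i))"
  have sum_lim: "(\<lambda>n. \<Sum>i | i \<in> {1..r} \<and> \<theta> i = \<theta> i0. (norm (?x n i))\<^sup>2) \<longlonglongrightarrow> 1 / ((\<theta> i0)\<^sup>2 * psi2 \<mu> \<rho>)"
      "(\<lambda>n. \<Sum>i | i \<in> {1..r} \<and> \<theta> i = \<theta> i0. (norm (?y n i))\<^sup>2) \<longlonglongrightarrow> 1 / ((\<theta> i0)\<^sup>2 * psi2 \<mu> \<rho>)"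
    by (rule overlap_sum[where u' = "\<lambda>n. ($) (u' n)" and v' = "\<lambda>n. ($) (v' n)"]; rule o; assumption)+
  have other: "(\<lambda>n. ?x n j) \<longlonglongrightarrow> 0" "(\<lambda>n. ?y n j) \<longlonglongrightarrow> 0" if "j \<in> {1..r}" "\<theta> j \<noteq> \<theta> i0" for j
    by (rule overlap_other[where u' = "\<lambda>n. ($) (u' n)" and v' = "\<lambda>n. ($) (v' n)", OF _ _ _ _ that]; rule o; assumption)+
  have bound: "\<forall>\<^sub>F n in sequentially. norm (?x n j) \<le> 2" "\<forall>\<^sub>F n in sequentially. norm (?y n j) \<le> 2" if "j \<in> {1..r}" for j
    by (rule overlap_bound[where u' = "\<lambda>n. ($) (u' n)" and v' = "\<lambda>n. ($) (v' n)", OF _ _ _ _ that]; rule o; assumption)+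
  have rel: "(\<lambda>n. ?x n j - of_real (phi \<mu> \<rho> * \<theta> j) * ?y n j) \<longlonglongrightarrow> 0" if "j \<in> {1..r}" for j
    by (rule overlap_limits(1)[where u' = "\<lambda>n. ($) (u' n)" and v' = "\<lambda>n. ($) (v' n)", OF _ _ _ _ that]; rule o; assumption)
  have car: "\<forall>\<^sub>F n in sequentially. u' n \<in> carrier_vec n" "\<forall>\<^sub>F n in sequentially. v' n \<in> carrier_vec n"
    using pair'(1,2) by (auto intro!: eventually_sequentiallyI[of i0])
  have lim: "1 / ((\<theta> i0)\<^sup>2 * psi2 \<mu> \<rho>) = - 1 / ((\<theta> i0)\<^sup>2 * deriv (phi \<mu>) \<rho>)"
    using DERIV_imp_deriv[OF phi_DERIV[of \<rho>]] \<rho> by simp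
  have PL: "(\<lambda>n. (proj_norm (x n) (vspan n {w n i | i. i \<in> {1..r} \<and> Q i}))\<^sup>2 - (\<Sum>i | i \<in> {1..r} \<and> Q i. (norm (ip {..<n} (($) (x n)) (($) (w n i))))\<^sup>2)) \<longlonglongrightarrow> 0"
    if w: "\<And>n i. i \<in> {1..r} \<Longrightarrow> w n i \<in> carrier_vec n" and x: "\<forall>\<^sub>F n in sequentially. x n \<in> carrier_vec n"
      and gram: "\<And>i j. i \<in> {1..r} \<Longrightarrow> j \<in> {1..r} \<Longrightarrow> (\<lambda>n. ip {..<n} (($) (w n i)) (($) (w n j))) \<longlonglongrightarrow> (if i = j then 1 else 0)"
      and bd: "\<And>i. i \<in> {1..r} \<Longrightarrow> \<forall>\<^sub>F n in sequentially. norm (ip {..<n} (($) (x n)) (($) (w n i))) \<le> 2"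
    for x :: "nat \<Rightarrow> 'a vec" and w :: "nat \<Rightarrow> nat \<Rightarrow> 'a vec" and Q
  proof (rule proj_norm_limit[of "{i. i \<in> {1..r} \<and> Q i}" w x 2, unfolded mem_Collect_eq])
    show "finite {i. i \<in> {1..r} \<and> Q i}" by simp
  qed ((rule x | (elim conjE, rule w gram bd, assumption+))+)
  have sum_null: "(\<lambda>n. \<Sum>i | i \<in> {1..r} \<and> Q i. (norm (f n i))\<^sup>2) \<longlonglongrightarrow> 0"
    if "\<And>i. i \<in> {1..r} \<Longrightarrow> Q i \<Longrightarrow> (\<lambda>n. f n i) \<longlonglongrightarrow> 0" for f :: "nat \<Rightarrow> nat \<Rightarrow> 'a" and Q
  proof -
    have "(\<lambda>n. \<Sum>i | i \<in> {1..r} \<and> Q i. (norm (f n i))\<^sup>2) \<longlonglongrightarrow> (\<Sum>i | i \<in> {1..r} \<and> Q i. (norm (0 :: 'a))\<^sup>2)"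
      by (intro tendsto_sum tendsto_power tendsto_norm that) auto
    then show ?thesis by simp
  qed
  note PLu = PL[of u u', OF uv(1) car(1) gram_limit(1) bound(1)] and PLv = PL[of v v', OF uv(2) car(2) gram_limit(2) bound(2)]
  from tendsto_add[OF PLu[of "\<lambda>i. \<theta> i = \<theta> i0"] sum_lim(1)] show ?a unfolding lim by simp
  from tendsto_add[OF PLv[of "\<lambda>i. \<theta> i = \<theta> i0"] sum_lim(2)] show ?b unfolding lim by simp
  from tendsto_add[OF PLu[of "\<lambda>i. \<theta> i \<noteq> \<theta> i0"] sum_null[of "\<lambda>i. \<theta> i \<noteq> \<theta> i0" ?x, OF other(1)]] show ?c by simp
  from tendsto_add[OF PLv[of "\<lambda>i. \<theta> i \<noteq> \<theta> i0"] sum_null[of "\<lambda>i. \<theta> i \<noteq> \<theta> i0" ?y, OF other(2)]] show ?d by simp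
  define D where "D n = of_real (phi \<mu> \<rho>) \<cdot>\<^sub>v (perturbation n r \<theta> (u n) (v n) *\<^sub>v v' n) - u' n" for n
  have D: "D n \<in> carrier_vec n" if "i0 \<le> n" for n
    using pair'(1)[OF that] mult_mat_vec_carrier[OF P pair'(2)[OF that]] by (simp add: D_def)
  \<comment> \<open>Exact formula: Gram errors weighted by bounded overlaps, minus the expression
    that the first coupled relation sends to 0.\<close>
  have Dx: "ip {..<n} (($) (D n)) (($) (u n j)) = (\<Sum>i\<in>{1..r}. of_real (phi \<mu> \<rho> * \<theta> i) * (?y n i * (ip {..<n} (($) (u n i)) (($) (u n j)) - (if i = j then 1 else 0))))
      - (?x n j - of_real (phi \<mu> \<rho> * \<theta> j) * ?y n j)" if n: "i0 \<le> n" and j: "j \<in> {1..r}" for n j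
  proof -
    have "D n $ k = of_real (phi \<mu> \<rho>) * (\<Sum>i\<in>{1..r}. of_real (\<theta> i) * ?y n i * u n i $ k) - u' n $ k" if k: "k < n" for k
    proof -
      \<comment> \<open>The perturbation alone is treated as a low-rank change of the zero
        matrix.\<close>
      have "perturbation n r \<theta> (u n) (v n) $$ (i, j) = low_rank \<theta> {1..r} (\<lambda>i. ($) (u n i)) (\<lambda>i. ($) (v n i)) (\<lambda>i j. 0) i j" if "i < n" "j < n" for i j
        using that by (simp add: perturbation_def low_rank_def)
      from mult_mat_vec_mv[OF P pair'(2)[OF n] k this]
      have "(perturbation n r \<theta> (u n) (v n) *\<^sub>v v' n) $ k = (\<Sum>i\<in>{1..r}. of_real (\<theta> i) * ?y n i * u n i $ k)"
        unfolding mv_low_rank by (simp add: mv_def)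
      then show ?thesis using pair'(1)[OF n] P[of n] k by (simp add: D_def)
    qed
    then have "ip {..<n} (($) (D n)) (($) (u n j)) = ip {..<n} (\<lambda>k. of_real (phi \<mu> \<rho>) * (\<Sum>i\<in>{1..r}. (of_real (\<theta> i) * ?y n i) * u n i $ k) - u' n $ k) (($) (u n j))"
      by (intro ip_cong) simp_all
    also have "\<dots> = (\<Sum>i\<in>{1..r}. of_real (phi \<mu> \<rho> * \<theta> i) * (?y n i * ip {..<n} (($) (u n i)) (($) (u n j)))) - ?x n j"
      by (simp only: ip_diff_left ip_mult_left ip_sum_left sum_distrib_left of_real_mult mult.assoc)
    also have "(\<Sum>i\<in>{1..r}. of_real (phi \<mu> \<rho> * \<theta> i) * (?y n i * ip {..<n} (($) (u n i)) (($) (u n j)))) =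
      (\<Sum>i\<in>{1..r}. of_real (phi \<mu> \<rho> * \<theta> i) * (?y n i * (ip {..<n} (($) (u n i)) (($) (u n j)) - (if i = j then 1 else 0))) + (if i = j then of_real (phi \<mu> \<rho> * \<theta> i) * ?y n i else 0))"
      by (intro sum.cong refl) (simp add: algebra_simps)
    also have "\<dots> = (\<Sum>i\<in>{1..r}. of_real (phi \<mu> \<rho> * \<theta> i) * (?y n i * (ip {..<n} (($) (u n i)) (($) (u n j)) - (if i = j then 1 else 0)))) + of_real (phi \<mu> \<rho> * \<theta> j) * ?y n j"
      unfolding sum.distrib using j by simp
    finally show ?thesis by simp
  qed
  have Dlim: "(\<lambda>n. ip {..<n} (($) (D n)) (($) (u n j))) \<longlonglongrightarrow> 0" if j: "j \<in> {1..r}" for j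
  proof -
    have "(\<lambda>n. ?y n i * (ip {..<n} (($) (u n i)) (($) (u n j)) - (if i = j then 1 else 0))) \<longlonglongrightarrow> 0" if "i \<in> {1..r}" for i
      by (rule lim_null_mult_left_bounded[OF bound(2)[OF that] LIM_zero[OF gram_limit(1)[OF that j]]])
    then have "(\<lambda>n. (\<Sum>i\<in>{1..r}. of_real (phi \<mu> \<rho> * \<theta> i) * (?y n i * (ip {..<n} (($) (u n i)) (($) (u n j)) - (if i = j then 1 else 0))))
      - (?x n j - of_real (phi \<mu> \<rho> * \<theta> j) * ?y n j)) \<longlonglongrightarrow> (\<Sum>i\<in>{1..r}. of_real (phi \<mu> \<rho> * \<theta> i) * 0) - 0"
      by (intro tendsto_diff tendsto_sum tendsto_mult tendsto_const rel[OF j])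
    then have "(\<lambda>n. (\<Sum>i\<in>{1..r}. of_real (phi \<mu> \<rho> * \<theta> i) * (?y n i * (ip {..<n} (($) (u n i)) (($) (u n j)) - (if i = j then 1 else 0))))
      - (?x n j - of_real (phi \<mu> \<rho> * \<theta> j) * ?y n j)) \<longlonglongrightarrow> 0" by simp
    then show ?thesis by (rule Lim_transform_eventually) (use Dx[OF _ j] in \<open>auto intro!: eventually_sequentiallyI[of i0]\<close>)
  qed
  have "\<forall>\<^sub>F n in sequentially. D n \<in> carrier_vec n" using D by (auto intro!: eventually_sequentiallyI[of i0])
  moreover have "\<forall>\<^sub>F n in sequentially. norm (ip {..<n} (($) (D n)) (($) (u n i))) \<le> 2" if "i \<in> {1..r}" for i
    using order_tendstoD(2)[OF tendsto_norm_zero[OF Dlim[OF that]], of 2] by (auto elim: eventually_mono)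
  ultimately have "(\<lambda>n. (proj_norm (D n) (vspan n {u n i | i. i \<in> {1..r} \<and> \<theta> i = \<theta> i0}))\<^sup>2 - (\<Sum>i | i \<in> {1..r} \<and> \<theta> i = \<theta> i0. (norm (ip {..<n} (($) (D n)) (($) (u n i))))\<^sup>2)) \<longlonglongrightarrow> 0"
    by (intro PL uv(1) gram_limit(1))
  from tendsto_add[OF this sum_null[of "\<lambda>i. \<theta> i = \<theta> i0" "\<lambda>n i. ip {..<n} (($) (D n)) (($) (u n i))", OF Dlim]] have "(\<lambda>n. (proj_norm (D n) (vspan n {u n i | i. i \<in> {1..r} \<and> \<theta> i = \<theta> i0}))\<^sup>2) \<longlonglongrightarrow> 0" by simp
  then show ?e unfolding D_def by (rule null_proj_norm)
qed

section \<open>Hypotheses on the limit measure, the entries and the perturbation\<close>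

text \<open>The complement of the support is a union of null open sets, and by Lindelof countably
  many of them cover it.\<close>

lemma AE_Inf_support_le:
  assumes "real_distribution \<mu>" and comp: "compact (measure_support \<mu>)"
  shows "AE t in \<mu>. Inf (measure_support \<mu>) \<le> t"
proof -
  interpret real_distribution \<mu> by (rule assms)
  define \<F> where "\<F> = {U. open U \<and> emeasure \<mu> U = 0}"
  obtain \<F>' where F: "\<F>' \<subseteq> \<F>" "countable \<F>'" "\<Union>\<F>' = \<Union>\<F>"
    by (rule Lindelof[of \<F>]) (auto simp: \<F>_def)
  have "(\<Union>U\<in>\<F>'. U) \<in> null_sets \<mu>"
    by (rule null_sets_UN'[OF F(2)]) (use F(1) in \<open>auto simp: \<F>_def null_sets_def\<close>)
  then have "AE t in \<mu>. t \<notin> \<Union>\<F>" unfolding F(3)[symmetric] by (intro AE_not_in) simp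
  then show ?thesis
  proof eventually_elim
    case (elim t)
    then have "t \<in> measure_support \<mu>" by (auto simp: \<F>_def measure_support_def zero_less_iff_neq_zero)
    then show ?case using compact_imp_bounded[OF comp] by (intro cInf_lower bounded_imp_bdd_below)
  qed
qed

text \<open>The square of \<open>\<kappa>\<close> is 1 plus the eighth moment, since y^4 and (y^2 -
  1)^4 are both at most 1 + y^8.\<close>

lemma iid_coordinates_of_eighth_moment:
  fixes \<nu> :: "'a :: real_or_complex measure"
  assumes \<nu>: "prob_space \<nu>" "sets \<nu> = sets borel" and mean: "integrable \<nu> (\<lambda>x. x)" "(\<integral>x. x \<partial>\<nu>) = 0"
    and var: "integrable \<nu> (\<lambda>x. (norm x)\<^sup>2)" "(\<integral>x. (norm x)\<^sup>2 \<partial>\<nu>) = 1"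
    and m8: "(\<integral>\<^sup>+x. ennreal (norm x ^ 8) \<partial>\<nu>) < \<infinity>"
  shows "\<exists>\<kappa>. iid_coordinates \<nu> \<kappa>"
proof -
  interpret prob_space \<nu> by (rule \<nu>)
  have [measurable]: "(\<lambda>x. norm x ^ 8) \<in> borel_measurable \<nu>"
    unfolding measurable_cong_sets[OF \<nu>(2) refl] by measurable
  define A where "A = (\<integral>\<^sup>+x. ennreal (1 + norm x ^ 8) \<partial>\<nu>)"
  have "ennreal (1 + norm x ^ 8) = 1 + ennreal (norm x ^ 8)" for x :: 'a by (subst ennreal_plus) simp_all
  then have "A = (\<integral>\<^sup>+x. 1 + ennreal (norm x ^ 8) \<partial>\<nu>)" unfolding A_def by (simp only:)
  also have "\<dots> = 1 + (\<integral>\<^sup>+x. ennreal (norm x ^ 8) \<partial>\<nu>)"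
    by (subst nn_integral_add) (simp_all add: emeasure_space_1)
  finally have A: "A < \<infinity>" using m8 by (simp add: ennreal_add_less_top)
  define \<kappa> where "\<kappa> = sqrt (enn2real A)"
  have \<kappa>: "ennreal (\<kappa>\<^sup>2) = A" using A by (simp add: \<kappa>_def)
  have 8: "x ^ 8 = (x ^ 4)\<^sup>2" "x ^ 8 = (x\<^sup>2) ^ 4" for x :: real by (simp_all flip: power_mult)
  have p1: "x ^ 4 \<le> 1 + x ^ 8" for x :: real
    unfolding 8(1) using sum_squares_bound[of "x ^ 4" 1] by (simp add: power2_eq_square) (smt (verit) zero_le_even_power even_numeral mult_nonneg_nonneg)
  have p2: "(x\<^sup>2 - 1) ^ 4 \<le> 1 + x ^ 8" for x :: real
  proof -
    have "\<bar>x\<^sup>2 - 1\<bar> ^ 4 \<le> (max (x\<^sup>2) 1) ^ 4" by (intro power_mono) (auto simp: abs_if max_def)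
    also have "\<dots> \<le> 1 + (x\<^sup>2) ^ 4" by (simp add: max_def)
    finally show ?thesis unfolding 8(2) by simp
  qed
  have "iid_coordinates \<nu> \<kappa>"
    unfolding iid_coordinates_def iid_coordinates_axioms_def
  proof (intro conjI \<nu> mean var)
    show "0 \<le> \<kappa>" by (simp add: \<kappa>_def)
    show "(\<integral>\<^sup>+x. ennreal (norm x ^ 4) \<partial>\<nu>) \<le> ennreal (\<kappa>\<^sup>2)"
      unfolding \<kappa> A_def by (intro nn_integral_mono ennreal_leI p1)
    show "(\<integral>\<^sup>+x. ennreal (((norm x)\<^sup>2 - 1) ^ 4) \<partial>\<nu>) \<le> ennreal (\<kappa>\<^sup>2)"
      unfolding \<kappa> A_def by (intro nn_integral_mono ennreal_leI p2)
  qed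
  then show ?thesis by blast
qed

lemma spectral_mean_limit:
  fixes A :: "nat \<Rightarrow> 'a :: real_or_complex mat" and f :: "real \<Rightarrow> real"
  assumes A: "\<And>n. A n \<in> carrier_mat n n" and svd: "\<And>n. is_svd n (entries (A n)) (s n) (p n) (q n)"
    and \<mu>: "real_distribution \<mu>" and weak: "weak_conv_m (\<lambda>n. empirical_singular_measure (A n)) \<mu>"
    and f: "\<And>x. isCont f x" "\<And>x. norm (f x) \<le> B"
  shows "(\<lambda>n. (\<Sum>c<n. f (s n c)) / real n) \<longlonglongrightarrow> (\<integral>t. f t \<partial>\<mu>)"
proof -
  have meas: "f \<in> borel_measurable borel"
    using f(1) by (intro borel_measurable_continuous_onI continuous_at_imp_continuous_on) auto
  \<comment> \<open>At n = 0 the empirical measure is not a probability measure, so the sequence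
    starts at 1.\<close>
  have "weak_conv_m (\<lambda>n. empirical_singular_measure (A (Suc n))) \<mu>"
    using weak unfolding weak_conv_m_def weak_conv_def by (intro allI impI LIMSEQ_Suc) auto
  moreover have "real_distribution (empirical_singular_measure (A (Suc n)))" for n
    by (rule real_distribution_empirical_singular_measure) (use A[of "Suc n"] in auto)
  ultimately have "(\<lambda>n. \<integral>t. f t \<partial>empirical_singular_measure (A (Suc n))) \<longlonglongrightarrow> (\<integral>t. f t \<partial>\<mu>)"
    by (intro weak_conv_imp_integral_bdd_continuous_conv[OF _ \<mu> _ f])
  then have "(\<lambda>n. (\<Sum>c<Suc n. f (s (Suc n) c)) / real (Suc n)) \<longlonglongrightarrow> (\<integral>t. f t \<partial>\<mu>)"
    unfolding integral_empirical_singular_measure[OF A svd meas] .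
  then show ?thesis by (rule LIMSEQ_imp_Suc)
qed

text \<open>Each vector carries 1 / sqrt n, which accounts for the division by \<open>n\<close> in
  the given averages; \<open>form_limit_weierstrass\<close> then passes from powers to continuous
  weights.\<close>

lemma limit_forms_of_powers:
  fixes A B :: "nat \<Rightarrow> nat \<Rightarrow> nat \<Rightarrow> 'a :: real_or_complex"
  assumes \<mu>: "distribution_above \<mu> a" and s_low: "\<And>c. c < a \<Longrightarrow> \<forall>\<^sub>F n in sequentially. \<forall>k<n. c < s n k"
    and lim: "\<And>m i j. i \<in> J \<Longrightarrow> j \<in> J \<Longrightarrow>
     (\<lambda>n. (\<Sum>c<n. of_real ((1 / (1 + (s n c)\<^sup>2)) ^ m) * (A n i c * conjugate (A n j c))) / of_nat n) \<longlonglongrightarrow> of_real (if i = j then \<integral>t. (1 / (1 + t\<^sup>2)) ^ m \<partial>\<mu> else 0) \<and>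
     (\<lambda>n. (\<Sum>c<n. of_real ((1 / (1 + (s n c)\<^sup>2)) ^ m) * (B n i c * conjugate (B n j c))) / of_nat n) \<longlonglongrightarrow> of_real (if i = j then \<integral>t. (1 / (1 + t\<^sup>2)) ^ m \<partial>\<mu> else 0) \<and>
     (\<lambda>n. (\<Sum>c<n. of_real ((1 / (1 + (s n c)\<^sup>2)) ^ Suc m * s n c) * (A n i c * conjugate (B n j c))) / of_nat n) \<longlonglongrightarrow> 0"
  shows "limit_forms \<mu> a s (\<lambda>n i c. of_real (1 / sqrt (real n)) * A n i c) (\<lambda>n i c. of_real (1 / sqrt (real n)) * B n i c) J"
proof -
  interpret distribution_above \<mu> a by (rule \<mu>)
  let ?h = "\<lambda>t :: real. 1 / (1 + t\<^sup>2)"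
  have pos: "0 < 1 + t\<^sup>2" for t :: real by (simp add: add_pos_nonneg)
  have h: "0 \<le> ?h t" "?h t \<le> 1" for t using pos[of t] by (simp_all add: divide_le_eq)
  have half: "\<bar>?h t * t\<bar> \<le> 1" for t
  proof -
    have "0 \<le> (\<bar>t\<bar> - 1)\<^sup>2" by simp
    then have "\<bar>t\<bar> \<le> 1 + t\<^sup>2" by (simp add: power2_eq_square algebra_simps)
    then show ?thesis using pos[of t] by (simp add: abs_mult divide_le_eq)
  qed
  have meas: "?h \<in> borel_measurable \<mu>" by simp
  have scale: "(\<Sum>c<n. of_real (w c) * ((of_real (1 / sqrt (real n)) * x c) * conjugate (of_real (1 / sqrt (real n)) * y c)))
    = (\<Sum>c<n. of_real (w c) * (x c * conjugate (y c))) / of_nat n" for n w and x y :: "nat \<Rightarrow> 'a"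
  proof -
    have "of_real (1 / sqrt (real n)) * (of_real (1 / sqrt (real n)) :: 'a) = of_real (1 / real n)"
      unfolding of_real_mult[symmetric] of_real_eq_iff by simp
    then have eq: "of_real (w c) * ((of_real (1 / sqrt (real n)) * x c) * conjugate (of_real (1 / sqrt (real n)) * y c))
      = of_real (1 / real n) * (of_real (w c) * (x c * conjugate (y c)))" for c
      unfolding conjugate_dist_mul conjugate_of_real by (metis (no_types, lifting) mult.assoc mult.commute)
    show ?thesis unfolding sum_divide_distrib by (rule sum.cong[OF refl], subst eq) simp
  qed
  let ?A = "\<lambda>n i c. of_real (1 / sqrt (real n)) * A n i c" and ?B = "\<lambda>n i c. of_real (1 / sqrt (real n)) * B n i c"
  have limA: "(\<lambda>n. \<Sum>c<n. of_real (1 * ?h (s n c) ^ m) * (?A n i c * conjugate (?A n j c))) \<longlonglongrightarrow> of_real ((if i = j then 1 else 0) * (\<integral>t. ?h t ^ m \<partial>\<mu>))"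
    and limB: "(\<lambda>n. \<Sum>c<n. of_real (1 * ?h (s n c) ^ m) * (?B n i c * conjugate (?B n j c))) \<longlonglongrightarrow> of_real ((if i = j then 1 else 0) * (\<integral>t. ?h t ^ m \<partial>\<mu>))"
    and limC: "(\<lambda>n. \<Sum>c<n. of_real ((?h (s n c) * s n c) * ?h (s n c) ^ m) * (?A n i c * conjugate (?B n j c))) \<longlonglongrightarrow> of_real (0 * (\<integral>t. ?h t ^ m \<partial>\<mu>))"
    if ij: "i \<in> J" "j \<in> J" for i j m
  proof -
    have e: "(if i = j then 1 else 0) * x = (if i = j then x else 0)" for x :: real by simp
    have e': "?h x * x * ?h x ^ m = ?h x ^ Suc m * x" for x :: real by simp
    show "(\<lambda>n. \<Sum>c<n. of_real (1 * ?h (s n c) ^ m) * (?A n i c * conjugate (?A n j c))) \<longlonglongrightarrow> of_real ((if i = j then 1 else 0) * (\<integral>t. ?h t ^ m \<partial>\<mu>))"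
      unfolding scale e mult_1_left using lim[OF ij, of m] by blast
    show "(\<lambda>n. \<Sum>c<n. of_real (1 * ?h (s n c) ^ m) * (?B n i c * conjugate (?B n j c))) \<longlonglongrightarrow> of_real ((if i = j then 1 else 0) * (\<integral>t. ?h t ^ m \<partial>\<mu>))"
      unfolding scale e mult_1_left using lim[OF ij, of m] by blast
    show "(\<lambda>n. \<Sum>c<n. of_real ((?h (s n c) * s n c) * ?h (s n c) ^ m) * (?A n i c * conjugate (?B n j c))) \<longlonglongrightarrow> of_real (0 * (\<integral>t. ?h t ^ m \<partial>\<mu>))"
      unfolding scale e' mult_zero_left of_real_0 using lim[OF ij, of m] by blast
  qed
  have p1: "prob UNIV = 1" using prob_space by simp
  have norm_bd: "\<forall>\<^sub>F n in sequentially. sqrt (nsq {..<n} (x n)) \<le> 2"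
    if "(\<lambda>n. \<Sum>c<n. of_real (1 * ?h (s n c) ^ 0) * (x n c * conjugate (x n c))) \<longlonglongrightarrow> of_real 1" for x :: "nat \<Rightarrow> nat \<Rightarrow> 'a"
  proof -
    have "(\<Sum>c<n. of_real (1 * ?h (s n c) ^ 0) * (x n c * conjugate (x n c))) = of_real (nsq {..<n} (x n))" for n
      unfolding ip_self[symmetric] by (simp add: ip_def)
    with that have "(\<lambda>n. nsq {..<n} (x n)) \<longlonglongrightarrow> 1" by (simp only: tendsto_of_real_iff)
    from order_tendstoD(2)[OF tendsto_real_sqrt[OF this], of 2] show ?thesis by (auto elim: eventually_mono)
  qed
  have bdA: "\<forall>\<^sub>F n in sequentially. sqrt (nsq {..<n} (?A n i)) \<le> 2" if "i \<in> J" for i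
    by (rule norm_bd) (use limA[OF that that, of 0] in \<open>simp add: p1\<close>)
  have bdB: "\<forall>\<^sub>F n in sequentially. sqrt (nsq {..<n} (?B n i)) \<le> 2" if "i \<in> J" for i
    by (rule norm_bd) (use limB[OF that that, of 0] in \<open>simp add: p1\<close>)
  have prod: "\<forall>\<^sub>F n in sequentially. sqrt (nsq {..<n} (x n)) * sqrt (nsq {..<n} (y n)) \<le> 2 * 2"
    if "\<forall>\<^sub>F n in sequentially. sqrt (nsq {..<n} (x n)) \<le> 2" "\<forall>\<^sub>F n in sequentially. sqrt (nsq {..<n} (y n)) \<le> 2" for x y :: "nat \<Rightarrow> nat \<Rightarrow> 'a"
    using that
  proof eventually_elim
    case (elim n)
    then show ?case by (intro mult_mono) auto
  qed
  show ?thesis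
  proof (unfold_locales, goal_cases)
    case (1 c)
    then show ?case by (rule s_low)
  next
    case (2 F i j)
    show ?case unfolding wform_def
      by (rule form_limit_weierstrass[OF prob_space_axioms meas h h _ prod[OF bdA[OF 2(2)] bdA[OF 2(3)]] _ limA[OF 2(2,3)] 2(1)]) auto
  next
    case (3 F i j)
    show ?case unfolding wform_def
      by (rule form_limit_weierstrass[OF prob_space_axioms meas h h _ prod[OF bdB[OF 3(2)] bdB[OF 3(3)]] _ limB[OF 3(2,3)] 3(1)]) auto
  next
    case (4 F i j)
    have "(\<lambda>n. \<Sum>c<n. of_real ((?h (s n c) * s n c) * F (?h (s n c))) * (?A n i c * conjugate (?B n j c))) \<longlonglongrightarrow> of_real (0 * (\<integral>t. F (?h t) \<partial>\<mu>))"
      by (rule form_limit_weierstrass[OF prob_space_axioms meas h h half prod[OF bdA[OF 4(2)] bdB[OF 4(3)]] _ limC[OF 4(2,3)] 4(1)]) auto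
    then show ?case unfolding wform_def mult_zero_left of_real_0 .
  qed
qed

text \<open>By Parseval, closeness of the vectors is closeness of their singular
  coordinates.\<close>

lemma limit_forms_close:
  assumes lf: "limit_forms \<mu> a s (\<lambda>n i c. ip {..<n} (u n i) (p n c)) (\<lambda>n i c. ip {..<n} (v n i) (q n c)) J"
    and svd: "\<And>n. is_svd n (X n) (s n) (p n) (q n)"
    and u: "\<And>i. i \<in> J \<Longrightarrow> (\<lambda>n. sqrt (nsq {..<n} (\<lambda>k. u' n i k - u n i k))) \<longlonglongrightarrow> 0"
    and v: "\<And>i. i \<in> J \<Longrightarrow> (\<lambda>n. sqrt (nsq {..<n} (\<lambda>k. v' n i k - v n i k))) \<longlonglongrightarrow> 0"
  shows "limit_forms \<mu> a s (\<lambda>n i c. ip {..<n} (u' n i) (p n c)) (\<lambda>n i c. ip {..<n} (v' n i) (q n c)) J"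
  by (rule limit_forms.limit_forms_perturb[OF lf];
      simp only: ip_diff_left[symmetric] orthonormal_basis.parseval_nsq[OF is_svdD(1)[OF svd]] orthonormal_basis.parseval_nsq[OF is_svdD(2)[OF svd]] u v)

lemma iid_vector_index:
  "G \<in> carrier_mat n r \<Longrightarrow> k < n \<Longrightarrow> i \<in> {1..r} \<Longrightarrow> iid_vector G i $ k = of_real (1 / sqrt (real n)) * G $$ (k, i - 1)"
  by (auto simp: iid_vector_def)

text \<open>Gram-Schmidt commutes with scaling and the final normalisation removes the scale, so it
  may be applied to the columns divided by sqrt n, which are asymptotically orthonormal. Along such
  a realisation the columns are dependent for finitely many \<open>n\<close> only.\<close>

lemma orthonormalized_vector_close:
  fixes G :: "nat \<Rightarrow> 'a :: real_or_complex mat"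
  assumes G: "\<And>n. G n \<in> carrier_mat n r"
    and gram: "\<And>i j. i \<in> {1..r} \<Longrightarrow> j \<in> {1..r} \<Longrightarrow>
      (\<lambda>n. ip {..<n} (\<lambda>k. of_real (1 / sqrt (real n)) * G n $$ (k, i - 1)) (\<lambda>k. of_real (1 / sqrt (real n)) * G n $$ (k, j - 1))) \<longlonglongrightarrow> (if i = j then 1 else 0)"
    and i: "i \<in> {1..r}"
  shows "(\<lambda>n. sqrt (nsq {..<n} (\<lambda>k. orthonormalized_vector (G n) i $ k - of_real (1 / sqrt (real n)) * G n $$ (k, i - 1)))) \<longlonglongrightarrow> 0"
    and "orthonormalized_vector (G n) i \<in> carrier_vec n"
proof -
  define c where "c n = 1 / sqrt (real n)" for n
  define w where "w n j = gram_schmidt n (cols (G n)) ! j" for n j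
  define g where "g n j k = of_real (c n) * G n $$ (k, j)" for n j k
  define y where "y n j k = of_real (c n) * w n j $ k" for n j k
  have cols: "set (cols (G n)) \<subseteq> carrier_vec n" "length (cols (G n)) = r" for n
    using G[of n] cols_dim[of "G n"] by auto
  have col: "cols (G n) ! j $ k = G n $$ (k, j)" if "j < r" "k < n" for n j k using that G[of n] by auto
  have gs: "w n j $ k = G n $$ (k, j) - (\<Sum>l<j. ip {..<n} (\<lambda>k. G n $$ (k, j)) (($) (w n l)) / ip {..<n} (($) (w n l)) (($) (w n l)) * w n l $ k)"
    if j: "j < r" and k: "k < n" for n j k
  proof -
    have "ip {..<n} (($) (cols (G n) ! j)) z = ip {..<n} (\<lambda>k. G n $$ (k, j)) z" for z
      by (rule ip_cong) (simp_all add: col[OF j])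
    then show ?thesis using gram_schmidt_index(2)[OF cols(1), of j n k] j k by (simp only: cols(2) w_def col)
  qed
  have wc: "w n j \<in> carrier_vec n" if "j < r" for n j
  proof -
    have "set (gram_schmidt n (cols (G n))) \<subseteq> carrier_vec n" "length (gram_schmidt n (cols (G n))) = r"
      unfolding gram_schmidt_code using gram_schmidt_sub2_carrier[of "[]" n "cols (G n)"] cols[of n] length_gram_schmidt_sub2[of n "[]" "cols (G n)"] by auto
    then show ?thesis unfolding w_def using that nth_mem by blast
  qed
  have rec: "y n j k = g n j k - (\<Sum>l<j. ip {..<n} (g n j) (y n l) / ip {..<n} (y n l) (y n l) * y n l k)" if j: "j < r" and k: "k < n" for n j k
  proof -
    have c0: "of_real (c n) \<noteq> (0 :: 'a)" using k by (simp add: c_def)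
    have "ip {..<n} (g n j) (y n l) / ip {..<n} (y n l) (y n l) = ip {..<n} (\<lambda>k. G n $$ (k, j)) (($) (w n l)) / ip {..<n} (($) (w n l)) (($) (w n l))" for l
      unfolding g_def[abs_def] y_def[abs_def] ip_mult_left ip_mult_right conjugate_of_real using c0 by simp
    then show ?thesis
      unfolding y_def[of n j k] gs[OF j k] right_diff_distrib g_def[of n j k] sum_distrib_left
      by (simp add: y_def mult_ac)
  qed
  obtain j where j: "i = Suc j" "j < r" using i by (cases i) auto
  have gram': "(\<lambda>n. ip {..<n} (g n l) (g n m)) \<longlonglongrightarrow> (if l = m then 1 else 0)" if "l < r" "m < r" for l m
    using gram[of "Suc l" "Suc m"] that by (simp add: g_def[abs_def] c_def)
  have n: "dim_row (G n) = n" for n using G[of n] by simp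
  have w: "orthonormalized_vector (G n) i = of_real (1 / l2norm (w n j)) \<cdot>\<^sub>v w n j" for n
    by (simp add: orthonormalized_vector_def Let_def n w_def j(1))
  show "orthonormalized_vector (G n) i \<in> carrier_vec n" unfolding w using wc[OF j(2)] by simp
  have "orthonormalized_vector (G n) i $ k = of_real (1 / sqrt (nsq {..<n} (y n j))) * y n j k" if k: "k < n" for n k
  proof -
    have c0: "0 < c n" using k by (simp add: c_def)
    have "sqrt (nsq {..<n} (y n j)) = c n * l2norm (w n j)"
      unfolding y_def[abs_def] nsq_mult real_sqrt_mult using c0 wc[OF j(2), of n] by (simp add: l2norm_def nsq_def)
    then have "of_real (1 / sqrt (nsq {..<n} (y n j))) * y n j k = of_real (1 / l2norm (w n j)) * w n j $ k"
      using c0 by (simp add: y_def)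
    then show ?thesis unfolding w using wc[OF j(2), of n] k by simp
  qed
  then have "nsq {..<n} (\<lambda>k. orthonormalized_vector (G n) i $ k - of_real (1 / sqrt (real n)) * G n $$ (k, i - 1))
    = nsq {..<n} (\<lambda>k. of_real (1 / sqrt (nsq {..<n} (y n j))) * y n j k - g n j k)" for n
    by (intro nsq_cong) (simp add: g_def c_def j(1))
  then show "(\<lambda>n. sqrt (nsq {..<n} (\<lambda>k. orthonormalized_vector (G n) i $ k - of_real (1 / sqrt (real n)) * G n $$ (k, i - 1)))) \<longlonglongrightarrow> 0"
    using orthonormalized_close[OF gram' rec j(2)] by simp
qed

theorem theorem2p14:
  fixes M :: "'w measure"
    and X :: "nat \<Rightarrow> 'w \<Rightarrow> 'a :: real_or_complex mat"
    and Gu Gv :: "nat \<Rightarrow> 'w \<Rightarrow> 'a mat"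
    and u v :: "nat \<Rightarrow> 'w \<Rightarrow> nat \<Rightarrow> 'a vec"
    and P X' :: "nat \<Rightarrow> 'w \<Rightarrow> 'a mat"
    and u' v' :: "nat \<Rightarrow> 'w \<Rightarrow> 'a vec"
    and \<theta> :: "nat \<Rightarrow> real"
    and \<nu> :: "'a measure"
    and \<mu> :: "real measure"
    and a \<rho> :: real
    and r i0 :: nat
  assumes M: "prob_space M"
    \<comment> \<open>the random matrices \<open>X\<^sub>n\<close>\<close>
    and X_dim: "\<And>n \<omega>. \<omega> \<in> space M \<Longrightarrow> X n \<omega> \<in> carrier_mat n n"
    and X_meas: "\<And>n i j. i < n \<Longrightarrow> j < n \<Longrightarrow> (\<lambda>\<omega>. X n \<omega> $$ (i, j)) \<in> borel_measurable M"
    \<comment> \<open>their limiting singular value distribution and smallest singular value\<close>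
    and \<mu>: "real_distribution \<mu>"
    and \<mu>_supp: "compact (measure_support \<mu>)"
    and a_def: "a = Inf (measure_support \<mu>)"
    and X_weak: "AE \<omega> in M. weak_conv_m (\<lambda>n. empirical_singular_measure (X n \<omega>)) \<mu>"
    and X_smallest: "AE \<omega> in M. (\<lambda>n. singular_value n (X n \<omega>)) \<longlonglongrightarrow> a"
    and a_pos: "a > 0"
    \<comment> \<open>the law of the entries of \<open>G\<^sub>u\<close> and \<open>G\<^sub>v\<close>\<close>
    and \<nu>: "prob_space \<nu>" "sets \<nu> = sets borel"
    and \<nu>_mean: "integrable \<nu> (\<lambda>x. x)" "(\<integral>x. x \<partial>\<nu>) = 0"
    and \<nu>_var: "integrable \<nu> (\<lambda>x. (norm x)\<^sup>2)" "(\<integral>x. (norm x)\<^sup>2 \<partial>\<nu>) = 1"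
    and \<nu>_lsi: "log_sobolev \<nu>"
    \<comment> \<open>the parameters of the perturbation\<close>
    and r: "r \<ge> 1"
    and \<theta>_decr: "\<And>i j. 1 \<le> i \<Longrightarrow> i \<le> j \<Longrightarrow> j \<le> r \<Longrightarrow> \<theta> j \<le> \<theta> i"
    and \<theta>_pos: "\<And>i. 1 \<le> i \<Longrightarrow> i \<le> r \<Longrightarrow> \<theta> i > 0"
    \<comment> \<open>for each \<open>n\<close>, all entries of \<open>G\<^sub>u\<close> and \<open>G\<^sub>v\<close> together are i.i.d. of law \<open>\<nu>\<close>\<close>
    and G_dim: "\<And>n \<omega>. \<omega> \<in> space M \<Longrightarrow> Gu n \<omega> \<in> carrier_mat n r \<and> Gv n \<omega> \<in> carrier_mat n r"
    and G_indep: "\<And>n. prob_space.indep_vars M (\<lambda>_. borel)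
        (\<lambda>(b, i, k) \<omega>. (if b then Gu else Gv) n \<omega> $$ (i, k)) (UNIV \<times> {..<n} \<times> {..<r})"
    and G_law: "\<And>n i k. i < n \<Longrightarrow> k < r \<Longrightarrow>
        distr M borel (\<lambda>\<omega>. Gu n \<omega> $$ (i, k)) = \<nu> \<and> distr M borel (\<lambda>\<omega>. Gv n \<omega> $$ (i, k)) = \<nu>"
    \<comment> \<open>the family of all \<open>(G\<^sub>u, G\<^sub>v)\<close> is independent of the family of all \<open>X\<^sub>n\<close>\<close>
    and GX_indep: "prob_space.indep_set M
        (generated_sigma M ({\<lambda>\<omega>. Gu n \<omega> $$ (i, k) | n i k. i < n \<and> k < r} \<union>
                            {\<lambda>\<omega>. Gv n \<omega> $$ (i, k) | n i k. i < n \<and> k < r}))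
        (generated_sigma M {\<lambda>\<omega>. X n \<omega> $$ (i, j) | n i j. i < n \<and> j < n})"
    \<comment> \<open>the i.i.d. model or the orthonormalized model\<close>
    and model:
      "(\<forall>n. \<forall>\<omega>\<in>space M. \<forall>i\<in>{1..r}.
          u n \<omega> i = iid_vector (Gu n \<omega>) i \<and> v n \<omega> i = iid_vector (Gv n \<omega>) i) \<or>
       (\<forall>n. \<forall>\<omega>\<in>space M. \<forall>i\<in>{1..r}.
          u n \<omega> i = orthonormalized_vector (Gu n \<omega>) i \<and>
          v n \<omega> i = orthonormalized_vector (Gv n \<omega>) i)"
    and P_def: "\<And>n \<omega>. P n \<omega> = perturbation n r \<theta> (u n \<omega>) (v n \<omega>)"
    and X'_def: "\<And>n \<omega>. X' n \<omega> = X n \<omega> + P n \<omega>"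
    and i0: "i0 \<in> {1..r}"
    and supercritical: "threshold \<mu> a < ereal (\<theta> i0)"
    and singular_vectors: "\<And>n \<omega>. n \<ge> i0 \<Longrightarrow> \<omega> \<in> space M \<Longrightarrow>
        singular_vector_pair (X' n \<omega>) (singular_value (n + 1 - i0) (X' n \<omega>)) (u' n \<omega>) (v' n \<omega>)"
    and \<rho>_def: "\<rho> = phi_inv \<mu> a (- 1 / \<theta> i0)"
  shows "AE \<omega> in M.
     (\<lambda>n. (proj_norm (u' n \<omega>) (vspan n {u n \<omega> i | i. i \<in> {1..r} \<and> \<theta> i = \<theta> i0}))\<^sup>2)
       \<longlonglongrightarrow> - 1 / ((\<theta> i0)\<^sup>2 * deriv (phi \<mu>) \<rho>) \<and>
     (\<lambda>n. (proj_norm (v' n \<omega>) (vspan n {v n \<omega> i | i. i \<in> {1..r} \<and> \<theta> i = \<theta> i0}))\<^sup>2)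
       \<longlonglongrightarrow> - 1 / ((\<theta> i0)\<^sup>2 * deriv (phi \<mu>) \<rho>) \<and>
     (\<lambda>n. (proj_norm (u' n \<omega>) (vspan n {u n \<omega> i | i. i \<in> {1..r} \<and> \<theta> i \<noteq> \<theta> i0}))\<^sup>2) \<longlonglongrightarrow> 0 \<and>
     (\<lambda>n. (proj_norm (v' n \<omega>) (vspan n {v n \<omega> i | i. i \<in> {1..r} \<and> \<theta> i \<noteq> \<theta> i0}))\<^sup>2) \<longlonglongrightarrow> 0 \<and>
     (\<lambda>n. proj_norm (of_real (phi \<mu> \<rho>) \<cdot>\<^sub>v (P n \<omega> *\<^sub>v v' n \<omega>) - u' n \<omega>)
            (vspan n {u n \<omega> i | i. i \<in> {1..r} \<and> \<theta> i = \<theta> i0})) \<longlonglongrightarrow> 0"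
proof -
  interpret M: prob_space M by (rule M)
  obtain \<kappa> where \<kappa>: "iid_coordinates \<nu> \<kappa>"
    using iid_coordinates_of_eighth_moment[OF \<nu> \<nu>_mean \<nu>_var eighth_moment_finite[OF \<nu> \<nu>_var \<nu>_lsi]] by blast
  interpret \<mu>: distribution_above \<mu> a
    using \<mu> AE_Inf_support_le[OF \<mu> \<mu>_supp] a_pos by (simp add: distribution_above_def distribution_above_axioms_def a_def)
  have \<theta>0: "0 < \<theta> i0" using \<theta>_pos i0 by simp
  obtain z where z: "0 < z" "z < a" "phi \<mu> z < - 1 / \<theta> i0"
    using \<mu>.threshold_imp_large[OF \<theta>0 supercritical] by blast
  \<comment> \<open>The intermediate value theorem gives a root at most \<open>z\<close>;
    injectivity of \<open>phi\<close> then identifies it with \<rho>.\<close>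
  obtain x where x: "0 < x" "x \<le> z" "phi \<mu> x = - 1 / \<theta> i0"
    using \<mu>.phi_root[OF z(1,2) less_imp_le[OF z(3)]] \<theta>0 by auto
  have \<rho>x: "\<rho> = x" using \<mu>.phi_inv_eq[of x] x z unfolding \<rho>_def x(3) by simp
  have \<rho>: "0 < \<rho>" "\<rho> < a" "phi \<mu> \<rho> = - 1 / \<theta> i0" using x z unfolding \<rho>x by auto
  \<comment> \<open>A decomposition is chosen for every outcome, without regard to
    measurability.\<close>
  have "\<forall>n \<omega>. \<exists>s p q. is_svd n (entries (X n \<omega>)) s p q" by (intro allI svd_exists)
  then obtain s p q where svd: "is_svd n (entries (X n \<omega>)) (s n \<omega>) (p n \<omega>) (q n \<omega>)" for n \<omega>
    unfolding choice_iff by (elim exE) (rule that, blast)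
  define g where "g n = (\<lambda>(b, i, k) \<omega>. (if b then Gu else Gv) n \<omega> $$ (i, k))" for n
  define XF where "XF = {\<lambda>\<omega>. X n \<omega> $$ (i, j) | n i j. i < n \<and> j < n}"
  define XS where "XS = {f -` A \<inter> space M | f A. f \<in> XF \<and> A \<in> sets borel}"
  define N where "N = sigma (space M) XS"
  have XS: "XS \<subseteq> sets M" using X_meas by (auto simp: XS_def XF_def intro: measurable_sets)
  then have XSp: "XS \<subseteq> Pow (space M)" using sets.sets_into_space by blast
  have N: "space N = space M" "sets N = generated_sigma M XF"
    using XSp by (simp_all add: N_def generated_sigma_def XS_def space_measure_of_conv)
  have NM: "sets N \<subseteq> sets M"
    unfolding N_def sets_measure_of[OF XSp] by (rule sets.sigma_sets_subset[OF XS])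
  have Xm: "(\<lambda>\<omega>. entries (X n \<omega>) i j) \<in> borel_measurable N" if "i < n" "j < n" for n i j
  proof (rule measurableI)
    fix A :: "'a set" assume A: "A \<in> sets borel"
    have "(\<lambda>\<omega>. X n \<omega> $$ (i, j)) \<in> XF" using that by (auto simp: XF_def)
    then have "(\<lambda>\<omega>. X n \<omega> $$ (i, j)) -` A \<inter> space M \<in> XS" unfolding XS_def using A by blast
    then show "(\<lambda>\<omega>. entries (X n \<omega>) i j) -` A \<inter> space N \<in> sets N"
      unfolding N(1) unfolding N_def sets_measure_of[OF XSp] entries_def by (rule sigma_sets.Basic)
  qed simp
  have law: "distr M borel (g n e) = \<nu>" if "e \<in> UNIV \<times> {..<n} \<times> {..<r}" for n e
    using that G_law[of _ n] by (cases e) (auto simp: g_def)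
  have indep: "M.indep_set (sigma_sets (space M) {g n e -` A \<inter> space M | e A. e \<in> UNIV \<times> {..<n} \<times> {..<r} \<and> A \<in> sets borel}) (sets N)" for n
    unfolding M.indep_set_def
  proof (rule M.indep_sets_mono_sets[OF GX_indep[unfolded M.indep_set_def]])
    let ?GF = "{\<lambda>\<omega>. Gu n \<omega> $$ (i, k) | n i k. i < n \<and> k < r} \<union> {\<lambda>\<omega>. Gv n \<omega> $$ (i, k) | n i k. i < n \<and> k < r}"
    have gGF: "g n e \<in> ?GF" if "e \<in> UNIV \<times> {..<n} \<times> {..<r}" for e
    proof -
      obtain b i k where e': "e = (b, i, k)" by (cases e)
      with that have e: "e = (b, i, k)" "i < n" "k < r" by auto
      show ?thesis by (cases b) (use e in \<open>auto simp: g_def\<close>)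
    qed
    have "{g n e -` A \<inter> space M | e A. e \<in> UNIV \<times> {..<n} \<times> {..<r} \<and> A \<in> sets borel} \<subseteq> {f -` A \<inter> space M | f A. f \<in> ?GF \<and> A \<in> sets borel}"
    proof
      fix S assume "S \<in> {g n e -` A \<inter> space M | e A. e \<in> UNIV \<times> {..<n} \<times> {..<r} \<and> A \<in> sets borel}"
      then obtain e A where S: "S = g n e -` A \<inter> space M" "e \<in> UNIV \<times> {..<n} \<times> {..<r}" "A \<in> sets borel" by blast
      show "S \<in> {f -` A \<inter> space M | f A. f \<in> ?GF \<and> A \<in> sets borel}"
        by (rule CollectI, rule exI[of _ "g n e"], rule exI[of _ A]) (intro conjI S(1,3) gGF[OF S(2)])
    qed
    then have "sigma_sets (space M) {g n e -` A \<inter> space M | e A. e \<in> UNIV \<times> {..<n} \<times> {..<r} \<and> A \<in> sets borel} \<subseteq> generated_sigma M ?GF"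
      unfolding generated_sigma_def by (rule sigma_sets_mono')
    \<comment> \<open>Independence of two \<sigma>-algebras is independence of a family indexed by
      the booleans, so the two inclusions appear as cases.\<close>
    then show "(case b of True \<Rightarrow> sigma_sets (space M) {g n e -` A \<inter> space M | e A. e \<in> UNIV \<times> {..<n} \<times> {..<r} \<and> A \<in> sets borel} | False \<Rightarrow> sets N)
        \<subseteq> (case b of True \<Rightarrow> generated_sigma M ?GF | False \<Rightarrow> generated_sigma M {\<lambda>\<omega>. X n \<omega> $$ (i, j) | n i j. i < n \<and> j < n})" for b
      unfolding N(2) XF_def by (cases b) simp_all
  qed
  have pos: "1 + t\<^sup>2 \<noteq> 0" for t :: real using zero_le_power2[of t] by linarith
  have weak: "AE \<omega> in M. \<forall>m. (\<lambda>n. (\<Sum>c<n. (1 / (1 + (s n \<omega> c)\<^sup>2)) ^ m) / real n) \<longlonglongrightarrow> (\<integral>t. (1 / (1 + t\<^sup>2)) ^ m \<partial>\<mu>)"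
    using X_weak AE_space
  proof eventually_elim
    case (elim \<omega>)
    have "norm (1 / (1 + t\<^sup>2)) \<le> 1" for t :: real by (simp add: divide_le_eq add_pos_nonneg)
    then have "norm ((1 / (1 + t\<^sup>2)) ^ m) \<le> 1" for t :: real and m
      by (simp only: norm_power power_le_one norm_ge_zero)
    then show ?case
      by (intro allI spectral_mean_limit[OF X_dim[OF elim(2)] svd \<mu> elim(1), where B = 1]) (auto intro!: continuous_intros simp: pos)
  qed
  have forms: "AE \<omega> in M. \<forall>m. \<forall>k<r. \<forall>l<r.
     (\<lambda>n. (\<Sum>c<n. of_real ((1 / (1 + (s n \<omega> c)\<^sup>2)) ^ m) * (ip {..<n} (\<lambda>i. g n (True, i, k) \<omega>) (p n \<omega> c)
         * conjugate (ip {..<n} (\<lambda>i. g n (True, i, l) \<omega>) (p n \<omega> c)))) / of_nat n) \<longlonglongrightarrow> of_real (if k = l then \<integral>t. (1 / (1 + t\<^sup>2)) ^ m \<partial>\<mu> else 0) \<and>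
     (\<lambda>n. (\<Sum>c<n. of_real ((1 / (1 + (s n \<omega> c)\<^sup>2)) ^ m) * (ip {..<n} (\<lambda>i. g n (False, i, k) \<omega>) (q n \<omega> c)
         * conjugate (ip {..<n} (\<lambda>i. g n (False, i, l) \<omega>) (q n \<omega> c)))) / of_nat n) \<longlonglongrightarrow> of_real (if k = l then \<integral>t. (1 / (1 + t\<^sup>2)) ^ m \<partial>\<mu> else 0) \<and>
     (\<lambda>n. (\<Sum>c<n. of_real ((1 / (1 + (s n \<omega> c)\<^sup>2)) ^ Suc m * s n \<omega> c) * (ip {..<n} (\<lambda>i. g n (True, i, k) \<omega>) (p n \<omega> c)
         * conjugate (ip {..<n} (\<lambda>i. g n (False, i, l) \<omega>) (q n \<omega> c)))) / of_nat n) \<longlonglongrightarrow> 0"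
    by (rule iid_coordinates.resolvent_forms_AE[OF \<kappa> M _ law N(1) NM indep Xm svd weak])
      (use G_indep in \<open>simp_all add: g_def[abs_def]\<close>)
  show ?thesis
    using forms X_smallest AE_space
  proof eventually_elim
    case (elim \<omega>)
    note \<omega> = elim(3)
    have s_low: "\<forall>\<^sub>F n in sequentially. \<forall>k<n. c < s n \<omega> k" if "c < a" for c
      using order_tendstoD(1)[OF elim(2) that]
    proof eventually_elim
      case (elim n)
      then show ?case using smallest_singular_value_le[OF X_dim[OF \<omega>] svd] by (meson less_le_trans)
    qed
    define u0 where "u0 n i k = of_real (1 / sqrt (real n)) * Gu n \<omega> $$ (k, i - 1)" for n i k
    define v0 where "v0 n i k = of_real (1 / sqrt (real n)) * Gv n \<omega> $$ (k, i - 1)" for n i k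
    have lf: "limit_forms \<mu> a (\<lambda>n. s n \<omega>) (\<lambda>n i c. ip {..<n} (u0 n i) (p n \<omega> c)) (\<lambda>n i c. ip {..<n} (v0 n i) (q n \<omega> c)) {1..r}"
      unfolding u0_def[abs_def] v0_def[abs_def] ip_mult_left
    proof (rule limit_forms_of_powers[OF \<mu>.distribution_above_axioms s_low])
      fix m i j assume "i \<in> {1..r}" "j \<in> {1..r}"
      \<comment> \<open>Vectors are numbered from 1 and columns from 0; truncated subtraction of 1
        is injective on {1..r}.\<close>
      then have ij: "i - 1 < r" "j - 1 < r" "i - 1 = j - 1 \<longleftrightarrow> i = j" by auto
      show "(\<lambda>n. (\<Sum>c<n. of_real ((1 / (1 + (s n \<omega> c)\<^sup>2)) ^ m) * (ip {..<n} (\<lambda>k. Gu n \<omega> $$ (k, i - 1)) (p n \<omega> c)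
          * conjugate (ip {..<n} (\<lambda>k. Gu n \<omega> $$ (k, j - 1)) (p n \<omega> c)))) / of_nat n) \<longlonglongrightarrow> of_real (if i = j then \<integral>t. (1 / (1 + t\<^sup>2)) ^ m \<partial>\<mu> else 0) \<and>
        (\<lambda>n. (\<Sum>c<n. of_real ((1 / (1 + (s n \<omega> c)\<^sup>2)) ^ m) * (ip {..<n} (\<lambda>k. Gv n \<omega> $$ (k, i - 1)) (q n \<omega> c)
          * conjugate (ip {..<n} (\<lambda>k. Gv n \<omega> $$ (k, j - 1)) (q n \<omega> c)))) / of_nat n) \<longlonglongrightarrow> of_real (if i = j then \<integral>t. (1 / (1 + t\<^sup>2)) ^ m \<partial>\<mu> else 0) \<and>
        (\<lambda>n. (\<Sum>c<n. of_real ((1 / (1 + (s n \<omega> c)\<^sup>2)) ^ Suc m * s n \<omega> c) * (ip {..<n} (\<lambda>k. Gu n \<omega> $$ (k, i - 1)) (p n \<omega> c)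
          * conjugate (ip {..<n} (\<lambda>k. Gv n \<omega> $$ (k, j - 1)) (q n \<omega> c)))) / of_nat n) \<longlonglongrightarrow> 0"
        using elim(1)[rule_format, OF ij(1,2), of m] unfolding ij(3) g_def prod.case if_True if_False .
    qed
    have Gd: "Gu n \<omega> \<in> carrier_mat n r" "Gv n \<omega> \<in> carrier_mat n r" for n using G_dim[OF \<omega>] by auto
    \<comment> \<open>In the i.i.d. model the vectors coincide with the reference vectors
      \<open>u0\<close> and \<open>v0\<close>; in the orthonormalized model they are only close to
      them.\<close>
    have zero: "(\<lambda>n. sqrt (nsq {..<n} (\<lambda>k. iid_vector (G n) i $ k - of_real (1 / sqrt (real n)) * G n $$ (k, i - 1)))) \<longlonglongrightarrow> 0"
      if "\<And>n. G n \<in> carrier_mat n r" "i \<in> {1..r}" for G :: "nat \<Rightarrow> 'a mat" and i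
    proof -
      have "nsq {..<n} (\<lambda>k. iid_vector (G n) i $ k - of_real (1 / sqrt (real n)) * G n $$ (k, i - 1)) = nsq {..<n} (\<lambda>k. 0 :: 'a)" for n
        by (rule nsq_cong) (use iid_vector_index[OF that(1) _ that(2)] in simp)
      then show ?thesis by (simp add: nsq_def)
    qed
    have gram: "(\<lambda>n. ip {..<n} (u0 n i) (u0 n j)) \<longlonglongrightarrow> (if i = j then 1 else 0)"
      "(\<lambda>n. ip {..<n} (v0 n i) (v0 n j)) \<longlonglongrightarrow> (if i = j then 1 else 0)" if "i \<in> {1..r}" "j \<in> {1..r}" for i j
      using limit_forms.gram[OF lf that]
      by (simp_all only: orthonormal_basis.parseval[OF is_svdD(1)[OF svd]] orthonormal_basis.parseval[OF is_svdD(2)[OF svd]])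
    have close: "(\<lambda>n. sqrt (nsq {..<n} (\<lambda>k. u n \<omega> i $ k - u0 n i k))) \<longlonglongrightarrow> 0 \<and> (\<lambda>n. sqrt (nsq {..<n} (\<lambda>k. v n \<omega> i $ k - v0 n i k))) \<longlonglongrightarrow> 0
        \<and> (\<forall>n. u n \<omega> i \<in> carrier_vec n \<and> v n \<omega> i \<in> carrier_vec n)" if i: "i \<in> {1..r}" for i
      using model
    proof
      assume "\<forall>n. \<forall>\<omega>\<in>space M. \<forall>i\<in>{1..r}. u n \<omega> i = iid_vector (Gu n \<omega>) i \<and> v n \<omega> i = iid_vector (Gv n \<omega>) i"
      then have uv: "u n \<omega> i = iid_vector (Gu n \<omega>) i" "v n \<omega> i = iid_vector (Gv n \<omega>) i" for n using \<omega> i by auto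
      have "iid_vector (Gu n \<omega>) i \<in> carrier_vec n" "iid_vector (Gv n \<omega>) i \<in> carrier_vec n" for n
        using Gd[of n] by (auto intro!: carrier_vecI simp: iid_vector_def)
      then show ?thesis unfolding uv u0_def v0_def using zero[OF Gd(1) i] zero[OF Gd(2) i] by blast
    next
      assume "\<forall>n. \<forall>\<omega>\<in>space M. \<forall>i\<in>{1..r}. u n \<omega> i = orthonormalized_vector (Gu n \<omega>) i \<and> v n \<omega> i = orthonormalized_vector (Gv n \<omega>) i"
      then have uv: "u n \<omega> i = orthonormalized_vector (Gu n \<omega>) i" "v n \<omega> i = orthonormalized_vector (Gv n \<omega>) i" for n using \<omega> i by auto
      note ou = orthonormalized_vector_close[OF Gd(1) gram(1)[unfolded u0_def[abs_def]] i]
        and ov = orthonormalized_vector_close[OF Gd(2) gram(2)[unfolded v0_def[abs_def]] i]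
      show ?thesis unfolding uv u0_def v0_def using ou ov by blast
    qed
    have "limit_forms \<mu> a (\<lambda>n. s n \<omega>) (\<lambda>n i c. ip {..<n} (($) (u n \<omega> i)) (p n \<omega> c)) (\<lambda>n i c. ip {..<n} (($) (v n \<omega> i)) (q n \<omega> c)) {1..r}"
      by (rule limit_forms_close[OF lf svd]) (use close in auto)
    note projections = perturbed_projections[where A = "\<lambda>n. X n \<omega>" and u = "\<lambda>n. u n \<omega>" and v = "\<lambda>n. v n \<omega>"
        and u' = "\<lambda>n. u' n \<omega>" and v' = "\<lambda>n. v' n \<omega>" and \<theta> = \<theta>, OF X_dim[OF \<omega>] svd _ _ this i0 \<theta>_decr _ \<rho> singular_vectors[OF _ \<omega>, unfolded X'_def P_def]]
    show ?case
      unfolding P_def by (intro conjI; rule projections) (use close \<theta>_pos in auto)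
  qed
qed


end
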